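(* Let $d \ge 2$, let $A \subset \mathbb{R}^+ = (0,\infty)$ be a Lebesgue measurable set, and let $$|A|_d = d\, N_d \int_A r^{d-1}\, dr,$$ where $N_d$ is the volume of the unit ball in $\mathbb{R}^d$. Let $X_d = SL(d,\mathbb{R})/SL(d,\mathbb{Z})$ be the space of unimodular lattices in $\mathbb{R}^d$ with its Haar probability measure $\nu = \nu_d$, and for $\Lambda \in X_d$ let $\Omega(\Lambda) \subset \mathbb{R}^+$ be the set of Euclidean lengths of non-zero vectors of the dual lattice $\Lambda^*$. Then $$\nu\big(\{\Lambda \in X_d : \Omega(\Lambda) \cap A = \emptyset\}\big) \le \frac{C_d}{|A|_d},$$ where $C_d = 8\,\zeta(d-1)/\zeta(d)$ for $d \ge 3$ and $C_2 = 16\,\zeta(2)$.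
   Context: A unimodular lattice in $\mathbb{R}^d$ is a discrete additive subgroup of covolume $1$; it has the form $g\mathbb{Z}^d$ with $g \in SL(d,\mathbb{R})$, and the space of all such lattices is identified with $X_d = SL(d,\mathbb{R})/SL(d,\mathbb{Z})$ via $g\mathbb{Z}^d \mapsto g\,SL(d,\mathbb{Z})$. The measure $\nu = \nu_d$ is the unique $SL(d,\mathbb{R})$-invariant Borel probability measure on $X_d$ (completed, so that the event above is measurable). The dual lattice of $\Lambda$ is $\Lambda^* = \{w \in \mathbb{R}^d : \langle w, v\rangle \in \mathbb{Z} \text{ for all } v \in \Lambda\}$. The set $\Omega(\Lambda) = \{\|w\| : w \in \Lambda^*\setminus\{0\}\}$ is the paper's normalization of the spectrum of the Laplacian on the flat torus $\mathbb{R}^d/\Lambda$. Here $\zeta$ is the Riemann zeta function. The right-hand side is read as $+\infty$ if $|A|_d = 0$ and as $0$ if $|A|_d = \infty$. *)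

theory Defs
  imports "HOL-Probability.Probability"
begin

definition SL_real :: "(real^'n^'n) set" where
  "SL_real = {g. det g = 1}"

definition SL_int :: "(real^'n^'n) set" where
  "SL_int = {g. det g = 1 \<and> (\<forall>i j. g $ i $ j \<in> \<int>)}"

definition int_lattice :: "(real^'n) set" where
  "int_lattice = {m. \<forall>i. m $ i \<in> \<int>}"

definition lattice_of :: "real^'n^'n \<Rightarrow> (real^'n) set" where
  "lattice_of g = (\<lambda>m. g *v m) ` int_lattice"

(* A point of SL(d,R)/SL(d,Z) is represented by the lattice it stands for: by lemma
   lattice_of_eq_iff below, the fibres of lattice_of on SL(d,R) are exactly the cosets g SL(d,Z). *)
definition unimodular_lattices :: "(real^'n) set set" where
  "unimodular_lattices = lattice_of ` SL_real"

(* The quotient topology of SL(d,R)/SL(d,Z); see quotient_map_lattice_of. *)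
definition lattice_topology :: "(real^'n) set topology" where
  "lattice_topology = topology (\<lambda>U. U \<subseteq> unimodular_lattices \<and>
     openin (top_of_set SL_real) {g \<in> SL_real. lattice_of g \<in> U})"

definition lattice_borel :: "(real^'n) set measure" where
  "lattice_borel = sigma unimodular_lattices {U. openin lattice_topology U}"

definition lattice_act :: "real^'n^'n \<Rightarrow> (real^'n) set \<Rightarrow> (real^'n) set" where
  "lattice_act g L = (\<lambda>v. g *v v) ` L"

definition haar_probability :: "(real^'n) set measure \<Rightarrow> bool" where
  "haar_probability \<nu> \<longleftrightarrow>
     prob_space \<nu> \<and> sets \<nu> = sets lattice_borel \<and>
     (\<forall>g \<in> SL_real. \<forall>E \<in> sets \<nu>. emeasure \<nu> (lattice_act g ` E) = emeasure \<nu> E)"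

definition dual_lattice :: "(real^'n) set \<Rightarrow> (real^'n) set" where
  "dual_lattice L = {w. \<forall>v\<in>L. w \<bullet> v \<in> \<int>}"

definition length_spectrum :: "(real^'n) set \<Rightarrow> real set" where
  "length_spectrum L = norm ` (dual_lattice L - {0})"

(* d N_d \<integral>_A r^(d-1) dr, possibly infinite, where d = CARD('n). *)
definition radial_volume :: "'n::finite itself \<Rightarrow> real set \<Rightarrow> ennreal" where
  "radial_volume _ A =
     ennreal (real CARD('n) * measure lborel (ball (0::real^'n) 1)) *
     (\<integral>\<^sup>+ r\<in>A. ennreal (r ^ (CARD('n) - 1)) \<partial>lebesgue)"

(* The Riemann zeta function at an integer k \<ge> 2, where the Dirichlet series converges. *)
definition zeta :: "nat \<Rightarrow> real" where
  "zeta k = (\<Sum>n. 1 / real (Suc n) ^ k)"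

definition gap_const :: "nat \<Rightarrow> real" where
  "gap_const d = (if d = 2 then 16 * zeta 2 else 8 * zeta (d - 1) / zeta d)"

lemma openin_lattice_topology:
  "openin lattice_topology U \<longleftrightarrow> U \<subseteq> (unimodular_lattices :: (real^'n) set set) \<and>
     openin (top_of_set SL_real) {g \<in> SL_real. lattice_of g \<in> U}"
proof -
  let ?P = "\<lambda>U. U \<subseteq> (unimodular_lattices :: (real^'n) set set) \<and>
     openin (top_of_set SL_real) {g \<in> SL_real. lattice_of g \<in> U}"
  have "istopology ?P"
    unfolding istopology_def
  proof (intro conjI allI impI)
    fix S T :: "(real^'n) set set"
    assume S: "?P S" and T: "?P T"
    show "S \<inter> T \<subseteq> unimodular_lattices" using S by blast
    have "{g \<in> SL_real. lattice_of g \<in> S \<inter> T} =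
      {g \<in> SL_real. lattice_of g \<in> S} \<inter> {g \<in> SL_real. lattice_of g \<in> T}" by blast
    then show "openin (top_of_set SL_real) {g \<in> SL_real. lattice_of g \<in> S \<inter> T}"
      using S T by (simp add: openin_Int)
  next
    fix K :: "(real^'n) set set set"
    assume K: "\<forall>S\<in>K. ?P S"
    show "\<Union>K \<subseteq> unimodular_lattices" using K by blast
    have "{g \<in> SL_real. lattice_of g \<in> \<Union>K} =
      \<Union>((\<lambda>S. {g \<in> SL_real. lattice_of g \<in> S}) ` K)" by blast
    then show "openin (top_of_set SL_real) {g \<in> SL_real. lattice_of g \<in> \<Union>K}"
      using K by (auto intro!: openin_Union)
  qed
  then show ?thesis
    by (simp add: lattice_topology_def topology_inverse')
qed

lemma topspace_lattice_topology:
  "topspace lattice_topology = (unimodular_lattices :: (real^'n) set set)"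
proof -
  have "{g \<in> SL_real. lattice_of g \<in> (unimodular_lattices :: (real^'n) set set)} = SL_real"
    by (auto simp: unimodular_lattices_def)
  then have "openin lattice_topology (unimodular_lattices :: (real^'n) set set)"
    by (simp add: openin_lattice_topology)
  then show ?thesis
    by (metis openin_lattice_topology openin_subset openin_topspace subset_antisym)
qed

lemma quotient_map_lattice_of: "quotient_map (top_of_set SL_real) lattice_topology lattice_of"
  unfolding quotient_map_def topspace_lattice_topology
  by (auto simp: openin_lattice_topology unimodular_lattices_def)

lemma space_lattice_borel: "space lattice_borel = unimodular_lattices"
  unfolding lattice_borel_def
  by (rule space_measure_of) (auto simp: openin_lattice_topology)

lemma int_lattice_mult:
  assumes "\<forall>i j. \<gamma> $ i $ j \<in> \<int>" and "m \<in> int_lattice"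
  shows "\<gamma> *v m \<in> int_lattice"
  using assms by (auto simp: int_lattice_def matrix_vector_mult_def intro!: Ints_sum Ints_mult)

lemma lattice_of_subset_imp:
  fixes g h :: "real^'n^'n"
  assumes "g \<in> SL_real" and sub: "lattice_of h \<subseteq> lattice_of g"
  shows "\<exists>\<gamma>. (\<forall>i j. \<gamma> $ i $ j \<in> \<int>) \<and> h = g ** \<gamma>"
proof -
  have inv: "invertible g" using assms by (simp add: SL_real_def invertible_det_nz)
  then obtain g' where g': "g ** g' = mat 1" "g' ** g = mat 1" by (auto simp: invertible_def)
  define \<gamma> where "\<gamma> = g' ** h"
  have h: "h = g ** \<gamma>"
    by (simp add: \<gamma>_def matrix_mul_assoc g')
  have "\<gamma> $ i $ j \<in> \<int>" for i j
  proof -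
    have "axis j 1 \<in> int_lattice" by (auto simp: int_lattice_def axis_def)
    then have "h *v axis j 1 \<in> lattice_of g" using sub by (auto simp: lattice_of_def)
    then obtain m where m: "m \<in> int_lattice" "h *v axis j 1 = g *v m"
      by (auto simp: lattice_of_def)
    then have "g *v (\<gamma> *v axis j 1) = g *v m" by (simp add: h matrix_vector_mul_assoc)
    then have "\<gamma> *v axis j 1 = m"
      by (metis g'(2) matrix_vector_mul_assoc matrix_vector_mul_lid)
    then have "column j \<gamma> = m" by (simp add: matrix_vector_mult_basis)
    then have "\<gamma> $ i $ j = m $ i" by (auto simp: column_def)
    then show ?thesis using m by (simp add: int_lattice_def)
  qed
  then show ?thesis using h by blast
qed

lemma lattice_of_eq_iff:
  fixes g h :: "real^'n^'n"
  assumes g: "g \<in> SL_real" and h: "h \<in> SL_real"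
  shows "lattice_of g = lattice_of h \<longleftrightarrow> (\<exists>\<gamma>\<in>SL_int. h = g ** \<gamma>)"
proof
  assume eq: "lattice_of g = lattice_of h"
  then obtain \<gamma> where \<gamma>: "\<forall>i j. \<gamma> $ i $ j \<in> \<int>" "h = g ** \<gamma>"
    using lattice_of_subset_imp[OF g] by blast
  then have "det \<gamma> = 1" using g h by (simp add: SL_real_def det_mul)
  then show "\<exists>\<gamma>\<in>SL_int. h = g ** \<gamma>" using \<gamma> by (auto simp: SL_int_def)
next
  assume "\<exists>\<gamma>\<in>SL_int. h = g ** \<gamma>"
  then obtain \<gamma> where \<gamma>: "\<forall>i j. \<gamma> $ i $ j \<in> \<int>" "det \<gamma> = 1" "h = g ** \<gamma>"
    by (auto simp: SL_int_def)
  have "\<exists>m'\<in>int_lattice. \<gamma> *v m' = m" if m: "m \<in> int_lattice" for m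
  proof -
    define m' where "m' = (\<chi> k. det (\<chi> i j. if j = k then m $ i else \<gamma> $ i $ j))"
    have "\<gamma> *v m' = m" using cramer[of \<gamma> m' m] \<gamma>(2) by (simp add: m'_def)
    moreover have "m' \<in> int_lattice"
      using \<gamma>(1) m unfolding int_lattice_def m'_def det_def
      by (auto intro!: Ints_sum Ints_mult Ints_prod)
    ultimately show ?thesis by blast
  qed
  then have "(\<lambda>m. \<gamma> *v m) ` int_lattice = int_lattice"
    using int_lattice_mult[OF \<gamma>(1)] by blast
  then show "lattice_of g = lattice_of h"
    unfolding lattice_of_def \<gamma>(3)
    by (metis (no_types, lifting) image_cong image_image matrix_vector_mul_assoc)
qed

lemma lattice_act_lattice_of: "lattice_act g (lattice_of h) = lattice_of (g ** h)"
  by (simp add: lattice_act_def lattice_of_def image_image matrix_vector_mul_assoc)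

end

theory Submission
  imports Defs
begin

text \<open>
  Write the dual of a random lattice as \<open>h \<int>\<^sup>d\<close>; the law of \<open>h \<int>\<^sup>d\<close> is again invariant. The event says that no
  nonzero point of \<open>h \<int>\<^sup>d\<close> lies in the radial set \<open>{v. norm v \<in> A}\<close>, so by Chebyshev's inequality it suffices
  to bound the variance of the number of points in a compact set \<open>B = - B\<close> by a multiple of the volume \<open>|B|\<close>.

  The key tool is an invariance principle: given a primitive lattice vector \<open>v\<close>, the lattice may be moved
  by unimodular matrices that fix \<open>v\<close>. Averaging over large shears (Riemann sums) gives Siegel's mean value
  formula, its analogue with factor \<open>1 / \<zeta>(d)\<close> for primitive vectors, and, for \<open>d \<ge> 3\<close>, Rogers' bound
  \<open>|B|\<^sup>2\<close> for the expected number of linearly independent pairs in \<open>B\<close>. Pairs of dependent vectors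
  contribute \<open>4 \<zeta>(d - 1) / \<zeta>(d) |B|\<close>.

  For \<open>d = 2\<close> only primitive vectors are counted. The expected number of independent primitive pairs, weighted
  by \<open>f v * f (s w)\<close>, is invariant under \<open>(v, w) \<mapsto> (l v, w / l)\<close>. Hence the nonnegative variance of a difference
  of counts at the scales \<open>s\<close> and \<open>1 / s\<close> bounds the excess of pairs at scale \<open>1\<close> by the excesses at the scales
  \<open>s\<^sup>2\<close> and \<open>1 / s\<^sup>2\<close>. For large scales there are no pairs since determinants are integers; for small scales the
  excess is negligible on a logarithmic average, by counting all lattice points in a large region.
\<close>

section \<open>Lebesgue measure on vectors and matrices\<close>

text \<open>The constants come from multiples of one primitive vector: if n v and k v both lie in B,
  the pair is charged to the larger multiple, which costs a factor n and turns zeta(d) into zeta(d -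
  1). For d = 2 this would be the divergent zeta(1), hence the restriction to primitive vectors,
  whose only dependent primitive partners are plus and minus themselves. A second obstacle in the
  plane is that matrices of determinant one fixing v preserve det(v, w), so shears cannot
  equidistribute w; integrality of det(v, w) and the scaling symmetry replace them. Invariance of
  the law is available only for functions of the lattice, whereas a stabilising matrix depends on
  the chosen vector. The way round is to sum over all bases of the lattice: this gives a left
  invariant functional on SL(d,R), which is Haar measure up to a factor, hence right invariant as
  well, and Haar measure can be written in columns. Chebyshev's inequality yields 4 zeta(d - 1) /
  zeta(d) and 4 zeta(2), within the stated constants.\<close>

lemma borel_measurable_vec_nth [measurable (raw)]:
  fixes f :: "'a \<Rightarrow> 'b::topological_space ^ 'n"
  assumes "f \<in> borel_measurable M"
  shows "(\<lambda>x. f x $ i) \<in> borel_measurable M"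
proof -
  have "(\<lambda>y::'b^'n. y $ i) \<in> borel_measurable borel"
    by (intro borel_measurable_continuous_onI continuous_intros)
  from measurable_compose[OF assms this] show ?thesis .
qed

lemma borel_measurable_vec_lambda [measurable (raw)]:
  fixes f :: "'n::finite \<Rightarrow> 'a \<Rightarrow> 'b::euclidean_space"
  assumes "\<And>i. f i \<in> borel_measurable M"
  shows "(\<lambda>x. \<chi> i. f i x) \<in> borel_measurable M"
proof (subst borel_measurable_euclidean_space, intro ballI)
  fix u :: "'b^'n" assume "u \<in> Basis"
  then obtain i b where u: "u = axis i b" by (auto simp: Basis_vec_def)
  have "(\<lambda>x. (\<chi> i. f i x) \<bullet> u) = (\<lambda>x. f i x \<bullet> b)"
    by (simp add: u inner_axis)
  then show "(\<lambda>x. (\<chi> i. f i x) \<bullet> u) \<in> borel_measurable M"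
    using assms by simp
qed

lemma borel_measurable_matrix_mult [measurable (raw)]:
  fixes f g :: "'a \<Rightarrow> real^'n^'n"
  assumes [measurable]: "f \<in> borel_measurable M" "g \<in> borel_measurable M"
  shows "(\<lambda>x. f x ** g x) \<in> borel_measurable M"
  unfolding matrix_matrix_mult_def by measurable

lemma borel_measurable_matrix_vector_mult [measurable (raw)]:
  fixes f :: "'a \<Rightarrow> real^'n^'n" and g :: "'a \<Rightarrow> real^'n"
  assumes [measurable]: "f \<in> borel_measurable M" "g \<in> borel_measurable M"
  shows "(\<lambda>x. f x *v g x) \<in> borel_measurable M"
  unfolding matrix_vector_mult_def by measurable

lemma borel_measurable_det [measurable (raw)]:
  fixes f :: "'a \<Rightarrow> real^'n^'n"
  assumes [measurable]: "f \<in> borel_measurable M"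
  shows "(\<lambda>x. det (f x)) \<in> borel_measurable M"
  unfolding det_def by measurable

lemma borel_measurable_transpose [measurable (raw)]:
  fixes f :: "'a \<Rightarrow> real^'n^'n"
  assumes [measurable]: "f \<in> borel_measurable M"
  shows "(\<lambda>x. transpose (f x)) \<in> borel_measurable M"
  unfolding transpose_def by measurable

text \<open>The hypotheses make T a permutation of coordinates that is its own inverse, so it
  carries boxes to boxes with the same side lengths. Instances are the exchange of two rows, the
  transpose, and the exchange of coordinates between two vectors.\<close>

lemma lborel_distr_basis_involution:
  fixes T :: "'a::euclidean_space \<Rightarrow> 'a"
  assumes [measurable]: "T \<in> borel_measurable borel"
    and adj: "\<And>x b. b \<in> Basis \<Longrightarrow> T x \<bullet> b = x \<bullet> T b"
    and B: "\<And>b. b \<in> Basis \<Longrightarrow> T b \<in> Basis" "\<And>b. b \<in> Basis \<Longrightarrow> T (T b) = b"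
  shows "distr lborel borel T = lborel"
proof (rule lborel_eqI[symmetric])
  fix l u :: 'a assume le: "\<And>b. b \<in> Basis \<Longrightarrow> l \<bullet> b \<le> u \<bullet> b"
  have TT: "T (T x) \<bullet> b = x \<bullet> b" if "b \<in> Basis" for x b
    using that by (simp add: adj B)
  have "T -` box l u = box (T l) (T u)"
  proof (intro set_eqI iffI)
    fix x assume x: "x \<in> T -` box l u"
    have "T l \<bullet> b < x \<bullet> b \<and> x \<bullet> b < T u \<bullet> b" if b: "b \<in> Basis" for b
    proof -
      have "l \<bullet> T b < T x \<bullet> T b \<and> T x \<bullet> T b < u \<bullet> T b" using x B(1)[OF b] by (auto simp: box_def)
      then show ?thesis using b by (simp add: adj B)
    qed
    then show "x \<in> box (T l) (T u)" by (simp add: box_def)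
  next
    fix x assume x: "x \<in> box (T l) (T u)"
    have "l \<bullet> b < T x \<bullet> b \<and> T x \<bullet> b < u \<bullet> b" if b: "b \<in> Basis" for b
    proof -
      have "T l \<bullet> T b < x \<bullet> T b \<and> x \<bullet> T b < T u \<bullet> T b" using x B(1)[OF b] by (auto simp: box_def)
      then show ?thesis using b by (simp add: adj B)
    qed
    then show "x \<in> T -` box l u" by (simp add: box_def)
  qed
  moreover have "(\<Prod>b\<in>Basis. (T u - T l) \<bullet> b) = (\<Prod>b\<in>Basis. (u - l) \<bullet> b)"
    by (rule prod.reindex_bij_witness[where i=T and j=T]) (auto simp: B adj inner_diff_left)
  moreover have "T l \<bullet> b \<le> T u \<bullet> b" if "b \<in> Basis" for b
    using le[OF B(1)[OF that]] that by (simp add: adj)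
  ultimately show "emeasure (distr lborel borel T) (box l u) = ennreal (\<Prod>b\<in>Basis. (u - l) \<bullet> b)"
    by (simp add: emeasure_distr emeasure_lborel_box_eq)
qed simp

text \<open>The entries may themselves be vectors, so one decomposition serves
  \<open>real^'n\<close> by coordinates and \<open>real^'n^'n\<close> by rows.\<close>

lemma lborel_vec_eq_PiM:
  "(lborel :: ('b::euclidean_space^'n) measure) =
     distr (\<Pi>\<^sub>M i\<in>UNIV. lborel) borel (\<lambda>x. \<chi> i. x i)"
proof (rule lborel_eqI)
  interpret product_sigma_finite "\<lambda>_::'n. lborel :: 'b measure" ..
  have m [measurable]: "(\<lambda>x. \<chi> i. x i) \<in> borel_measurable (\<Pi>\<^sub>M i\<in>(UNIV::'n set). (lborel::'b measure))"
    by (intro borel_measurable_vec_lambda) (simp add: measurable_component_singleton)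
  fix l u :: "'b^'n"
  assume le: "\<And>b. b \<in> Basis \<Longrightarrow> l \<bullet> b \<le> u \<bullet> b"
  have le': "l $ i \<bullet> b \<le> u $ i \<bullet> b" if "b \<in> Basis" for i b
    using le[of "axis i b"] that by (auto simp: Basis_vec_def inner_axis)
  have eq: "(\<lambda>x. \<chi> i. x i) -` box l u \<inter> space (\<Pi>\<^sub>M i\<in>(UNIV::'n set). (lborel::'b measure)) =
      (\<Pi>\<^sub>E i\<in>UNIV. box (l $ i) (u $ i))"
    by (auto simp: box_def Basis_vec_def inner_axis space_PiM PiE_def Pi_def)
  have "emeasure (distr (\<Pi>\<^sub>M i\<in>UNIV. lborel) borel (\<lambda>x. \<chi> i. x i)) (box l u) =
      (\<Prod>i\<in>UNIV. emeasure lborel (box (l $ i) (u $ i)))"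
    by (simp add: emeasure_distr eq emeasure_PiM)
  also have "\<dots> = (\<Prod>i\<in>UNIV. ennreal (\<Prod>b\<in>Basis. (u $ i - l $ i) \<bullet> b))"
    using le' by (intro prod.cong refl) (auto simp: emeasure_lborel_box_eq)
  also have "\<dots> = ennreal (\<Prod>i\<in>UNIV. \<Prod>b\<in>Basis. (u $ i - l $ i) \<bullet> b)"
    using le' by (intro prod_ennreal prod_nonneg) (auto simp: inner_diff_left)
  also have "(\<Prod>i\<in>UNIV. \<Prod>b\<in>Basis. (u $ i - l $ i) \<bullet> b) = (\<Prod>b\<in>Basis. (u - l) \<bullet> b)"
  proof -
    have "(\<Prod>b\<in>Basis. (u - l) \<bullet> b) = (\<Prod>b\<in>(\<lambda>(i,b). axis i b) ` (UNIV \<times> Basis). (u - l) \<bullet> b)"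
      by (intro prod.cong) (auto simp: Basis_vec_def)
    also have "\<dots> = (\<Prod>(i,b)\<in>UNIV \<times> Basis. (u - l) \<bullet> axis i b)"
      by (subst prod.reindex) (auto simp: inj_on_def axis_eq_axis intro!: prod.cong)
    finally show ?thesis by (simp add: prod.cartesian_product inner_axis)
  qed
  finally show "emeasure (distr (\<Pi>\<^sub>M i\<in>UNIV. lborel) borel (\<lambda>x. \<chi> i. x i)) (box l u) =
    ennreal (\<Prod>b\<in>Basis. (u - l) \<bullet> b)" .
qed simp

lemma nn_integral_lborel_vec_split:
  fixes F :: "('b::euclidean_space^'n) \<Rightarrow> ennreal"
  assumes [measurable]: "F \<in> borel_measurable borel"
  shows "(\<integral>\<^sup>+x. F x \<partial>lborel) =
    (\<integral>\<^sup>+z. (\<integral>\<^sup>+y. F (\<chi> k. if k = i then y else z k) \<partial>lborel) \<partial>(\<Pi>\<^sub>M i\<in>UNIV - {i}. lborel))"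
    (is "_ = ?A")
    and "(\<integral>\<^sup>+x. F x \<partial>lborel) =
    (\<integral>\<^sup>+y. (\<integral>\<^sup>+z. F (\<chi> k. if k = i then y else z k) \<partial>(\<Pi>\<^sub>M i\<in>UNIV - {i}. lborel)) \<partial>lborel)"
proof -
  interpret product_sigma_finite "\<lambda>_::'n. lborel :: 'b measure" ..
  have m [measurable]: "(\<lambda>x. \<chi> i. x i) \<in> borel_measurable (\<Pi>\<^sub>M i\<in>(UNIV::'n set). (lborel::'b measure))"
    by (intro borel_measurable_vec_lambda) (simp add: measurable_component_singleton)
  have ins: "insert i (UNIV - {i}) = UNIV" by auto
  have m2: "(\<lambda>x. F (\<chi> i. x i)) \<in> borel_measurable (\<Pi>\<^sub>M i\<in>(insert i (UNIV - {i})). (lborel::'b measure))"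
    unfolding ins by measurable
  have upd: "(\<chi> k. (z(i := y)) k) = (\<chi> k. if k = i then y else z k)" for z and y :: 'b
    by (simp add: vec_eq_iff)
  have 1: "(\<integral>\<^sup>+x. F x \<partial>lborel) = (\<integral>\<^sup>+x. F (\<chi> i. x i) \<partial>(\<Pi>\<^sub>M i\<in>UNIV. lborel))"
    by (subst lborel_vec_eq_PiM) (simp add: nn_integral_distr)
  show "(\<integral>\<^sup>+x. F x \<partial>lborel) = ?A"
    using 1 product_nn_integral_insert[OF _ _ m2] unfolding ins upd by simp
  show "(\<integral>\<^sup>+x. F x \<partial>lborel) =
    (\<integral>\<^sup>+y. (\<integral>\<^sup>+z. F (\<chi> k. if k = i then y else z k) \<partial>(\<Pi>\<^sub>M i\<in>UNIV - {i}. lborel)) \<partial>lborel)"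
    using 1 product_nn_integral_insert_rev[OF _ _ m2] unfolding ins upd by simp
qed

text \<open>Left multiplication with entries in any real vector space: \<open>'b = real\<close>
  gives matrix times vector and \<open>'b = real^'n\<close> gives matrix times matrix, so a single
  change of variables covers both. The Jacobian is the power \<open>DIM('b)\<close> of the
  determinant.\<close>

definition mat_act :: "real^'n^'n \<Rightarrow> 'b::real_vector^'n \<Rightarrow> 'b^'n" where
  "mat_act A x = (\<chi> i. \<Sum>j\<in>UNIV. A $ i $ j *\<^sub>R x $ j)"

lemma mat_act_mult: "mat_act (A ** B) x = mat_act A (mat_act B x)"
proof -
  have "(\<Sum>j\<in>UNIV. (\<Sum>k\<in>UNIV. A $ i $ k * B $ k $ j) *\<^sub>R x $ j) =
    (\<Sum>k\<in>UNIV. A $ i $ k *\<^sub>R (\<Sum>j\<in>UNIV. B $ k $ j *\<^sub>R x $ j))" for i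
    unfolding scaleR_sum_left scaleR_sum_right scaleR_scaleR by (rule sum.swap)
  then show ?thesis by (simp add: mat_act_def matrix_matrix_mult_def)
qed

lemma mat_act_vec: "mat_act A x = A *v x"
  by (simp add: mat_act_def matrix_vector_mult_def)

lemma mat_act_mat: "mat_act A X = A ** X"
  by (simp add: mat_act_def matrix_matrix_mult_def vec_eq_iff)

lemma borel_measurable_mat_act [measurable]:
  "mat_act A \<in> borel_measurable (borel :: ('b::euclidean_space^'n) measure)"
  unfolding mat_act_def by measurable

text \<open>Both sides are multiplicative in A, so elementary matrices suffice: diagonal ones scale,
  swaps permute coordinates, and adding one row to another is a translation in that row.\<close>

lemma nn_integral_mat_act:
  fixes A :: "real^'n^'n" and F :: "'b::euclidean_space^'n \<Rightarrow> ennreal"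
  assumes "F \<in> borel_measurable borel" "det A \<noteq> 0"
  shows "ennreal (\<bar>det A\<bar> ^ DIM('b)) * (\<integral>\<^sup>+x. F (mat_act A x) \<partial>lborel) = (\<integral>\<^sup>+x. F x \<partial>lborel)"
proof -
  interpret product_sigma_finite "\<lambda>_::'n. lborel :: 'b measure" ..
  let ?P = "\<lambda>A::real^'n^'n. det A \<noteq> 0 \<longrightarrow> (\<forall>F\<in>borel_measurable (borel::('b^'n) measure).
     ennreal (\<bar>det A\<bar> ^ DIM('b)) * (\<integral>\<^sup>+x. F (mat_act A x) \<partial>lborel) = (\<integral>\<^sup>+x. F x \<partial>lborel))"
  have "?P A"
  proof (induction A rule: induct_matrix_elementary_alt)
    case (1 A B)
    show ?case
    proof (intro impI ballI)
      fix F :: "'b^'n \<Rightarrow> ennreal" assume [measurable]: "F \<in> borel_measurable borel"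
      assume "det (A ** B) \<noteq> 0"
      then have d: "det A \<noteq> 0" "det B \<noteq> 0" by (auto simp: det_mul)
      have "ennreal (\<bar>det (A ** B)\<bar> ^ DIM('b)) * (\<integral>\<^sup>+x. F (mat_act (A ** B) x) \<partial>lborel) =
        ennreal (\<bar>det A\<bar> ^ DIM('b)) * (ennreal (\<bar>det B\<bar> ^ DIM('b)) * (\<integral>\<^sup>+x. F (mat_act A (mat_act B x)) \<partial>lborel))"
        by (simp add: det_mul abs_mult power_mult_distrib ennreal_mult mat_act_mult mult.assoc)
      also have "ennreal (\<bar>det B\<bar> ^ DIM('b)) * (\<integral>\<^sup>+x. F (mat_act A (mat_act B x)) \<partial>lborel) =
          (\<integral>\<^sup>+x. F (mat_act A x) \<partial>lborel)"
        using 1(2)[THEN mp, OF d(2), THEN bspec, of "\<lambda>x. F (mat_act A x)"] by simp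
      also have "ennreal (\<bar>det A\<bar> ^ DIM('b)) * \<dots> = (\<integral>\<^sup>+x. F x \<partial>lborel)"
        using 1(1) d(1) by simp
      finally show "ennreal (\<bar>det (A ** B)\<bar> ^ DIM('b)) * (\<integral>\<^sup>+x. F (mat_act (A ** B) x) \<partial>lborel) =
         (\<integral>\<^sup>+x. F x \<partial>lborel)" .
    qed
  next
    case (2 A i)
    then show ?case by (metis det_zero_row(2))
  next
    case (3 A)
    have det: "det A = (\<Prod>i\<in>UNIV. A $ i $ i)" by (rule det_diagonal) (use 3 in auto)
    show ?case
    proof (intro impI ballI)
      fix F :: "'b^'n \<Rightarrow> ennreal" assume [measurable]: "F \<in> borel_measurable borel"
      assume "det A \<noteq> 0"
      then have nz: "A $ i $ i \<noteq> 0" for i by (auto simp: det)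
      \<comment> \<open>\<open>lborel_affine_euclidean\<close> indexes its scale factors by basis
        vectors. On a basis vector supported in row i the sum has a single term, the i-th diagonal
        entry.\<close>
      define c where "c b = (\<Sum>i\<in>UNIV. if b $ i \<noteq> 0 then A $ i $ i else 0)" for b :: "'b^'n"
      have c: "c (axis i b) = A $ i $ i" if "b \<in> Basis" for i b
      proof -
        have "c (axis i b) = (\<Sum>k\<in>UNIV. if k = i then A $ k $ k else 0)"
          unfolding c_def using that nonzero_Basis[of b] by (intro sum.cong) (auto simp: axis_def)
        then show ?thesis by simp
      qed
      have cn: "c b \<noteq> 0" if "b \<in> Basis" for b
        using that nz by (auto simp: Basis_vec_def c)
      have inj: "inj_on (\<lambda>(i,b). axis i b :: 'b^'n) (UNIV \<times> Basis)"
        by (auto simp: inj_on_def axis_eq_axis)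
      have B: "(Basis :: ('b^'n) set) = (\<lambda>(i,b). axis i b) ` (UNIV \<times> Basis)"
        by (auto simp: Basis_vec_def)
      have T: "0 + (\<Sum>b\<in>Basis. (c b * (x \<bullet> b)) *\<^sub>R b) = mat_act A x" for x
      proof -
        have "(\<Sum>b\<in>Basis. (c b * (x \<bullet> b)) *\<^sub>R b) = (\<Sum>(i,b)\<in>UNIV\<times>Basis. (A $ i $ i * (x $ i \<bullet> b)) *\<^sub>R axis i b)"
          unfolding B by (subst sum.reindex[OF inj]) (auto simp: c inner_axis intro!: sum.cong)
        also have "\<dots> = (\<chi> k. \<Sum>b\<in>Basis. (A $ k $ k * (x $ k \<bullet> b)) *\<^sub>R b)"
        proof -
          have "(\<Sum>(i,b)\<in>UNIV\<times>Basis. (A $ i $ i * (x $ i \<bullet> b)) *\<^sub>R axis i b) $ k =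
            (\<Sum>i\<in>UNIV. if i = k then (\<Sum>b\<in>Basis. (A $ k $ k * (x $ k \<bullet> b)) *\<^sub>R b) else 0)" for k
            unfolding sum.cartesian_product[symmetric] sum_component
            by (intro sum.cong) (auto simp: axis_def)
          then show ?thesis by (simp add: vec_eq_iff)
        qed
        also have "\<dots> = (\<chi> k. A $ k $ k *\<^sub>R x $ k)"
        proof -
          have "(\<Sum>b\<in>Basis. (A $ k $ k * (x $ k \<bullet> b)) *\<^sub>R b) = A $ k $ k *\<^sub>R (\<Sum>b\<in>Basis. (x $ k \<bullet> b) *\<^sub>R b)" for k
            by (simp add: scaleR_sum_right)
          then show ?thesis by (simp add: euclidean_representation)
        qed
        also have "\<dots> = mat_act A x"
        proof -
          have "(\<Sum>j\<in>UNIV. A $ i $ j *\<^sub>R x $ j) = (\<Sum>j\<in>UNIV. if j = i then A $ i $ i *\<^sub>R x $ i else 0)" for i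
            by (intro sum.cong) (auto simp: 3)
          then show ?thesis by (simp add: mat_act_def)
        qed
        finally show ?thesis by simp
      qed
      have pr: "(\<Prod>j\<in>Basis. \<bar>c j\<bar>) = \<bar>det A\<bar> ^ DIM('b)"
      proof -
        have "(\<Prod>j\<in>Basis. \<bar>c j\<bar>) = (\<Prod>(i,b)\<in>UNIV\<times>(Basis::'b set). \<bar>A $ i $ i\<bar>)"
          unfolding B by (subst prod.reindex[OF inj]) (auto simp: c intro!: prod.cong)
        also have "\<dots> = (\<Prod>i\<in>UNIV. \<bar>A $ i $ i\<bar> ^ DIM('b))"
          unfolding prod.cartesian_product[symmetric] by simp
        finally show ?thesis by (simp add: det abs_prod prod_power_distrib)
      qed
      have "(\<integral>\<^sup>+x. F x \<partial>lborel) = (\<integral>\<^sup>+x. F x \<partial>density (distr lborel borel (mat_act A)) (\<lambda>_. \<bar>det A\<bar> ^ DIM('b)))"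
        using lborel_affine_euclidean[of c 0] cn unfolding T pr by simp
      also have "\<dots> = ennreal (\<bar>det A\<bar> ^ DIM('b)) * (\<integral>\<^sup>+x. F (mat_act A x) \<partial>lborel)"
        by (simp add: nn_integral_density nn_integral_distr nn_integral_cmult)
      finally show "ennreal (\<bar>det A\<bar> ^ DIM('b)) * (\<integral>\<^sup>+x. F (mat_act A x) \<partial>lborel) = (\<integral>\<^sup>+x. F x \<partial>lborel)" ..
    qed
  next
    case (4 m n)
    let ?t = "Transposition.transpose m n"
    let ?A = "(\<chi> i j. mat 1 $ i $ ?t j) :: real^'n^'n"
    have act: "mat_act ?A x = (\<chi> i. x $ ?t i)" for x :: "'b^'n"
    proof -
      have "(\<Sum>j\<in>UNIV. ?A $ i $ j *\<^sub>R x $ j) = (\<Sum>j\<in>UNIV. if j = ?t i then x $ ?t i else 0)" for i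
        by (intro sum.cong) (auto simp: mat_def)
      then show ?thesis by (simp add: mat_act_def)
    qed
    have "det ?A = - det (mat 1 :: real^'n^'n)"
    proof -
      have "?A = (\<chi> i. transpose (mat 1 :: real^'n^'n) $ ?t i)"
        by (auto simp: vec_eq_iff transpose_def mat_def transpose_eq_iff)
      then show ?thesis using det_permute_rows[of ?t "transpose (mat 1 :: real^'n^'n)"] 4
        by (simp add: sign_swap_id permutes_swap_id)
    qed
    then have det: "\<bar>det ?A\<bar> = 1" by simp
    show ?case
    proof (intro impI ballI)
      fix F :: "'b^'n \<Rightarrow> ennreal" assume [measurable]: "F \<in> borel_measurable borel"
      have "distr lborel borel (\<lambda>x::'b^'n. \<chi> i. x $ ?t i) = lborel"
      proof (rule lborel_distr_basis_involution)
        fix b :: "'b^'n" assume "b \<in> Basis"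
        then obtain i a where b: "b = axis i a" "a \<in> Basis" by (auto simp: Basis_vec_def)
        have t: "(\<chi> k. b $ ?t k) = axis (?t i) a"
          unfolding b vec_eq_iff axis_def by (auto simp: transpose_eq_iff)
        show "(\<chi> k. x $ ?t k) \<bullet> b = x \<bullet> (\<chi> k. b $ ?t k)" for x
          unfolding t unfolding b by (simp add: inner_axis)
        show "(\<chi> k. b $ ?t k) \<in> Basis" unfolding t using b by (auto simp: Basis_vec_def)
        show "(\<chi> k. (\<chi> k. b $ ?t k) $ ?t k) = b" by (simp add: vec_eq_iff)
      qed measurable
      then have "(\<integral>\<^sup>+x. F x \<partial>lborel) = (\<integral>\<^sup>+x. F x \<partial>distr lborel borel (\<lambda>x::'b^'n. \<chi> i. x $ ?t i))"
        by simp
      also have "\<dots> = (\<integral>\<^sup>+x. F (mat_act ?A x) \<partial>lborel)"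
        by (simp add: nn_integral_distr act)
      finally show "ennreal (\<bar>det ?A\<bar> ^ DIM('b)) * (\<integral>\<^sup>+x. F (mat_act ?A x) \<partial>lborel) = (\<integral>\<^sup>+x. F x \<partial>lborel)"
        unfolding det by simp
    qed
  next
    case (5 m n)
    let ?A = "(\<chi> i j. of_bool (i = m \<and> j = n \<or> i = j)) :: real^'n^'n"
    have act: "mat_act ?A x = (\<chi> i. if i = m then x $ m + x $ n else x $ i)" for x :: "'b^'n"
    proof -
      have "(\<Sum>j\<in>UNIV. ?A $ i $ j *\<^sub>R x $ j) =
        (\<Sum>j\<in>UNIV. (if j = i then x $ i else 0) + (if j = n then if i = m then x $ n else 0 else 0))" for i
        using 5 by (intro sum.cong) auto
      then show ?thesis by (simp add: mat_act_def sum.distrib vec_eq_iff)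
    qed
    have det: "det ?A = 1"
    proof -
      have "?A = (\<chi> k. if k = m then row m (mat 1) + 1 *s row n (mat 1 :: real^'n^'n) else row k (mat 1))"
        using 5 by (auto simp: vec_eq_iff row_def mat_def)
      then show ?thesis using det_row_operation[OF 5, of "mat 1 :: real^'n^'n" 1] by simp
    qed
    \<comment> \<open>Row m is integrated first with the other rows fixed; there the addition of row
      n is a translation.\<close>
    show ?case
    proof (intro impI ballI)
      fix F :: "'b^'n \<Rightarrow> ennreal" assume [measurable]: "F \<in> borel_measurable borel"
      have "(\<integral>\<^sup>+x. F (mat_act ?A x) \<partial>lborel) =
        (\<integral>\<^sup>+z. (\<integral>\<^sup>+y. F (mat_act ?A (\<chi> k. if k = m then y else z k)) \<partial>lborel) \<partial>(\<Pi>\<^sub>M i\<in>UNIV - {m}. lborel))"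
        by (rule nn_integral_lborel_vec_split) measurable
      also have "\<dots> = (\<integral>\<^sup>+z. (\<integral>\<^sup>+y. F (\<chi> k. if k = m then z n + y else z k) \<partial>lborel) \<partial>(\<Pi>\<^sub>M i\<in>UNIV - {m}. lborel))"
        unfolding act using 5 by (intro nn_integral_cong arg_cong[of _ _ F]) (auto simp: vec_eq_iff add.commute)
      also have "\<dots> = (\<integral>\<^sup>+z. (\<integral>\<^sup>+y. F (\<chi> k. if k = m then y else z k) \<partial>lborel) \<partial>(\<Pi>\<^sub>M i\<in>UNIV - {m}. lborel))"
      proof (rule nn_integral_cong)
        fix z :: "'n \<Rightarrow> 'b"
        have "(\<integral>\<^sup>+y. F (\<chi> k. if k = m then y else z k) \<partial>lborel) =
          (\<integral>\<^sup>+y. F (\<chi> k. if k = m then y else z k) \<partial>distr lborel borel ((+) (z n)))"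
          by (simp add: lborel_distr_plus)
        also have "\<dots> = (\<integral>\<^sup>+y. F (\<chi> k. if k = m then z n + y else z k) \<partial>lborel)"
          by (subst nn_integral_distr) (auto cong: if_cong)
        finally show "(\<integral>\<^sup>+y. F (\<chi> k. if k = m then z n + y else z k) \<partial>lborel) =
          (\<integral>\<^sup>+y. F (\<chi> k. if k = m then y else z k) \<partial>lborel)" by (rule sym)
      qed
      also have "\<dots> = (\<integral>\<^sup>+x. F x \<partial>lborel)"
        by (rule nn_integral_lborel_vec_split[symmetric]) measurable
      finally show "ennreal (\<bar>det ?A\<bar> ^ DIM('b)) * (\<integral>\<^sup>+x. F (mat_act ?A x) \<partial>lborel) = (\<integral>\<^sup>+x. F x \<partial>lborel)"
        unfolding det by simp
    qed
  qed
  then show ?thesis using assms by blast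
qed

lemma nn_integral_matrix_vector_mult:
  fixes A :: "real^'n^'n" and F :: "real^'n \<Rightarrow> ennreal"
  assumes "F \<in> borel_measurable borel" "\<bar>det A\<bar> = 1"
  shows "(\<integral>\<^sup>+x. F (A *v x) \<partial>lborel) = (\<integral>\<^sup>+x. F x \<partial>lborel)"
  using nn_integral_mat_act[OF assms(1), of A] assms(2) by (auto simp: mat_act_vec)

lemma nn_integral_matrix_mult_left:
  fixes A :: "real^'n^'n" and F :: "real^'n^'n \<Rightarrow> ennreal"
  assumes "F \<in> borel_measurable borel" "\<bar>det A\<bar> = 1"
  shows "(\<integral>\<^sup>+X. F (A ** X) \<partial>lborel) = (\<integral>\<^sup>+X. F X \<partial>lborel)"
  using nn_integral_mat_act[OF assms(1), of A] assms(2) by (auto simp: mat_act_mat)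

lemma nn_integral_transpose:
  fixes F :: "real^'n^'n \<Rightarrow> ennreal"
  assumes [measurable]: "F \<in> borel_measurable borel"
  shows "(\<integral>\<^sup>+X. F (transpose X) \<partial>lborel) = (\<integral>\<^sup>+X. F X \<partial>lborel)"
proof -
  have "distr lborel borel (transpose :: real^'n^'n \<Rightarrow> _) = lborel"
  proof (rule lborel_distr_basis_involution)
    fix b :: "real^'n^'n" assume "b \<in> Basis"
    then obtain i j where b: "b = axis i (axis j 1)" by (auto simp: Basis_vec_def)
    have "transpose b = axis j (axis i 1)"
      by (simp add: b vec_eq_iff transpose_def axis_def)
    then show "transpose b \<in> Basis" by (auto simp: Basis_vec_def)
    show "transpose x \<bullet> b = x \<bullet> transpose b" for x :: "real^'n^'n"
      by (simp add: inner_vec_def transpose_def) (rule sum.swap)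
  qed (simp_all, measurable)
  then have "(\<integral>\<^sup>+X. F X \<partial>lborel) = (\<integral>\<^sup>+X. F X \<partial>distr lborel borel transpose)" by simp
  also have "\<dots> = (\<integral>\<^sup>+X. F (transpose X) \<partial>lborel)"
    by (rule nn_integral_distr) auto
  finally show ?thesis ..
qed

lemma nn_integral_matrix_mult_right:
  fixes A :: "real^'n^'n" and F :: "real^'n^'n \<Rightarrow> ennreal"
  assumes [measurable]: "F \<in> borel_measurable borel" and "\<bar>det A\<bar> = 1"
  shows "(\<integral>\<^sup>+X. F (X ** A) \<partial>lborel) = (\<integral>\<^sup>+X. F X \<partial>lborel)"
proof -
  have "(\<integral>\<^sup>+X. F (X ** A) \<partial>lborel) = (\<integral>\<^sup>+X. F (transpose (transpose A ** transpose X)) \<partial>lborel)"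
    by (simp add: matrix_transpose_mul)
  also have "\<dots> = (\<integral>\<^sup>+X. F (transpose (transpose A ** X)) \<partial>lborel)"
    by (rule nn_integral_transpose) measurable
  also have "\<dots> = (\<integral>\<^sup>+X. F (transpose X) \<partial>lborel)"
    using assms(2) by (intro nn_integral_matrix_mult_left[of "\<lambda>X. F (transpose X)"]) (auto simp: det_transpose)
  also have "\<dots> = (\<integral>\<^sup>+X. F X \<partial>lborel)"
    by (rule nn_integral_transpose) fact
  finally show ?thesis .
qed

section \<open>Integer matrices and primitive vectors\<close>

text \<open>On determinant one, Cramer's rule gives the inverse as a polynomial map, hence a continuous one.\<close>

definition sinv :: "real^'n^'n \<Rightarrow> real^'n^'n" where
  "sinv g = (\<chi> k j. det (\<chi> i l. if l = k then (if i = j then 1 else 0) else g $ i $ l))"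

lemma borel_measurable_sinv [measurable (raw)]:
  fixes f :: "'a \<Rightarrow> real^'n^'n"
  assumes [measurable]: "f \<in> borel_measurable M"
  shows "(\<lambda>x. sinv (f x)) \<in> borel_measurable M"
  unfolding sinv_def by measurable

lemma sinv:
  fixes g :: "real^'n^'n"
  assumes "det g = 1"
  shows sinv_right: "g ** sinv g = mat 1" and sinv_left: "sinv g ** g = mat 1"
proof -
  have "g *v column j (sinv g) = axis j 1" for j
  proof -
    have "column j (sinv g) = (\<chi> k. det (\<chi> i l. if l = k then axis j 1 $ i else g $ i $ l) / det g)"
      by (simp add: column_def sinv_def axis_def assms cong: if_cong)
    then show ?thesis using cramer[of g "column j (sinv g)" "axis j 1"] assms by simp
  qed
  moreover have "(g ** sinv g) $ i $ j = (g *v column j (sinv g)) $ i" for i j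
    by (simp add: matrix_matrix_mult_def matrix_vector_mult_def column_def)
  ultimately show "g ** sinv g = mat 1"
    by (simp add: vec_eq_iff mat_def axis_def)
  then show "sinv g ** g = mat 1"
    by (simp add: matrix_left_right_inverse)
qed

lemma sinv_unique:
  fixes g :: "real^'n^'n"
  assumes "det g = 1" "g ** h = mat 1"
  shows "h = sinv g"
proof -
  have "sinv g ** (g ** h) = h"
    by (simp add: matrix_mul_assoc sinv_left[OF assms(1)])
  then show ?thesis by (simp add: assms(2))
qed

lemma det_sinv [simp]: "det g = 1 \<Longrightarrow> det (sinv g) = 1"
  using det_mul[of g "sinv g"] by (simp add: sinv_right)

lemma sinv_mult:
  assumes "det g = 1" "det h = 1"
  shows "sinv (g ** h) = sinv h ** sinv g"
proof (rule sinv_unique[symmetric])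
  show "g ** h ** (sinv h ** sinv g) = mat 1"
    using sinv_right[OF assms(1)] sinv_right[OF assms(2)]
    by (metis matrix_mul_assoc matrix_mul_rid)
qed (simp add: det_mul assms)

lemma sinv_mat_1 [simp]: "sinv (mat 1) = mat 1"
  by (rule sinv_unique[symmetric]) auto

lemma sinv_sinv: "det g = 1 \<Longrightarrow> sinv (sinv g) = g"
  by (rule sinv_unique[symmetric]) (auto simp: sinv_left)

lemma sinv_cancel:
  fixes g x :: "real^'n^'n"
  assumes "det g = 1"
  shows "sinv g ** (g ** x) = x" "g ** (sinv g ** x) = x" "x ** g ** sinv g = x" "x ** sinv g ** g = x"
    "sinv g *v (g *v v) = v" "g *v (sinv g *v v) = v"
proof -
  show "sinv g ** (g ** x) = x" "g ** (sinv g ** x) = x"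
    by (simp_all add: matrix_mul_assoc sinv[OF assms])
  show "x ** g ** sinv g = x" "x ** sinv g ** g = x"
    by (simp_all add: matrix_mul_assoc[symmetric] sinv[OF assms])
  show "sinv g *v (g *v v) = v" "g *v (sinv g *v v) = v"
    by (simp_all add: matrix_vector_mul_assoc sinv[OF assms])
qed

lemma SL_int_iff: "\<gamma> \<in> SL_int \<longleftrightarrow> det \<gamma> = 1 \<and> (\<forall>i j. \<gamma> $ i $ j \<in> \<int>)"
  by (simp add: SL_int_def)

lemma SL_int_det: "\<gamma> \<in> SL_int \<Longrightarrow> det \<gamma> = 1"
  unfolding SL_int_def by blast

lemma SL_int_mat_1 [simp]: "mat 1 \<in> SL_int"
proof -
  have "(mat 1 :: real^'n^'n) $ i $ j \<in> \<int>" for i j by (simp add: mat_def)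
  then show ?thesis unfolding SL_int_iff using det_I by blast
qed

lemma SL_int_mult:
  assumes "\<gamma> \<in> SL_int" "\<delta> \<in> SL_int"
  shows "\<gamma> ** \<delta> \<in> SL_int"
proof -
  have "(\<gamma> ** \<delta>) $ i $ j \<in> \<int>" for i j
    using assms unfolding SL_int_def matrix_matrix_mult_def by (auto intro!: Ints_sum Ints_mult)
  then show ?thesis using assms by (auto simp: SL_int_iff det_mul)
qed

lemma SL_int_sinv:
  assumes "\<gamma> \<in> SL_int"
  shows "sinv \<gamma> \<in> SL_int"
proof -
  have d: "det \<gamma> = 1" using assms unfolding SL_int_def by blast
  have I: "\<gamma> $ i $ j \<in> \<int>" for i j using assms unfolding SL_int_def by blast
  have "(if l = k then (if i = j then 1 else 0) else \<gamma> $ i $ l) \<in> \<int>" for i j k l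
    using I by simp
  then have "sinv \<gamma> $ i $ j \<in> \<int>" for i j
    unfolding sinv_def det_def vec_lambda_beta
    by (intro Ints_sum Ints_mult Ints_prod Ints_of_int)
  then show ?thesis unfolding SL_int_iff by (intro conjI allI det_sinv[OF d])
qed

lemma SL_int_transpose:
  assumes "\<gamma> \<in> SL_int"
  shows "transpose \<gamma> \<in> SL_int"
proof -
  have "transpose \<gamma> $ i $ j \<in> \<int>" for i j
    using assms unfolding SL_int_def transpose_def by simp
  moreover have "det (transpose \<gamma>) = 1" using assms by (simp add: det_transpose SL_int_det)
  ultimately show ?thesis unfolding SL_int_iff by (intro conjI allI)
qed

lemma SL_int_int_lattice: "\<gamma> \<in> SL_int \<Longrightarrow> m \<in> int_lattice \<Longrightarrow> \<gamma> *v m \<in> int_lattice"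
  by (rule int_lattice_mult) (auto simp: SL_int_def)

lemma countable_int_lattice [simp]: "countable (int_lattice :: (real^'n) set)"
proof -
  have "(int_lattice :: (real^'n) set) \<subseteq> range (\<lambda>f::'n \<Rightarrow> int. \<chi> i. of_int (f i))"
  proof
    fix m :: "real^'n" assume "m \<in> int_lattice"
    then have "m = (\<chi> i. of_int \<lfloor>m $ i\<rfloor>)" by (simp add: int_lattice_def vec_eq_iff)
    then show "m \<in> range (\<lambda>f::'n \<Rightarrow> int. \<chi> i. of_int (f i))" by (metis rangeI)
  qed
  then show ?thesis by (rule countable_subset) simp
qed

lemma countable_SL_int [simp]: "countable (SL_int :: (real^'n^'n) set)"
proof -
  have "(SL_int :: (real^'n^'n) set) \<subseteq> range (\<lambda>f::'n \<Rightarrow> 'n \<Rightarrow> int. \<chi> i j. of_int (f i j))"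
  proof
    fix m :: "real^'n^'n" assume "m \<in> SL_int"
    then have "m = (\<chi> i j. of_int \<lfloor>m $ i $ j\<rfloor>)" by (simp add: SL_int_def vec_eq_iff)
    then show "m \<in> range (\<lambda>f::'n \<Rightarrow> 'n \<Rightarrow> int. \<chi> i j. of_int (f i j))" by (metis rangeI)
  qed
  then show ?thesis by (rule countable_subset) simp
qed

section \<open>Elementary integer matrices and primitive vectors\<close>

definition transvection :: "'n::finite \<Rightarrow> 'n \<Rightarrow> real \<Rightarrow> real^'n^'n" where
  "transvection i j c = (\<chi> a b. (if a = b then 1 else 0) + (if a = i \<and> b = j then c else 0))"

lemma det_transvection:
  fixes i :: "'n::finite"
  assumes "i \<noteq> j" shows "det (transvection i j c) = 1"
proof -
  have "transvection i j c = (\<chi> k. if k = i then row i (mat 1) + c *s row j (mat 1 :: real^'n^'n) else row k (mat 1))"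
    using assms by (auto simp: vec_eq_iff row_def mat_def transvection_def)
  then show ?thesis using det_row_operation[OF assms, of "mat 1 :: real^'n^'n" c] by simp
qed

lemma transvection_vec: "transvection i j c *v x = (\<chi> a. x $ a + (if a = i then c * x $ j else 0))"
proof -
  have "(\<Sum>b\<in>UNIV. ((if a = b then 1 else 0) + (if a = i \<and> b = j then c else 0)) * x $ b) =
    (\<Sum>b\<in>UNIV. (if b = a then x $ a else 0) + (if b = j then (if a = i then c * x $ j else 0) else 0))" for a
    by (intro sum.cong) (auto simp: algebra_simps)
  then show ?thesis by (simp only: transvection_def matrix_vector_mult_def vec_eq_iff vec_lambda_beta sum.distrib) simp
qed

lemma transvection_SL_int: "i \<noteq> j \<Longrightarrow> c \<in> \<int> \<Longrightarrow> transvection i j c \<in> SL_int"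
  by (simp add: SL_int_def det_transvection) (auto simp: transvection_def)

text \<open>Encoded as an orbit, so that a sum over primitive vectors is a sum over cosets of a
  stabiliser in \<open>SL_int\<close>. In dimension at least 2 the orbit consists of the integer
  vectors with coprime entries, whatever i is.\<close>

definition prim_vecs :: "'n \<Rightarrow> (real^'n) set" where
  "prim_vecs i = (\<lambda>\<gamma>. \<gamma> *v axis i 1) ` SL_int"

lemma countable_prim_vecs [simp]: "countable (prim_vecs i)"
  by (simp add: prim_vecs_def)

lemma SL_int_prim_vecs: "\<gamma> \<in> SL_int \<Longrightarrow> p \<in> prim_vecs i \<Longrightarrow> \<gamma> *v p \<in> prim_vecs i"
  by (auto simp: prim_vecs_def matrix_vector_mul_assoc SL_int_mult intro!: imageI)

lemma axis_int_lattice: "axis i 1 \<in> int_lattice"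
  by (auto simp: int_lattice_def axis_def)

lemma prim_vecs_int_lattice: "p \<in> prim_vecs i \<Longrightarrow> p \<in> int_lattice"
  by (auto simp: prim_vecs_def intro!: SL_int_int_lattice axis_int_lattice)

lemma SL_int_vec_eq_0_iff: "det g = 1 \<Longrightarrow> g *v x = 0 \<longleftrightarrow> x = 0"
  for g :: "real^'n^'n"
  by (metis matrix_vector_mult_0_right sinv_cancel(5))

lemma prim_vecs_nonzero: "p \<in> prim_vecs i \<Longrightarrow> p \<noteq> 0"
  by (auto simp: prim_vecs_def SL_int_vec_eq_0_iff SL_int_det axis_eq_0_iff)

lemma Ints_abs_ge_1: "x \<in> \<int> \<Longrightarrow> x \<noteq> 0 \<Longrightarrow> \<bar>x\<bar> \<ge> (1::real)"
  by (rule Ints_nonzero_abs_ge1)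

text \<open>Euclid's algorithm by row operations: while two entries are nonzero, the larger one is
  reduced by the smaller and the l1 norm drops. A single remaining entry is then moved to position
  i0 and made positive.\<close>

lemma reduce_to_axis:
  fixes x :: "real^'n"
  assumes card: "CARD('n) \<ge> 2" and "x \<in> int_lattice" "x \<noteq> 0"
  shows "\<exists>\<gamma>\<in>SL_int. \<exists>k::nat. k \<ge> 1 \<and> \<gamma> *v x = real k *\<^sub>R axis i0 1"
  using assms(2,3)
proof (induction "nat \<lfloor>\<Sum>i\<in>UNIV. \<bar>x $ i\<bar>\<rfloor>" arbitrary: x rule: less_induct)
  case less
  note xI = less.prems(1)
  have xi: "x $ i \<in> \<int>" for i using xI by (simp add: int_lattice_def)
  have step: "\<exists>\<gamma>\<in>SL_int. \<exists>k::nat. k \<ge> 1 \<and> \<gamma> *v x = real k *\<^sub>R axis i0 1"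
    if "\<gamma>0 \<in> SL_int" "\<exists>\<gamma>\<in>SL_int. \<exists>k::nat. k \<ge> 1 \<and> \<gamma> *v (\<gamma>0 *v x) = real k *\<^sub>R axis i0 1" for \<gamma>0
  proof -
    from that(2) obtain \<gamma> k where "\<gamma> \<in> SL_int" "k \<ge> 1" "\<gamma> *v (\<gamma>0 *v x) = real k *\<^sub>R axis i0 1" by blast
    then show ?thesis using that(1)
      by (intro bexI[of _ "\<gamma> ** \<gamma>0"] exI[of _ k]) (auto simp: matrix_vector_mul_assoc SL_int_mult)
  qed
  show ?case
  proof (cases "\<exists>i j. i \<noteq> j \<and> \<bar>x $ i\<bar> \<ge> \<bar>x $ j\<bar> \<and> x $ j \<noteq> 0")
    case True
    then obtain i j where ij: "i \<noteq> j" "\<bar>x $ i\<bar> \<ge> \<bar>x $ j\<bar>" "x $ j \<noteq> 0" by blast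
    \<comment> \<open>With this sign the entry i shrinks in absolute value by exactly the absolute
      value of entry j, which is at least 1.\<close>
    define s where "s = - (sgn (x $ i) * sgn (x $ j))"
    have sI: "s \<in> \<int>" by (auto simp: s_def sgn_if)
    define y where "y = transvection i j s *v x"
    have yI: "y \<in> int_lattice"
      unfolding y_def by (intro SL_int_int_lattice transvection_SL_int ij sI xI)
    have y0: "y \<noteq> 0"
      unfolding y_def using less.prems det_transvection[OF ij(1)] by (simp add: SL_int_vec_eq_0_iff)
    have yi: "\<bar>y $ i\<bar> = \<bar>x $ i\<bar> - \<bar>x $ j\<bar>"
      using ij by (auto simp: y_def transvection_vec s_def sgn_if abs_if split: if_splits)
    have yk: "y $ k = x $ k" if "k \<noteq> i" for k
      using that by (simp add: y_def transvection_vec)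
    have "(\<Sum>k\<in>UNIV. \<bar>y $ k\<bar>) = \<bar>y $ i\<bar> + (\<Sum>k\<in>UNIV-{i}. \<bar>y $ k\<bar>)"
      by (simp add: sum.remove[of _ i])
    also have "\<dots> = \<bar>x $ i\<bar> - \<bar>x $ j\<bar> + (\<Sum>k\<in>UNIV-{i}. \<bar>x $ k\<bar>)"
      using yk by (simp add: yi)
    also have "\<dots> = (\<Sum>k\<in>UNIV. \<bar>x $ k\<bar>) - \<bar>x $ j\<bar>"
      by (simp add: sum.remove[of _ i])
    finally have s: "(\<Sum>k\<in>UNIV. \<bar>y $ k\<bar>) = (\<Sum>k\<in>UNIV. \<bar>x $ k\<bar>) - \<bar>x $ j\<bar>" .
    have "\<bar>x $ j\<bar> \<ge> 1" by (rule Ints_abs_ge_1) (use xi ij in auto)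
    moreover have "(\<Sum>k\<in>UNIV. \<bar>y $ k\<bar>) \<ge> 0" by (simp add: sum_nonneg)
    ultimately have "nat \<lfloor>\<Sum>k\<in>UNIV. \<bar>y $ k\<bar>\<rfloor> < nat \<lfloor>\<Sum>k\<in>UNIV. \<bar>x $ k\<bar>\<rfloor>"
      using s by linarith
    from less.hyps[OF this yI y0] show ?thesis
      unfolding y_def using step transvection_SL_int[OF ij(1) sI] by blast
  next
    case False
    then have single: "x $ i = 0 \<or> x $ j = 0" if "i \<noteq> j" for i j
      using that by (metis linear)
    obtain i where i: "x $ i \<noteq> 0" using less.prems(2) by (auto simp: vec_eq_iff)
    have zero: "x $ j = 0" if "j \<noteq> i" for j using single[OF that] i by blast
    have offdiag: "\<exists>\<gamma>\<in>SL_int. \<exists>k::nat. k \<ge> 1 \<and> \<gamma> *v z = real k *\<^sub>R axis i0 1"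
      if z: "z \<in> int_lattice" "j \<noteq> i0" "z $ j \<noteq> 0" "\<And>k. k \<noteq> j \<Longrightarrow> z $ k = 0" for z :: "real^'n" and j
    proof -
      define s where "s = sgn (z $ j)"
      have sI: "s \<in> \<int>" by (auto simp: s_def sgn_if)
      have zj: "z $ j \<in> \<int>" using z by (simp add: int_lattice_def)
      then obtain q where q: "z $ j = of_int q" by (auto elim: Ints_cases)
      \<comment> \<open>The first factor to act writes the absolute value of entry j into position
        i0; the second subtracts it, with the right sign, from position j.\<close>
      let ?T = "transvection j i0 (- s) ** transvection i0 j s"
      have "?T *v z = real (nat \<bar>q\<bar>) *\<^sub>R axis i0 1"
        using z by (auto simp: matrix_vector_mul_assoc[symmetric] transvection_vec vec_eq_iff axis_def q s_def sgn_if abs_if)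
      moreover have "?T \<in> SL_int" using z sI by (intro SL_int_mult transvection_SL_int) auto
      moreover have "nat \<bar>q\<bar> \<ge> 1" using z q by auto
      ultimately show ?thesis by blast
    qed
    show ?thesis
    proof (cases "i = i0")
      case False
      then show ?thesis using offdiag[OF xI _ i] zero by blast
    next
      case True
      obtain j where j: "j \<noteq> i0"
      proof -
        have "UNIV \<noteq> {i0}"
        proof
          assume "UNIV = {i0}"
          then have "CARD('n) = card {i0}" by (rule arg_cong)
          then show False using card by simp
        qed
        then show thesis using that by blast
      qed
      \<comment> \<open>The entry at i0 may be negative, and its sign cannot be changed by
        operations that stay in that position. It is moved to another position j first, after which
        the previous case applies.\<close>
      let ?T = "transvection i0 j (- 1) ** transvection j i0 1"
      have T: "?T \<in> SL_int" using j by (intro SL_int_mult transvection_SL_int) auto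
      have "(?T *v x) $ j \<noteq> 0" "\<And>k. k \<noteq> j \<Longrightarrow> (?T *v x) $ k = 0"
        using j True i zero by (auto simp: matrix_vector_mul_assoc[symmetric] transvection_vec)
      from offdiag[OF SL_int_int_lattice[OF T xI] j this]
      show ?thesis using step[OF T] by blast
    qed
  qed
qed

lemma prim_multiple_exists:
  fixes m :: "real^'n"
  assumes "CARD('n) \<ge> 2" "m \<in> int_lattice" "m \<noteq> 0"
  obtains k :: nat and p where "k \<ge> 1" "p \<in> prim_vecs i0" "m = real k *\<^sub>R p"
proof -
  obtain \<gamma> k where *: "\<gamma> \<in> SL_int" "k \<ge> 1" "\<gamma> *v m = real k *\<^sub>R axis i0 1"
    using reduce_to_axis[OF assms] by blast
  have "m = sinv \<gamma> *v (\<gamma> *v m)" using *(1) by (simp only: sinv_cancel SL_int_det)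
  also have "\<dots> = real k *\<^sub>R (sinv \<gamma> *v axis i0 1)"
    by (simp add: *(3) matrix_vector_mult_scaleR)
  finally show thesis using that[OF *(2), of "sinv \<gamma> *v axis i0 1"] * by (auto simp: prim_vecs_def SL_int_sinv)
qed

text \<open>A unimodular integer matrix carries p to a basis vector, where the claim is read off in
  one coordinate.\<close>

lemma prim_multiple_dvd:
  fixes p q :: "real^'n"
  assumes "p \<in> prim_vecs i0" "q \<in> int_lattice" "real k *\<^sub>R p = real l *\<^sub>R q"
  shows "l dvd k"
proof -
  obtain \<gamma> where \<gamma>: "\<gamma> \<in> SL_int" "p = \<gamma> *v axis i0 1" using assms(1) by (auto simp: prim_vecs_def)
  have "real k *\<^sub>R axis i0 1 = sinv \<gamma> *v (real k *\<^sub>R p)"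
    using \<gamma> by (simp add: sinv_cancel SL_int_det matrix_vector_mult_scaleR)
  also have "\<dots> = real l *\<^sub>R (sinv \<gamma> *v q)" by (simp add: assms(3) matrix_vector_mult_scaleR)
  finally have "real k = real l * (sinv \<gamma> *v q) $ i0"
    by (simp add: vec_eq_iff axis_def split: if_splits)
  moreover have "(sinv \<gamma> *v q) $ i0 \<in> \<int>"
    using SL_int_int_lattice[OF SL_int_sinv[OF \<gamma>(1)] assms(2)] by (simp add: int_lattice_def)
  ultimately obtain z where "real k = real l * of_int z" by (auto elim: Ints_cases)
  then have "int k = int l * z" by (metis of_int_eq_iff of_int_mult of_int_of_nat_eq)
  then show ?thesis by (metis dvd_triv_left int_dvd_int_iff)
qed

lemma prim_multiple_unique:
  assumes "p \<in> prim_vecs i0" "q \<in> prim_vecs i0" "k \<ge> 1" "real k *\<^sub>R p = real l *\<^sub>R q"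
  shows "k = l" "p = q"
proof -
  have "l dvd k" "k dvd l"
    using prim_multiple_dvd[OF assms(1) prim_vecs_int_lattice[OF assms(2)] assms(4)]
      prim_multiple_dvd[OF assms(2) prim_vecs_int_lattice[OF assms(1)] assms(4)[symmetric]] by auto
  then show "k = l" by (rule dvd_antisym[rotated])
  then show "p = q" using assms by simp
qed

lemma bij_betw_prim_multiple:
  assumes "CARD('n) \<ge> 2"
  shows "bij_betw (\<lambda>(k::nat, p). real k *\<^sub>R p) ({1..} \<times> prim_vecs i0) (int_lattice - {0 :: real^'n})"
  unfolding bij_betw_def
proof
  show "inj_on (\<lambda>(k::nat, p). real k *\<^sub>R p) ({1..} \<times> prim_vecs i0)"
    by (rule inj_onI) (use prim_multiple_unique in \<open>(auto simp: Suc_le_eq; blast)\<close>)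
  have "real k *\<^sub>R p \<in> int_lattice - {0 :: real^'n}" if "k \<ge> 1" "p \<in> prim_vecs i0" for k p
    using that prim_vecs_int_lattice[OF that(2)] prim_vecs_nonzero[OF that(2)] by (auto simp: int_lattice_def)
  moreover have "m \<in> (\<lambda>(k::nat, p). real k *\<^sub>R p) ` ({1..} \<times> prim_vecs i0)" if "m \<in> int_lattice - {0}" for m :: "real^'n"
  proof -
    have "m \<in> int_lattice" "m \<noteq> 0" using that by auto
    from prim_multiple_exists[OF assms this, of i0] obtain k p where "k \<ge> 1" "p \<in> prim_vecs i0" "m = real k *\<^sub>R p" .
    then show ?thesis by (auto intro!: image_eqI[of _ _ "(k, p)"])
  qed
  ultimately show "(\<lambda>(k::nat, p). real k *\<^sub>R p) ` ({1..} \<times> prim_vecs i0) = int_lattice - {0}"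
    by auto
qed

section \<open>Fundamental domains\<close>

text \<open>The continuous map (g, h) to g^-1 h - 1 vanishes on the diagonal, so near any point it
  has norm below 1. At (g, g \<gamma>) its value \<gamma> - 1 has integer entries and must then be
  zero. Second countability makes the cover countable.\<close>

lemma injective_cover:
  obtains U :: "nat \<Rightarrow> (real^'n^'n) set"
  where "\<And>i. open (U i)" "SL_real \<subseteq> (\<Union>i. U i)"
    "\<And>i g \<gamma>. g \<in> U i \<Longrightarrow> g \<in> SL_real \<Longrightarrow> \<gamma> \<in> SL_int \<Longrightarrow> g ** \<gamma> \<in> U i \<Longrightarrow> \<gamma> = mat 1"
proof -
  define good where "good V \<longleftrightarrow> open V \<and> (\<forall>g \<gamma>. g \<in> V \<longrightarrow> g \<in> SL_real \<longrightarrow> \<gamma> \<in> SL_int \<longrightarrow> g ** \<gamma> \<in> V \<longrightarrow> \<gamma> = mat 1)"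
    for V :: "(real^'n^'n) set"
  have ex: "\<exists>V. good V \<and> g0 \<in> V" if g0: "g0 \<in> SL_real" for g0 :: "real^'n^'n"
  proof -
    let ?f = "\<lambda>p::(real^'n^'n) \<times> (real^'n^'n). sinv (fst p) ** snd p - mat 1"
    have cont: "continuous_on UNIV ?f"
    proof -
      have vn: "continuous_on UNIV (\<lambda>p::(real^'n^'n) \<times> (real^'n^'n). f p $ i $ l)"
        if "continuous_on UNIV f" for i l f by (intro continuous_intros that)
      have c1: "continuous_on UNIV (\<lambda>p::(real^'n^'n) \<times> (real^'n^'n). if l = k then (if i = j then 1 else 0) else fst p $ i $ l)"
        for i j k l :: 'n by (cases "l = k") (auto intro!: continuous_intros)
      have c2: "continuous_on UNIV (\<lambda>p::(real^'n^'n) \<times> (real^'n^'n). sinv (fst p) $ k $ j)" for k j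
        unfolding sinv_def det_def vec_lambda_beta by (intro continuous_intros c1)
      show ?thesis unfolding matrix_matrix_mult_def
        by (intro continuous_on_diff continuous_on_const continuous_on_vec_lambda continuous_on_sum continuous_on_mult c2 vn
          continuous_on_snd continuous_on_id)
    qed
    have "open (?f -` ball 0 1)" by (rule open_vimage[OF open_ball cont])
    moreover have "(g0, g0) \<in> ?f -` ball 0 1" using g0 by (simp add: SL_real_def sinv_left)
    ultimately obtain A B where AB: "open A" "open B" "(g0, g0) \<in> A \<times> B" "A \<times> B \<subseteq> ?f -` ball 0 1"
      by (rule open_prod_elim)
    have "\<gamma> = mat 1" if "g \<in> A \<inter> B" "g \<in> SL_real" "\<gamma> \<in> SL_int" "g ** \<gamma> \<in> A \<inter> B" for g \<gamma>
    proof -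
      have "(g, g ** \<gamma>) \<in> ?f -` ball 0 1" using AB that by blast
      then have n: "norm (\<gamma> - mat 1) < 1" using that(2) by (simp add: SL_real_def sinv_cancel)
      have "\<gamma> $ i $ j = mat 1 $ i $ j" for i j
      proof -
        have "\<bar>(\<gamma> - mat 1) $ i $ j\<bar> \<le> norm (\<gamma> - mat 1)"
        proof -
          have "\<bar>(\<gamma> - mat 1) $ i $ j\<bar> \<le> norm ((\<gamma> - mat 1) $ i)" by (rule component_le_norm_cart)
          also have "\<dots> \<le> norm (\<gamma> - mat 1)" by (rule Finite_Cartesian_Product.norm_nth_le)
          finally show ?thesis .
        qed
        then have "\<bar>\<gamma> $ i $ j - mat 1 $ i $ j\<bar> < 1" using n by simp
        moreover have "\<gamma> $ i $ j - mat 1 $ i $ j \<in> \<int>"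
          using that(3) by (intro Ints_diff) (auto simp: SL_int_iff mat_def[of 1])
        ultimately have "\<gamma> $ i $ j - mat 1 $ i $ j = 0"
          using Ints_abs_ge_1[of "\<gamma> $ i $ j - mat 1 $ i $ j"] by linarith
        then show ?thesis by simp
      qed
      then show ?thesis by (simp add: vec_eq_iff)
    qed
    then have "good (A \<inter> B)" using AB by (auto simp: good_def)
    then show ?thesis using AB by blast
  qed
  have op: "open S" if "S \<in> {V. good V}" for S using that by (simp add: good_def)
  obtain F where F: "F \<subseteq> {V. good V}" "countable F" "\<Union>F = \<Union>{V. good V}"
    by (rule Lindelof[OF op])
  have "(mat 1 :: real^'n^'n) \<in> SL_real" by (simp add: SL_real_def)
  from ex[OF this] have "mat 1 \<in> \<Union>F" unfolding F(3) by blast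
  then have ne: "F \<noteq> {}" by blast
  show thesis
  proof (rule that[of "from_nat_into F"])
    have g: "good (from_nat_into F i)" for i using from_nat_into[OF ne, of i] F(1) by blast
    then show "open (from_nat_into F i)" for i by (simp add: good_def)
    show "\<gamma> = mat 1" if "g \<in> from_nat_into F i" "g \<in> SL_real" "\<gamma> \<in> SL_int" "g ** \<gamma> \<in> from_nat_into F i" for i g \<gamma>
      using g[of i, unfolded good_def, THEN conjunct2, rule_format, OF that] .
    have "(\<Union>i. from_nat_into F i) = \<Union>F" using ne F(2) by simp
    moreover have "SL_real \<subseteq> \<Union>F" unfolding F(3) using ex by blast
    ultimately show "SL_real \<subseteq> (\<Union>i. from_nat_into F i)" by simp
  qed
qed

text \<open>Its use is with the stabiliser of \<open>axis i 1\<close>: choosing one matrix in each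
  coset unfolds sums over primitive vectors into sums over \<open>SL_int\<close>.\<close>

lemma fundamental_domain:
  fixes \<Gamma> :: "(real^'n^'n) set"
  assumes sub: "\<Gamma> \<subseteq> SL_int" and one: "mat 1 \<in> \<Gamma>"
    and mult: "\<And>a b. a \<in> \<Gamma> \<Longrightarrow> b \<in> \<Gamma> \<Longrightarrow> a ** b \<in> \<Gamma>" and inv: "\<And>a. a \<in> \<Gamma> \<Longrightarrow> sinv a \<in> \<Gamma>"
  obtains D :: "(real^'n^'n) set" where "D \<in> sets borel"
    "\<And>g. det g = 1 \<Longrightarrow> \<exists>!s. s \<in> \<Gamma> \<and> g ** s \<in> D"
proof (rule injective_cover)
  fix U :: "nat \<Rightarrow> (real^'n^'n) set"
  assume U: "\<And>i. open (U i)" "SL_real \<subseteq> (\<Union>i. U i)"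
    "\<And>i g \<gamma>. g \<in> U i \<Longrightarrow> g \<in> SL_real \<Longrightarrow> \<gamma> \<in> SL_int \<Longrightarrow> g ** \<gamma> \<in> U i \<Longrightarrow> \<gamma> = mat 1"
  \<comment> \<open>A matrix belongs to D if it lies in the first cover set that its orbit meets.
    Since a cover set contains at most one translate, each orbit meets D exactly once.\<close>
  define D where "D = (\<Union>i. U i \<inter> (\<Inter>j\<in>{..<i}. \<Inter>s\<in>\<Gamma>. (\<lambda>g. g ** s) -` (- U j)))"
  have cnt: "countable \<Gamma>" using sub countable_SL_int by (rule countable_subset)
  have vm: "(\<lambda>g. g ** s) -` (- U j) \<in> sets borel" for s :: "real^'n^'n" and j
    using measurable_sets[of "\<lambda>g. g ** s" borel borel "- U j"] U(1)[of j] by simp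
  have Uset [simp]: "U i \<in> sets borel" for i using U(1) by simp
  have 1: "(\<Inter>s\<in>\<Gamma>. (\<lambda>g. g ** s) -` (- U j)) \<in> sets borel" for j
    by (rule sets.countable_INT''[OF _ cnt vm]) simp
  have 2: "(\<Inter>j\<in>{..<i}. \<Inter>s\<in>\<Gamma>. (\<lambda>g. g ** s) -` (- U j)) \<in> sets borel" for i :: nat
    by (rule sets.countable_INT''[OF _ countable_finite 1]) simp_all
  have "D \<in> sets borel"
    unfolding D_def by (rule sets.countable_UN''[OF _ sets.Int[OF Uset 2]]) simp
  moreover have "\<exists>!s. s \<in> \<Gamma> \<and> g ** s \<in> D" if g: "det g = 1" for g
  proof -
    have d: "det s = 1" if "s \<in> \<Gamma>" for s using that sub SL_int_det by blast
    have gs: "g ** s \<in> SL_real" if "s \<in> \<Gamma>" for s using g that sub by (auto simp: SL_real_def det_mul SL_int_det)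
    define i where "i = (LEAST i. \<exists>s\<in>\<Gamma>. g ** s \<in> U i)"
    have "\<exists>i. \<exists>s\<in>\<Gamma>. g ** s \<in> U i" using gs[OF one] U(2) one by blast
    then have i: "\<exists>s\<in>\<Gamma>. g ** s \<in> U i" unfolding i_def by (rule LeastI_ex)
    have least: "g ** s \<notin> U j" if "s \<in> \<Gamma>" "j < i" for s j
      using not_less_Least[of j "\<lambda>i. \<exists>s\<in>\<Gamma>. g ** s \<in> U i"] that unfolding i_def by blast
    from i obtain s where s: "s \<in> \<Gamma>" "g ** s \<in> U i" by blast
    have "g ** s \<in> D"
      using s least mult by (auto simp: D_def matrix_mul_assoc[symmetric] intro!: exI[of _ i])
    moreover have "t = s" if t: "t \<in> \<Gamma>" "g ** t \<in> D" for t
    proof -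
      obtain k where k: "g ** t \<in> U k" "\<And>j r. j < k \<Longrightarrow> r \<in> \<Gamma> \<Longrightarrow> g ** t ** r \<notin> U j"
        using t(2) by (auto simp: D_def)
      have "k = i"
      proof (rule ccontr)
        assume "k \<noteq> i"
        then have "i < k" using least[OF t(1), of k] k(1) by force
        from k(2)[OF this mult[OF inv[OF t(1)] s(1)]] have "g ** t ** (sinv t ** s) \<notin> U i" .
        moreover have "g ** t ** (sinv t ** s) = g ** s"
          by (simp add: matrix_mul_assoc sinv_cancel(3)[OF d[OF t(1)]])
        ultimately show False using s by simp
      qed
      have "g ** s ** (sinv s ** t) = g ** t"
        by (simp add: matrix_mul_assoc sinv_cancel(3)[OF d[OF s(1)]])
      then have "g ** s ** (sinv s ** t) \<in> U i" using k(1) \<open>k = i\<close> by simp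
      moreover have "sinv s ** t \<in> SL_int" using s(1) t(1) sub by (blast intro: SL_int_mult SL_int_sinv)
      ultimately have "sinv s ** t = mat 1"
        using U(3)[OF s(2) gs[OF s(1)]] by blast
      then have "s ** (sinv s ** t) = s" by simp
      then show "t = s" by (simp add: sinv_cancel(2)[OF d[OF s(1)]])
    qed
    ultimately show ?thesis using s(1) by blast
  qed
  ultimately show thesis by (rule that)
qed

section \<open>Random matrices representing random lattices\<close>

text \<open>The law of a random \<open>g \<in> SL(d,\<real>)\<close> such that the law of the lattice \<open>g \<int>\<^sup>d\<close> is invariant:
  invariance is only required for functions of the coset \<open>g SL(d,\<int>)\<close>.\<close>

definition inv_law :: "(real^'n^'n) measure \<Rightarrow> bool" where
  "inv_law \<pi> \<longleftrightarrow> prob_space \<pi> \<and> sets \<pi> = sets borel \<and> (AE g in \<pi>. det g = 1) \<and>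
     (\<forall>h \<Phi>. det h = 1 \<longrightarrow> \<Phi> \<in> borel_measurable borel \<longrightarrow>
        (\<forall>g \<gamma>. det g = 1 \<longrightarrow> \<gamma> \<in> SL_int \<longrightarrow> \<Phi> (g ** \<gamma>) = (\<Phi> g :: ennreal)) \<longrightarrow>
        (\<integral>\<^sup>+g. \<Phi> (h ** g) \<partial>\<pi>) = (\<integral>\<^sup>+g. \<Phi> g \<partial>\<pi>))"

lemma inv_law_D:
  assumes "inv_law \<pi>"
  shows "prob_space \<pi>" "sets \<pi> = sets borel" "AE g in \<pi>. det g = 1"
  using assms unfolding inv_law_def by blast+

lemma inv_law_nn_integral:
  assumes "inv_law \<pi>" "det h = 1" "\<Phi> \<in> borel_measurable borel"
    and "\<And>g \<gamma>. det g = 1 \<Longrightarrow> \<gamma> \<in> SL_int \<Longrightarrow> \<Phi> (g ** \<gamma>) = (\<Phi> g :: ennreal)"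
  shows "(\<integral>\<^sup>+g. \<Phi> (h ** g) \<partial>\<pi>) = (\<integral>\<^sup>+g. \<Phi> g \<partial>\<pi>)"
proof -
  have "\<forall>h \<Phi>. det h = 1 \<longrightarrow> \<Phi> \<in> borel_measurable borel \<longrightarrow>
        (\<forall>g \<gamma>. det g = 1 \<longrightarrow> \<gamma> \<in> SL_int \<longrightarrow> \<Phi> (g ** \<gamma>) = (\<Phi> g :: ennreal)) \<longrightarrow>
        (\<integral>\<^sup>+g. \<Phi> (h ** g) \<partial>\<pi>) = (\<integral>\<^sup>+g. \<Phi> g \<partial>\<pi>)"
    using assms(1) unfolding inv_law_def by blast
  from this[rule_format, OF assms(2,3)] assms(4) show ?thesis .
qed

text \<open>Inverse transposition is an automorphism that preserves \<open>SL_int\<close> and maps a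
  basis of a lattice to a basis of the dual lattice. It turns left multiplication by h into left
  multiplication by the inverse transpose of h.\<close>

lemma inv_law_dual:
  fixes \<pi> :: "(real^'n^'n) measure"
  assumes "inv_law \<pi>"
  shows "inv_law (distr \<pi> borel (\<lambda>g. transpose (sinv g)))"
proof -
  interpret prob_space \<pi> by (rule inv_law_D[OF assms])
  note [measurable_cong] = inv_law_D(2)[OF assms]
  have m [measurable]: "(\<lambda>g. transpose (sinv g)) \<in> borel_measurable \<pi>" by measurable
  have "prob_space (distr \<pi> borel (\<lambda>g. transpose (sinv g)))" by (rule prob_space_distr) fact
  moreover have "AE g in distr \<pi> borel (\<lambda>g. transpose (sinv g)). det g = 1"
    using inv_law_D(3)[OF assms] by (subst AE_distr_iff) (auto simp: det_transpose elim!: eventually_mono)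
  moreover have "(\<integral>\<^sup>+g. \<Phi> (h ** g) \<partial>distr \<pi> borel (\<lambda>g. transpose (sinv g))) =
      (\<integral>\<^sup>+g. \<Phi> g \<partial>distr \<pi> borel (\<lambda>g. transpose (sinv g)))"
    if h: "det h = 1" and [measurable]: "\<Phi> \<in> borel_measurable borel"
    and inv: "\<forall>g \<gamma>. det g = 1 \<longrightarrow> \<gamma> \<in> SL_int \<longrightarrow> \<Phi> (g ** \<gamma>) = (\<Phi> g :: ennreal)"
    for h :: "real^'n^'n" and \<Phi>
  proof -
    define k where "k = transpose (sinv h)"
    have k: "det k = 1" using h by (simp add: k_def det_transpose)
    have kh: "transpose (sinv k) = h"
    proof -
      have "sinv k = transpose h"
      proof (rule sinv_unique[symmetric, OF k])
        show "k ** transpose h = mat 1"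
          unfolding k_def by (metis h matrix_transpose_mul sinv_right transpose_mat)
      qed
      then show ?thesis by simp
    qed
    have "(\<integral>\<^sup>+g. \<Phi> (h ** g) \<partial>distr \<pi> borel (\<lambda>g. transpose (sinv g))) =
      (\<integral>\<^sup>+g. \<Phi> (h ** transpose (sinv g)) \<partial>\<pi>)"
      by (rule nn_integral_distr) measurable
    also have "\<dots> = (\<integral>\<^sup>+g. \<Phi> (transpose (sinv (k ** g))) \<partial>\<pi>)"
      using inv_law_D(3)[OF assms]
      by (intro nn_integral_cong_AE, elim eventually_mono) (simp add: sinv_mult k matrix_transpose_mul kh)
    also have "\<dots> = (\<integral>\<^sup>+g. \<Phi> (transpose (sinv g)) \<partial>\<pi>)"
    proof (rule inv_law_nn_integral[OF assms k])
      fix g \<gamma> :: "real^'n^'n" assume g: "det g = 1" "\<gamma> \<in> SL_int"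
      have "transpose (sinv (g ** \<gamma>)) = transpose (sinv g) ** transpose (sinv \<gamma>)"
        using g by (simp add: sinv_mult SL_int_det matrix_transpose_mul)
      then show "\<Phi> (transpose (sinv (g ** \<gamma>))) = \<Phi> (transpose (sinv g))"
        using inv[rule_format, of "transpose (sinv g)" "transpose (sinv \<gamma>)"] g
        by (simp add: det_transpose SL_int_transpose SL_int_sinv)
    qed measurable
    also have "\<dots> = (\<integral>\<^sup>+g. \<Phi> g \<partial>distr \<pi> borel (\<lambda>g. transpose (sinv g)))"
      by (rule nn_integral_distr[symmetric]) measurable
    finally show ?thesis .
  qed
  ultimately show ?thesis unfolding inv_law_def by simp
qed

text \<open>The quotient map is open because the saturation of V is the union of the right
  translates of V by integer matrices.\<close>

lemma openin_lattice_of_image: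
  fixes V :: "(real^'n^'n) set"
  assumes "open V"
  shows "openin lattice_topology (lattice_of ` (V \<inter> SL_real))"
  unfolding openin_lattice_topology
proof
  show "lattice_of ` (V \<inter> SL_real) \<subseteq> unimodular_lattices"
    by (auto simp: unimodular_lattices_def)
  have "{g \<in> SL_real. lattice_of g \<in> lattice_of ` (V \<inter> SL_real)} =
     (\<Union>\<gamma>\<in>SL_int. SL_real \<inter> (\<lambda>g. g ** \<gamma>) -` V)" (is "?L = ?R")
  proof (intro set_eqI iffI)
    fix g assume "g \<in> ?L"
    then obtain h where h: "g \<in> SL_real" "h \<in> V" "h \<in> SL_real" "lattice_of g = lattice_of h" by auto
    then obtain \<gamma> where "\<gamma> \<in> SL_int" "h = g ** \<gamma>" using lattice_of_eq_iff by blast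
    then show "g \<in> ?R" using h by blast
  next
    fix g assume "g \<in> ?R"
    then obtain \<gamma> where g: "\<gamma> \<in> SL_int" "g \<in> SL_real" "g ** \<gamma> \<in> V" by blast
    moreover have s: "g ** \<gamma> \<in> SL_real" using g by (simp add: SL_real_def det_mul SL_int_det)
    moreover have "lattice_of g = lattice_of (g ** \<gamma>)"
      using lattice_of_eq_iff[OF g(2) s] g(1) by blast
    ultimately show "g \<in> ?L" by auto
  qed
  moreover have "openin (top_of_set SL_real) (SL_real \<inter> (\<lambda>g. g ** \<gamma>) -` V)" for \<gamma>
  proof -
    have "continuous_on UNIV (\<lambda>g::real^'n^'n. g ** \<gamma>)"
      unfolding matrix_matrix_mult_def by (intro continuous_intros continuous_on_vec_lambda)
    then have "open ((\<lambda>g. g ** \<gamma>) -` V)" using assms by (rule open_vimage[rotated])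
    then show ?thesis by (rule openin_open_Int)
  qed
  ultimately show "openin (top_of_set SL_real) {g \<in> SL_real. lattice_of g \<in> lattice_of ` (V \<inter> SL_real)}"
    by (simp only:) (rule openin_Union, blast)
qed

text \<open>On each set of \<open>injective_cover\<close> the quotient map is injective and open, so
  it has a continuous inverse on its image. Taking the first cover set whose image contains L glues
  these inverses along differences of open sets.\<close>

lemma borel_section:
  obtains s :: "(real^'n) set \<Rightarrow> real^'n^'n"
  where "s \<in> lattice_borel \<rightarrow>\<^sub>M borel"
    "\<And>L. L \<in> unimodular_lattices \<Longrightarrow> det (s L) = 1"
    "\<And>L. L \<in> unimodular_lattices \<Longrightarrow> lattice_of (s L) = L"
proof (rule injective_cover)
  fix U :: "nat \<Rightarrow> (real^'n^'n) set"
  assume U: "\<And>i. open (U i)" "SL_real \<subseteq> (\<Union>i. U i)"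
    "\<And>i g \<gamma>. g \<in> U i \<Longrightarrow> g \<in> SL_real \<Longrightarrow> \<gamma> \<in> SL_int \<Longrightarrow> g ** \<gamma> \<in> U i \<Longrightarrow> \<gamma> = mat 1"
  define Y where "Y i = lattice_of ` (U i \<inter> SL_real)" for i
  define idx where "idx L = (LEAST i. L \<in> Y i)" for L
  define s where "s L = (SOME g. g \<in> U (idx L) \<inter> SL_real \<and> lattice_of g = L)" for L
  have uniq: "g = h" if gh: "g \<in> U i \<inter> SL_real" "h \<in> U i \<inter> SL_real" "lattice_of g = lattice_of h" for g h i
  proof -
    obtain \<gamma> where \<gamma>: "\<gamma> \<in> SL_int" "h = g ** \<gamma>" using lattice_of_eq_iff[of g h] gh by blast
    then have "\<gamma> = mat 1" using U(3)[of g i \<gamma>] gh by blast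
    then show ?thesis using \<gamma> by simp
  qed
  have idx: "L \<in> Y (idx L)" if L: "L \<in> unimodular_lattices" for L
  proof -
    obtain g where "g \<in> SL_real" "L = lattice_of g" using L unfolding unimodular_lattices_def by blast
    then have "\<exists>i. L \<in> Y i" using U(2) unfolding Y_def by blast
    then show ?thesis unfolding idx_def by (rule LeastI_ex)
  qed
  have s: "s L \<in> U (idx L) \<inter> SL_real \<and> lattice_of (s L) = L" if L: "L \<in> unimodular_lattices" for L
  proof -
    have "\<exists>g. g \<in> U (idx L) \<inter> SL_real \<and> lattice_of g = L" using idx[OF L] unfolding Y_def by blast
    then show ?thesis unfolding s_def by (rule someI_ex)
  qed
  have op: "lattice_of ` (V \<inter> SL_real) \<in> sets lattice_borel" if "open V" for V :: "(real^'n^'n) set"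
    unfolding lattice_borel_def using openin_lattice_of_image[OF that]
    by (subst sets_measure_of) (auto simp: openin_lattice_topology)
  have "s -` W \<inter> space lattice_borel = (\<Union>i. lattice_of ` ((U i \<inter> W) \<inter> SL_real) - (\<Union>j\<in>{..<i}. Y j))"
    (is "?L = ?R") if "open W" for W
  proof (intro set_eqI iffI)
    fix L assume "L \<in> ?L"
    then have L: "L \<in> unimodular_lattices" "s L \<in> W" by (auto simp: space_lattice_borel)
    have "L \<in> lattice_of ` ((U (idx L) \<inter> W) \<inter> SL_real)" using s[OF L(1)] L(2) by (intro image_eqI[of _ _ "s L"]) auto
    moreover have "L \<notin> Y j" if "j < idx L" for j using not_less_Least[of j "\<lambda>i. L \<in> Y i"] that unfolding idx_def by blast
    ultimately show "L \<in> ?R" by blast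
  next
    fix L assume "L \<in> ?R"
    then obtain i g where g: "g \<in> U i" "g \<in> W" "g \<in> SL_real" "L = lattice_of g" "\<And>j. j < i \<Longrightarrow> L \<notin> Y j" by blast
    have L: "L \<in> unimodular_lattices" using g unfolding unimodular_lattices_def by blast
    have "L \<in> Y i" using g unfolding Y_def by blast
    then have "idx L = i" unfolding idx_def using g(5) by (intro Least_equality) (auto intro: leI)
    then have "s L = g" using s[OF L] g uniq by blast
    then show "L \<in> ?L" using g L by (simp add: space_lattice_borel)
  qed
  moreover have "(\<Union>i. lattice_of ` ((U i \<inter> W) \<inter> SL_real) - (\<Union>j\<in>{..<i}. Y j)) \<in> sets lattice_borel" if "open W" for W
  proof -
    have Yi: "Y i \<in> sets lattice_borel" for i unfolding Y_def by (rule op[OF U(1)])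
    have "(\<Union>j\<in>{..<i}. Y j) \<in> sets lattice_borel" for i by (rule sets.finite_UN) (simp_all add: Yi)
    then show ?thesis
      by (intro sets.countable_UN''[OF _ sets.Diff[OF op[OF open_Int[OF U(1) that]]]]) simp_all
  qed
  ultimately have "s \<in> lattice_borel \<rightarrow>\<^sub>M borel" by (intro borel_measurableI) simp
  then show thesis using that[of s] s by (simp add: SL_real_def)
qed

lemma lattice_act_simps:
  assumes "det h = 1" "L \<in> unimodular_lattices"
  shows "lattice_act h L \<in> unimodular_lattices" "lattice_act h (lattice_act (sinv h) L) = L"
    "lattice_act (sinv h) (lattice_act h L) = L"
proof -
  obtain g where g: "g \<in> SL_real" "L = lattice_of g" using assms(2) unfolding unimodular_lattices_def by blast
  then show "lattice_act h L \<in> unimodular_lattices"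
    using assms(1) unfolding unimodular_lattices_def
    by (auto simp: lattice_act_lattice_of SL_real_def det_mul intro!: imageI)
  show "lattice_act h (lattice_act (sinv h) L) = L" "lattice_act (sinv h) (lattice_act h L) = L"
    by (simp_all add: g lattice_act_lattice_of sinv_cancel assms(1))
qed

lemma measurable_lattice_act:
  assumes "det h = 1"
  shows "lattice_act h \<in> lattice_borel \<rightarrow>\<^sub>M (lattice_borel :: (real^'n) set measure)"
  unfolding lattice_borel_def
proof (rule measurable_measure_of)
  show "{U. openin lattice_topology U} \<subseteq> Pow (unimodular_lattices :: (real^'n) set set)"
    by (auto simp: openin_lattice_topology)
  have sp: "space (sigma unimodular_lattices {U. openin lattice_topology U}) = (unimodular_lattices :: (real^'n) set set)"
    using space_lattice_borel unfolding lattice_borel_def .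
  show "lattice_act h \<in> space (sigma unimodular_lattices {U. openin lattice_topology U}) \<rightarrow> (unimodular_lattices :: (real^'n) set set)"
    unfolding sp using lattice_act_simps(1)[OF assms] by blast
  fix W :: "(real^'n) set set" assume "W \<in> {U. openin lattice_topology U}"
  then have W: "W \<subseteq> unimodular_lattices" "openin (top_of_set SL_real) {g \<in> SL_real. lattice_of g \<in> W}"
    by (auto simp: openin_lattice_topology)
  from W(2) obtain T where T: "open T" "{g \<in> SL_real. lattice_of g \<in> W} = SL_real \<inter> T"
    unfolding openin_open by blast
  have "continuous_on UNIV (\<lambda>g::real^'n^'n. h ** g)"
    unfolding matrix_matrix_mult_def by (intro continuous_intros continuous_on_vec_lambda)
  then have "open ((\<lambda>g. h ** g) -` T)" using T(1) by (rule open_vimage[rotated])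
  moreover have "{g \<in> SL_real. lattice_of g \<in> lattice_act h -` W \<inter> unimodular_lattices} = SL_real \<inter> (\<lambda>g. h ** g) -` T"
  proof -
    have "g \<in> SL_real \<and> lattice_of g \<in> lattice_act h -` W \<inter> unimodular_lattices \<longleftrightarrow> g \<in> SL_real \<and> h ** g \<in> T" for g
    proof (cases "g \<in> SL_real")
      case True
      then have 1: "lattice_of g \<in> unimodular_lattices" unfolding unimodular_lattices_def by blast
      have hg: "h ** g \<in> SL_real" using True assms by (simp add: SL_real_def det_mul)
      have "lattice_of (h ** g) \<in> W \<longleftrightarrow> h ** g \<in> {g \<in> SL_real. lattice_of g \<in> W}" using hg by simp
      also have "\<dots> \<longleftrightarrow> h ** g \<in> T" unfolding T(2) using hg by simp
      finally show ?thesis using True 1 by (simp add: lattice_act_lattice_of)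
    qed simp
    then show ?thesis by blast
  qed
  ultimately have "openin lattice_topology (lattice_act h -` W \<inter> unimodular_lattices)"
    unfolding openin_lattice_topology by (simp add: openin_open_Int)
  then show "lattice_act h -` W \<inter> space (sigma unimodular_lattices {U. openin lattice_topology U}) \<in>
      sets (sigma unimodular_lattices {U. openin lattice_topology U})"
    unfolding sp by (subst sets_measure_of) (auto simp: openin_lattice_topology)
qed

text \<open>The matrices s (h L) and h s(L) are bases of the same lattice but need not be equal.
  Hence invariance passes only to functions constant on cosets, which is why \<open>inv_law\<close>
  is restricted to them.\<close>

lemma inv_law_section:
  fixes \<nu> :: "(real^'n) set measure"
  assumes haar: "haar_probability \<nu>"
    and s: "s \<in> lattice_borel \<rightarrow>\<^sub>M borel"
      "\<And>L. L \<in> unimodular_lattices \<Longrightarrow> det (s L) = 1"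
      "\<And>L. L \<in> unimodular_lattices \<Longrightarrow> lattice_of (s L) = L"
  shows "inv_law (distr \<nu> borel s)"
proof -
  interpret prob_space \<nu> using haar by (simp add: haar_probability_def)
  have sets: "sets \<nu> = sets lattice_borel" using haar by (simp add: haar_probability_def)
  note [measurable_cong] = sets
  have sp: "space \<nu> = unimodular_lattices" using sets_eq_imp_space_eq[OF sets] by (simp add: space_lattice_borel)
  have [measurable]: "s \<in> borel_measurable \<nu>" using s(1) by measurable
  have "prob_space (distr \<nu> borel s)" by (rule prob_space_distr) measurable
  moreover have "AE g in distr \<nu> borel s. det g = 1"
    by (subst AE_distr_iff) (auto simp: sp s(2))
  moreover have "(\<integral>\<^sup>+g. \<Phi> (h ** g) \<partial>distr \<nu> borel s) = (\<integral>\<^sup>+g. \<Phi> g \<partial>distr \<nu> borel s)"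
    if h: "det h = 1" and [measurable]: "\<Phi> \<in> borel_measurable borel"
      and inv: "\<forall>g \<gamma>. det g = 1 \<longrightarrow> \<gamma> \<in> SL_int \<longrightarrow> \<Phi> (g ** \<gamma>) = (\<Phi> g :: ennreal)"
    for h :: "real^'n^'n" and \<Phi>
  proof -
    have act [measurable]: "lattice_act h \<in> \<nu> \<rightarrow>\<^sub>M \<nu>"
      using measurable_lattice_act[OF h] by measurable
    \<comment> \<open>Invariance is given for images of sets; the preimage under the action of h is
      the image under the action of its inverse.\<close>
    have "\<nu> = distr \<nu> \<nu> (lattice_act h)"
    proof (rule measure_eqI)
      fix E assume E: "E \<in> sets \<nu>"
      have EX: "E \<subseteq> unimodular_lattices" using sets.sets_into_space[OF E] sp by simp
      have "lattice_act h -` E \<inter> space \<nu> = lattice_act (sinv h) ` E"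
      proof (intro set_eqI iffI)
        fix L assume "L \<in> lattice_act h -` E \<inter> space \<nu>"
        then show "L \<in> lattice_act (sinv h) ` E"
          using lattice_act_simps(3)[OF h, of L] sp by (metis IntD1 IntD2 image_eqI vimageD)
      next
        fix L assume "L \<in> lattice_act (sinv h) ` E"
        then obtain K where K: "K \<in> E" "L = lattice_act (sinv h) K" by blast
        then show "L \<in> lattice_act h -` E \<inter> space \<nu>"
          using EX lattice_act_simps(2)[OF h, of K] lattice_act_simps(1)[of "sinv h" K] h sp by auto
      qed
      moreover have "emeasure \<nu> (lattice_act (sinv h) ` E) = emeasure \<nu> E"
        using haar E h by (simp add: haar_probability_def SL_real_def)
      ultimately show "emeasure \<nu> E = emeasure (distr \<nu> \<nu> (lattice_act h)) E"
        using E by (simp add: emeasure_distr[OF act])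
    qed simp
    then have "(\<integral>\<^sup>+L. \<Phi> (s L) \<partial>\<nu>) = (\<integral>\<^sup>+L. \<Phi> (s L) \<partial>distr \<nu> \<nu> (lattice_act h))" by simp
    also have "\<dots> = (\<integral>\<^sup>+L. \<Phi> (s (lattice_act h L)) \<partial>\<nu>)"
      by (rule nn_integral_distr) measurable
    also have "\<dots> = (\<integral>\<^sup>+L. \<Phi> (h ** s L) \<partial>\<nu>)"
    proof (rule nn_integral_cong)
      fix L assume "L \<in> space \<nu>"
      then have L: "L \<in> unimodular_lattices" by (simp add: sp)
      have hL: "lattice_act h L \<in> unimodular_lattices" by (rule lattice_act_simps(1)[OF h L])
      have d: "det (h ** s L) = 1" by (simp add: det_mul h s(2)[OF L])
      have "lattice_of (h ** s L) = lattice_of (s (lattice_act h L))"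
        by (simp add: lattice_act_lattice_of[symmetric] s(3)[OF L] s(3)[OF hL])
      then obtain \<gamma> where "\<gamma> \<in> SL_int" "s (lattice_act h L) = h ** s L ** \<gamma>"
        using lattice_of_eq_iff[of "h ** s L" "s (lattice_act h L)"] d s(2)[OF hL] by (auto simp: SL_real_def)
      then show "\<Phi> (s (lattice_act h L)) = \<Phi> (h ** s L)" using inv d by simp
    qed
    finally show ?thesis by (simp add: nn_integral_distr)
  qed
  ultimately show ?thesis unfolding inv_law_def by simp
qed

section \<open>Uniqueness of Haar measure and invariance under stabilisers\<close>

lemma borel_measurable_nn_integral_count_space:
  fixes f :: "'a \<Rightarrow> 'i \<Rightarrow> ennreal"
  assumes A: "countable A" and f: "\<And>a. a \<in> A \<Longrightarrow> (\<lambda>x. f x a) \<in> borel_measurable M"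
  shows "(\<lambda>x. \<integral>\<^sup>+a. f x a \<partial>count_space A) \<in> borel_measurable M"
proof -
  interpret sigma_finite_measure "count_space A"
    by (rule sigma_finite_measure_count_space_countable) fact
  have "(\<lambda>(a, x). f x a) \<in> borel_measurable (count_space A \<Otimes>\<^sub>M M)"
    using f by (intro measurable_pair_measure_countable1[OF A]) simp
  from measurable_compose[OF measurable_pair_swap' this]
  have "case_prod f \<in> borel_measurable (M \<Otimes>\<^sub>M count_space A)"
    by (simp add: split_beta')
  then show ?thesis by (rule borel_measurable_nn_integral)
qed

lemma borel_measurable_sum_SL_int [measurable (raw)]:
  fixes f :: "'a \<Rightarrow> real^'n^'n \<Rightarrow> ennreal"
  assumes "\<And>\<gamma>. \<gamma> \<in> SL_int \<Longrightarrow> (\<lambda>x. f x \<gamma>) \<in> borel_measurable M"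
  shows "(\<lambda>x. \<integral>\<^sup>+\<gamma>. f x \<gamma> \<partial>count_space SL_int) \<in> borel_measurable M"
  using assms by (intro borel_measurable_nn_integral_count_space) auto

section \<open>The Haar integral and its uniqueness\<close>

lemma det_scaleR_matrix: "det (c *\<^sub>R X) = c ^ CARD('n) * det X" for X :: "real^'n^'n"
proof -
  have "c *\<^sub>R X = (\<chi> i. c *s X $ i)" by (simp add: vec_eq_iff)
  then show ?thesis by (simp add: det_rows_mul)
qed

lemma scaleR_matrix_mult:
  fixes X Y :: "real^'n^'n"
  shows "(c *\<^sub>R X) ** Y = c *\<^sub>R (X ** Y)" "X ** (c *\<^sub>R Y) = c *\<^sub>R (X ** Y)" "(c *\<^sub>R X) *v v = c *\<^sub>R (X *v v)"
  by (simp_all add: matrix_matrix_mult_def matrix_vector_mult_def vec_eq_iff sum_distrib_left mult_ac)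

definition normal_mat :: "real^'n^'n \<Rightarrow> real^'n^'n" where
  "normal_mat X = (det X powr (- 1 / real CARD('n))) *\<^sub>R X"

lemma borel_measurable_normal_mat [measurable (raw)]:
  fixes f :: "'a \<Rightarrow> real^'n^'n"
  assumes [measurable]: "f \<in> borel_measurable M"
  shows "(\<lambda>x. normal_mat (f x)) \<in> borel_measurable M"
  unfolding normal_mat_def by measurable

lemma det_normal_mat: "det X > 0 \<Longrightarrow> det (normal_mat X) = 1"
proof -
  assume X: "det X > 0"
  have "(det X powr (- 1 / real CARD('a))) ^ CARD('a) = (det X powr (- 1 / real CARD('a))) powr real CARD('a)"
    using X by (subst powr_realpow) auto
  also have "\<dots> = det X powr - 1" by (simp add: powr_powr)
  finally show ?thesis using X by (simp add: normal_mat_def det_scaleR_matrix powr_minus)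
qed

lemma normal_mat_mult:
  assumes "det h = 1"
  shows "normal_mat (h ** X) = h ** normal_mat X" "normal_mat (X ** h) = normal_mat X ** h"
  using assms by (simp_all add: normal_mat_def scaleR_matrix_mult det_mul)

definition unit_cone :: "(real^'n^'n) set" where
  "unit_cone = {X. 0 < det X \<and> det X \<le> 1}"

lemma unit_cone_sets [measurable]: "unit_cone \<in> sets borel"
proof -
  have "unit_cone = det -` {0<..1} \<inter> space (borel :: (real^'n^'n) measure)"
    by (auto simp: unit_cone_def)
  also have "\<dots> \<in> sets borel" by (rule measurable_sets[where A=borel]) measurable
  finally show ?thesis .
qed

text \<open>The Haar integral on \<open>SL(d,\<real>)\<close>, through Lebesgue measure on the cone over it.\<close>

definition haar_int :: "(real^'n^'n \<Rightarrow> ennreal) \<Rightarrow> ennreal" where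
  "haar_int F = (\<integral>\<^sup>+X. indicator unit_cone X * F (normal_mat X) \<partial>lborel)"

lemma haar_int_left:
  assumes [measurable]: "F \<in> borel_measurable borel" and h: "det h = 1"
  shows "haar_int (\<lambda>X. F (h ** X)) = haar_int F"
proof -
  have "haar_int F = (\<integral>\<^sup>+X. indicator unit_cone (h ** X) * F (normal_mat (h ** X)) \<partial>lborel)"
    unfolding haar_int_def
    by (rule nn_integral_matrix_mult_left[symmetric]) (use h in auto)
  also have "\<dots> = haar_int (\<lambda>X. F (h ** X))"
    unfolding haar_int_def normal_mat_mult[OF h]
    by (simp add: indicator_def unit_cone_def det_mul h)
  finally show ?thesis ..
qed

lemma haar_int_right:
  assumes [measurable]: "F \<in> borel_measurable borel" and h: "det h = 1"
  shows "haar_int (\<lambda>X. F (X ** h)) = haar_int F"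
proof -
  have "haar_int F = (\<integral>\<^sup>+X. indicator unit_cone (X ** h) * F (normal_mat (X ** h)) \<partial>lborel)"
    unfolding haar_int_def
    by (rule nn_integral_matrix_mult_right[symmetric]) (use h in auto)
  also have "\<dots> = haar_int (\<lambda>X. F (X ** h))"
    unfolding haar_int_def normal_mat_mult[OF h]
    by (simp add: indicator_def unit_cone_def det_mul h)
  finally show ?thesis ..
qed

text \<open>The expected sum of F over all determinant one bases of the random lattice. For fixed F
  the inner sum depends on the lattice only, so invariance of the law makes this a left invariant
  functional of F, although F itself is arbitrary.\<close>

definition basis_int :: "(real^'n^'n) measure \<Rightarrow> (real^'n^'n \<Rightarrow> ennreal) \<Rightarrow> ennreal" where
  "basis_int \<pi> F = (\<integral>\<^sup>+g. (\<integral>\<^sup>+\<gamma>. F (g ** \<gamma>) \<partial>count_space SL_int) \<partial>\<pi>)"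

lemma bij_betw_SL_int_mult:
  assumes "\<gamma> \<in> SL_int"
  shows "bij_betw ((**) \<gamma>) SL_int SL_int"
  by (rule bij_betw_byWitness[where f'="(**) (sinv \<gamma>)"])
     (auto simp: sinv_cancel SL_int_det[OF assms] intro!: SL_int_mult assms SL_int_sinv)

lemma sum_SL_int_shift:
  assumes "\<gamma> \<in> SL_int"
  shows "(\<integral>\<^sup>+\<delta>. f (g ** \<gamma> ** \<delta>) \<partial>count_space SL_int) = (\<integral>\<^sup>+\<delta>. f (g ** \<delta>) \<partial>count_space SL_int)"
  using nn_integral_bij_count_space[OF bij_betw_SL_int_mult[OF assms], of "\<lambda>\<delta>. f (g ** \<delta>)"]
  by (simp add: matrix_mul_assoc)

text \<open>This is the classical proof that Haar measure is unique: a double integral of F(x)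
  H(x^-1 y), with x running over bases and y over Haar measure, is evaluated in two ways.\<close>

lemma basis_int_haar_int:
  fixes \<pi> :: "(real^'n^'n) measure"
  assumes \<pi>: "inv_law \<pi>" and [measurable]: "F \<in> borel_measurable borel" "H \<in> borel_measurable borel"
  shows "basis_int \<pi> F * haar_int H = basis_int \<pi> (\<lambda>x. H (sinv x)) * haar_int F"
proof -
  interpret prob_space \<pi> by (rule inv_law_D[OF \<pi>])
  interpret pl: pair_sigma_finite \<pi> "lborel :: (real^'n^'n) measure" ..
  note [measurable_cong] = inv_law_D(2)[OF \<pi>]
  \<comment> \<open>Left invariance in y gives the first evaluation; replacing x by y x and then
    using right invariance in y gives the second.\<close>
  define T where "T = (\<integral>\<^sup>+X. indicator unit_cone X *
    (\<integral>\<^sup>+g. (\<integral>\<^sup>+\<gamma>. F (g ** \<gamma>) * H (sinv (g ** \<gamma>) ** normal_mat X) \<partial>count_space SL_int) \<partial>\<pi>) \<partial>lborel)"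
  have "T = (\<integral>\<^sup>+X. (\<integral>\<^sup>+g. (\<integral>\<^sup>+\<gamma>. indicator unit_cone X * (F (g ** \<gamma>) * H (sinv (g ** \<gamma>) ** normal_mat X))
     \<partial>count_space SL_int) \<partial>\<pi>) \<partial>lborel)"
    unfolding T_def by (intro nn_integral_cong) (simp add: nn_integral_cmult)
  also have "\<dots> = (\<integral>\<^sup>+g. (\<integral>\<^sup>+X. (\<integral>\<^sup>+\<gamma>. indicator unit_cone X * (F (g ** \<gamma>) * H (sinv (g ** \<gamma>) ** normal_mat X))
     \<partial>count_space SL_int) \<partial>lborel) \<partial>\<pi>)"
    by (rule pl.Fubini') measurable
  also have "\<dots> = (\<integral>\<^sup>+g. (\<integral>\<^sup>+\<gamma>. (\<integral>\<^sup>+X. indicator unit_cone X * (F (g ** \<gamma>) * H (sinv (g ** \<gamma>) ** normal_mat X)) \<partial>lborel)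
     \<partial>count_space SL_int) \<partial>\<pi>)"
    by (intro nn_integral_cong nn_integral_count_space_nn_integral) auto
  also have "\<dots> = (\<integral>\<^sup>+g. (\<integral>\<^sup>+\<gamma>. F (g ** \<gamma>) * haar_int H \<partial>count_space SL_int) \<partial>\<pi>)"
  proof (intro nn_integral_cong_AE, rule eventually_mono[OF inv_law_D(3)[OF \<pi>]])
    fix g :: "real^'n^'n" assume g: "det g = 1"
    show "(\<integral>\<^sup>+\<gamma>. (\<integral>\<^sup>+X. indicator unit_cone X * (F (g ** \<gamma>) * H (sinv (g ** \<gamma>) ** normal_mat X)) \<partial>lborel) \<partial>count_space SL_int)
      = (\<integral>\<^sup>+\<gamma>. F (g ** \<gamma>) * haar_int H \<partial>count_space SL_int)"
    proof (rule nn_integral_cong)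
      fix \<gamma> :: "real^'n^'n" assume "\<gamma> \<in> space (count_space SL_int)"
      then have d: "det (g ** \<gamma>) = 1" using g by (simp add: det_mul SL_int_det)
      have "(\<integral>\<^sup>+X. indicator unit_cone X * (F (g ** \<gamma>) * H (sinv (g ** \<gamma>) ** normal_mat X)) \<partial>lborel) =
         F (g ** \<gamma>) * haar_int (\<lambda>Y. H (sinv (g ** \<gamma>) ** Y))"
        unfolding haar_int_def by (subst nn_integral_cmult[symmetric]) (auto simp: mult_ac)
      then show "(\<integral>\<^sup>+X. indicator unit_cone X * (F (g ** \<gamma>) * H (sinv (g ** \<gamma>) ** normal_mat X)) \<partial>lborel) =
         F (g ** \<gamma>) * haar_int H"
        using haar_int_left[of H "sinv (g ** \<gamma>)"] d by simp
    qed
  qed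
  also have "\<dots> = basis_int \<pi> F * haar_int H"
    unfolding basis_int_def by (simp add: nn_integral_multc)
  finally have 1: "T = basis_int \<pi> F * haar_int H" .
  have "T = (\<integral>\<^sup>+X. indicator unit_cone X *
    (\<integral>\<^sup>+g. (\<integral>\<^sup>+\<gamma>. F (normal_mat X ** (g ** \<gamma>)) * H (sinv (g ** \<gamma>)) \<partial>count_space SL_int) \<partial>\<pi>) \<partial>lborel)"
    unfolding T_def
  proof (rule nn_integral_cong)
    fix X :: "real^'n^'n"
    show "indicator unit_cone X *
       (\<integral>\<^sup>+g. (\<integral>\<^sup>+\<gamma>. F (g ** \<gamma>) * H (sinv (g ** \<gamma>) ** normal_mat X) \<partial>count_space SL_int) \<partial>\<pi>) =
      indicator unit_cone X *
       (\<integral>\<^sup>+g. (\<integral>\<^sup>+\<gamma>. F (normal_mat X ** (g ** \<gamma>)) * H (sinv (g ** \<gamma>)) \<partial>count_space SL_int) \<partial>\<pi>)"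
    proof (cases "X \<in> unit_cone")
      case True
      \<comment> \<open>With g written as y (y^-1 g), invariance of the law removes y^-1, since the
        sum over \<gamma> is a function of the lattice.\<close>
      define y where "y = normal_mat X"
      have y: "det y = 1" using True by (simp add: y_def det_normal_mat unit_cone_def)
      have "(\<integral>\<^sup>+g. (\<integral>\<^sup>+\<gamma>. F (g ** \<gamma>) * H (sinv (g ** \<gamma>) ** y) \<partial>count_space SL_int) \<partial>\<pi>) =
        (\<integral>\<^sup>+g. (\<integral>\<^sup>+\<gamma>. F (y ** (sinv y ** g ** \<gamma>)) * H (sinv (sinv y ** g ** \<gamma>)) \<partial>count_space SL_int) \<partial>\<pi>)"
      proof (intro nn_integral_cong_AE, rule eventually_mono[OF inv_law_D(3)[OF \<pi>]], rule nn_integral_cong)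
        fix g \<gamma> :: "real^'n^'n" assume "det g = 1" "\<gamma> \<in> space (count_space SL_int)"
        then have "det (g ** \<gamma>) = 1" by (simp add: det_mul SL_int_det)
        then show "F (g ** \<gamma>) * H (sinv (g ** \<gamma>) ** y) = F (y ** (sinv y ** g ** \<gamma>)) * H (sinv (sinv y ** g ** \<gamma>))"
          using y by (simp add: matrix_mul_assoc[symmetric] sinv_cancel sinv_mult[of "sinv y" "g ** \<gamma>"] sinv_sinv)
      qed
      also have "\<dots> = (\<integral>\<^sup>+g. (\<integral>\<^sup>+\<gamma>. F (y ** (g ** \<gamma>)) * H (sinv (g ** \<gamma>)) \<partial>count_space SL_int) \<partial>\<pi>)"
      proof (rule inv_law_nn_integral[OF \<pi>])
        fix g \<gamma> :: "real^'n^'n" assume "\<gamma> \<in> SL_int"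
        then show "(\<integral>\<^sup>+\<delta>. F (y ** (g ** \<gamma> ** \<delta>)) * H (sinv (g ** \<gamma> ** \<delta>)) \<partial>count_space SL_int) =
          (\<integral>\<^sup>+\<delta>. F (y ** (g ** \<delta>)) * H (sinv (g ** \<delta>)) \<partial>count_space SL_int)"
          by (rule sum_SL_int_shift)
      qed (use y in auto)
      finally show ?thesis by (simp add: y_def)
    qed simp
  qed
  also have "\<dots> = (\<integral>\<^sup>+X. (\<integral>\<^sup>+g. (\<integral>\<^sup>+\<gamma>. indicator unit_cone X * (F (normal_mat X ** (g ** \<gamma>)) * H (sinv (g ** \<gamma>)))
     \<partial>count_space SL_int) \<partial>\<pi>) \<partial>lborel)"
    by (intro nn_integral_cong) (simp add: nn_integral_cmult)
  also have "\<dots> = (\<integral>\<^sup>+g. (\<integral>\<^sup>+X. (\<integral>\<^sup>+\<gamma>. indicator unit_cone X * (F (normal_mat X ** (g ** \<gamma>)) * H (sinv (g ** \<gamma>)))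
     \<partial>count_space SL_int) \<partial>lborel) \<partial>\<pi>)"
    by (rule pl.Fubini') measurable
  also have "\<dots> = (\<integral>\<^sup>+g. (\<integral>\<^sup>+\<gamma>. (\<integral>\<^sup>+X. indicator unit_cone X * (F (normal_mat X ** (g ** \<gamma>)) * H (sinv (g ** \<gamma>))) \<partial>lborel)
     \<partial>count_space SL_int) \<partial>\<pi>)"
    by (intro nn_integral_cong nn_integral_count_space_nn_integral) auto
  also have "\<dots> = (\<integral>\<^sup>+g. (\<integral>\<^sup>+\<gamma>. H (sinv (g ** \<gamma>)) * haar_int F \<partial>count_space SL_int) \<partial>\<pi>)"
  proof (intro nn_integral_cong_AE, rule eventually_mono[OF inv_law_D(3)[OF \<pi>]], rule nn_integral_cong)
    fix g \<gamma> :: "real^'n^'n" assume g: "det g = 1" and "\<gamma> \<in> space (count_space SL_int)"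
    then have d: "det (g ** \<gamma>) = 1" using g by (simp add: det_mul SL_int_det)
    have "(\<integral>\<^sup>+X. indicator unit_cone X * (F (normal_mat X ** (g ** \<gamma>)) * H (sinv (g ** \<gamma>))) \<partial>lborel) =
       H (sinv (g ** \<gamma>)) * haar_int (\<lambda>Y. F (Y ** (g ** \<gamma>)))"
      unfolding haar_int_def by (subst nn_integral_cmult[symmetric]) (auto simp: mult_ac)
    then show "(\<integral>\<^sup>+X. indicator unit_cone X * (F (normal_mat X ** (g ** \<gamma>)) * H (sinv (g ** \<gamma>))) \<partial>lborel) =
       H (sinv (g ** \<gamma>)) * haar_int F"
      using haar_int_right[of F "g ** \<gamma>"] d by simp
  qed
  also have "\<dots> = basis_int \<pi> (\<lambda>x. H (sinv x)) * haar_int F"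
    unfolding basis_int_def by (simp add: nn_integral_multc)
  finally show ?thesis using 1 by simp
qed

text \<open>A test function H whose integral can be cancelled in
  \<open>basis_int_haar_int\<close>.\<close>

lemma haar_int_nbhd:
  defines "H \<equiv> indicator (ball (mat 1 :: real^'n^'n) 1) :: _ \<Rightarrow> ennreal"
  shows "0 < haar_int H" "haar_int H < \<infinity>"
proof -
  let ?S = "{X :: real^'n^'n. 0 < det X \<and> det X < 1 \<and> dist (mat 1) (normal_mat X) < 1}"
  have int: "haar_int H = emeasure lborel (unit_cone \<inter> normal_mat -` ball (mat 1 :: real^'n^'n) 1)"
  proof -
    have "haar_int H = (\<integral>\<^sup>+X. indicator (unit_cone \<inter> normal_mat -` ball (mat 1 :: real^'n^'n) 1) X \<partial>lborel)"
      unfolding haar_int_def H_def by (intro nn_integral_cong) (auto simp: indicator_def)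
    moreover have "normal_mat -` ball (mat 1 :: real^'n^'n) 1 \<in> sets borel"
    proof -
      have "normal_mat \<in> borel_measurable (borel :: (real^'n^'n) measure)" by measurable
      from measurable_sets[OF this, of "ball (mat 1) 1"] show ?thesis by simp
    qed
    then have "(\<integral>\<^sup>+X. indicator (unit_cone \<inter> normal_mat -` ball (mat 1 :: real^'n^'n) 1) X \<partial>lborel) =
      emeasure lborel (unit_cone \<inter> normal_mat -` ball (mat 1 :: real^'n^'n) 1)"
      by (subst nn_integral_indicator) auto
    ultimately show ?thesis by simp
  qed
  have contdet: "continuous_on A (det :: real^'n^'n \<Rightarrow> real)" for A
    unfolding det_def by (intro continuous_intros)
  have "open {X :: real^'n^'n. 0 < det X \<and> det X < 1}"
    using open_vimage[OF open_greaterThanLessThan[of "0::real" 1] contdet]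
    by (simp add: vimage_def)
  moreover have "continuous_on {X :: real^'n^'n. 0 < det X \<and> det X < 1} normal_mat"
    unfolding normal_mat_def by (intro continuous_intros contdet) auto
  ultimately have "open ({X :: real^'n^'n. 0 < det X \<and> det X < 1} \<inter> normal_mat -` ball (mat 1) 1)"
    by (intro continuous_open_preimage) auto
  moreover have "{X :: real^'n^'n. 0 < det X \<and> det X < 1} \<inter> normal_mat -` ball (mat 1) 1 = ?S" by auto
  ultimately have op: "open ?S" by simp
  \<comment> \<open>The identity has determinant 1 and sits on the boundary of the cone. Half of it
    has the same normalisation and lies in the interior.\<close>
  define x where "x = (1/2) *\<^sub>R (mat 1 :: real^'n^'n)"
  have dx: "det x = (1/2) ^ CARD('n)" unfolding x_def by (subst det_scaleR_matrix) simp
  have "normal_mat x = mat 1"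
  proof -
    have "((1/2::real) ^ CARD('n)) powr (- 1 / real CARD('n)) = 2"
      by (simp add: powr_realpow[symmetric] powr_powr powr_minus_divide)
    then show ?thesis unfolding normal_mat_def dx by (simp add: x_def)
  qed
  then have "x \<in> ?S" using dx by (simp add: power_less_one_iff)
  then obtain e where e: "e > 0" "ball x e \<subseteq> ?S" using op by (auto simp: open_contains_ball)
  have sub: "ball x e \<subseteq> unit_cone \<inter> normal_mat -` ball (mat 1) 1"
    using e(2) by (auto simp: unit_cone_def)
  have ms: "unit_cone \<inter> normal_mat -` ball (mat 1) 1 \<in> sets (lborel :: (real^'n^'n) measure)"
  proof -
    have "normal_mat \<in> borel_measurable (borel :: (real^'n^'n) measure)" by measurable
    from measurable_sets[OF this, of "ball (mat 1) 1"] show ?thesis by auto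
  qed
  have "0 < emeasure lborel (ball x e)"
    using e(1) by (simp add: emeasure_ball)
  also have "\<dots> \<le> haar_int H" unfolding int using sub ms by (rule emeasure_mono)
  finally show "0 < haar_int H" .
  \<comment> \<open>In the cone the determinant is at most 1, so normalising can only enlarge the
    norm; a bound on the normalised matrix bounds X itself.\<close>
  have "unit_cone \<inter> normal_mat -` ball (mat 1 :: real^'n^'n) 1 \<subseteq> cball 0 (norm (mat 1 :: real^'n^'n) + 1)"
  proof
    fix X :: "real^'n^'n" assume "X \<in> unit_cone \<inter> normal_mat -` ball (mat 1) 1"
    then have X: "0 < det X" "det X \<le> 1" "dist (mat 1) (normal_mat X) < 1" by (auto simp: unit_cone_def)
    have c: "1 \<le> det X powr (- 1 / real CARD('n))"
    proof -
      have "det X powr 0 \<le> det X powr (- 1 / real CARD('n))"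
        using X by (intro powr_mono') auto
      then show ?thesis using X by simp
    qed
    have "norm X \<le> det X powr (- 1 / real CARD('n)) * norm X"
      using mult_right_mono[OF c norm_ge_zero[of X]] by simp
    also have "\<dots> = norm (normal_mat X)" by (simp add: normal_mat_def)
    also have "\<dots> \<le> norm (mat 1 :: real^'n^'n) + dist (mat 1) (normal_mat X)"
      using norm_triangle_sub[of "normal_mat X" "mat 1"] by (simp add: dist_norm norm_minus_commute)
    finally have "norm X \<le> norm (mat 1 :: real^'n^'n) + dist (mat 1) (normal_mat X)" .
    then show "X \<in> cball 0 (norm (mat 1 :: real^'n^'n) + 1)" using X by simp
  qed
  then have "haar_int H \<le> emeasure lborel (cball (0 :: real^'n^'n) (norm (mat 1 :: real^'n^'n) + 1))"
    unfolding int by (rule emeasure_mono) simp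
  also have "\<dots> < \<infinity>" by (rule emeasure_lborel_cball_finite)
  finally show "haar_int H < \<infinity>" .
qed

text \<open>The proportionality factor between the two functionals need not be known: cancelling one
  fixed H already shows that \<open>basis_int\<close> depends on F only through its Haar
  integral.\<close>

corollary basis_int_cong_haar:
  fixes \<pi> :: "(real^'n^'n) measure"
  assumes \<pi>: "inv_law \<pi>" and F: "F \<in> borel_measurable borel" "F' \<in> borel_measurable borel"
    and eq: "haar_int F = haar_int F'"
  shows "basis_int \<pi> F = basis_int \<pi> F'"
proof -
  let ?H = "indicator (ball (mat 1 :: real^'n^'n) 1) :: _ \<Rightarrow> ennreal"
  have m: "?H \<in> borel_measurable borel" by (rule borel_measurable_indicator) simp
  have "basis_int \<pi> F * haar_int ?H = basis_int \<pi> F' * haar_int ?H"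
    using basis_int_haar_int[OF \<pi> F(1) m] basis_int_haar_int[OF \<pi> F(2) m] eq by simp
  then show ?thesis
    using haar_int_nbhd[where 'n='n] by (auto simp: mult.commute[of _ "haar_int ?H"] ennreal_mult_cancel_left)
qed

section \<open>Matrix fields that fix their base point\<close>

lemma nn_integral_PiM_matrix_vector_mult:
  fixes A :: "real^'n^'n" and f :: "('i \<Rightarrow> real^'n) \<Rightarrow> ennreal"
  assumes I: "finite I" and A: "det A = 1" and f: "f \<in> borel_measurable (\<Pi>\<^sub>M i\<in>I. lborel)"
  shows "(\<integral>\<^sup>+z. f (\<lambda>k\<in>I. A *v z k) \<partial>(\<Pi>\<^sub>M i\<in>I. lborel)) = (\<integral>\<^sup>+z. f z \<partial>(\<Pi>\<^sub>M i\<in>I. lborel))"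
proof -
  interpret product_sigma_finite "\<lambda>_::'i. lborel :: (real^'n) measure" ..
  let ?P = "\<Pi>\<^sub>M i\<in>I. (lborel :: (real^'n) measure)"
  let ?T = "\<lambda>z. \<lambda>k\<in>I. A *v z k"
  have T [measurable]: "?T \<in> ?P \<rightarrow>\<^sub>M ?P"
    by (rule measurable_restrict) measurable
  have "distr ?P ?P ?T = ?P"
  proof (rule PiM_eqI[OF I])
    fix B assume B: "\<And>i. i \<in> I \<Longrightarrow> B i \<in> sets (lborel :: (real^'n) measure)"
    have pre: "?T -` (Pi\<^sub>E I B) \<inter> space ?P = Pi\<^sub>E I (\<lambda>i. (\<lambda>x. A *v x) -` B i)"
      by (auto simp: space_PiM PiE_iff)
    have m: "(\<lambda>x. A *v x) \<in> borel_measurable borel" by measurable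
    have B': "(\<lambda>x. A *v x) -` B i \<in> sets (lborel :: (real^'n) measure)" if "i \<in> I" for i
      using measurable_sets[OF m, of "B i"] B[OF that] by simp
    have eq: "emeasure lborel ((\<lambda>x. A *v x) -` B i) = emeasure lborel (B i)" if "i \<in> I" for i
    proof -
      have Bi [measurable]: "B i \<in> sets borel" using B[OF that] by simp
      have "emeasure lborel ((\<lambda>x. A *v x) -` B i) = (\<integral>\<^sup>+x. indicator (B i) (A *v x) \<partial>lborel)"
      proof -
        have "(\<lambda>x. indicator (B i) (A *v x) :: ennreal) = indicator ((\<lambda>x. A *v x) -` B i)"
          by (auto simp: indicator_def)
        then show ?thesis using B'[OF that] by simp
      qed
      also have "\<dots> = (\<integral>\<^sup>+x. indicator (B i) x \<partial>lborel)"
        using A by (intro nn_integral_matrix_vector_mult) auto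
      also have "\<dots> = emeasure lborel (B i)" by simp
      finally show ?thesis .
    qed
    have "emeasure (distr ?P ?P ?T) (Pi\<^sub>E I B) = emeasure ?P (Pi\<^sub>E I (\<lambda>i. (\<lambda>x. A *v x) -` B i))"
      using B by (subst emeasure_distr[OF T]) (auto simp: pre I)
    also have "\<dots> = (\<Prod>i\<in>I. emeasure lborel (B i))"
      using B' by (subst emeasure_PiM[OF I]) (auto simp: eq)
    finally show "emeasure (distr ?P ?P ?T) (Pi\<^sub>E I B) = (\<Prod>i\<in>I. emeasure lborel (B i))" .
  qed simp
  then have "(\<integral>\<^sup>+z. f z \<partial>?P) = (\<integral>\<^sup>+z. f z \<partial>distr ?P ?P ?T)" by simp
  also have "\<dots> = (\<integral>\<^sup>+z. f (?T z) \<partial>?P)" using f by (subst nn_integral_distr[OF T]) auto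
  finally show ?thesis by simp
qed

text \<open>A field \<open>A\<close> of matrices fixing their base point acts on matrices by fixing the first column
  and mapping each other column by a matrix of determinant one that depends on the first column only.\<close>

lemma nn_integral_column_field:
  fixes A :: "real^'n \<Rightarrow> real^'n^'n" and F :: "real^'n^'n \<Rightarrow> ennreal"
  assumes [measurable]: "A \<in> borel_measurable borel" "F \<in> borel_measurable borel"
    and det: "\<And>v. det (A v) = 1" and fix_v: "\<And>v. A v *v v = v"
  shows "(\<integral>\<^sup>+X. F (A (X *v axis i 1) ** X) \<partial>lborel) = (\<integral>\<^sup>+X. F X \<partial>lborel)"
proof -
  let ?P = "\<Pi>\<^sub>M k\<in>UNIV - {i}. (lborel :: (real^'n) measure)"
  have tr: "A (transpose Y *v axis i 1) ** transpose Y = transpose (\<chi> k. A (Y $ i) *v Y $ k)" for Y :: "real^'n^'n"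
    by (simp add: vec_eq_iff transpose_def matrix_matrix_mult_def matrix_vector_mult_def matrix_vector_mult_basis[unfolded matrix_vector_mult_def] column_def)
       (simp add: axis_def if_distrib cong: if_cong)
  have "(\<integral>\<^sup>+X. F (A (X *v axis i 1) ** X) \<partial>lborel) =
    (\<integral>\<^sup>+Y. F (A (transpose Y *v axis i 1) ** transpose Y) \<partial>lborel)"
    by (rule nn_integral_transpose[symmetric]) measurable
  also have "\<dots> = (\<integral>\<^sup>+Y. F (transpose (\<chi> k. A (Y $ i) *v Y $ k)) \<partial>lborel)"
    by (simp only: tr)
  also have "\<dots> = (\<integral>\<^sup>+y. (\<integral>\<^sup>+z. F (transpose (\<chi> k. A y *v (if k = i then y else z k))) \<partial>?P) \<partial>lborel)"
    by (subst nn_integral_lborel_vec_split(2)[of _ i]) auto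
  also have "\<dots> = (\<integral>\<^sup>+y. (\<integral>\<^sup>+z. F (transpose (\<chi> k. if k = i then y else z k)) \<partial>?P) \<partial>lborel)"
  proof (rule nn_integral_cong)
    fix y :: "real^'n"
    let ?f = "\<lambda>z. F (transpose (\<chi> k. if k = i then y else z k))"
    have f: "?f \<in> borel_measurable ?P"
    proof -
      have "(\<lambda>z. if k = i then y else z k) \<in> borel_measurable ?P" for k
        by (cases "k = i") (auto simp: measurable_component_singleton)
      then show ?thesis by measurable
    qed
    have "(\<integral>\<^sup>+z. F (transpose (\<chi> k. A y *v (if k = i then y else z k))) \<partial>?P) =
      (\<integral>\<^sup>+z. ?f (\<lambda>k\<in>UNIV - {i}. A y *v z k) \<partial>?P)"
      by (intro nn_integral_cong arg_cong[of _ _ F] arg_cong[of _ _ transpose]) (simp add: vec_eq_iff fix_v)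
    also have "\<dots> = (\<integral>\<^sup>+z. ?f z \<partial>?P)"
      by (rule nn_integral_PiM_matrix_vector_mult[OF _ det f]) simp
    finally show "(\<integral>\<^sup>+z. F (transpose (\<chi> k. A y *v (if k = i then y else z k))) \<partial>?P) = (\<integral>\<^sup>+z. ?f z \<partial>?P)" .
  qed
  also have "\<dots> = (\<integral>\<^sup>+Y. F (transpose Y) \<partial>lborel)"
    by (rule nn_integral_lborel_vec_split(2)[symmetric]) measurable
  also have "\<dots> = (\<integral>\<^sup>+X. F X \<partial>lborel)"
    by (rule nn_integral_transpose) measurable
  finally show ?thesis .
qed

text \<open>Normalising X multiplies column i by a positive factor. Homogeneity of degree zero makes
  the field blind to that factor, so the Lebesgue statement passes to the cone.\<close>

lemma haar_int_column_field:
  fixes A :: "real^'n \<Rightarrow> real^'n^'n" and F :: "real^'n^'n \<Rightarrow> ennreal"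
  assumes [measurable]: "A \<in> borel_measurable borel" "F \<in> borel_measurable borel"
    and det: "\<And>v. det (A v) = 1" and fix_v: "\<And>v. A v *v v = v"
    and hom: "\<And>c v. c > 0 \<Longrightarrow> A (c *\<^sub>R v) = A v"
  shows "haar_int (\<lambda>X. F (A (X *v axis i 1) ** X)) = haar_int F"
proof -
  have "haar_int (\<lambda>X. F (A (X *v axis i 1) ** X)) =
    (\<integral>\<^sup>+X. indicator unit_cone (A (X *v axis i 1) ** X) * F (normal_mat (A (X *v axis i 1) ** X)) \<partial>lborel)"
    unfolding haar_int_def
  proof (rule nn_integral_cong)
    fix X :: "real^'n^'n"
    have c: "normal_mat X *v axis i 1 = (det X powr (- 1 / real CARD('n))) *\<^sub>R (X *v axis i 1)"
      by (simp add: normal_mat_def scaleR_matrix_mult)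
    have "A (normal_mat X *v axis i 1) = A (X *v axis i 1)" if "det X > 0"
      unfolding c by (rule hom) (use that in simp)
    then show "indicator unit_cone X * F (A (normal_mat X *v axis i 1) ** normal_mat X) =
      indicator unit_cone (A (X *v axis i 1) ** X) * F (normal_mat (A (X *v axis i 1) ** X))"
      by (auto simp: indicator_def unit_cone_def det_mul det normal_mat_mult)
  qed
  also have "\<dots> = haar_int F"
    unfolding haar_int_def by (rule nn_integral_column_field) (use det fix_v in auto)
  finally show ?thesis .
qed

text \<open>The integer matrices with a prescribed column i form a coset of the stabiliser of
  \<open>axis i 1\<close>; P picks one representative from each.\<close>

lemma nn_integral_SL_int_prim_vecs:
  fixes P :: "real^'n^'n \<Rightarrow> bool"
  assumes "\<And>p. p \<in> prim_vecs i \<Longrightarrow> \<exists>!\<gamma>. \<gamma> \<in> SL_int \<and> \<gamma> *v axis i 1 = p \<and> P \<gamma>"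
  shows "(\<integral>\<^sup>+p. f p \<partial>count_space (prim_vecs i)) =
    (\<integral>\<^sup>+\<gamma>. indicator {\<gamma>. P \<gamma>} \<gamma> * f (\<gamma> *v axis i 1) \<partial>count_space SL_int)"
proof -
  have "bij_betw (\<lambda>\<gamma>. \<gamma> *v axis i 1) {\<gamma> \<in> SL_int. P \<gamma>} (prim_vecs i)"
    unfolding bij_betw_def
  proof
    show "inj_on (\<lambda>\<gamma>. \<gamma> *v axis i 1) {\<gamma> \<in> SL_int. P \<gamma>}"
    proof (rule inj_onI)
      fix a b assume ab: "a \<in> {\<gamma> \<in> SL_int. P \<gamma>}" "b \<in> {\<gamma> \<in> SL_int. P \<gamma>}" "a *v axis i 1 = b *v axis i 1"
      then have "a *v axis i 1 \<in> prim_vecs i" by (auto simp: prim_vecs_def)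
      from ex1_implies_ex[OF assms[OF this]] assms[OF this] show "a = b" using ab by auto
    qed
    show "(\<lambda>\<gamma>. \<gamma> *v axis i 1) ` {\<gamma> \<in> SL_int. P \<gamma>} = prim_vecs i"
    proof
      show "(\<lambda>\<gamma>. \<gamma> *v axis i 1) ` {\<gamma> \<in> SL_int. P \<gamma>} \<subseteq> prim_vecs i" by (auto simp: prim_vecs_def)
      show "prim_vecs i \<subseteq> (\<lambda>\<gamma>. \<gamma> *v axis i 1) ` {\<gamma> \<in> SL_int. P \<gamma>}"
      proof
        fix p :: "real^'n" assume "p \<in> prim_vecs i"
        from ex1_implies_ex[OF assms[OF this]] show "p \<in> (\<lambda>\<gamma>. \<gamma> *v axis i 1) ` {\<gamma> \<in> SL_int. P \<gamma>}" by auto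
      qed
    qed
  qed
  then have "(\<integral>\<^sup>+p. f p \<partial>count_space (prim_vecs i)) = (\<integral>\<^sup>+\<gamma>. f (\<gamma> *v axis i 1) \<partial>count_space {\<gamma> \<in> SL_int. P \<gamma>})"
    by (rule nn_integral_bij_count_space[symmetric])
  also have "\<dots> = (\<integral>\<^sup>+\<gamma>. f (\<gamma> *v axis i 1) * indicator {\<gamma> \<in> SL_int. P \<gamma>} \<gamma> \<partial>count_space UNIV)"
    by (rule nn_integral_count_space_indicator) simp
  also have "\<dots> = (\<integral>\<^sup>+\<gamma>. (indicator {\<gamma>. P \<gamma>} \<gamma> * f (\<gamma> *v axis i 1)) * indicator SL_int \<gamma> \<partial>count_space UNIV)"
    by (intro nn_integral_cong) (auto simp: indicator_def)
  also have "\<dots> = (\<integral>\<^sup>+\<gamma>. indicator {\<gamma>. P \<gamma>} \<gamma> * f (\<gamma> *v axis i 1) \<partial>count_space SL_int)"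
    by (rule nn_integral_count_space_indicator[symmetric]) simp
  finally show ?thesis .
qed

text \<open>Summing over the bases of the lattice unfolds both sides into Haar integrals in which the primitive
  vector is the first column.\<close>

theorem prim_stabiliser_invariance:
  fixes \<pi> :: "(real^'n^'n) measure" and A :: "real^'n \<Rightarrow> real^'n^'n"
    and F :: "real^'n \<Rightarrow> real^'n^'n \<Rightarrow> ennreal"
  assumes \<pi>: "inv_law \<pi>"
    and [measurable]: "A \<in> borel_measurable borel" "case_prod F \<in> borel_measurable (borel \<Otimes>\<^sub>M borel)"
    and det: "\<And>v. det (A v) = 1" and fix_v: "\<And>v. A v *v v = v"
    and hom: "\<And>c v. c > 0 \<Longrightarrow> A (c *\<^sub>R v) = A v"
    and inv: "\<And>v g \<gamma>. det g = 1 \<Longrightarrow> \<gamma> \<in> SL_int \<Longrightarrow> F v (g ** \<gamma>) = F v g"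
  shows "(\<integral>\<^sup>+g. (\<integral>\<^sup>+p. F (g *v p) (A (g *v p) ** g) \<partial>count_space (prim_vecs i)) \<partial>\<pi>) =
    (\<integral>\<^sup>+g. (\<integral>\<^sup>+p. F (g *v p) g \<partial>count_space (prim_vecs i)) \<partial>\<pi>)"
proof (rule fundamental_domain)
  let ?e = "axis i 1 :: real^'n"
  let ?\<Gamma> = "{\<gamma> \<in> SL_int. \<gamma> *v ?e = ?e}"
  show "?\<Gamma> \<subseteq> SL_int" "mat 1 \<in> ?\<Gamma>" by auto
  show "a ** b \<in> ?\<Gamma>" if "a \<in> ?\<Gamma>" "b \<in> ?\<Gamma>" for a b
    using that by (auto simp: SL_int_mult matrix_vector_mul_assoc[symmetric])
  show "sinv a \<in> ?\<Gamma>" if "a \<in> ?\<Gamma>" for a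
  proof -
    have a: "a \<in> SL_int" "a *v ?e = ?e" using that by auto
    have "sinv a *v (a *v ?e) = ?e" by (rule sinv_cancel(5)[OF SL_int_det[OF a(1)]])
    then show ?thesis using a by (simp add: SL_int_sinv)
  qed
  fix D assume D [measurable]: "D \<in> sets (borel :: (real^'n^'n) measure)"
    and uniq: "\<And>g. det g = 1 \<Longrightarrow> \<exists>!s. s \<in> ?\<Gamma> \<and> g ** s \<in> D"
  \<comment> \<open>The candidates \<gamma> form the coset \<gamma>0 ?\<Gamma>, and D meets the
    corresponding orbit of k \<gamma>0 once.\<close>
  have unique: "\<exists>!\<gamma>. \<gamma> \<in> SL_int \<and> \<gamma> *v ?e = p \<and> k ** \<gamma> \<in> D"
    if p: "p \<in> prim_vecs i" and k: "det k = 1" for p and k :: "real^'n^'n"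
  proof -
    obtain \<gamma>0 where \<gamma>0: "\<gamma>0 \<in> SL_int" "\<gamma>0 *v ?e = p" using p by (auto simp: prim_vecs_def)
    have "det (k ** \<gamma>0) = 1" using k \<gamma>0 by (simp add: det_mul SL_int_det)
    from uniq[OF this] obtain s where s: "s \<in> ?\<Gamma>" "k ** \<gamma>0 ** s \<in> D"
      and u: "\<And>t. t \<in> ?\<Gamma> \<Longrightarrow> k ** \<gamma>0 ** t \<in> D \<Longrightarrow> t = s" by blast
    show ?thesis
    proof (rule ex1I[of _ "\<gamma>0 ** s"])
      show "\<gamma>0 ** s \<in> SL_int \<and> \<gamma>0 ** s *v ?e = p \<and> k ** (\<gamma>0 ** s) \<in> D"
        using s \<gamma>0 by (auto simp: SL_int_mult matrix_vector_mul_assoc[symmetric] matrix_mul_assoc)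
      fix \<gamma> assume \<gamma>: "\<gamma> \<in> SL_int \<and> \<gamma> *v ?e = p \<and> k ** \<gamma> \<in> D"
      have d: "det \<gamma>0 = 1" by (rule SL_int_det) fact
      have "sinv \<gamma>0 ** \<gamma> \<in> ?\<Gamma>"
        using \<gamma> \<gamma>0 d sinv_cancel(5)[OF d, of ?e] by (auto simp: SL_int_mult SL_int_sinv matrix_vector_mul_assoc[symmetric])
      moreover have "k ** \<gamma>0 ** (sinv \<gamma>0 ** \<gamma>) \<in> D"
        using \<gamma> by (simp add: matrix_mul_assoc sinv_cancel(3)[OF d])
      ultimately have "sinv \<gamma>0 ** \<gamma> = s" by (rule u)
      then show "\<gamma> = \<gamma>0 ** s" using sinv_cancel(2)[OF d, of \<gamma>] by simp
    qed
  qed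
  define \<Phi> where "\<Phi> X = indicator D X * F (X *v ?e) X" for X
  define \<tau> where "\<tau> X = A (X *v ?e) ** X" for X
  have [measurable]: "\<Phi> \<in> borel_measurable borel" "\<tau> \<in> borel_measurable borel"
    unfolding \<Phi>_def \<tau>_def by measurable
  have 1: "(\<integral>\<^sup>+p. F (g *v p) g \<partial>count_space (prim_vecs i)) = (\<integral>\<^sup>+\<gamma>. \<Phi> (g ** \<gamma>) \<partial>count_space SL_int)"
    if g: "det g = 1" for g
  proof -
    have "(\<integral>\<^sup>+p. F (g *v p) g \<partial>count_space (prim_vecs i)) =
      (\<integral>\<^sup>+\<gamma>. indicator {\<gamma>. g ** \<gamma> \<in> D} \<gamma> * F (g *v (\<gamma> *v ?e)) g \<partial>count_space SL_int)"
      by (rule nn_integral_SL_int_prim_vecs[OF unique[OF _ g]])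
    also have "\<dots> = (\<integral>\<^sup>+\<gamma>. \<Phi> (g ** \<gamma>) \<partial>count_space SL_int)"
      using inv[OF g] by (intro nn_integral_cong) (auto simp: \<Phi>_def indicator_def matrix_vector_mul_assoc)
    finally show ?thesis .
  qed
  have 2: "(\<integral>\<^sup>+p. F (g *v p) (A (g *v p) ** g) \<partial>count_space (prim_vecs i)) = (\<integral>\<^sup>+\<gamma>. \<Phi> (\<tau> (g ** \<gamma>)) \<partial>count_space SL_int)"
    if g: "det g = 1" for g
  proof -
    \<comment> \<open>Representatives are chosen relative to the moved lattice, so that the selected
      matrices are those with \<tau> (g \<gamma>) in D. The two sides then differ exactly by
      composing with \<tau>, which preserves the Haar integral.\<close>
    have "\<exists>!\<gamma>. \<gamma> \<in> SL_int \<and> \<gamma> *v ?e = p \<and> A (g *v (\<gamma> *v ?e)) ** g ** \<gamma> \<in> D" if "p \<in> prim_vecs i" for p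
    proof -
      have "\<exists>!\<gamma>. \<gamma> \<in> SL_int \<and> \<gamma> *v ?e = p \<and> A (g *v p) ** g ** \<gamma> \<in> D"
        by (rule unique[OF that]) (simp add: det_mul det g)
      moreover have "(\<gamma> \<in> SL_int \<and> \<gamma> *v ?e = p \<and> A (g *v (\<gamma> *v ?e)) ** g ** \<gamma> \<in> D) =
        (\<gamma> \<in> SL_int \<and> \<gamma> *v ?e = p \<and> A (g *v p) ** g ** \<gamma> \<in> D)" for \<gamma> by blast
      ultimately show ?thesis by simp
    qed
    then have "(\<integral>\<^sup>+p. F (g *v p) (A (g *v p) ** g) \<partial>count_space (prim_vecs i)) =
      (\<integral>\<^sup>+\<gamma>. indicator {\<gamma>. A (g *v (\<gamma> *v ?e)) ** g ** \<gamma> \<in> D} \<gamma> * F (g *v (\<gamma> *v ?e)) (A (g *v (\<gamma> *v ?e)) ** g) \<partial>count_space SL_int)"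
      by (rule nn_integral_SL_int_prim_vecs)
    also have "\<dots> = (\<integral>\<^sup>+\<gamma>. \<Phi> (\<tau> (g ** \<gamma>)) \<partial>count_space SL_int)"
    proof (rule nn_integral_cong)
      fix \<gamma> :: "real^'n^'n" assume "\<gamma> \<in> space (count_space SL_int)"
      then have \<gamma>: "\<gamma> \<in> SL_int" by simp
      let ?v = "g *v (\<gamma> *v ?e)"
      have "\<tau> (g ** \<gamma>) = A ?v ** g ** \<gamma>" by (simp add: \<tau>_def matrix_vector_mul_assoc matrix_mul_assoc)
      moreover have "\<tau> (g ** \<gamma>) *v ?e = ?v"
        by (simp add: \<tau>_def matrix_vector_mul_assoc[symmetric] fix_v)
      moreover have "F ?v (A ?v ** g ** \<gamma>) = F ?v (A ?v ** g)"
        by (rule inv) (auto simp: det_mul det g \<gamma>)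
      ultimately show "indicator {\<gamma>. A (g *v (\<gamma> *v ?e)) ** g ** \<gamma> \<in> D} \<gamma> * F (g *v (\<gamma> *v ?e)) (A (g *v (\<gamma> *v ?e)) ** g) =
        \<Phi> (\<tau> (g ** \<gamma>))"
        by (simp add: \<Phi>_def indicator_def)
    qed
    finally show ?thesis .
  qed
  have "(\<integral>\<^sup>+g. (\<integral>\<^sup>+p. F (g *v p) (A (g *v p) ** g) \<partial>count_space (prim_vecs i)) \<partial>\<pi>) = basis_int \<pi> (\<lambda>X. \<Phi> (\<tau> X))"
    unfolding basis_int_def by (intro nn_integral_cong_AE eventually_mono[OF inv_law_D(3)[OF \<pi>]] 2)
  also have "\<dots> = basis_int \<pi> \<Phi>"
    by (rule basis_int_cong_haar[OF \<pi>]) (auto simp: \<tau>_def intro!: haar_int_column_field det fix_v hom)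
  also have "\<dots> = (\<integral>\<^sup>+g. (\<integral>\<^sup>+p. F (g *v p) g \<partial>count_space (prim_vecs i)) \<partial>\<pi>)"
    unfolding basis_int_def by (intro nn_integral_cong_AE eventually_mono[OF inv_law_D(3)[OF \<pi>]] 1[symmetric])
  finally show "(\<integral>\<^sup>+g. (\<integral>\<^sup>+p. F (g *v p) (A (g *v p) ** g) \<partial>count_space (prim_vecs i)) \<partial>\<pi>) =
    (\<integral>\<^sup>+g. (\<integral>\<^sup>+p. F (g *v p) g \<partial>count_space (prim_vecs i)) \<partial>\<pi>)" .
qed

section \<open>Equidistribution of sheared lattices\<close>

lemma nn_integral_vec_scaleR:
  fixes F :: "real^'n \<Rightarrow> ennreal"
  assumes "F \<in> borel_measurable borel" "c > 0"
  shows "ennreal (c ^ CARD('n)) * (\<integral>\<^sup>+x. F (c *\<^sub>R x) \<partial>lborel) = (\<integral>\<^sup>+x. F x \<partial>lborel)"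
proof -
  have "mat_act (c *\<^sub>R mat 1) x = c *\<^sub>R x" for x :: "real^'n"
    by (simp add: mat_act_vec scaleR_matrix_mult)
  moreover have "det (c *\<^sub>R mat 1 :: real^'n^'n) = c ^ CARD('n)" by (subst det_scaleR_matrix) simp
  ultimately show ?thesis using nn_integral_mat_act[OF assms(1), of "c *\<^sub>R mat 1"] assms(2) by simp
qed

definition floor_vec :: "real^'n \<Rightarrow> real^'n" where
  "floor_vec z = (\<chi> i. of_int \<lfloor>z $ i\<rfloor>)"

lemma borel_measurable_floor_vec [measurable (raw)]:
  assumes [measurable]: "f \<in> borel_measurable M"
  shows "(\<lambda>x. floor_vec (f x)) \<in> borel_measurable M"
  unfolding floor_vec_def by measurable

text \<open>The half open unit cells tile space and have volume 1. Writing a lattice sum as an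
  integral makes dominated convergence available for Riemann sums.\<close>

lemma nn_integral_floor_vec:
  fixes h :: "real^'n \<Rightarrow> ennreal"
  shows "(\<integral>\<^sup>+z. h (floor_vec z) \<partial>lborel) = (\<integral>\<^sup>+m. h m \<partial>count_space int_lattice)"
proof -
  have fl: "floor_vec z \<in> int_lattice" for z :: "real^'n" by (simp add: floor_vec_def int_lattice_def)
  have cell: "emeasure lborel {z. floor_vec z = m} = 1" if m: "m \<in> int_lattice" for m :: "real^'n"
  proof -
    have ms: "{z. floor_vec z = m} \<in> sets (borel :: (real^'n) measure)"
    proof -
      have "floor_vec -` {m} \<inter> space (borel :: (real^'n) measure) \<in> sets borel"
        by (rule measurable_sets[where A=borel]) measurable
      then show ?thesis by (simp add: vimage_def)
    qed
    have mi: "\<exists>q::int. m $ i = of_int q" for i using m by (auto simp: int_lattice_def elim: Ints_cases)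
    have 1: "box m (m + 1) \<subseteq> {z. floor_vec z = m}"
    proof
      fix z assume z: "z \<in> box m (m + 1)"
      have "of_int \<lfloor>z $ i\<rfloor> = m $ i" for i
      proof -
        obtain q :: int where q: "m $ i = of_int q" using mi by blast
        have "m $ i < z $ i" "z $ i < m $ i + 1" using z by (auto simp: mem_box_cart)
        then have "\<lfloor>z $ i\<rfloor> = q" using q by (intro floor_unique) auto
        then show ?thesis using q by simp
      qed
      then show "z \<in> {z. floor_vec z = m}" by (simp add: floor_vec_def vec_eq_iff)
    qed
    have 2: "{z. floor_vec z = m} \<subseteq> cbox m (m + 1)"
    proof
      fix z assume "z \<in> {z. floor_vec z = m}"
      then have "of_int \<lfloor>z $ i\<rfloor> = m $ i" for i by (auto simp: floor_vec_def)
      then have "m $ i \<le> z $ i \<and> z $ i \<le> m $ i + 1" for i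
        by (metis floor_correct less_le of_int_add of_int_1)
      then show "z \<in> cbox m (m + 1)" by (simp add: mem_box_cart)
    qed
    have edges: "(\<Prod>b\<in>Basis. (m + 1 - m) \<bullet> b) = 1"
      by (intro prod.neutral) (auto simp: Basis_vec_def inner_axis)
    have "m \<bullet> b \<le> (m + 1) \<bullet> b" if "b \<in> Basis" for b
      using that by (auto simp: Basis_vec_def inner_axis)
    then have "emeasure lborel (box m (m + 1)) = 1" "emeasure lborel (cbox m (m + 1)) = 1"
      using edges by (simp_all add: emeasure_lborel_box_eq emeasure_lborel_cbox_eq)
    then show ?thesis
      using emeasure_mono[OF 1, of lborel] emeasure_mono[OF 2, of lborel] ms by (simp add: antisym)
  qed
  have "(\<integral>\<^sup>+z. h (floor_vec z) \<partial>lborel) =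
    (\<integral>\<^sup>+z. (\<integral>\<^sup>+m. h m * indicator {z. floor_vec z = m} z \<partial>count_space int_lattice) \<partial>lborel)"
  proof (rule nn_integral_cong)
    fix z :: "real^'n"
    have "(\<integral>\<^sup>+m. h m * indicator {z. floor_vec z = m} z \<partial>count_space int_lattice) =
      (\<integral>\<^sup>+m. h (floor_vec z) * indicator {floor_vec z} m \<partial>count_space int_lattice)"
      by (intro nn_integral_cong) (auto simp: indicator_def)
    also have "\<dots> = h (floor_vec z)" using fl by (simp add: nn_integral_cmult_indicator)
    finally show "h (floor_vec z) = (\<integral>\<^sup>+m. h m * indicator {z. floor_vec z = m} z \<partial>count_space int_lattice)" ..
  qed
  also have "\<dots> = (\<integral>\<^sup>+m. (\<integral>\<^sup>+z. h m * indicator {z. floor_vec z = m} z \<partial>lborel) \<partial>count_space int_lattice)"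
  proof (rule nn_integral_count_space_nn_integral)
    fix m :: "real^'n"
    have "{z. floor_vec z = m} \<in> sets (borel :: (real^'n) measure)"
    proof -
      have "floor_vec -` {m} \<inter> space (borel :: (real^'n) measure) \<in> sets borel"
        by (rule measurable_sets[where A=borel]) measurable
      then show ?thesis by (simp add: vimage_def)
    qed
    then show "(\<lambda>z. h m * indicator {z. floor_vec z = m} z) \<in> borel_measurable lborel" by measurable
  qed simp
  also have "\<dots> = (\<integral>\<^sup>+m. h m \<partial>count_space int_lattice)"
  proof (rule nn_integral_cong)
    fix m :: "real^'n" assume "m \<in> space (count_space int_lattice)"
    then have m: "m \<in> int_lattice" by simp
    have "{z. floor_vec z = m} \<in> sets lborel"
      using cell[OF m] emeasure_notin_sets by fastforce
    then show "(\<integral>\<^sup>+z. h m * indicator {z. floor_vec z = m} z \<partial>lborel) = h m"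
      by (simp add: nn_integral_cmult_indicator cell[OF m])
  qed
  finally show ?thesis .
qed

lemma AE_lborel_component_nonzero: "AE x::real^'n in lborel. x $ j \<noteq> 0"
proof -
  have "(\<integral>\<^sup>+x. indicator {x::real^'n. x $ j = 0} x \<partial>lborel) =
    (\<integral>\<^sup>+z. (\<integral>\<^sup>+y. indicator {0} y \<partial>(lborel :: real measure)) \<partial>(\<Pi>\<^sub>M i\<in>UNIV - {j}. (lborel :: real measure)))"
    by (subst nn_integral_lborel_vec_split(1)[of _ j], simp, intro nn_integral_cong, simp only: indicator_def mem_Collect_eq)
       simp
  also have "(\<integral>\<^sup>+y. indicator {0} y \<partial>(lborel :: real measure)) = 0"
    by (subst nn_integral_indicator) auto
  finally have "emeasure lborel {x::real^'n. x $ j = 0} = 0" by simp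
  then show ?thesis
    by (intro AE_I[of _ _ "{x::real^'n. x $ j = 0}"]) auto
qed

lemma matrix_vector_bound:
  fixes A :: "real^'n^'n"
  shows "\<exists>B>0. \<forall>x. norm (A *v x) \<le> B * norm x"
  using bounded_linear.pos_bounded[OF matrix_vector_mul_bounded_linear[of A]]
  by (metis mult.commute)

text \<open>The sum is the integral of a step function obtained by rounding to the grid of mesh 1 /
  T. Rounded points move with n, which is why the limit hypothesis speaks of sequences V tending to
  W; the excluded hyperplane is null.\<close>

lemma riemann_sum_limit:
  fixes g :: "real^'n^'n" and G :: "nat \<Rightarrow> real^'n \<Rightarrow> ennreal" and G' :: "real^'n \<Rightarrow> ennreal"
  assumes g: "det g = 1" and T: "\<And>n. T n \<ge> 1" "filterlim T at_top sequentially"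
    and [measurable]: "\<And>n. G n \<in> borel_measurable borel" "G' \<in> borel_measurable borel"
    and C: "\<And>n W. G n W \<le> ennreal C" and R: "\<And>n W. G n W \<noteq> 0 \<Longrightarrow> norm W \<le> R"
    and lim: "\<And>V W. W $ j \<noteq> 0 \<Longrightarrow> V \<longlonglongrightarrow> W \<Longrightarrow> (\<lambda>n. G n (V n)) \<longlonglongrightarrow> G' W"
  shows "(\<lambda>n. \<integral>\<^sup>+m. ennreal (1 / T n ^ CARD('n)) * G n ((1 / T n) *\<^sub>R (g *v m)) \<partial>count_space int_lattice)
    \<longlonglongrightarrow> (\<integral>\<^sup>+W. G' W \<partial>lborel)"
proof -
  define fl where "fl n y = (1 / T n) *\<^sub>R floor_vec (T n *\<^sub>R y)" for n and y :: "real^'n"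
  have Tpos: "T n > 0" for n using T(1)[of n] by simp
  have [measurable]: "fl n \<in> borel_measurable borel" for n unfolding fl_def by measurable
  have fl_dist: "norm (fl n y - y) \<le> real CARD('n) / T n" for n y
  proof -
    have "\<bar>(fl n y - y) $ i\<bar> \<le> 1 / T n" for i
    proof -
      have "(fl n y - y) $ i = (of_int \<lfloor>T n * y $ i\<rfloor> - T n * y $ i) / T n"
        using Tpos[of n] by (simp add: fl_def floor_vec_def field_simps)
      moreover have "\<bar>of_int \<lfloor>T n * y $ i\<rfloor> - T n * y $ i\<bar> \<le> 1" by linarith
      ultimately show ?thesis using Tpos[of n] by (simp add: divide_right_mono)
    qed
    then have "(\<Sum>i\<in>UNIV. \<bar>(fl n y - y) $ i\<bar>) \<le> real CARD('n) * (1 / T n)"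
      by (intro sum_bounded_above)
    then show ?thesis using norm_le_l1_cart[of "fl n y - y"] by simp
  qed
  have eq: "(\<integral>\<^sup>+m. ennreal (1 / T n ^ CARD('n)) * G n ((1 / T n) *\<^sub>R (g *v m)) \<partial>count_space int_lattice) =
    (\<integral>\<^sup>+y. G n (g *v fl n y) \<partial>lborel)" for n
  proof -
    have "(\<integral>\<^sup>+m. ennreal (1 / T n ^ CARD('n)) * G n ((1 / T n) *\<^sub>R (g *v m)) \<partial>count_space int_lattice) =
      ennreal (1 / T n ^ CARD('n)) * (\<integral>\<^sup>+z. G n ((1 / T n) *\<^sub>R (g *v floor_vec z)) \<partial>lborel)"
      by (subst nn_integral_floor_vec[of "\<lambda>m. G n ((1 / T n) *\<^sub>R (g *v m))"]) (rule nn_integral_cmult, simp)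
    also have "(\<integral>\<^sup>+z. G n ((1 / T n) *\<^sub>R (g *v floor_vec z)) \<partial>lborel) =
      ennreal (T n ^ CARD('n)) * (\<integral>\<^sup>+y. G n ((1 / T n) *\<^sub>R (g *v floor_vec (T n *\<^sub>R y))) \<partial>lborel)"
      by (rule nn_integral_vec_scaleR[symmetric]) (use Tpos in auto)
    also have "ennreal (1 / T n ^ CARD('n)) * (ennreal (T n ^ CARD('n)) * (\<integral>\<^sup>+y. G n ((1 / T n) *\<^sub>R (g *v floor_vec (T n *\<^sub>R y))) \<partial>lborel)) =
      (\<integral>\<^sup>+y. G n ((1 / T n) *\<^sub>R (g *v floor_vec (T n *\<^sub>R y))) \<partial>lborel)"
      using Tpos[of n] by (simp add: mult.assoc[symmetric] ennreal_mult[symmetric])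
    finally show ?thesis by (simp add: fl_def matrix_vector_mult_scaleR)
  qed
  obtain B where B: "B > 0" "\<And>x. norm (sinv g *v x) \<le> B * norm x" using matrix_vector_bound[of "sinv g"] by blast
  \<comment> \<open>B transfers the support bound R through g^-1, and the second term absorbs the
    rounding error, which is at most d because T is at least 1.\<close>
  define R' where "R' = B * \<bar>R\<bar> + real CARD('n)"
  have supp: "norm y \<le> R'" if "G n (g *v fl n y) \<noteq> 0" for n y
  proof -
    have "norm (fl n y) \<le> B * norm (g *v fl n y)" using B(2)[of "g *v fl n y"] by (simp add: sinv_cancel g)
    also have "\<dots> \<le> B * \<bar>R\<bar>" using R[OF that] B(1) by (intro mult_left_mono) auto
    finally have 1: "norm (fl n y) \<le> B * \<bar>R\<bar>" .
    have "real CARD('n) / T n \<le> real CARD('n)" using T(1)[of n] by (simp add: divide_le_eq mult_le_cancel_left1)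
    then show ?thesis using fl_dist[of n y] 1 norm_triangle_sub[of y "fl n y"]
      unfolding R'_def by (simp add: norm_minus_commute)
  qed
  have conv: "(\<lambda>n. fl n y) \<longlonglongrightarrow> y" for y
  proof -
    have "(\<lambda>n. real CARD('n) / T n) \<longlonglongrightarrow> 0" by (rule real_tendsto_divide_at_top[OF tendsto_const T(2)])
    then have "(\<lambda>n. norm (fl n y - y)) \<longlonglongrightarrow> 0"
      by (rule Lim_null_comparison[rotated]) (simp add: fl_dist)
    then show ?thesis by (simp add: LIM_zero_iff tendsto_norm_zero_iff)
  qed
  have gconv: "(\<lambda>n. g *v fl n y) \<longlonglongrightarrow> g *v y" for y
    by (rule bounded_linear.tendsto[OF matrix_vector_mul_bounded_linear conv])
  have ae: "AE y in lborel. (g *v y) $ j \<noteq> 0"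
  proof -
    have "(\<integral>\<^sup>+y. indicator {x::real^'n. x $ j = 0} (g *v y) \<partial>lborel) = (\<integral>\<^sup>+x. indicator {x::real^'n. x $ j = 0} x \<partial>lborel)"
      by (rule nn_integral_matrix_vector_mult) (use g in auto)
    also have "\<dots> = 0"
      using AE_lborel_component_nonzero[of j] by (subst nn_integral_0_iff_AE) (auto simp: indicator_def)
    finally have "AE y in lborel. indicator {x::real^'n. x $ j = 0} (g *v y) = (0::ennreal)"
      by (subst (asm) nn_integral_0_iff_AE) auto
    then show ?thesis by (rule eventually_mono) (auto simp: indicator_def split: if_splits)
  qed
  have [measurable]: "cball (0 :: real^'n) R' \<in> sets borel" by simp
  have "(\<lambda>n. \<integral>\<^sup>+y. G n (g *v fl n y) \<partial>lborel) \<longlonglongrightarrow> (\<integral>\<^sup>+y. G' (g *v y) \<partial>lborel)"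
  proof (rule nn_integral_dominated_convergence[where w="\<lambda>y. ennreal C * indicator (cball 0 R') y"])
    show "AE y in lborel. G n (g *v fl n y) \<le> ennreal C * indicator (cball 0 R') y" for n
      using C[of n] supp[of n] by (intro AE_I2) (auto simp: indicator_def)
    show "(\<integral>\<^sup>+y. ennreal C * indicator (cball 0 R') (y::real^'n) \<partial>lborel) < \<infinity>"
      using emeasure_lborel_cball_finite[of "0::real^'n" R'] by (simp add: nn_integral_cmult_indicator ennreal_mult_less_top)
    show "AE y in lborel. (\<lambda>n. G n (g *v fl n y)) \<longlonglongrightarrow> G' (g *v y)"
      using ae by (rule eventually_mono) (rule lim[OF _ gconv])
  qed auto
  moreover have "(\<integral>\<^sup>+y. G' (g *v y) \<partial>lborel) = (\<integral>\<^sup>+y. G' y \<partial>lborel)"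
    by (rule nn_integral_matrix_vector_mult) (use g in auto)
  ultimately show ?thesis by (simp add: eq)
qed

text \<open>The probability density from which shear parameters are drawn; continuity makes the
  averaged sums converge, and compact support keeps them bounded.\<close>

definition tent :: "real \<Rightarrow> real" where
  "tent x = max 0 (1 - \<bar>x\<bar>)"

lemma tent_bounds [simp]: "0 \<le> tent x" "tent x \<le> 1"
  by (auto simp: tent_def)

lemma tent_eq_0: "\<bar>x\<bar> \<ge> 1 \<Longrightarrow> tent x = 0"
  by (simp add: tent_def)

lemma continuous_tent: "continuous_on A tent"
  unfolding tent_def by (intro continuous_intros)

lemma borel_measurable_tent [measurable]: "tent \<in> borel_measurable borel"
  by (rule borel_measurable_continuous_onI[OF continuous_tent])

lemma nn_integral_tent: "(\<integral>\<^sup>+x. ennreal (tent x) \<partial>lborel) = 1"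
proof -
  have A: "(\<integral>\<^sup>+x. ennreal (1 - x) * indicator {0..1} x \<partial>lborel) = ennreal ((1 - 1\<^sup>2/2) - (0 - 0\<^sup>2/2))"
    by (rule nn_integral_FTC_Icc[where F="\<lambda>x. x - x\<^sup>2/2"]) (auto intro!: derivative_eq_intros)
  have B: "(\<integral>\<^sup>+x. ennreal (1 + x) * indicator {-1..0} x \<partial>lborel) = ennreal ((0 + 0\<^sup>2/2) - (-1 + (-1)\<^sup>2/2))"
    by (rule nn_integral_FTC_Icc[where F="\<lambda>x. x + x\<^sup>2/2"]) (auto intro!: derivative_eq_intros)
  have "(\<integral>\<^sup>+x. ennreal (tent x) \<partial>lborel) =
    (\<integral>\<^sup>+x. ennreal (1 - x) * indicator {0..1} x + ennreal (1 + x) * indicator {-1..0} x \<partial>lborel)"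
    using AE_lborel_singleton[of "0::real"]
    by (intro nn_integral_cong_AE, elim eventually_mono) (auto simp: tent_def indicator_def max_def)
  also have "\<dots> = ennreal (1/2) + ennreal (1/2)"
    using A B by (subst nn_integral_add) (auto simp: power2_eq_square)
  also have "\<dots> = ennreal (1/2 + 1/2)" by (rule ennreal_plus[symmetric]) simp_all
  finally show ?thesis by simp
qed

lemma nn_integral_tent_scale:
  assumes "c \<noteq> 0"
  shows "(\<integral>\<^sup>+x. ennreal (tent (x / c)) \<partial>lborel) = ennreal \<bar>c\<bar>"
proof -
  have "(\<integral>\<^sup>+x. ennreal (tent (x / c)) \<partial>lborel) = ennreal \<bar>c\<bar> * (\<integral>\<^sup>+x. ennreal (tent ((0 + c * x) / c)) \<partial>lborel)"
    by (rule nn_integral_real_affine) (use assms in auto)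
  then show ?thesis using assms by (simp add: nn_integral_tent)
qed

lemma nn_integral_lborel_vec_prod:
  fixes f :: "'n::finite \<Rightarrow> real \<Rightarrow> ennreal"
  assumes [measurable]: "\<And>i. f i \<in> borel_measurable borel"
  shows "(\<integral>\<^sup>+y. (\<Prod>i\<in>UNIV. f i (y $ i)) \<partial>(lborel :: (real^'n) measure)) = (\<Prod>i\<in>UNIV. \<integral>\<^sup>+x. f i x \<partial>lborel)"
proof -
  interpret product_sigma_finite "\<lambda>_::'n. lborel :: real measure" ..
  have m [measurable]: "(\<lambda>x. \<chi> i. x i) \<in> borel_measurable (\<Pi>\<^sub>M i\<in>(UNIV::'n set). (lborel::real measure))"
    by (intro borel_measurable_vec_lambda) (simp add: measurable_component_singleton)
  have "(\<integral>\<^sup>+y. (\<Prod>i\<in>UNIV. f i (y $ i)) \<partial>(lborel :: (real^'n) measure)) =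
    (\<integral>\<^sup>+y. (\<Prod>i\<in>UNIV. f i (y i)) \<partial>(\<Pi>\<^sub>M i\<in>UNIV. lborel))"
    by (subst lborel_vec_eq_PiM) (simp add: nn_integral_distr)
  also have "\<dots> = (\<Prod>i\<in>UNIV. \<integral>\<^sup>+x. f i x \<partial>lborel)"
    by (rule product_nn_integral_prod) auto
  finally show ?thesis .
qed

definition tents :: "real^'n \<Rightarrow> real" where
  "tents y = (\<Prod>i\<in>UNIV. tent (y $ i))"

lemma tents_bounds [simp]: "0 \<le> tents y" "tents y \<le> 1"
  unfolding tents_def by (auto intro!: prod_nonneg prod_le_1)

lemma tents_nonzero: "tents y \<noteq> 0 \<Longrightarrow> \<bar>y $ i\<bar> \<le> 1"
  using tent_eq_0[of "y $ i"] by (force simp: tents_def)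

lemma continuous_tents: "continuous_on A tents"
  unfolding tents_def
  by (intro continuous_on_prod continuous_on_compose2[OF continuous_tent[of UNIV]] continuous_intros) auto

lemma borel_measurable_tents [measurable]: "tents \<in> borel_measurable borel"
  by (rule borel_measurable_continuous_onI[OF continuous_tents])

lemma nn_integral_tents: "(\<integral>\<^sup>+y. ennreal (tents y) \<partial>lborel) = 1"
  unfolding tents_def
  by (subst prod_ennreal[symmetric])
     (simp_all add: nn_integral_lborel_vec_prod[of "\<lambda>_ x. ennreal (tent x)"] nn_integral_tent)

section \<open>Averages over large shears\<close>

definition mix :: "'n set \<Rightarrow> 'a^'n \<Rightarrow> 'a^'n \<Rightarrow> 'a^'n" where
  "mix K y W = (\<chi> i. if i \<in> K then y $ i else W $ i)"

lemma borel_measurable_mix [measurable (raw)]: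
  fixes f g :: "'a \<Rightarrow> real^'n"
  assumes [measurable]: "f \<in> borel_measurable M" "g \<in> borel_measurable M"
  shows "(\<lambda>x. mix K (f x) (g x)) \<in> borel_measurable M"
  unfolding mix_def by measurable

text \<open>Exchanging the coordinates in K between two vectors permutes the coordinates of the
  pair.\<close>

lemma nn_integral_mix_swap:
  fixes H :: "real^'n \<Rightarrow> real^'n \<Rightarrow> ennreal"
  assumes [measurable]: "case_prod H \<in> borel_measurable (borel \<Otimes>\<^sub>M borel)"
  shows "(\<integral>\<^sup>+W. (\<integral>\<^sup>+y. H (mix K y W) (mix K W y) \<partial>lborel) \<partial>lborel) = (\<integral>\<^sup>+W. (\<integral>\<^sup>+y. H W y \<partial>lborel) \<partial>lborel)"
proof -
  let ?T = "\<lambda>p::(real^'n) \<times> (real^'n). (mix K (snd p) (fst p), mix K (fst p) (snd p))"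
  have Hb [measurable]: "case_prod H \<in> borel_measurable borel" using assms by (simp add: borel_prod)
  have T [measurable]: "?T \<in> borel_measurable borel"
  proof -
    have "(\<lambda>p. fst p) \<in> borel_measurable (borel :: ((real^'n) \<times> (real^'n)) measure)"
      "(\<lambda>p. snd p) \<in> borel_measurable (borel :: ((real^'n) \<times> (real^'n)) measure)"
      by (auto intro!: borel_measurable_continuous_onI continuous_intros)
    then have "?T \<in> borel \<rightarrow>\<^sub>M (borel \<Otimes>\<^sub>M borel)" by measurable
    then show ?thesis by (simp add: borel_prod)
  qed
  have d: "distr lborel borel ?T = lborel"
  proof (rule lborel_distr_basis_involution[OF T])
    fix b :: "(real^'n) \<times> (real^'n)" assume "b \<in> Basis"
    then obtain i where b: "b = (axis i 1, 0) \<or> b = (0, axis i 1)"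
      by (auto simp: Basis_prod_def Basis_vec_def)
    have ax: "mix K (axis i (1::real)) 0 = (if i \<in> K then axis i 1 else 0)" "mix K 0 (axis i (1::real)) = (if i \<in> K then 0 else axis i 1)"
      by (auto simp: mix_def vec_eq_iff axis_def)
    have bi: "axis i (1::real) \<in> Basis" by (simp add: axis_in_Basis_iff)
    have T1: "?T (axis i 1, 0) = (if i \<in> K then (0, axis i 1) else (axis i 1, 0))"
        and T2: "?T (0, axis i 1) = (if i \<in> K then (axis i 1, 0) else (0, axis i 1))"
        by (simp_all add: ax)
    show "?T b \<in> Basis"
      using b bi T1 T2 by (elim disjE) (simp_all only: Basis_prod_def Un_iff image_iff split: if_split, auto)
    show "?T (?T b) = b"
      using b T1 T2 by (elim disjE) (simp_all only: split: if_split, simp_all)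
    have "?T x \<bullet> (axis i 1, 0) = x \<bullet> ?T (axis i 1, 0)" "?T x \<bullet> (0, axis i 1) = x \<bullet> ?T (0, axis i 1)" for x
      unfolding T1 T2 by (cases x; auto simp: inner_axis mix_def)+
    then show "?T x \<bullet> b = x \<bullet> ?T b" for x
      using b by blast
  qed
  have "(\<integral>\<^sup>+W. (\<integral>\<^sup>+y. H W y \<partial>lborel) \<partial>lborel) = (\<integral>\<^sup>+p. case_prod H p \<partial>(lborel \<Otimes>\<^sub>M lborel))"
    by (subst lborel.nn_integral_fst[symmetric]) simp_all
  also have "\<dots> = (\<integral>\<^sup>+p. case_prod H p \<partial>distr lborel borel ?T)" by (simp add: lborel_prod d)
  also have "\<dots> = (\<integral>\<^sup>+p. case_prod H (?T p) \<partial>lborel)" by (rule nn_integral_distr) auto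
  also have "\<dots> = (\<integral>\<^sup>+p. (case p of (W, y) \<Rightarrow> H (mix K y W) (mix K W y)) \<partial>(lborel \<Otimes>\<^sub>M lborel))"
    by (simp add: lborel_prod split_beta')
  also have "\<dots> = (\<integral>\<^sup>+W. (\<integral>\<^sup>+y. H (mix K y W) (mix K W y) \<partial>lborel) \<partial>lborel)"
    by (subst lborel.nn_integral_fst[symmetric]) simp_all
  finally show ?thesis ..
qed

text \<open>Coordinates outside K are contracted by T. A coordinate a in K first receives \<xi>_a
  times coordinate j and is then expanded by l_a. The expansion spreads each lattice point over a
  wide range as \<xi> varies, so after averaging a lattice sum becomes a Riemann sum in w /
  T.\<close>

definition shear_mat :: "'n::finite set \<Rightarrow> 'n \<Rightarrow> ('n \<Rightarrow> real) \<Rightarrow> real \<Rightarrow> real^'n \<Rightarrow> real^'n^'n" where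
  "shear_mat K j l T \<xi> = (\<chi> a b. if a \<in> K then l a * ((if a = b then 1 else 0) + (if b = j then \<xi> $ a else 0))
     else (if a = b then 1 / T else 0))"

lemma shear_mat_vec:
  "shear_mat K j l T \<xi> *v w = (\<chi> a. if a \<in> K then l a * (w $ a + \<xi> $ a * w $ j) else w $ a / T)"
proof -
  have "(\<Sum>b\<in>UNIV. shear_mat K j l T \<xi> $ a $ b * w $ b) = (if a \<in> K then l a * (w $ a + \<xi> $ a * w $ j) else w $ a / T)" for a
  proof (cases "a \<in> K")
    case True
    have "(\<Sum>b\<in>UNIV. shear_mat K j l T \<xi> $ a $ b * w $ b) =
      (\<Sum>b\<in>UNIV. (if b = a then l a * w $ a else 0) + (if b = j then l a * (\<xi> $ a * w $ j) else 0))"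
      using True by (intro sum.cong) (auto simp: shear_mat_def algebra_simps)
    then show ?thesis using True by (simp add: sum.distrib algebra_simps)
  next
    case False
    have "(\<Sum>b\<in>UNIV. shear_mat K j l T \<xi> $ a $ b * w $ b) = (\<Sum>b\<in>UNIV. (if b = a then w $ a / T else 0))"
      using False by (intro sum.cong) (auto simp: shear_mat_def)
    then show ?thesis using False by simp
  qed
  then show ?thesis by (simp add: matrix_vector_mult_def)
qed

lemma borel_measurable_shear_mat [measurable (raw)]:
  assumes [measurable]: "f \<in> borel_measurable M"
  shows "(\<lambda>x. shear_mat K j l T (f x)) \<in> borel_measurable M"
  unfolding shear_mat_def by measurable

lemma det_shear_mat:
  fixes K :: "'n::finite set"
  assumes j: "j \<notin> K" and l: "(\<Prod>a\<in>K. l a) = T ^ card (- K)" and T: "T > 0"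
  shows "det (shear_mat K j l T \<xi>) = 1"
proof -
  define S :: "'n set \<Rightarrow> real^'n^'n"
    where "S K = (\<chi> a b. (if a = b then 1 else 0) + (if a \<in> K \<and> b = j then \<xi> $ a else 0))" for K
  have "finite K" by simp
  then have det: "det (S K) = 1" using j
  proof (induction K rule: finite_induct)
    case empty
    have "S {} = mat 1" by (simp add: S_def mat_def vec_eq_iff)
    then show ?case by simp
  next
    case (insert a K)
    have "S (insert a K) = (\<chi> k. if k = a then row a (S K) + \<xi> $ a *s row j (S K) else row k (S K))"
      using insert by (auto simp: S_def row_def vec_eq_iff)
    then show ?case using det_row_operation[of a j "S K" "\<xi> $ a"] insert by auto
  qed
  have "shear_mat K j l T \<xi> = (\<chi> a. (if a \<in> K then l a else 1 / T) *s S K $ a)"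
    by (auto simp: shear_mat_def S_def vec_eq_iff)
  then have "det (shear_mat K j l T \<xi>) = (\<Prod>a\<in>UNIV. if a \<in> K then l a else 1 / T)"
    using det by (simp add: det_rows_mul)
  also have "\<dots> = (\<Prod>a\<in>K. l a) * (\<Prod>a\<in>-K. 1 / T)"
    by (subst prod.If_cases) (auto simp: Compl_eq)
  finally show ?thesis using l T by (simp add: power_one_over)
qed

text \<open>The average over \<xi> as a function of W = w / T, in the variable y that records the
  image coordinates in K. The argument of \<open>tents\<close> is the \<xi> producing this image,
  with s_a = 1 / (l_a T); coordinates of y outside K are the remaining components of \<xi>. In the
  uses the value 0 at W_j = 0 agrees with f vanishing there.\<close>

definition sheared :: "'n::finite set \<Rightarrow> 'n \<Rightarrow> ('n \<Rightarrow> real) \<Rightarrow> (real^'n \<Rightarrow> real) \<Rightarrow> real^'n \<Rightarrow> ennreal" where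
  "sheared K j s f W = (if W $ j = 0 then 0 else ennreal (1 / \<bar>W $ j\<bar> ^ card K) *
     (\<integral>\<^sup>+y. ennreal (f (mix K y W) * tents (\<chi> i. if i \<in> K then (s i * y $ i - W $ i) / W $ j else y $ i)) \<partial>lborel))"

lemma borel_measurable_sheared [measurable]:
  assumes [measurable]: "f \<in> borel_measurable borel"
  shows "sheared K j s f \<in> borel_measurable borel"
proof -
  have "(\<lambda>x. if i \<in> K then (s i * snd x $ i - fst x $ i) / fst x $ j else snd x $ i)
     \<in> borel_measurable (borel \<Otimes>\<^sub>M (lborel :: (real^'a) measure))" for i
    by (cases "i \<in> K") auto
  then have "(\<lambda>x. \<chi> i. if i \<in> K then (s i * snd x $ i - fst x $ i) / fst x $ j else snd x $ i)
     \<in> borel_measurable (borel \<Otimes>\<^sub>M (lborel :: (real^'a) measure))" by (rule borel_measurable_vec_lambda)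
  then have [measurable]: "(\<lambda>(W, y). ennreal (f (mix K y W) * tents (\<chi> i. if i \<in> K then (s i * y $ i - W $ i) / W $ j else y $ i)))
     \<in> borel_measurable (borel \<Otimes>\<^sub>M (lborel :: (real^'a) measure))"
    unfolding split_beta' by measurable
  show ?thesis
    unfolding sheared_def by measurable
qed

text \<open>An affine substitution in \<xi>, diagonal up to translation. The normalisation of the
  l_a makes its Jacobian carry exactly the Riemann weight T^-d.\<close>

lemma shear_average:
  fixes f :: "real^'n \<Rightarrow> real"
  assumes [measurable]: "f \<in> borel_measurable borel" and nonneg: "\<And>v. f v \<ge> 0" and f0: "\<And>v. v $ j = 0 \<Longrightarrow> f v = 0"
    and j: "j \<notin> K" and T: "T > 0" and l: "\<And>a. a \<in> K \<Longrightarrow> l a > 0" "(\<Prod>a\<in>K. l a) = T ^ card (- K)"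
  shows "(\<integral>\<^sup>+\<xi>. ennreal (tents \<xi>) * ennreal (f (shear_mat K j l T \<xi> *v w)) \<partial>lborel) =
    ennreal (1 / T ^ CARD('n)) * sheared K j (\<lambda>a. 1 / (l a * T)) f ((1 / T) *\<^sub>R w)"
proof (cases "w $ j = 0")
  case True
  then have "(shear_mat K j l T \<xi> *v w) $ j = 0" for \<xi> using j by (simp add: shear_mat_vec)
  then show ?thesis using True by (simp add: f0 sheared_def)
next
  case False
  define D :: "real^'n^'n" where "D = (\<chi> a b. if a = b then (if a \<in> K then 1 / (l a * w $ j) else 1) else 0)"
  define t :: "real^'n" where "t = (\<chi> a. if a \<in> K then - w $ a / w $ j else 0)"
  define F where "F \<xi> = ennreal (tents \<xi>) * ennreal (f (shear_mat K j l T \<xi> *v w))" for \<xi>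
  let ?W = "(1 / T) *\<^sub>R w"
  have [measurable]: "F \<in> borel_measurable borel" unfolding F_def by measurable
  have Dv: "mat_act D y = (\<chi> a. if a \<in> K then y $ a / (l a * w $ j) else y $ a)" for y :: "real^'n"
  proof -
    have "(\<Sum>b\<in>UNIV. D $ a $ b *\<^sub>R y $ b) = (\<Sum>b\<in>UNIV. if b = a then (if a \<in> K then y $ a / (l a * w $ j) else y $ a) else 0)" for a
      by (intro sum.cong) (auto simp: D_def)
    then show ?thesis by (simp add: mat_act_def)
  qed
  have detD: "det D = (\<Prod>a\<in>K. 1 / (l a * w $ j))"
  proof -
    have "det D = (\<Prod>a\<in>UNIV. D $ a $ a)" by (rule det_diagonal) (simp add: D_def)
    also have "\<dots> = (\<Prod>a\<in>UNIV. if a \<in> K then 1 / (l a * w $ j) else 1)" by (simp add: D_def)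
    finally show ?thesis by (simp add: prod.If_cases)
  qed
  \<comment> \<open>The product of the l_a supplies the power card (- K) of T, and w_j = T W_j
    supplies the power card K.\<close>
  have absD: "\<bar>det D\<bar> = (1 / T ^ CARD('n)) * (1 / \<bar>?W $ j\<bar> ^ card K)"
  proof -
    have "\<bar>det D\<bar> = (\<Prod>a\<in>K. 1 / (l a * \<bar>w $ j\<bar>))"
      unfolding detD abs_prod using l(1) by (intro prod.cong) (auto simp: abs_mult abs_of_pos)
    also have "\<dots> = 1 / (T ^ card (- K) * \<bar>w $ j\<bar> ^ card K)"
      by (simp add: prod_dividef prod.distrib l(2))
    also have "\<bar>w $ j\<bar> = T * \<bar>?W $ j\<bar>" using T by (simp add: abs_mult)
    also have "1 / (T ^ card (- K) * (T * \<bar>?W $ j\<bar>) ^ card K) = 1 / (T ^ (card (- K) + card K)) * (1 / \<bar>?W $ j\<bar> ^ card K)"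
      by (simp only: power_mult_distrib power_add) (simp only: times_divide_times_eq mult_1 mult.assoc)
    also have "card (- K) + card K = CARD('n)"
      by (subst card_Un_disjoint[symmetric]) (auto simp: Compl_partition2)
    finally show ?thesis .
  qed
  have nz: "det D \<noteq> 0" unfolding detD using l(1) False by (auto simp: less_imp_neq[symmetric])
  have Ft: "F (t + mat_act D y) = ennreal (f (mix K y ?W) * tents (\<chi> i. if i \<in> K then (1 / (l i * T) * y $ i - ?W $ i) / ?W $ j else y $ i))" for y
  proof -
    have "shear_mat K j l T (t + mat_act D y) *v w = mix K y ?W"
    proof -
      have "l a * (w $ a + (- w $ a / w $ j + y $ a / (l a * w $ j)) * w $ j) = y $ a" if "a \<in> K" for a
        using l(1)[OF that] False by (simp add: field_simps)
      then show ?thesis by (auto simp: shear_mat_vec vec_eq_iff mix_def t_def Dv)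
    qed
    moreover have "t + mat_act D y = (\<chi> i. if i \<in> K then (1 / (l i * T) * y $ i - ?W $ i) / ?W $ j else y $ i)"
    proof -
      have "- w $ a / w $ j + y $ a / (l a * w $ j) = (1 / (l a * T) * y $ a - ?W $ a) / ?W $ j" if "a \<in> K" for a
        using l(1)[OF that] False T by (simp add: field_simps)
      then show ?thesis by (auto simp: vec_eq_iff t_def Dv)
    qed
    ultimately show ?thesis by (simp add: F_def ennreal_mult nonneg mult.commute)
  qed
  have "(\<integral>\<^sup>+\<xi>. F \<xi> \<partial>lborel) = (\<integral>\<^sup>+\<xi>. F \<xi> \<partial>distr lborel borel ((+) t))" by (simp add: lborel_distr_plus)
  also have "\<dots> = (\<integral>\<^sup>+\<xi>. F (t + \<xi>) \<partial>lborel)" by (rule nn_integral_distr) auto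
  also have "\<dots> = ennreal \<bar>det D\<bar> * (\<integral>\<^sup>+y. F (t + mat_act D y) \<partial>lborel)"
    using nn_integral_mat_act[of "\<lambda>\<xi>. F (t + \<xi>)", OF _ nz] by simp
  also have "\<dots> = ennreal (1 / T ^ CARD('n)) * sheared K j (\<lambda>a. 1 / (l a * T)) f ?W"
    unfolding absD Ft using False T
    by (subst ennreal_mult) (auto simp: sheared_def mult.assoc)
  finally show ?thesis unfolding F_def .
qed

text \<open>Mixing leaves coordinate j of W unchanged, so W_j is at least \<delta> in size when the
  integrand is nonzero. In y, coordinates in K are bounded by R through f and the others by 1
  through \<open>tents\<close>, whence the radius d (R + 1).\<close>

lemma sheared_le:
  fixes f :: "real^'n \<Rightarrow> real"
  assumes nonneg: "\<And>v. f v \<ge> 0" and C: "\<And>v. f v \<le> C"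
    and supp: "\<And>v. f v \<noteq> 0 \<Longrightarrow> \<delta> \<le> \<bar>v $ j\<bar> \<and> (\<forall>i. \<bar>v $ i\<bar> \<le> R)" and \<delta>: "\<delta> > 0" and R: "R \<ge> 0" and j: "j \<notin> K"
  shows "sheared K j s f W \<le> ennreal (1 / \<delta> ^ card K) * (ennreal C * emeasure lborel (cball (0::real^'n) (real CARD('n) * (R + 1))))"
proof (cases "\<delta> \<le> \<bar>W $ j\<bar>")
  case False
  have "f (mix K y W) = 0" for y
    using supp[of "mix K y W"] False j by (auto simp: mix_def)
  then show ?thesis by (simp add: sheared_def)
next
  case True
  let ?B = "cball (0::real^'n) (real CARD('n) * (R + 1))"
  have "ennreal (f (mix K y W) * tents (\<chi> i. if i \<in> K then (s i * y $ i - W $ i) / W $ j else y $ i)) \<le> ennreal C * indicator ?B y" for y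
  proof (cases "f (mix K y W) = 0 \<or> tents (\<chi> i. if i \<in> K then (s i * y $ i - W $ i) / W $ j else y $ i) = 0")
    case False
    then have 1: "\<And>i. \<bar>mix K y W $ i\<bar> \<le> R" and 2: "\<And>i. \<bar>(\<chi> i. if i \<in> K then (s i * y $ i - W $ i) / W $ j else y $ i) $ i\<bar> \<le> 1"
      using supp tents_nonzero by blast+
    have "\<bar>y $ i\<bar> \<le> R + 1" for i
      using 1[of i] 2[of i] R by (cases "i \<in> K") (auto simp: mix_def)
    then have "(\<Sum>i\<in>UNIV. \<bar>y $ i\<bar>) \<le> real CARD('n) * (R + 1)" by (intro sum_bounded_above)
    then have "y \<in> ?B" using norm_le_l1_cart[of y] by simp
    moreover have "f (mix K y W) * tents (\<chi> i. if i \<in> K then (s i * y $ i - W $ i) / W $ j else y $ i) \<le> C * 1"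
      using nonneg C tents_bounds by (intro mult_mono) (auto intro: order_trans[OF nonneg C])
    ultimately show ?thesis by (simp add: ennreal_leI)
  qed auto
  then have "(\<integral>\<^sup>+y. ennreal (f (mix K y W) * tents (\<chi> i. if i \<in> K then (s i * y $ i - W $ i) / W $ j else y $ i)) \<partial>lborel) \<le>
     (\<integral>\<^sup>+y. ennreal C * indicator ?B y \<partial>lborel)"
    by (intro nn_integral_mono)
  also have "\<dots> = ennreal C * emeasure lborel ?B" by (simp add: nn_integral_cmult_indicator)
  finally have "(\<integral>\<^sup>+y. ennreal (f (mix K y W) * tents (\<chi> i. if i \<in> K then (s i * y $ i - W $ i) / W $ j else y $ i)) \<partial>lborel) \<le>
     ennreal C * emeasure lborel ?B" .
  moreover have "1 / \<bar>W $ j\<bar> ^ card K \<le> 1 / \<delta> ^ card K"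
    using True \<delta> by (intro divide_left_mono power_mono mult_pos_pos) auto
  ultimately show ?thesis using True \<delta> by (auto simp: sheared_def intro!: mult_mono ennreal_leI)
qed

text \<open>Stated along an arbitrary sequence V tending to W, the form of convergence that
  \<open>riemann_sum_limit\<close> consumes.\<close>

lemma sheared_tendsto:
  fixes f :: "real^'n \<Rightarrow> real"
  assumes cont: "continuous_on UNIV f" and nonneg: "\<And>v. f v \<ge> 0" and C: "\<And>v. f v \<le> C"
    and supp: "\<And>v. f v \<noteq> 0 \<Longrightarrow> \<delta> \<le> \<bar>v $ j\<bar> \<and> (\<forall>i. \<bar>v $ i\<bar> \<le> R)" and \<delta>: "\<delta> > 0" and R: "R \<ge> 0" and j: "j \<notin> K"
    and s: "\<And>a. a \<in> K \<Longrightarrow> (\<lambda>n. s n a) \<longlonglongrightarrow> 0" and W: "W $ j \<noteq> 0" and V: "V \<longlonglongrightarrow> W"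
  shows "(\<lambda>n. sheared K j (s n) f (V n)) \<longlonglongrightarrow> sheared K j (\<lambda>_. 0) f W"
proof -
  have [measurable]: "f \<in> borel_measurable borel" using cont by (rule borel_measurable_continuous_onI)
  have Vi: "(\<lambda>n. V n $ i) \<longlonglongrightarrow> W $ i" for i using V by (rule tendsto_vec_nth)
  let ?B = "cball (0::real^'n) (real CARD('n) * (R + 1))"
  have Bm [measurable]: "?B \<in> sets borel" by simp
  let ?g = "\<lambda>s W y. ennreal (f (mix K y W) * tents (\<chi> i. if i \<in> K then (s i * y $ i - W $ i) / W $ j else y $ i))"
  have gm: "?g s W \<in> borel_measurable borel" for s and W :: "real^'n"
  proof -
    have "(\<lambda>y. if i \<in> K then (s i * y $ i - W $ i) / W $ j else y $ i) \<in> borel_measurable (borel :: (real^'n) measure)" for i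
      by (cases "i \<in> K") auto
    then have "(\<lambda>y. \<chi> i. if i \<in> K then (s i * y $ i - W $ i) / W $ j else y $ i) \<in> borel_measurable (borel :: (real^'n) measure)"
      by (rule borel_measurable_vec_lambda)
    then show ?thesis by measurable
  qed
  have dom: "?g s W y \<le> ennreal C * indicator ?B y" for s W y
  proof (cases "f (mix K y W) = 0 \<or> tents (\<chi> i. if i \<in> K then (s i * y $ i - W $ i) / W $ j else y $ i) = 0")
    case False
    then have 1: "\<And>i. \<bar>mix K y W $ i\<bar> \<le> R" and 2: "\<And>i. \<bar>(\<chi> i. if i \<in> K then (s i * y $ i - W $ i) / W $ j else y $ i) $ i\<bar> \<le> 1"
      using supp tents_nonzero by blast+
    have "\<bar>y $ i\<bar> \<le> R + 1" for i
      using 1[of i] 2[of i] R by (cases "i \<in> K") (auto simp: mix_def)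
    then have "(\<Sum>i\<in>UNIV. \<bar>y $ i\<bar>) \<le> real CARD('n) * (R + 1)" by (intro sum_bounded_above)
    then have "y \<in> ?B" using norm_le_l1_cart[of y] by simp
    moreover have "f (mix K y W) * tents (\<chi> i. if i \<in> K then (s i * y $ i - W $ i) / W $ j else y $ i) \<le> C * 1"
      using nonneg C tents_bounds by (intro mult_mono) (auto intro: order_trans[OF nonneg C])
    ultimately show ?thesis by (simp add: ennreal_leI)
  qed auto
  have "(\<lambda>n. \<integral>\<^sup>+y. ?g (s n) (V n) y \<partial>lborel) \<longlonglongrightarrow> (\<integral>\<^sup>+y. ?g (\<lambda>_. 0) W y \<partial>lborel)"
  proof (rule nn_integral_dominated_convergence[where w="\<lambda>y. ennreal C * indicator ?B y"])
    show "(\<integral>\<^sup>+y. ennreal C * indicator ?B y \<partial>lborel) < \<infinity>"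
      using emeasure_lborel_cball_finite[of "0::real^'n" "real CARD('n) * (R + 1)"]
      by (simp add: nn_integral_cmult_indicator ennreal_mult_less_top)
    have "(\<lambda>n. ?g (s n) (V n) y) \<longlonglongrightarrow> ?g (\<lambda>_. 0) W y" for y
    proof -
      have "(\<lambda>n. mix K y (V n)) \<longlonglongrightarrow> mix K y W"
        unfolding mix_def by (intro tendsto_vec_lambda) (auto intro: Vi)
      then have "(\<lambda>n. f (mix K y (V n))) \<longlonglongrightarrow> f (mix K y W)"
        using cont by (intro continuous_on_tendsto_compose[OF cont]) auto
      moreover have "(\<lambda>n. \<chi> i. if i \<in> K then (s n i * y $ i - V n $ i) / V n $ j else y $ i) \<longlonglongrightarrow>
        (\<chi> i. if i \<in> K then (0 * y $ i - W $ i) / W $ j else y $ i)"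
      proof (intro tendsto_vec_lambda)
        fix i
        show "(\<lambda>n. if i \<in> K then (s n i * y $ i - V n $ i) / V n $ j else y $ i) \<longlonglongrightarrow>
          (if i \<in> K then (0 * y $ i - W $ i) / W $ j else y $ i)"
        proof (cases "i \<in> K")
          case True
          have "(\<lambda>n. (s n i * y $ i - V n $ i) / V n $ j) \<longlonglongrightarrow> (0 * y $ i - W $ i) / W $ j"
            by (intro tendsto_intros s True Vi W)
          then show ?thesis using True by simp
        qed simp
      qed
      then have "(\<lambda>n. tents (\<chi> i. if i \<in> K then (s n i * y $ i - V n $ i) / V n $ j else y $ i)) \<longlonglongrightarrow>
        tents (\<chi> i. if i \<in> K then (0 * y $ i - W $ i) / W $ j else y $ i)"
        by (intro continuous_on_tendsto_compose[OF continuous_tents[of UNIV]]) auto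
      ultimately show ?thesis by (intro tendsto_ennrealI tendsto_mult)
    qed
    then show "AE y in lborel. (\<lambda>n. ?g (s n) (V n) y) \<longlonglongrightarrow> ?g (\<lambda>_. 0) W y" by simp
  qed (use gm dom in auto)
  moreover have "(\<lambda>n. ennreal (1 / \<bar>V n $ j\<bar> ^ card K)) \<longlonglongrightarrow> ennreal (1 / \<bar>W $ j\<bar> ^ card K)"
    using W by (intro tendsto_ennrealI tendsto_intros Vi) auto
  moreover have "(\<integral>\<^sup>+y. ?g (\<lambda>_. 0) W y \<partial>lborel) < \<infinity>"
  proof -
    have "(\<integral>\<^sup>+y. ?g (\<lambda>_. 0) W y \<partial>lborel) \<le> (\<integral>\<^sup>+y. ennreal C * indicator ?B y \<partial>lborel)"
      by (intro nn_integral_mono dom)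
    also have "\<dots> < \<infinity>"
      using emeasure_lborel_cball_finite[of "0::real^'n" "real CARD('n) * (R + 1)"]
      by (simp add: nn_integral_cmult_indicator ennreal_mult_less_top)
    finally show ?thesis .
  qed
  ultimately have "(\<lambda>n. ennreal (1 / \<bar>V n $ j\<bar> ^ card K) * (\<integral>\<^sup>+y. ?g (s n) (V n) y \<partial>lborel)) \<longlonglongrightarrow>
    ennreal (1 / \<bar>W $ j\<bar> ^ card K) * (\<integral>\<^sup>+y. ?g (\<lambda>_. 0) W y \<partial>lborel)"
    by (intro tendsto_mult_ennreal) auto
  moreover have "\<forall>\<^sub>F n in sequentially. V n $ j \<noteq> 0"
    using Vi[of j] W by (rule tendsto_imp_eventually_ne)
  ultimately show ?thesis
    using W by (simp add: sheared_def)
      (erule Lim_transform_eventually, erule eventually_mono, simp)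
qed

text \<open>In a coordinate of K, the tent factor gives |s y - W_i| at most |W_j|, hence at most R,
  and s y is at most R in size; this is the origin of 2 R.\<close>

lemma sheared_support:
  fixes f :: "real^'n \<Rightarrow> real"
  assumes supp: "\<And>v. f v \<noteq> 0 \<Longrightarrow> \<delta> \<le> \<bar>v $ j\<bar> \<and> (\<forall>i. \<bar>v $ i\<bar> \<le> R)" and R: "R \<ge> 0" and j: "j \<notin> K"
    and s: "\<And>a. a \<in> K \<Longrightarrow> \<bar>s a\<bar> \<le> 1" and nz: "sheared K j s f W \<noteq> 0"
  shows "norm W \<le> real CARD('n) * (2 * R)"
proof -
  have "\<exists>y. f (mix K y W) * tents (\<chi> i. if i \<in> K then (s i * y $ i - W $ i) / W $ j else y $ i) \<noteq> 0"
  proof (rule ccontr)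
    assume "\<not> ?thesis"
    then have "f (mix K y W) * tents (\<chi> i. if i \<in> K then (s i * y $ i - W $ i) / W $ j else y $ i) = 0" for y by blast
    then have "sheared K j s f W = 0" by (simp only: sheared_def) simp
    then show False using nz by simp
  qed
  then obtain y where y: "f (mix K y W) \<noteq> 0" "tents (\<chi> i. if i \<in> K then (s i * y $ i - W $ i) / W $ j else y $ i) \<noteq> 0" by auto
  have Wj: "W $ j \<noteq> 0" using nz by (auto simp: sheared_def)
  have 1: "\<bar>mix K y W $ i\<bar> \<le> R" for i using supp[OF y(1)] by blast
  have WjR: "\<bar>W $ j\<bar> \<le> R" using 1[of j] j by (simp add: mix_def)
  have "\<bar>W $ i\<bar> \<le> 2 * R" for i
  proof (cases "i \<in> K")
    case True
    have "\<bar>(s i * y $ i - W $ i) / W $ j\<bar> \<le> 1" using tents_nonzero[OF y(2), of i] True by simp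
    then have "\<bar>s i * y $ i - W $ i\<bar> \<le> R" using Wj WjR by (simp add: divide_le_eq)
    moreover have "\<bar>y $ i\<bar> \<le> R" using 1[of i] True by (simp add: mix_def)
    then have "\<bar>s i * y $ i\<bar> \<le> 1 * R"
      unfolding abs_mult by (intro mult_mono s True) auto
    ultimately show ?thesis by linarith
  next
    case False
    then show ?thesis using 1[of i] R by (simp add: mix_def)
  qed
  then have "(\<Sum>i\<in>UNIV. \<bar>W $ i\<bar>) \<le> real CARD('n) * (2 * R)" by (intro sum_bounded_above)
  then show ?thesis using norm_le_l1_cart[of W] by simp
qed

text \<open>For s = 0 the factor f sees only the mixed vector and the tents see only what was
  exchanged. Swapping the coordinates in K decouples them, and the tents integrate to the power card
  K of |W_j|, cancelling the prefactor.\<close>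

lemma nn_integral_sheared_0:
  fixes f :: "real^'n \<Rightarrow> real"
  assumes [measurable]: "f \<in> borel_measurable borel" and nonneg: "\<And>v. f v \<ge> 0" and f0: "\<And>v. v $ j = 0 \<Longrightarrow> f v = 0"
    and j: "j \<notin> K"
  shows "(\<integral>\<^sup>+W. sheared K j (\<lambda>_. 0) f W \<partial>lborel) = (\<integral>\<^sup>+W. ennreal (f W) \<partial>lborel)"
proof -
  define H where "H W y = ennreal (1 / \<bar>W $ j\<bar> ^ card K) *
      (ennreal (f W) * ennreal (tents (\<chi> i. if i \<in> K then (- y $ i) / W $ j else y $ i)))" for W y :: "real^'n"
  have Hm: "case_prod H \<in> borel_measurable (borel \<Otimes>\<^sub>M borel)"
  proof -
    have "(\<lambda>x. if i \<in> K then - (snd x $ i) / fst x $ j else snd x $ i)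
       \<in> borel_measurable (borel \<Otimes>\<^sub>M (borel :: (real^'n) measure))" for i
      by (cases "i \<in> K") auto
    then have "(\<lambda>x. \<chi> i. if i \<in> K then - (snd x $ i) / fst x $ j else snd x $ i)
       \<in> borel_measurable (borel \<Otimes>\<^sub>M (borel :: (real^'n) measure))" by (rule borel_measurable_vec_lambda)
    then show ?thesis unfolding H_def split_beta' by measurable
  qed
  have "sheared K j (\<lambda>_. 0) f W = (\<integral>\<^sup>+y. H (mix K y W) (mix K W y) \<partial>lborel)" for W
  proof (cases "W $ j = 0")
    case True
    have "f (mix K y W) = 0" for y using True j by (intro f0) (simp add: mix_def)
    then show ?thesis using True by (simp add: sheared_def H_def)
  next
    case False
    have gm: "(\<lambda>y. ennreal (f (mix K y W) * tents (\<chi> i. if i \<in> K then (0 * y $ i - W $ i) / W $ j else y $ i))) \<in> borel_measurable borel"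
    proof -
      have "(\<lambda>y. if i \<in> K then (0 * y $ i - W $ i) / W $ j else y $ i) \<in> borel_measurable (borel :: (real^'n) measure)" for i
        by (cases "i \<in> K") auto
      then have "(\<lambda>y. \<chi> i. if i \<in> K then (0 * y $ i - W $ i) / W $ j else y $ i) \<in> borel_measurable (borel :: (real^'n) measure)"
        by (rule borel_measurable_vec_lambda)
      then show ?thesis by measurable
    qed
    have "(\<chi> i. if i \<in> K then (- mix K W y $ i) / mix K y W $ j else mix K W y $ i) =
      (\<chi> i. if i \<in> K then (0 * y $ i - W $ i) / W $ j else y $ i)" for y
      using j by (auto simp: vec_eq_iff mix_def)
    then have "H (mix K y W) (mix K W y) = ennreal (1 / \<bar>W $ j\<bar> ^ card K) *
      ennreal (f (mix K y W) * tents (\<chi> i. if i \<in> K then (0 * y $ i - W $ i) / W $ j else y $ i))" for y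
      using j nonneg by (simp add: H_def ennreal_mult) (simp add: mix_def)
    then show ?thesis using False gm
      by (simp add: sheared_def nn_integral_cmult del: mult_zero_left)
  qed
  then have "(\<integral>\<^sup>+W. sheared K j (\<lambda>_. 0) f W \<partial>lborel) = (\<integral>\<^sup>+W. (\<integral>\<^sup>+y. H W y \<partial>lborel) \<partial>lborel)"
    using nn_integral_mix_swap[OF Hm, of K] by simp
  also have "\<dots> = (\<integral>\<^sup>+W. ennreal (f W) \<partial>lborel)"
  proof (rule nn_integral_cong)
    fix W :: "real^'n"
    show "(\<integral>\<^sup>+y. H W y \<partial>lborel) = ennreal (f W)"
    proof (cases "W $ j = 0")
      case True
      then show ?thesis by (simp add: H_def f0)
    next
      case False
      have "(\<integral>\<^sup>+y. ennreal (tents (\<chi> i. if i \<in> K then (- y $ i) / W $ j else y $ i)) \<partial>lborel) =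
        (\<integral>\<^sup>+y. (\<Prod>i\<in>UNIV. ennreal (tent (if i \<in> K then y $ i / (- W $ j) else y $ i / 1))) \<partial>lborel)"
        unfolding tents_def by (subst prod_ennreal) (auto intro!: nn_integral_cong prod.cong arg_cong[of _ _ ennreal])
      also have "\<dots> = (\<Prod>i\<in>UNIV. \<integral>\<^sup>+x. ennreal (tent (if i \<in> K then x / (- W $ j) else x / 1)) \<partial>lborel)"
      proof (rule nn_integral_lborel_vec_prod)
        show "(\<lambda>x. ennreal (tent (if i \<in> K then x / (- W $ j) else x / 1))) \<in> borel_measurable borel" for i
          by (cases "i \<in> K") auto
      qed
      also have "\<dots> = (\<Prod>i\<in>UNIV. if i \<in> K then ennreal \<bar>W $ j\<bar> else 1)"
      proof (intro prod.cong refl)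
        fix i :: 'n
        show "(\<integral>\<^sup>+x. ennreal (tent (if i \<in> K then x / (- W $ j) else x / 1)) \<partial>lborel) = (if i \<in> K then ennreal \<bar>W $ j\<bar> else 1)"
          using nn_integral_tent_scale[of "- W $ j"] nn_integral_tent False by (cases "i \<in> K") auto
      qed
      also have "\<dots> = ennreal (\<bar>W $ j\<bar> ^ card K)" by (simp add: prod.If_cases ennreal_power)
      finally have 1: "(\<integral>\<^sup>+y. ennreal (tents (\<chi> i. if i \<in> K then (- y $ i) / W $ j else y $ i)) \<partial>lborel) = ennreal (\<bar>W $ j\<bar> ^ card K)" .
      have tm: "(\<lambda>y. ennreal (tents (\<chi> i. if i \<in> K then (- y $ i) / W $ j else y $ i))) \<in> borel_measurable borel"
      proof -
        have "(\<lambda>y. if i \<in> K then (- y $ i) / W $ j else y $ i) \<in> borel_measurable (borel :: (real^'n) measure)" for i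
          by (cases "i \<in> K") auto
        then have "(\<lambda>y. \<chi> i. if i \<in> K then (- y $ i) / W $ j else y $ i) \<in> borel_measurable (borel :: (real^'n) measure)"
          by (rule borel_measurable_vec_lambda)
        then show ?thesis by measurable
      qed
      have "(\<integral>\<^sup>+y. H W y \<partial>lborel) = ennreal (1 / \<bar>W $ j\<bar> ^ card K) * (ennreal (f W) * ennreal (\<bar>W $ j\<bar> ^ card K))"
        unfolding H_def using tm by (simp add: nn_integral_cmult 1)
      also have "\<dots> = ennreal (f W)"
        using False nonneg by (simp add: ennreal_mult[symmetric])
      finally show ?thesis .
    qed
  qed
  finally show ?thesis .
qed

text \<open>Keeping the support of f away from the hyperplane v_j = 0 bounds the shear needed to
  reach a given image. Allowing l_a = 1 is deliberate: it lets the shears fix a basis vector, as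
  required for pairs, while 1 / (l_a T) still tends to 0.\<close>

theorem shear_limit:
  fixes f :: "real^'n \<Rightarrow> real" and g :: "real^'n^'n"
  assumes cont: "continuous_on UNIV f" and nonneg: "\<And>v. f v \<ge> 0" and C: "\<And>v. f v \<le> C"
    and supp: "\<And>v. f v \<noteq> 0 \<Longrightarrow> \<delta> \<le> \<bar>v $ j\<bar> \<and> (\<forall>i. \<bar>v $ i\<bar> \<le> R)" and \<delta>: "\<delta> > 0" and R: "R \<ge> 0" and j: "j \<notin> K"
    and T: "\<And>n. T n \<ge> 1" "filterlim T at_top sequentially"
    and l: "\<And>n a. a \<in> K \<Longrightarrow> l n a \<ge> 1" "\<And>n. (\<Prod>a\<in>K. l n a) = T n ^ card (- K)" and g: "det g = 1"
  shows "(\<lambda>n. \<integral>\<^sup>+\<xi>. ennreal (tents \<xi>) *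
      (\<integral>\<^sup>+m. ennreal (f (shear_mat K j (l n) (T n) \<xi> *v (g *v m))) \<partial>count_space int_lattice) \<partial>lborel)
    \<longlonglongrightarrow> (\<integral>\<^sup>+W. ennreal (f W) \<partial>lborel)"
proof -
  have fm [measurable]: "f \<in> borel_measurable borel" using cont by (rule borel_measurable_continuous_onI)
  have Tpos: "T n > 0" for n using T(1)[of n] by simp
  have lpos: "l n a > 0" if "a \<in> K" for n a using l(1)[OF that, of n] by simp
  have f0: "f v = 0" if "v $ j = 0" for v using supp[of v] that \<delta> by auto
  define s where "s n a = 1 / (l n a * T n)" for n a
  have s1: "\<bar>s n a\<bar> \<le> 1 / T n" if "a \<in> K" for n a
  proof -
    have "T n \<le> l n a * T n" using l(1)[OF that, of n] Tpos[of n] by simp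
    then show ?thesis using lpos[OF that, of n] Tpos[of n] by (simp add: s_def abs_mult frac_le)
  qed
  have s2: "\<bar>s n a\<bar> \<le> 1" if "a \<in> K" for n a
  proof -
    have "1 / T n \<le> 1" using T(1)[of n] by simp
    then show ?thesis using s1[OF that, of n] by linarith
  qed
  have s0: "(\<lambda>n. s n a) \<longlonglongrightarrow> 0" if "a \<in> K" for a
  proof (rule Lim_null_comparison)
    show "(\<lambda>n. 1 / T n) \<longlonglongrightarrow> 0" by (rule real_tendsto_divide_at_top[OF tendsto_const T(2)])
    show "\<forall>\<^sub>F n in sequentially. norm (s n a) \<le> 1 / T n" using s1[OF that] by simp
  qed
  let ?C = "enn2real (ennreal (1 / \<delta> ^ card K) * (ennreal C * emeasure lborel (cball (0::real^'n) (real CARD('n) * (R + 1)))))"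
  have fin: "ennreal (1 / \<delta> ^ card K) * (ennreal C * emeasure lborel (cball (0::real^'n) (real CARD('n) * (R + 1)))) < top"
    using emeasure_lborel_cball_finite[of "0::real^'n" "real CARD('n) * (R + 1)"] by (simp add: ennreal_mult_less_top)
  have lim: "(\<lambda>n. \<integral>\<^sup>+m. ennreal (1 / T n ^ CARD('n)) * sheared K j (s n) f ((1 / T n) *\<^sub>R (g *v m)) \<partial>count_space int_lattice)
    \<longlonglongrightarrow> (\<integral>\<^sup>+W. sheared K j (\<lambda>_. 0) f W \<partial>lborel)"
  proof (rule riemann_sum_limit[OF g T, where C="?C" and R="real CARD('n) * (2 * R)"])
    show "sheared K j (s n) f W \<le> ennreal ?C" for n W
      using sheared_le[OF nonneg C supp \<delta> R j, where s = "s n" and W = W] fin by simp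
    show "norm W \<le> real CARD('n) * (2 * R)" if "sheared K j (s n) f W \<noteq> 0" for n W
      by (rule sheared_support[OF supp R j s2 that])
    show "(\<lambda>n. sheared K j (s n) f (V n)) \<longlonglongrightarrow> sheared K j (\<lambda>_. 0) f W" if "W $ j \<noteq> 0" "V \<longlonglongrightarrow> W" for V W
      by (rule sheared_tendsto[OF cont nonneg C supp \<delta> R j s0 that])
  qed auto
  have "(\<integral>\<^sup>+\<xi>. ennreal (tents \<xi>) * (\<integral>\<^sup>+m. ennreal (f (shear_mat K j (l n) (T n) \<xi> *v (g *v m))) \<partial>count_space int_lattice) \<partial>lborel) =
    (\<integral>\<^sup>+m. ennreal (1 / T n ^ CARD('n)) * sheared K j (s n) f ((1 / T n) *\<^sub>R (g *v m)) \<partial>count_space int_lattice)" for n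
  proof -
    have "(\<integral>\<^sup>+\<xi>. ennreal (tents \<xi>) * (\<integral>\<^sup>+m. ennreal (f (shear_mat K j (l n) (T n) \<xi> *v (g *v m))) \<partial>count_space int_lattice) \<partial>lborel) =
      (\<integral>\<^sup>+\<xi>. (\<integral>\<^sup>+m. ennreal (tents \<xi>) * ennreal (f (shear_mat K j (l n) (T n) \<xi> *v (g *v m))) \<partial>count_space int_lattice) \<partial>lborel)"
      by (intro nn_integral_cong nn_integral_cmult[symmetric]) simp
    also have "\<dots> = (\<integral>\<^sup>+m. (\<integral>\<^sup>+\<xi>. ennreal (tents \<xi>) * ennreal (f (shear_mat K j (l n) (T n) \<xi> *v (g *v m))) \<partial>lborel) \<partial>count_space int_lattice)"
      by (rule nn_integral_count_space_nn_integral) auto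
    also have "\<dots> = (\<integral>\<^sup>+m. ennreal (1 / T n ^ CARD('n)) * sheared K j (s n) f ((1 / T n) *\<^sub>R (g *v m)) \<partial>count_space int_lattice)"
      unfolding s_def using shear_average[OF fm nonneg f0 j Tpos lpos l(2)] by (intro nn_integral_cong) simp
    finally show ?thesis .
  qed
  then show ?thesis using lim nn_integral_sheared_0[OF fm nonneg f0 j] by simp
qed

section \<open>The mean value theorem\<close>

lemma bij_betw_SL_int_int_lattice:
  assumes "\<gamma> \<in> SL_int"
  shows "bij_betw ((*v) \<gamma>) int_lattice int_lattice"
  by (rule bij_betw_byWitness[where f'="(*v) (sinv \<gamma>)"])
     (auto simp: sinv_cancel SL_int_det[OF assms] intro!: SL_int_int_lattice assms SL_int_sinv)

lemma sum_int_lattice_shift: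
  assumes "\<gamma> \<in> SL_int"
  shows "(\<integral>\<^sup>+m. f (g ** \<gamma> *v m) \<partial>count_space int_lattice) = (\<integral>\<^sup>+m. f (g *v m) \<partial>count_space int_lattice)"
  using nn_integral_bij_count_space[OF bij_betw_SL_int_int_lattice[OF assms], of "\<lambda>m. f (g *v m)"]
  by (simp add: matrix_vector_mul_assoc)

lemma borel_measurable_sum_int_lattice [measurable (raw)]:
  fixes f :: "'a \<Rightarrow> real^'n \<Rightarrow> ennreal"
  assumes "\<And>m. m \<in> int_lattice \<Longrightarrow> (\<lambda>x. f x m) \<in> borel_measurable M"
  shows "(\<lambda>x. \<integral>\<^sup>+m. f x m \<partial>count_space int_lattice) \<in> borel_measurable M"
  using assms by (intro borel_measurable_nn_integral_count_space) auto

lemma SUP_min_of_nat: "(SUP n. min (of_nat n) x) = (x :: ennreal)"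
proof (rule antisym)
  show "(SUP n. min (of_nat n) x) \<le> x" by (rule SUP_least) simp
  show "x \<le> (SUP n. min (of_nat n) x)"
  proof (cases "x = top")
    case True
    then show ?thesis by (simp add: ennreal_SUP_of_nat_eq_top)
  next
    case False
    then obtain r where r: "x = ennreal r" "r \<ge> 0" by (cases x) auto
    obtain n :: nat where "r \<le> real n" using real_arch_simple by blast
    then have "x \<le> of_nat n" using r by (simp add: ennreal_of_nat_eq_real_of_nat ennreal_leI)
    then have "x = min (of_nat n) x" by simp
    also have "\<dots> \<le> (SUP n. min (of_nat n) x)" by (rule SUP_upper) simp
    finally show ?thesis .
  qed
qed

lemma nn_integral_le_truncated:
  fixes f :: "'a \<Rightarrow> ennreal"
  assumes [measurable]: "f \<in> borel_measurable M" and le: "\<And>n::nat. (\<integral>\<^sup>+x. min (of_nat n) (f x) \<partial>M) \<le> B"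
  shows "(\<integral>\<^sup>+x. f x \<partial>M) \<le> B"
proof -
  have "(\<integral>\<^sup>+x. f x \<partial>M) = (\<integral>\<^sup>+x. (SUP n. min (of_nat n) (f x)) \<partial>M)" by (simp add: SUP_min_of_nat)
  also have "\<dots> = (SUP n. \<integral>\<^sup>+x. min (of_nat n) (f x) \<partial>M)"
    by (rule nn_integral_monotone_convergence_SUP)
       (auto simp: incseq_def le_fun_def intro!: min.coboundedI1)
  also have "\<dots> \<le> B" using le by (intro SUP_least)
  finally show ?thesis .
qed

text \<open>Truncation by a constant is concave, so averaging before truncating can only increase
  the value.\<close>

lemma nn_integral_min_const:
  assumes "prob_space M" and [measurable]: "f \<in> borel_measurable M"
  shows "(\<integral>\<^sup>+x. min c (f x) \<partial>M) \<le> min c (\<integral>\<^sup>+x. f x \<partial>M)"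
proof -
  interpret prob_space M by fact
  have "(\<integral>\<^sup>+x. min c (f x) \<partial>M) \<le> (\<integral>\<^sup>+x. c \<partial>M)" by (rule nn_integral_mono) simp
  moreover have "(\<integral>\<^sup>+x. min c (f x) \<partial>M) \<le> (\<integral>\<^sup>+x. f x \<partial>M)" by (rule nn_integral_mono) simp
  ultimately show ?thesis by (simp add: emeasure_space_1)
qed

definition tents_law :: "(real^'n) measure" where
  "tents_law = density lborel (\<lambda>\<xi>. ennreal (tents \<xi>))"

lemma sets_tents_law [measurable_cong, simp]: "sets tents_law = sets borel"
  by (simp add: tents_law_def)

lemma prob_space_tents_law: "prob_space tents_law"
  by (rule prob_spaceI) (simp add: tents_law_def emeasure_density nn_integral_tents)

lemma nn_integral_tents_law:
  "f \<in> borel_measurable borel \<Longrightarrow> (\<integral>\<^sup>+\<xi>. f \<xi> \<partial>tents_law) = (\<integral>\<^sup>+\<xi>. ennreal (tents \<xi>) * f \<xi> \<partial>lborel)"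
  by (simp add: tents_law_def nn_integral_density)

text \<open>Integrability of the lattice sum is not known in advance. The upper bound is therefore
  proved for truncations, where dominated convergence applies, and the lower bound comes from
  Fatou's lemma.\<close>

lemma mean_value_continuous:
  fixes \<pi> :: "(real^'n^'n) measure" and f :: "real^'n \<Rightarrow> real"
  assumes \<pi>: "inv_law \<pi>" and card: "CARD('n) \<ge> 2"
    and cont: "continuous_on UNIV f" and nonneg: "\<And>v. f v \<ge> 0" and C: "\<And>v. f v \<le> C"
    and supp: "\<And>v. f v \<noteq> 0 \<Longrightarrow> \<delta> \<le> \<bar>v $ j\<bar> \<and> (\<forall>i. \<bar>v $ i\<bar> \<le> R)" and \<delta>: "\<delta> > 0" and R: "R \<ge> 0"
  shows "(\<integral>\<^sup>+g. (\<integral>\<^sup>+m. ennreal (f (g *v m)) \<partial>count_space int_lattice) \<partial>\<pi>) = (\<integral>\<^sup>+v. ennreal (f v) \<partial>lborel)"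
proof -
  interpret prob_space \<pi> by (rule inv_law_D[OF \<pi>])
  note [measurable_cong] = inv_law_D(2)[OF \<pi>]
  have [measurable]: "f \<in> borel_measurable borel" using cont by (rule borel_measurable_continuous_onI)
  interpret t: prob_space "tents_law :: (real^'n) measure" by (rule prob_space_tents_law)
  interpret pt: pair_sigma_finite \<pi> "tents_law :: (real^'n) measure" ..
  obtain k where k: "k \<noteq> j"
  proof -
    have "UNIV \<noteq> {j}"
    proof
      assume "UNIV = {j}"
      then have "CARD('n) = card {j}" by (rule arg_cong)
      then show False using card by simp
    qed
    then show thesis using that by blast
  qed
  define T where "T n = real n + 1" for n :: nat
  \<comment> \<open>Only coordinate k is expanded, so determinant one forces the full power d -
    1.\<close>
  define l where "l n a = T n ^ (CARD('n) - 1)" for n and a :: 'n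
  define A where "A n \<xi> = shear_mat {k} j (l n) (T n) \<xi>" for n \<xi>
  define N where "N g = (\<integral>\<^sup>+m. ennreal (f (g *v m)) \<partial>count_space int_lattice)" for g :: "real^'n^'n"
  define S where "S n g = (\<integral>\<^sup>+\<xi>. N (A n \<xi> ** g) \<partial>tents_law)" for n and g :: "real^'n^'n"
  have [measurable]: "A n \<in> borel_measurable borel" for n unfolding A_def by measurable
  have [measurable]: "N \<in> borel_measurable borel" unfolding N_def by measurable
  have T1: "T n \<ge> 1" "T n > 0" for n by (auto simp: T_def)
  have Tlim: "filterlim T at_top sequentially"
    unfolding T_def by (rule filterlim_at_top_mono[OF filterlim_real_sequentially]) auto
  have l1: "l n a \<ge> 1" for n a unfolding l_def using T1 by (intro one_le_power)
  have lp: "(\<Prod>a\<in>{k}. l n a) = T n ^ card (- {k})" for n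
    by (simp add: l_def card_Diff_subset Compl_eq_Diff_UNIV)
  have detA: "det (A n \<xi>) = 1" for n \<xi>
    unfolding A_def by (rule det_shear_mat) (use k lp T1 in auto)
  have Ninv: "N (g ** \<gamma>) = N g" if "\<gamma> \<in> SL_int" for g \<gamma>
    unfolding N_def by (rule sum_int_lattice_shift[OF that])
  have S_eq: "S n g = (\<integral>\<^sup>+\<xi>. ennreal (tents \<xi>) *
      (\<integral>\<^sup>+m. ennreal (f (shear_mat {k} j (l n) (T n) \<xi> *v (g *v m))) \<partial>count_space int_lattice) \<partial>lborel)" for n g
    unfolding S_def by (subst nn_integral_tents_law) (auto simp: N_def A_def matrix_vector_mul_assoc)
  have S_lim: "(\<lambda>n. S n g) \<longlonglongrightarrow> (\<integral>\<^sup>+v. ennreal (f v) \<partial>lborel)" if "det g = 1" for g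
    unfolding S_eq by (rule shear_limit[OF cont nonneg C supp \<delta> R _ T1(1) Tlim l1 lp that]) (use k in auto)
  have Sm [measurable]: "S n \<in> borel_measurable borel" for n
  proof -
    have "(\<lambda>(g, \<xi>). N (A n \<xi> ** g)) \<in> borel_measurable (borel \<Otimes>\<^sub>M tents_law)" by measurable
    then show ?thesis unfolding S_def by (rule t.borel_measurable_nn_integral)
  qed
  have avg: "(\<integral>\<^sup>+g. \<Phi> g \<partial>\<pi>) = (\<integral>\<^sup>+g. (\<integral>\<^sup>+\<xi>. \<Phi> (A n \<xi> ** g) \<partial>tents_law) \<partial>\<pi>)"
    if [measurable]: "\<Phi> \<in> borel_measurable borel" and inv: "\<And>g \<gamma>. \<gamma> \<in> SL_int \<Longrightarrow> \<Phi> (g ** \<gamma>) = \<Phi> g" for \<Phi> n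
  proof -
    have "(\<integral>\<^sup>+g. (\<integral>\<^sup>+\<xi>. \<Phi> (A n \<xi> ** g) \<partial>tents_law) \<partial>\<pi>) = (\<integral>\<^sup>+\<xi>. (\<integral>\<^sup>+g. \<Phi> (A n \<xi> ** g) \<partial>\<pi>) \<partial>tents_law)"
      by (rule pt.Fubini'[symmetric]) measurable
    also have "\<dots> = (\<integral>\<^sup>+\<xi>. (\<integral>\<^sup>+g. \<Phi> g \<partial>\<pi>) \<partial>(tents_law :: (real^'n) measure))"
      by (intro nn_integral_cong inv_law_nn_integral[OF \<pi> detA]) (auto intro: inv)
    finally show ?thesis by (simp add: t.emeasure_space_1)
  qed
  have "(\<integral>\<^sup>+g. min (of_nat M) (N g) \<partial>\<pi>) \<le> (\<integral>\<^sup>+v. ennreal (f v) \<partial>lborel)" for M :: nat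
  proof -
    \<comment> \<open>Invariance replaces N by its average over shears of the truncated sum, and
      concavity moves the truncation outside that average.\<close>
    have le: "(\<integral>\<^sup>+g. min (of_nat M) (N g) \<partial>\<pi>) \<le> (\<integral>\<^sup>+g. min (of_nat M) (S n g) \<partial>\<pi>)" for n
    proof -
      have "(\<integral>\<^sup>+g. min (of_nat M) (N g) \<partial>\<pi>) = (\<integral>\<^sup>+g. (\<integral>\<^sup>+\<xi>. min (of_nat M) (N (A n \<xi> ** g)) \<partial>tents_law) \<partial>\<pi>)"
        by (rule avg) (auto simp: Ninv)
      also have "\<dots> \<le> (\<integral>\<^sup>+g. min (of_nat M) (S n g) \<partial>\<pi>)"
        unfolding S_def by (intro nn_integral_mono nn_integral_min_const prob_space_tents_law) measurable
      finally show ?thesis .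
    qed
    have "(\<lambda>n. \<integral>\<^sup>+g. min (of_nat M) (S n g) \<partial>\<pi>) \<longlonglongrightarrow> (\<integral>\<^sup>+g. min (of_nat M) (\<integral>\<^sup>+v. ennreal (f v) \<partial>lborel) \<partial>\<pi>)"
    proof (rule nn_integral_dominated_convergence[where w="\<lambda>_. of_nat M"])
      show "AE g in \<pi>. (\<lambda>n. min (of_nat M) (S n g)) \<longlonglongrightarrow> min (of_nat M) (\<integral>\<^sup>+v. ennreal (f v) \<partial>lborel)"
        using inv_law_D(3)[OF \<pi>] by (rule eventually_mono) (intro tendsto_min tendsto_const S_lim)
      show "(\<integral>\<^sup>+g. of_nat M \<partial>\<pi>) < \<infinity>" by (simp add: emeasure_space_1 of_nat_less_top)
    qed (auto simp: emeasure_space_1)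
    then have "(\<integral>\<^sup>+g. min (of_nat M) (N g) \<partial>\<pi>) \<le> (\<integral>\<^sup>+g. min (of_nat M) (\<integral>\<^sup>+v. ennreal (f v) \<partial>lborel) \<partial>\<pi>)"
      by (rule LIMSEQ_le_const) (use le in blast)
    also have "\<dots> \<le> (\<integral>\<^sup>+v. ennreal (f v) \<partial>lborel)" by (simp add: emeasure_space_1)
    finally show ?thesis .
  qed
  then have "(\<integral>\<^sup>+g. N g \<partial>\<pi>) \<le> (\<integral>\<^sup>+v. ennreal (f v) \<partial>lborel)"
    by (rule nn_integral_le_truncated[rotated]) measurable
  \<comment> \<open>Each S n has the same integral as N by invariance, and S n converges pointwise,
    so Fatou's lemma gives this direction.\<close>
  moreover have "(\<integral>\<^sup>+v. ennreal (f v) \<partial>lborel) \<le> (\<integral>\<^sup>+g. N g \<partial>\<pi>)"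
  proof -
    have "(\<integral>\<^sup>+v. ennreal (f v) \<partial>lborel) = (\<integral>\<^sup>+g. (\<integral>\<^sup>+v. ennreal (f v) \<partial>lborel) \<partial>\<pi>)" by (simp add: emeasure_space_1)
    also have "\<dots> = (\<integral>\<^sup>+g. liminf (\<lambda>n. S n g) \<partial>\<pi>)"
      using inv_law_D(3)[OF \<pi>]
      by (intro nn_integral_cong_AE, elim eventually_mono) (simp add: lim_imp_Liminf[OF _ S_lim])
    also have "\<dots> \<le> liminf (\<lambda>n. \<integral>\<^sup>+g. S n g \<partial>\<pi>)" by (rule nn_integral_liminf) simp
    also have "(\<lambda>n. \<integral>\<^sup>+g. S n g \<partial>\<pi>) = (\<lambda>n. \<integral>\<^sup>+g. N g \<partial>\<pi>)"
      unfolding S_def by (intro ext avg[symmetric]) (auto simp: Ninv)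
    finally show ?thesis by (simp add: Liminf_const)
  qed
  ultimately show ?thesis unfolding N_def by (rule antisym)
qed

lemma indicator_open_SUP:
  fixes U :: "'a::metric_space set"
  assumes "open U" "U \<noteq> UNIV"
  shows "indicator U x = (SUP k. ennreal (min 1 (real k * infdist x (- U))))"
proof (cases "x \<in> U")
  case False
  then show ?thesis by (simp add: indicator_def)
next
  case True
  have ne: "- U \<noteq> {}" "closed (- U)" using assms by auto
  have "infdist x (- U) \<noteq> 0" using in_closed_iff_infdist_zero[OF ne(2,1), of x] True by simp
  then have pos: "infdist x (- U) > 0" using infdist_nonneg[of x "- U"] by simp
  obtain k :: nat where "1 < real k * infdist x (- U)" using reals_Archimedean3[OF pos] by blast
  then have "(1::ennreal) = ennreal (min 1 (real k * infdist x (- U)))" by simp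
  also have "\<dots> \<le> (SUP k. ennreal (min 1 (real k * infdist x (- U))))" by (rule SUP_upper) simp
  finally have "1 \<le> (SUP k. ennreal (min 1 (real k * infdist x (- U))))" .
  moreover have "(SUP k. ennreal (min 1 (real k * infdist x (- U)))) \<le> 1"
    by (rule SUP_least) (simp add: ennreal_le_1)
  ultimately show ?thesis using True by simp
qed

text \<open>The intensity measure of the random point set; the origin is removed because it would
  contribute an atom.\<close>

definition lattice_points :: "(real^'n^'n) measure \<Rightarrow> (real^'n) measure" where
  "lattice_points \<pi> = distr (count_space (int_lattice - {0}) \<Otimes>\<^sub>M \<pi>) borel (\<lambda>(m, g). g *v m)"

lemma sets_lattice_points [simp, measurable_cong]: "sets (lattice_points \<pi>) = sets borel"
  by (simp add: lattice_points_def)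

lemma nn_integral_lattice_points:
  fixes \<pi> :: "(real^'n^'n) measure"
  assumes \<pi>: "inv_law \<pi>" and [measurable]: "h \<in> borel_measurable borel"
  shows "(\<integral>\<^sup>+v. h v \<partial>lattice_points \<pi>) = (\<integral>\<^sup>+g. (\<integral>\<^sup>+m. h (g *v m) \<partial>count_space (int_lattice - {0})) \<partial>\<pi>)"
proof -
  interpret prob_space \<pi> by (rule inv_law_D[OF \<pi>])
  note [measurable_cong] = inv_law_D(2)[OF \<pi>]
  have m: "(\<lambda>(m, g). g *v m) \<in> count_space (int_lattice - {0}) \<Otimes>\<^sub>M \<pi> \<rightarrow>\<^sub>M (borel :: (real^'n) measure)"
    by (rule measurable_pair_measure_countable1) auto
  have "(\<integral>\<^sup>+v. h v \<partial>lattice_points \<pi>) = (\<integral>\<^sup>+x. h (case x of (m, g) \<Rightarrow> g *v m) \<partial>(count_space (int_lattice - {0}) \<Otimes>\<^sub>M \<pi>))"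
    unfolding lattice_points_def by (rule nn_integral_distr[OF m]) simp
  also have "\<dots> = (\<integral>\<^sup>+m. (\<integral>\<^sup>+g. h (g *v m) \<partial>\<pi>) \<partial>count_space (int_lattice - {0}))"
    using m by (subst nn_integral_fst[symmetric]) auto
  also have "\<dots> = (\<integral>\<^sup>+g. (\<integral>\<^sup>+m. h (g *v m) \<partial>count_space (int_lattice - {0})) \<partial>\<pi>)"
    by (rule nn_integral_count_space_nn_integral[symmetric]) auto
  finally show ?thesis .
qed

lemma nn_integral_count_space_remove_0:
  assumes "h 0 = (0::ennreal)"
  shows "(\<integral>\<^sup>+m. h m \<partial>count_space (int_lattice - {0})) = (\<integral>\<^sup>+m. h m \<partial>count_space int_lattice)"
  by (subst (1 2) nn_integral_count_space_indicator) (auto intro!: nn_integral_cong simp: indicator_def assms)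

text \<open>The continuous case sees functions supported off one coordinate hyperplane. Letting the
  hyperplane vary covers everything except the origin, where the intensity measure has no
  mass.\<close>

theorem mean_value:
  fixes \<pi> :: "(real^'n^'n) measure"
  assumes \<pi>: "inv_law \<pi>" and card: "CARD('n) \<ge> 2"
  shows "lattice_points \<pi> = lborel"
proof -
  interpret prob_space \<pi> by (rule inv_law_D[OF \<pi>])
  note [measurable_cong] = inv_law_D(2)[OF \<pi>]
  let ?N = "lattice_points \<pi>"
  \<comment> \<open>Bounded open sets at positive distance from the hyperplane x_j = 0: on them the
    continuous case applies and Lebesgue measure is finite, so agreement on open sets extends to
    Borel sets.\<close>
  define V where "V j n = {x::real^'n. 1 / (real n + 1) < \<bar>x $ j\<bar> \<and> (\<forall>i. \<bar>x $ i\<bar> < real n + 1)}" for j and n :: nat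
  have Vopen: "open (V j n)" for j n
  proof -
    have "V j n = {x. 1 / (real n + 1) < \<bar>x $ j\<bar>} \<inter> (\<Inter>i. {x. \<bar>x $ i\<bar> < real n + 1})" by (auto simp: V_def)
    also have "open \<dots>" by (intro open_Int open_INT open_Collect_less continuous_intros ballI) auto
    finally show ?thesis .
  qed
  have Vbdd: "V j n \<subseteq> cball 0 (real CARD('n) * (real n + 1))" for j n
  proof
    fix x assume "x \<in> V j n"
    then have "(\<Sum>i\<in>UNIV. \<bar>x $ i\<bar>) \<le> real CARD('n) * (real n + 1)"
      by (intro sum_bounded_above) (auto simp: V_def less_imp_le)
    then show "x \<in> cball 0 (real CARD('n) * (real n + 1))" using norm_le_l1_cart[of x] by simp
  qed
  have zero_notin: "0 \<notin> V j n" for j n by (auto simp: V_def)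
  have open_eq: "emeasure ?N U = emeasure lborel U" if U: "open U" "U \<subseteq> V j n" for U j n
  proof -
    have Um [measurable]: "U \<in> sets borel" using U by simp
    have nU: "U \<noteq> UNIV" using U zero_notin by auto
    let ?f = "\<lambda>k x. min 1 (real k * infdist x (- U))"
    have fm: "continuous_on UNIV (?f k)" for k by (intro continuous_intros)
    have [measurable]: "?f k \<in> borel_measurable borel" for k by (rule borel_measurable_continuous_onI[OF fm])
    have fz: "x \<in> U" if "?f k x \<noteq> 0" for k x
      using that infdist_zero[of x "- U"] by (cases "x \<in> U") auto
    have eq: "(\<integral>\<^sup>+v. ennreal (?f k v) \<partial>?N) = (\<integral>\<^sup>+v. ennreal (?f k v) \<partial>lborel)" for k
    proof -
      have "?f k 0 = 0" using fz[of k 0] U zero_notin by blast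
      then have "(\<integral>\<^sup>+v. ennreal (?f k v) \<partial>?N) = (\<integral>\<^sup>+g. (\<integral>\<^sup>+m. ennreal (?f k (g *v m)) \<partial>count_space int_lattice) \<partial>\<pi>)"
        by (subst nn_integral_lattice_points[OF \<pi>])
           (auto intro!: nn_integral_cong nn_integral_count_space_remove_0)
      also have "\<dots> = (\<integral>\<^sup>+v. ennreal (?f k v) \<partial>lborel)"
      proof (rule mean_value_continuous[OF \<pi> card fm, where C=1 and \<delta>="1 / (real n + 1)" and R="real n + 1" and j=j])
        show "1 / (real n + 1) \<le> \<bar>v $ j\<bar> \<and> (\<forall>i. \<bar>v $ i\<bar> \<le> real n + 1)" if "?f k v \<noteq> 0" for v
        proof -
          have "v \<in> V j n" using fz[OF that] U by blast
          then show ?thesis by (auto simp: V_def less_imp_le)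
        qed
      qed (auto simp: infdist_nonneg)
      finally show ?thesis .
    qed
    have inc: "incseq (\<lambda>k x. ennreal (?f k x))"
      by (intro incseq_SucI le_funI ennreal_leI min.mono mult_right_mono) (auto simp: infdist_nonneg)
    have "emeasure ?N U = (\<integral>\<^sup>+v. (SUP k. ennreal (?f k v)) \<partial>?N)"
      unfolding indicator_open_SUP[OF U(1) nU, symmetric] by simp
    also have "\<dots> = (SUP k. \<integral>\<^sup>+v. ennreal (?f k v) \<partial>?N)"
      by (rule nn_integral_monotone_convergence_SUP[OF inc]) simp
    also have "\<dots> = (SUP k. \<integral>\<^sup>+v. ennreal (?f k v) \<partial>lborel)" unfolding eq ..
    also have "\<dots> = (\<integral>\<^sup>+v. (SUP k. ennreal (?f k v)) \<partial>lborel)"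
      by (rule nn_integral_monotone_convergence_SUP[OF inc, symmetric]) simp
    also have "\<dots> = emeasure lborel U"
      unfolding indicator_open_SUP[OF U(1) nU, symmetric] by simp
    finally show ?thesis .
  qed
  have V_eq: "emeasure ?N (A \<inter> V j n) = emeasure lborel (A \<inter> V j n)" if A: "A \<in> sets borel" for A j n
  proof -
    have Vm [measurable]: "V j n \<in> sets borel" using Vopen by simp
    have "density ?N (indicator (V j n)) = density lborel (indicator (V j n))"
    proof (rule measure_eqI_generator_eq[where E="{S. open S}" and \<Omega>=UNIV and A="\<lambda>_. UNIV"])
      show "Int_stable {S :: (real^'n) set. open S}" by (auto simp: Int_stable_def)
      show "sets (density ?N (indicator (V j n))) = sigma_sets UNIV {S. open S}"
        "sets (density lborel (indicator (V j n))) = sigma_sets UNIV {S. open S}"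
        by (auto simp: borel_def)
      show "emeasure (density ?N (indicator (V j n))) X = emeasure (density lborel (indicator (V j n))) X"
        if "X \<in> {S. open S}" for X
      proof -
        have X: "open X" "X \<in> sets borel" using that by auto
        have "emeasure (density ?N (indicator (V j n))) X = emeasure ?N (V j n \<inter> X)"
          using X by (subst emeasure_density) (auto simp: indicator_inter_arith[symmetric])
        also have "\<dots> = emeasure lborel (V j n \<inter> X)" using X Vopen by (intro open_eq[of _ j n]) auto
        also have "\<dots> = emeasure (density lborel (indicator (V j n))) X"
          using X by (subst emeasure_density) (auto simp: indicator_inter_arith[symmetric])
        finally show ?thesis .
      qed
      have "emeasure (density ?N (indicator (V j n))) UNIV = emeasure lborel (V j n)"
        using Vopen open_eq[of "V j n" j n] by (subst emeasure_density) auto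
      also have "\<dots> \<le> emeasure lborel (cball (0::real^'n) (real CARD('n) * (real n + 1)))"
        using Vbdd by (intro emeasure_mono) auto
      also have "\<dots> < \<infinity>" by (rule emeasure_lborel_cball_finite)
      finally show "emeasure (density ?N (indicator (V j n))) UNIV \<noteq> \<infinity>" by simp
    qed auto
    from arg_cong[OF this, of "\<lambda>M. emeasure M A"] show ?thesis
      using A by (simp add: emeasure_density indicator_inter_arith[symmetric] Int_commute)
  qed
  have \<Omega>_eq: "emeasure ?N (A \<inter> {x. x $ j \<noteq> 0}) = emeasure lborel (A \<inter> {x. x $ j \<noteq> 0})" if A: "A \<in> sets borel" for A j
  proof -
    have inc: "incseq (\<lambda>n. A \<inter> V j n)"
    proof (rule incseq_SucI)
      fix n
      have "1 / (real (Suc n) + 1) \<le> 1 / (real n + 1)" by (simp add: frac_le)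
      then have "V j n \<subseteq> V j (Suc n)"
        unfolding V_def by (intro Collect_mono) (auto intro: order_le_less_trans order_less_trans)
      then show "A \<inter> V j n \<subseteq> A \<inter> V j (Suc n)" by blast
    qed
    have un: "(\<Union>n. A \<inter> V j n) = A \<inter> {x. x $ j \<noteq> 0}"
    proof (intro set_eqI iffI)
      fix x assume "x \<in> A \<inter> {x. x $ j \<noteq> 0}"
      then have x: "x \<in> A" "x $ j \<noteq> 0" by auto
      obtain a :: nat where a: "1 / \<bar>x $ j\<bar> < real a" using reals_Archimedean2 by blast
      obtain b :: nat where b: "norm x < real b" using reals_Archimedean2 by blast
      have "1 < real a * \<bar>x $ j\<bar>" using a x by (simp add: divide_less_eq)
      also have "\<dots> \<le> (real (max a b) + 1) * \<bar>x $ j\<bar>" by (intro mult_right_mono) auto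
      finally have "1 / (real (max a b) + 1) < \<bar>x $ j\<bar>" by (simp add: divide_less_eq mult.commute)
      moreover have "\<bar>x $ i\<bar> < real (max a b) + 1" for i
        using component_le_norm_cart[of x i] b by simp
      ultimately have "x \<in> V j (max a b)" by (simp add: V_def)
      then show "x \<in> (\<Union>n. A \<inter> V j n)" using x by blast
    next
      fix x assume "x \<in> (\<Union>n. A \<inter> V j n)"
      then obtain n where "x \<in> A" "x \<in> V j n" by blast
      moreover from this have "x $ j \<noteq> 0" by (auto simp: V_def)
      ultimately show "x \<in> A \<inter> {x. x $ j \<noteq> 0}" by blast
    qed
    have ms: "A \<inter> V j n \<in> sets borel" for n using A Vopen by auto
    show ?thesis
      unfolding un[symmetric]
      using SUP_emeasure_incseq[of "\<lambda>n. A \<inter> V j n" ?N] SUP_emeasure_incseq[of "\<lambda>n. A \<inter> V j n" lborel] inc ms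
      by (simp add: V_eq[OF A] image_subset_iff)
  qed
  fix j0 :: 'n
  have hyp_m: "{x::real^'n. x $ i = 0} \<in> sets borel" "{x::real^'n. x $ i \<noteq> 0} \<in> sets borel" for i
    by (auto intro!: borel_closed borel_open closed_Collect_eq open_Collect_neq continuous_intros)
  have hyp_null: "emeasure lborel {x::real^'n. x $ i = 0} = 0" for i
    using AE_lborel_component_nonzero[of i] hyp_m by (subst (asm) AE_iff_measurable[OF _ refl]) auto
  have N0: "emeasure ?N {0} = 0"
  proof -
    have "emeasure ?N {0} = (\<integral>\<^sup>+v. indicator {0} v \<partial>?N)" by simp
    also have "\<dots> = (\<integral>\<^sup>+g. (\<integral>\<^sup>+m. indicator {0} (g *v m) \<partial>count_space (int_lattice - {0})) \<partial>\<pi>)"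
      by (rule nn_integral_lattice_points[OF \<pi>]) simp
    also have "\<dots> = (\<integral>\<^sup>+g. 0 \<partial>\<pi>)"
      using inv_law_D(3)[OF \<pi>]
    proof (intro nn_integral_cong_AE, elim eventually_mono)
      fix g :: "real^'n^'n" assume g: "det g = 1"
      have "(\<integral>\<^sup>+m. indicator {0} (g *v m) \<partial>count_space (int_lattice - {0})) = (\<integral>\<^sup>+m. (0::ennreal) \<partial>count_space (int_lattice - {0 :: real^'n}))"
        using g by (intro nn_integral_cong) (auto simp: indicator_def SL_int_vec_eq_0_iff)
      then show "(\<integral>\<^sup>+m. indicator {0} (g *v m) \<partial>count_space (int_lattice - {0})) = (0::ennreal)" by simp
    qed
    finally show ?thesis by simp
  qed
  \<comment> \<open>Off the origin some coordinate is nonzero, and where x_i is nonzero the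
    intensity is already known to be Lebesgue measure, for which the hyperplane is null.\<close>
  have hyp_N: "emeasure ?N {x. x $ j0 = 0} = 0"
  proof -
    have "{x. x $ j0 = 0} \<subseteq> {0} \<union> (\<Union>i\<in>UNIV. {x. x $ j0 = 0} \<inter> {x. x $ i \<noteq> 0})" by (auto simp: vec_eq_iff)
    then have "emeasure ?N {x. x $ j0 = 0} \<le> emeasure ?N ({0} \<union> (\<Union>i\<in>UNIV. {x. x $ j0 = 0} \<inter> {x. x $ i \<noteq> 0}))"
      using hyp_m by (intro emeasure_mono) auto
    also have "\<dots> \<le> emeasure ?N {0} + emeasure ?N (\<Union>i\<in>UNIV. {x. x $ j0 = 0} \<inter> {x. x $ i \<noteq> 0})"
      using hyp_m by (intro emeasure_subadditive) auto
    also have "emeasure ?N (\<Union>i\<in>UNIV. {x. x $ j0 = 0} \<inter> {x. x $ i \<noteq> 0}) \<le> (\<Sum>i\<in>UNIV. emeasure ?N ({x. x $ j0 = 0} \<inter> {x. x $ i \<noteq> 0}))"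
      using hyp_m by (intro emeasure_subadditive_finite) auto
    also have "\<dots> = (\<Sum>i\<in>UNIV. emeasure lborel ({x::real^'n. x $ j0 = 0} \<inter> {x. x $ i \<noteq> 0}))"
      using hyp_m by (simp add: \<Omega>_eq)
    also have "\<dots> = 0"
    proof (intro sum.neutral ballI)
      fix i
      have "emeasure lborel ({x::real^'n. x $ j0 = 0} \<inter> {x. x $ i \<noteq> 0}) \<le> emeasure lborel {x::real^'n. x $ j0 = 0}"
        using hyp_m by (intro emeasure_mono) auto
      then show "emeasure lborel ({x::real^'n. x $ j0 = 0} \<inter> {x. x $ i \<noteq> 0}) = 0" using hyp_null by simp
    qed
    finally show ?thesis using N0 by simp
  qed
  have drop: "emeasure M A = emeasure M (A \<inter> {x. x $ j0 \<noteq> 0})"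
    if "sets M = sets borel" "emeasure M {x. x $ j0 = 0} = 0" "A \<in> sets borel" for M :: "(real^'n) measure" and A
  proof -
    have "{x. x $ j0 = 0} \<in> null_sets M" by (rule null_setsI[OF that(2)]) (simp only: that(1) hyp_m)
    moreover have "A \<in> sets M" using that(1,3) by simp
    ultimately have "emeasure M (A - {x. x $ j0 = 0}) = emeasure M A"
      by (rule emeasure_Diff_null_set)
    moreover have "A - {x. x $ j0 = 0} = A \<inter> {x. x $ j0 \<noteq> 0}" by auto
    ultimately show ?thesis by simp
  qed
  show ?thesis
  proof (rule measure_eqI)
    fix A assume "A \<in> sets ?N"
    then have A: "A \<in> sets borel" by simp
    show "emeasure ?N A = emeasure lborel A"
      using drop[of ?N A] drop[of lborel A] \<Omega>_eq[OF A, of j0] hyp_N hyp_null[of j0] A by simp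
  qed simp
qed

corollary nn_integral_mean_value:
  fixes \<pi> :: "(real^'n^'n) measure"
  assumes "inv_law \<pi>" "CARD('n) \<ge> 2" "h \<in> borel_measurable borel"
  shows "(\<integral>\<^sup>+g. (\<integral>\<^sup>+m. h (g *v m) \<partial>count_space (int_lattice - {0})) \<partial>\<pi>) = (\<integral>\<^sup>+v. h v \<partial>lborel)"
  using nn_integral_lattice_points[OF assms(1,3)] mean_value[OF assms(1,2)] by simp

section \<open>Primitive vectors and the factor 1 / zeta(d)\<close>

lemma borel_measurable_sum_prim_vecs [measurable (raw)]:
  fixes f :: "'a \<Rightarrow> real^'n \<Rightarrow> ennreal"
  assumes "\<And>p. p \<in> prim_vecs i \<Longrightarrow> (\<lambda>x. f x p) \<in> borel_measurable M"
  shows "(\<lambda>x. \<integral>\<^sup>+p. f x p \<partial>count_space (prim_vecs i)) \<in> borel_measurable M"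
  using assms by (intro borel_measurable_nn_integral_count_space) auto

lemma sum_int_lattice_eq_sum_prim:
  fixes h :: "real^'n \<Rightarrow> ennreal"
  assumes card: "CARD('n) \<ge> 2"
  shows "(\<integral>\<^sup>+m. h m \<partial>count_space (int_lattice - {0})) =
    (\<Sum>n. \<integral>\<^sup>+p. h (real (Suc n) *\<^sub>R p) \<partial>count_space (prim_vecs i))"
proof -
  interpret sigma_finite_measure "count_space (prim_vecs i :: (real^'n) set)"
    by (rule sigma_finite_measure_count_space_countable) simp
  have bS: "bij_betw Suc UNIV {1..}"
    by (rule bij_betw_byWitness[where f'="\<lambda>n. n - 1"]) auto
  have "(\<integral>\<^sup>+m. h m \<partial>count_space (int_lattice - {0})) =
    (\<integral>\<^sup>+x. h (case x of (k, p) \<Rightarrow> real k *\<^sub>R p) \<partial>count_space ({1..} \<times> prim_vecs i))"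
    by (rule nn_integral_bij_count_space[OF bij_betw_prim_multiple[OF card, of i], symmetric])
  also have "\<dots> = (\<integral>\<^sup>+x. h (case x of (k, p) \<Rightarrow> real k *\<^sub>R p) \<partial>(count_space {1..} \<Otimes>\<^sub>M count_space (prim_vecs i)))"
    by (subst pair_measure_countable) auto
  also have "\<dots> = (\<integral>\<^sup>+k. (\<integral>\<^sup>+p. h (real k *\<^sub>R p) \<partial>count_space (prim_vecs i)) \<partial>count_space {1::nat..})"
    by (subst nn_integral_fst[symmetric]) (auto simp: pair_measure_countable)
  also have "\<dots> = (\<integral>\<^sup>+n. (\<integral>\<^sup>+p. h (real (Suc n) *\<^sub>R p) \<partial>count_space (prim_vecs i)) \<partial>count_space (UNIV :: nat set))"
    by (rule nn_integral_bij_count_space[OF bS, symmetric])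
  finally show ?thesis by (simp add: nn_integral_count_space_nat)
qed

lemma zeta_summable:
  assumes "k \<ge> 2" shows "summable (\<lambda>n. 1 / real (Suc n) ^ k)"
  using inverse_power_summable[OF assms, where 'a=real]
  by (subst (asm) summable_Suc_iff[symmetric]) (simp add: divide_inverse)

text \<open>What matters about 7/4 is that it is below 2: the contraction factor zeta(d) - 1 is then
  below 1. It is 1 + 1/4 plus the telescoping bound 1/2 for the remaining terms with exponent
  2.\<close>

lemma zeta_bounds:
  assumes "k \<ge> 2" shows "1 \<le> zeta k" "zeta k \<le> 7 / 4"
proof -
  have "(\<Sum>n\<in>{0}. 1 / real (Suc n) ^ k) \<le> zeta k"
    unfolding zeta_def by (rule sum_le_suminf[OF zeta_summable[OF assms]]) auto
  then show "1 \<le> zeta k" by simp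
  have *: "(\<Sum>n<N. 1 / real (Suc n) ^ 2) \<le> 7 / 4 - 1 / real N" if "N \<ge> 2" for N
    using that
  proof (induction N rule: dec_induct)
    case base
    then show ?case by (simp add: numeral_2_eq_2)
  next
    case (step N)
    have "1 / real (Suc N) ^ 2 \<le> 1 / real N - 1 / real (Suc N)"
      using step by (simp add: divide_simps power2_eq_square)
    then show ?case using step by simp
  qed
  show "zeta k \<le> 7 / 4"
    unfolding zeta_def
  proof (rule suminf_le_const[OF zeta_summable[OF assms]])
    fix N
    have "(\<Sum>n<N. 1 / real (Suc n) ^ k) \<le> (\<Sum>n<N + 2. 1 / real (Suc n) ^ 2)"
    proof (rule order_trans)
      show "(\<Sum>n<N. 1 / real (Suc n) ^ k) \<le> (\<Sum>n<N. 1 / real (Suc n) ^ 2)"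
        using assms by (intro sum_mono frac_le power_increasing) auto
      show "(\<Sum>n<N. 1 / real (Suc n) ^ 2) \<le> (\<Sum>n<N + 2. 1 / real (Suc n) ^ 2)"
        by (rule sum_mono2) auto
    qed
    also have "\<dots> \<le> 7 / 4 - 1 / real (N + 2)" by (rule *) simp
    also have "\<dots> \<le> 7 / 4" by simp
    finally show "(\<Sum>n<N. 1 / real (Suc n) ^ k) \<le> 7 / 4" .
  qed
qed

lemma zeta_sums: "k \<ge> 2 \<Longrightarrow> (\<lambda>n. 1 / real (Suc n) ^ k) sums zeta k"
  unfolding zeta_def by (rule summable_sums[OF zeta_summable])

definition prim_int :: "'n::finite \<Rightarrow> (real^'n^'n) measure \<Rightarrow> (real^'n \<Rightarrow> ennreal) \<Rightarrow> ennreal" where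
  "prim_int i \<pi> h = (\<integral>\<^sup>+g. (\<integral>\<^sup>+p. h (g *v p) \<partial>count_space (prim_vecs i)) \<partial>\<pi>)"

lemma suminf_prim_int:
  fixes \<pi> :: "(real^'n^'n) measure"
  assumes \<pi>: "inv_law \<pi>" and card: "CARD('n) \<ge> 2" and [measurable]: "h \<in> borel_measurable borel"
  shows "(\<Sum>n. prim_int i \<pi> (\<lambda>v. h (real (Suc n) *\<^sub>R v))) = (\<integral>\<^sup>+v. h v \<partial>lborel)"
proof -
  note [measurable_cong] = inv_law_D(2)[OF \<pi>]
  have "(\<integral>\<^sup>+v. h v \<partial>lborel) = (\<integral>\<^sup>+g. (\<integral>\<^sup>+m. h (g *v m) \<partial>count_space (int_lattice - {0})) \<partial>\<pi>)"
    by (rule nn_integral_mean_value[symmetric]) (use assms in auto)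
  also have "\<dots> = (\<integral>\<^sup>+g. (\<Sum>n. \<integral>\<^sup>+p. h (real (Suc n) *\<^sub>R (g *v p)) \<partial>count_space (prim_vecs i)) \<partial>\<pi>)"
    by (subst sum_int_lattice_eq_sum_prim[OF card, of _ i]) (simp add: matrix_vector_mult_scaleR)
  also have "\<dots> = (\<Sum>n. prim_int i \<pi> (\<lambda>v. h (real (Suc n) *\<^sub>R v)))"
    unfolding prim_int_def by (rule nn_integral_suminf) measurable
  finally show ?thesis ..
qed

lemma prim_int_le:
  fixes \<pi> :: "(real^'n^'n) measure"
  assumes "inv_law \<pi>" "CARD('n) \<ge> 2" "h \<in> borel_measurable borel"
  shows "prim_int i \<pi> h \<le> (\<integral>\<^sup>+v. h v \<partial>lborel)"
proof -
  have "(\<Sum>n\<in>{0}. prim_int i \<pi> (\<lambda>v. h (real (Suc n) *\<^sub>R v))) \<le> (\<Sum>n. prim_int i \<pi> (\<lambda>v. h (real (Suc n) *\<^sub>R v)))"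
    by (rule sum_le_suminf) auto
  then show ?thesis using suminf_prim_int[OF assms, of i] by simp
qed

lemma nn_integral_vec_scaleR':
  fixes h :: "real^'n \<Rightarrow> ennreal"
  assumes "h \<in> borel_measurable borel" "c > 0"
  shows "(\<integral>\<^sup>+v. h (c *\<^sub>R v) \<partial>lborel) = ennreal (1 / c ^ CARD('n)) * (\<integral>\<^sup>+v. h v \<partial>lborel)"
  unfolding nn_integral_vec_scaleR[OF assms, symmetric] mult.assoc[symmetric]
  using assms by (simp add: ennreal_mult[symmetric])

text \<open>The defect \<open>D h = prim_int h - |h| / zeta d\<close> satisfies \<open>\<Sum>k\<ge>1. D (h(k \<cdot>)) = 0\<close>;
  as \<open>zeta d - 1 < 1\<close>, isolating the first term contracts any bound \<open>\<bar>D h\<bar> \<le> C |h|\<close>.\<close>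

lemma prim_int_finite:
  fixes \<pi> :: "(real^'n^'n) measure"
  assumes \<pi>: "inv_law \<pi>" and card: "CARD('n) \<ge> 2" and h: "h \<in> borel_measurable borel"
    and fin: "(\<integral>\<^sup>+v. h v \<partial>lborel) < \<infinity>"
  shows "prim_int i \<pi> h = ennreal (1 / zeta CARD('n)) * (\<integral>\<^sup>+v. h v \<partial>lborel)"
proof -
  let ?d = "CARD('n)"
  define \<theta> where "\<theta> = zeta ?d - 1"
  have z: "1 \<le> zeta ?d" "zeta ?d \<le> 7 / 4" using zeta_bounds[OF card] by auto
  define I where "I h = enn2real (\<integral>\<^sup>+v. h v \<partial>lborel)" for h :: "real^'n \<Rightarrow> ennreal"
  define P where "P h = enn2real (prim_int i \<pi> h)" for h
  have ok: "prim_int i \<pi> h < \<infinity>" "(\<integral>\<^sup>+v. h v \<partial>lborel) = ennreal (I h)" "prim_int i \<pi> h = ennreal (P h)" "0 \<le> P h" "P h \<le> I h"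
    if h: "h \<in> borel_measurable borel" and fin: "(\<integral>\<^sup>+v. h v \<partial>lborel) < \<infinity>" for h
  proof -
    show 1: "prim_int i \<pi> h < \<infinity>" using prim_int_le[OF \<pi> card h, of i] fin by (rule order_le_less_trans)
    show "(\<integral>\<^sup>+v. h v \<partial>lborel) = ennreal (I h)" "prim_int i \<pi> h = ennreal (P h)" using fin 1 by (simp_all add: I_def P_def)
    show "0 \<le> P h" by (simp add: P_def)
    show "P h \<le> I h" unfolding P_def I_def by (rule enn2real_mono[OF prim_int_le[OF \<pi> card h]]) (use fin in simp)
  qed
  have main: "\<bar>P h - I h / zeta ?d\<bar> \<le> \<theta> ^ r * I h"
    if "h \<in> borel_measurable borel" "(\<integral>\<^sup>+v. h v \<partial>lborel) < \<infinity>" for h r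
    using that
  proof (induction r arbitrary: h)
    case 0
    \<comment> \<open>Both quantities lie between 0 and I h, which starts the iteration with factor
      \<theta>^0 = 1.\<close>
    have "0 \<le> I h" using ok[OF 0] by linarith
    then have "0 \<le> I h / zeta ?d" "I h / zeta ?d \<le> I h" using z by (auto simp: divide_le_eq mult_le_cancel_left1)
    then show ?case using ok[OF 0] by (auto simp: abs_le_iff)
  next
    case (Suc r)
    note [measurable] = Suc.prems(1)
    let ?h = "\<lambda>n v. h (real (Suc n) *\<^sub>R v)"
    have int: "(\<integral>\<^sup>+v. ?h n v \<partial>lborel) = ennreal (1 / real (Suc n) ^ ?d * I h)" for n
      using nn_integral_vec_scaleR'[OF Suc.prems(1), of "real (Suc n)"] ok(2)[OF Suc.prems]
      by (simp add: ennreal_mult'[symmetric])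
    have hn: "?h n \<in> borel_measurable borel" "(\<integral>\<^sup>+v. ?h n v \<partial>lborel) < \<infinity>" for n
      by (measurable, simp only: int, simp)
    have I0: "0 \<le> I h" using ok[OF Suc.prems] by linarith
    have In: "I (?h n) = 1 / real (Suc n) ^ ?d * I h" for n
      unfolding I_def[of "?h n"] int using I0 by simp
    have "(\<lambda>n. prim_int i \<pi> (?h n)) sums ennreal (I h)"
      using suminf_prim_int[OF \<pi> card Suc.prems(1), of i] ok(2)[OF Suc.prems] by (simp add: sums_iff)
    then have sP: "(\<lambda>n. P (?h n)) sums I h"
      unfolding ok(3)[OF hn] using ok(4)[OF hn] I0 by (simp add: sums_ennreal)
    have sI: "(\<lambda>n. I (?h n) / zeta ?d) sums I h"
    proof -
      have "(\<lambda>n. 1 / real (Suc n) ^ ?d * (I h / zeta ?d)) sums (zeta ?d * (I h / zeta ?d))"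
        by (rule sums_mult2[OF zeta_sums[OF card]])
      then show ?thesis unfolding In using z by simp
    qed
    define D where "D = (\<lambda>n. P (?h n) - I (?h n) / zeta ?d)"
    have "D sums 0" using sums_diff[OF sP sI] unfolding D_def by simp
    \<comment> \<open>Solving for the first term expresses D h through the dilates by 2, 3 and so
      on, whose volumes add up to \<theta> I h.\<close>
    then have sD: "(\<lambda>n. D (Suc n)) sums (- D 0)" by (subst sums_Suc_iff) simp
    have bound: "\<bar>D (Suc n)\<bar> \<le> \<theta> ^ r * (I h * (1 / real (Suc (Suc n)) ^ ?d))" for n
      using Suc.IH[OF hn, of "Suc n"] unfolding D_def In by (simp add: mult_ac)
    have sz: "(\<lambda>n. 1 / real (Suc (Suc n)) ^ ?d) sums \<theta>"
      using zeta_sums[OF card] unfolding \<theta>_def by (subst sums_Suc_iff) simp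
    have sB: "(\<lambda>n. \<theta> ^ r * (I h * (1 / real (Suc (Suc n)) ^ ?d))) sums (\<theta> ^ r * (I h * \<theta>))"
      by (intro sums_mult sz)
    have "\<bar>- D 0\<bar> \<le> \<theta> ^ r * (I h * \<theta>)"
    proof -
      have "\<bar>\<Sum>n. D (Suc n)\<bar> \<le> (\<Sum>n. \<theta> ^ r * (I h * (1 / real (Suc (Suc n)) ^ ?d)))"
        using norm_suminf_le[of "\<lambda>n. D (Suc n)", OF _ sums_summable[OF sB]] bound by simp
      then show ?thesis using sums_unique[OF sD] sums_unique[OF sB] by simp
    qed
    then show ?case by (simp add: D_def mult_ac)
  qed
  have "\<theta> ^ r * I h \<ge> \<bar>P h - I h / zeta ?d\<bar>" for r using main[OF h fin] .
  moreover have "(\<lambda>r. \<theta> ^ r * I h) \<longlonglongrightarrow> 0 * I h"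
    by (intro tendsto_mult tendsto_const LIMSEQ_realpow_zero) (use z in \<open>auto simp: \<theta>_def\<close>)
  ultimately have "\<bar>P h - I h / zeta ?d\<bar> \<le> 0 * I h"
    by (intro LIMSEQ_le_const) auto
  then have "P h = 1 / zeta ?d * I h" by simp
  moreover have "0 \<le> I h" using ok[OF h fin] by linarith
  ultimately show ?thesis using ok(2,3)[OF h fin] z by (simp add: ennreal_mult'[symmetric])
qed

text \<open>Bounded functions of bounded support have finite integral, and monotone convergence does
  the rest.\<close>

theorem prim_mean_value:
  fixes \<pi> :: "(real^'n^'n) measure"
  assumes \<pi>: "inv_law \<pi>" and card: "CARD('n) \<ge> 2" and [measurable]: "h \<in> borel_measurable borel"
  shows "prim_int i \<pi> h = ennreal (1 / zeta CARD('n)) * (\<integral>\<^sup>+v. h v \<partial>lborel)"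
proof -
  note [measurable_cong] = inv_law_D(2)[OF \<pi>]
  define hn where "hn n v = min (of_nat n) (h v) * indicator (cball 0 (real n)) v" for n :: nat and v
  have cb [measurable]: "cball (0::real^'n) r \<in> sets borel" for r by simp
  have [measurable]: "hn n \<in> borel_measurable borel" for n unfolding hn_def by measurable
  have mono: "hn n v \<le> hn m v" if "n \<le> m" for n m v
    using that unfolding hn_def by (intro mult_mono min.mono) (auto simp: indicator_def)
  have sup: "(SUP n. hn n v) = h v" for v
  proof (rule antisym)
    show "(SUP n. hn n v) \<le> h v" by (rule SUP_least) (auto simp: hn_def indicator_def)
    obtain k :: nat where k: "norm v \<le> real k" using real_arch_simple by blast
    have "h v = (SUP n. min (of_nat n) (h v))" by (simp add: SUP_min_of_nat)
    also have "\<dots> \<le> (SUP n. hn n v)"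
    proof (rule SUP_least)
      fix n
      have "min (of_nat n) (h v) \<le> hn (max n k) v" using k by (auto simp: hn_def indicator_def intro: min.coboundedI1)
      also have "\<dots> \<le> (SUP n. hn n v)" by (rule SUP_upper) simp
      finally show "min (of_nat n) (h v) \<le> (SUP n. hn n v)" .
    qed
    finally show "h v \<le> (SUP n. hn n v)" .
  qed
  have fin: "(\<integral>\<^sup>+v. hn n v \<partial>lborel) < \<infinity>" for n
  proof -
    have "(\<integral>\<^sup>+v. hn n v \<partial>lborel) \<le> (\<integral>\<^sup>+v. of_nat n * indicator (cball (0::real^'n) (real n)) v \<partial>lborel)"
      by (rule nn_integral_mono) (auto simp: hn_def indicator_def)
    also have "\<dots> = of_nat n * emeasure lborel (cball (0::real^'n) (real n))" by (simp add: nn_integral_cmult_indicator)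
    also have "\<dots> < \<infinity>" using emeasure_lborel_cball_finite[of "0::real^'n" "real n"] by (simp add: ennreal_mult_less_top of_nat_less_top)
    finally show ?thesis .
  qed
  have "prim_int i \<pi> h = (\<integral>\<^sup>+g. (\<integral>\<^sup>+p. (SUP n. hn n (g *v p)) \<partial>count_space (prim_vecs i)) \<partial>\<pi>)"
    by (simp add: prim_int_def sup)
  also have "\<dots> = (\<integral>\<^sup>+g. (SUP n. \<integral>\<^sup>+p. hn n (g *v p) \<partial>count_space (prim_vecs i)) \<partial>\<pi>)"
    by (intro nn_integral_cong nn_integral_monotone_convergence_SUP) (auto simp: incseq_def le_fun_def mono)
  also have "\<dots> = (SUP n. prim_int i \<pi> (hn n))"
    unfolding prim_int_def
    by (intro nn_integral_monotone_convergence_SUP) (auto simp: incseq_def le_fun_def mono intro!: nn_integral_mono)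
  also have "\<dots> = (SUP n. ennreal (1 / zeta CARD('n)) * (\<integral>\<^sup>+v. hn n v \<partial>lborel))"
    using fin by (simp add: prim_int_finite[OF \<pi> card])
  also have "\<dots> = ennreal (1 / zeta CARD('n)) * (SUP n. \<integral>\<^sup>+v. hn n v \<partial>lborel)"
    by (rule SUP_mult_left_ennreal[symmetric])
  also have "(SUP n. \<integral>\<^sup>+v. hn n v \<partial>lborel) = (\<integral>\<^sup>+v. (SUP n. hn n v) \<partial>lborel)"
    by (intro nn_integral_monotone_convergence_SUP[symmetric]) (auto simp: incseq_def le_fun_def mono)
  finally show ?thesis by (simp add: sup)
qed

section \<open>Pairs of lattice vectors\<close>

text \<open>A unimodular shear taking \<open>axis i (v $ i)\<close> to v that depends only on the
  direction of v, as homogeneity in \<open>prim_stabiliser_invariance\<close> demands. When v_i = 0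
  the division yields 0 and the matrix is the identity.\<close>

definition base :: "'n::finite \<Rightarrow> real^'n \<Rightarrow> real^'n^'n" where
  "base i v = shear_mat (- {i}) i (\<lambda>_. 1) 1 (\<chi> a. v $ a / v $ i)"

lemma base_vec: "base i v *v w = (\<chi> a. if a = i then w $ i else w $ a + v $ a / v $ i * w $ i)"
  by (auto simp: base_def shear_mat_vec vec_eq_iff)

lemma det_base [simp]: "det (base i v) = 1"
  unfolding base_def by (rule det_shear_mat) auto

lemma borel_measurable_base [measurable (raw)]:
  assumes [measurable]: "f \<in> borel_measurable M"
  shows "(\<lambda>x. base i (f x)) \<in> borel_measurable M"
  unfolding base_def by measurable

lemma base_scaleR: "c \<noteq> 0 \<Longrightarrow> base i (c *\<^sub>R v) = base i v"
  by (simp add: base_def)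

lemma base_axis: "v $ i \<noteq> 0 \<Longrightarrow> base i v *v axis i (v $ i) = v"
  by (auto simp: base_vec vec_eq_iff axis_def)

lemma sinv_base_self: "v $ i \<noteq> 0 \<Longrightarrow> sinv (base i v) *v v = axis i (v $ i)"
  by (metis base_axis det_base sinv_cancel(5))

lemma sinv_base_vec: "sinv (base i v) *v w = (\<chi> a. if a = i then w $ i else w $ a - v $ a / v $ i * w $ i)"
proof -
  have "base i v *v (\<chi> a. if a = i then w $ i else w $ a - v $ a / v $ i * w $ i) = w"
    by (auto simp: base_vec vec_eq_iff)
  then show ?thesis by (metis det_base sinv_cancel(5))
qed

text \<open>Transports a matrix fixing \<open>axis i 1\<close> to one fixing v. The identity on the
  null set v_i = 0 makes the field defined, and fixing its base point, everywhere.\<close>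

definition stab_conj :: "'n::finite \<Rightarrow> real^'n^'n \<Rightarrow> real^'n \<Rightarrow> real^'n^'n" where
  "stab_conj i s v = (if v $ i = 0 then mat 1 else base i v ** s ** sinv (base i v))"

lemma borel_measurable_stab_conj [measurable (raw)]:
  assumes [measurable]: "f \<in> borel_measurable M" "s \<in> borel_measurable M"
  shows "(\<lambda>x. stab_conj i (s x) (f x)) \<in> borel_measurable M"
  unfolding stab_conj_def by measurable

lemma stab_conj:
  assumes s: "det s = 1" "s *v axis i 1 = axis i 1"
  shows "det (stab_conj i s v) = 1" "stab_conj i s v *v v = v" "c > 0 \<Longrightarrow> stab_conj i s (c *\<^sub>R v) = stab_conj i s v"
    "v $ i \<noteq> 0 \<Longrightarrow> sinv (base i v) *v (stab_conj i s v *v w) = s *v (sinv (base i v) *v w)"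
proof -
  show "det (stab_conj i s v) = 1" by (simp add: stab_conj_def det_mul s)
  show "stab_conj i s v *v v = v"
  proof (cases "v $ i = 0")
    case False
    have ax: "axis i (v $ i) = v $ i *\<^sub>R axis i 1" by (simp add: vec_eq_iff axis_def)
    then have "s *v axis i (v $ i) = axis i (v $ i)" by (simp add: matrix_vector_mult_scaleR s)
    then show ?thesis using False
      by (simp add: stab_conj_def matrix_vector_mul_assoc[symmetric] sinv_base_self base_axis)
  qed (simp add: stab_conj_def)
  show "c > 0 \<Longrightarrow> stab_conj i s (c *\<^sub>R v) = stab_conj i s v" by (simp add: stab_conj_def base_scaleR)
  show "v $ i \<noteq> 0 \<Longrightarrow> sinv (base i v) *v (stab_conj i s v *v w) = s *v (sinv (base i v) *v w)"
    by (simp add: stab_conj_def matrix_vector_mul_assoc[symmetric] sinv_cancel)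
qed

lemma prim_int_cmult:
  assumes "inv_law \<pi>" "h \<in> borel_measurable borel"
  shows "prim_int i \<pi> (\<lambda>v. c * h v) = c * prim_int i \<pi> h"
proof -
  note [measurable_cong] = inv_law_D(2)[OF assms(1)]
  note [measurable] = assms(2)
  show ?thesis unfolding prim_int_def by (simp add: nn_integral_cmult)
qed

text \<open>In the coordinates of \<open>base i v\<close> the stabiliser of v contains shears with K
  = {i, k} and source coordinate j; this is where a third coordinate is required. They
  equidistribute the second vector while the first stays fixed.\<close>

lemma pair_bound_continuous:
  fixes \<pi> :: "(real^'n^'n) measure" and \<psi> :: "real^'n \<Rightarrow> ennreal" and F :: "real^'n \<Rightarrow> real^'n \<Rightarrow> real"
  assumes \<pi>: "inv_law \<pi>" and card: "CARD('n) \<ge> 3" and ji: "j \<noteq> i"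
    and \<psi>m [measurable]: "\<psi> \<in> borel_measurable borel" and \<psi>fin: "(\<integral>\<^sup>+v. \<psi> v \<partial>lborel) < \<infinity>" and \<psi>0: "\<And>v. v $ i = 0 \<Longrightarrow> \<psi> v = 0"
    and Fm [measurable]: "case_prod F \<in> borel_measurable (borel \<Otimes>\<^sub>M borel)"
    and cont: "\<And>v. continuous_on UNIV (F v)" and nonneg: "\<And>v u. F v u \<ge> 0" and C: "\<And>v. \<exists>C. \<forall>u. F v u \<le> C"
    and supp: "\<And>v. \<exists>R\<ge>0. \<forall>u. F v u \<noteq> 0 \<longrightarrow> \<delta> \<le> \<bar>u $ j\<bar> \<and> (\<forall>a. \<bar>u $ a\<bar> \<le> R)" and \<delta>: "\<delta> > 0"
  shows "(\<integral>\<^sup>+g. (\<integral>\<^sup>+p. \<psi> (g *v p) * (\<integral>\<^sup>+m. ennreal (F (g *v p) (sinv (base i (g *v p)) *v (g *v m))) \<partial>count_space int_lattice)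
      \<partial>count_space (prim_vecs i)) \<partial>\<pi>)
    \<le> ennreal (1 / zeta CARD('n)) * (\<integral>\<^sup>+v. \<psi> v * (\<integral>\<^sup>+u. ennreal (F v u) \<partial>lborel) \<partial>lborel)"
proof -
  have card2: "CARD('n) \<ge> 2" using card by simp
  interpret prob_space \<pi> by (rule inv_law_D[OF \<pi>])
  note [measurable_cong] = inv_law_D(2)[OF \<pi>]
  interpret t: prob_space "tents_law :: (real^'n) measure" by (rule prob_space_tents_law)
  interpret pt: pair_sigma_finite \<pi> "tents_law :: (real^'n) measure" ..
  interpret ps: pair_sigma_finite "tents_law :: (real^'n) measure" \<pi> ..
  obtain k where k: "k \<noteq> i" "k \<noteq> j"
  proof -
    have "UNIV \<noteq> {i, j}"
    proof
      assume "UNIV = {i, j}"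
      then have "CARD('n) = card {i, j}" by (rule arg_cong)
      also have "\<dots> \<le> 2" by (simp add: card_insert_if)
      finally show False using card by simp
    qed
    then show thesis using that by blast
  qed
  define T where "T n = real n + 1" for n :: nat
  \<comment> \<open>Fixing \<open>axis i 1\<close> forces l_i = 1 and keeps i out of the contracted
    coordinates; k alone compensates for the other d - 2.\<close>
  define l where "l n a = (if a = i then 1 else T n ^ (CARD('n) - 2))" for n and a :: 'n
  define s where "s n \<xi> = shear_mat {i, k} j (l n) (T n) \<xi>" for n \<xi>
  have [measurable]: "s n \<in> borel_measurable borel" for n unfolding s_def by measurable
  have T1: "T n \<ge> 1" "T n > 0" for n by (auto simp: T_def)
  have Tlim: "filterlim T at_top sequentially"
    unfolding T_def by (rule filterlim_at_top_mono[OF filterlim_real_sequentially]) auto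
  have l1: "l n a \<ge> 1" for n a unfolding l_def using T1 by (auto intro: one_le_power)
  have cardc: "card (- {i, k}) = CARD('n) - 2"
    using k by (simp add: Compl_eq_Diff_UNIV card_Diff_subset)
  have lp: "(\<Prod>a\<in>{i, k}. l n a) = T n ^ card (- {i, k})" for n
    unfolding cardc using k by (auto simp: l_def)
  have jK: "j \<notin> {i, k}" using ji k by auto
  have dets: "det (s n \<xi>) = 1" for n \<xi>
    unfolding s_def by (rule det_shear_mat[OF jK lp T1(2)])
  have fixs: "s n \<xi> *v axis i 1 = axis i 1" for n \<xi>
    using k ji by (auto simp: s_def shear_mat_vec vec_eq_iff axis_def l_def)
  define N where "N v g = (\<integral>\<^sup>+m. ennreal (F v (sinv (base i v) *v (g *v m))) \<partial>count_space int_lattice)" for v and g :: "real^'n^'n"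
  define S where "S n v g = (\<integral>\<^sup>+\<xi>. N v (stab_conj i (s n \<xi>) v ** g) \<partial>tents_law)" for n v and g :: "real^'n^'n"
  define I where "I v = (\<integral>\<^sup>+u. ennreal (F v u) \<partial>lborel)" for v
  have Nm [measurable]: "(\<lambda>x. N (a x) (b x)) \<in> borel_measurable M"
    if [measurable]: "a \<in> borel_measurable M" "b \<in> borel_measurable M" for a b and M :: "'z measure"
  proof -
    have "(\<lambda>x. F (a x) (sinv (base i (a x)) *v (b x *v m))) \<in> borel_measurable M" for m
      using measurable_compose[of "\<lambda>x. (a x, sinv (base i (a x)) *v (b x *v m))" M "borel \<Otimes>\<^sub>M borel", OF _ Fm] by simp
    then show ?thesis unfolding N_def by measurable
  qed
  have Sm: "(\<lambda>x. S n (a x) (b x)) \<in> borel_measurable M"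
    if [measurable]: "a \<in> borel_measurable M" "b \<in> borel_measurable M" for a b and M :: "'z measure" and n
  proof -
    have "(\<lambda>(x, \<xi>). N (a x) (stab_conj i (s n \<xi>) (a x) ** b x)) \<in> borel_measurable (M \<Otimes>\<^sub>M tents_law)"
      unfolding split_beta' by measurable
    then show ?thesis unfolding S_def by (rule t.borel_measurable_nn_integral)
  qed
  have Im [measurable]: "I \<in> borel_measurable borel"
  proof -
    have "(\<lambda>(v, u). ennreal (F v u)) \<in> borel_measurable (borel \<Otimes>\<^sub>M lborel)"
      using Fm by measurable
    then show ?thesis unfolding I_def by (rule lborel.borel_measurable_nn_integral)
  qed
  have Ninv: "N v (g ** \<gamma>) = N v g" if "\<gamma> \<in> SL_int" for v g \<gamma>
    unfolding N_def by (rule sum_int_lattice_shift[OF that])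
  have S_lim: "(\<lambda>n. S n v g) \<longlonglongrightarrow> I v" if g: "det g = 1" and v: "v $ i \<noteq> 0" for v g
  proof -
    let ?g = "sinv (base i v) ** g"
    obtain C0 where C0: "\<And>u. F v u \<le> C0" using C by blast
    obtain R where R: "R \<ge> 0" "\<And>u. F v u \<noteq> 0 \<Longrightarrow> \<delta> \<le> \<bar>u $ j\<bar> \<and> (\<forall>a. \<bar>u $ a\<bar> \<le> R)" using supp[of v] by blast
    have dg: "det ?g = 1" by (simp add: det_mul g)
    have eq: "S n v g = (\<integral>\<^sup>+\<xi>. ennreal (tents \<xi>) *
      (\<integral>\<^sup>+m. ennreal (F v (shear_mat {i, k} j (l n) (T n) \<xi> *v (?g *v m))) \<partial>count_space int_lattice) \<partial>lborel)" for n
    proof -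
      have "N v (stab_conj i (s n \<xi>) v ** g) = (\<integral>\<^sup>+m. ennreal (F v (s n \<xi> *v (?g *v m))) \<partial>count_space int_lattice)" for \<xi>
        unfolding N_def using stab_conj(4)[OF dets fixs v] by (simp add: matrix_vector_mul_assoc[symmetric])
      moreover have "(\<lambda>\<xi>. N v (stab_conj i (s n \<xi>) v ** g)) \<in> borel_measurable borel" by measurable
      ultimately show ?thesis unfolding S_def by (simp add: nn_integral_tents_law s_def)
    qed
    show ?thesis unfolding eq I_def
      by (rule shear_limit[OF cont nonneg C0 R(2) \<delta> R(1) jK T1(1) Tlim l1 lp dg])
  qed
  have avg: "(\<integral>\<^sup>+g. (\<integral>\<^sup>+p. \<Phi> (g *v p) g \<partial>count_space (prim_vecs i)) \<partial>\<pi>) =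
      (\<integral>\<^sup>+g. (\<integral>\<^sup>+p. (\<integral>\<^sup>+\<xi>. \<Phi> (g *v p) (stab_conj i (s n \<xi>) (g *v p) ** g) \<partial>tents_law) \<partial>count_space (prim_vecs i)) \<partial>\<pi>)"
    if \<Phi>m: "case_prod \<Phi> \<in> borel_measurable (borel \<Otimes>\<^sub>M borel)" and inv: "\<And>v g \<gamma>. \<gamma> \<in> SL_int \<Longrightarrow> \<Phi> v (g ** \<gamma>) = (\<Phi> v g :: ennreal)" for \<Phi> n
  proof -
    have \<Phi>m' [measurable]: "(\<lambda>x. \<Phi> (a x) (b x)) \<in> borel_measurable M"
      if [measurable]: "a \<in> borel_measurable M" "b \<in> borel_measurable M" for a b and M :: "'z measure"
      using measurable_compose[of "\<lambda>x. (a x, b x)" M "borel \<Otimes>\<^sub>M borel", OF _ \<Phi>m] by simp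
    have "(\<integral>\<^sup>+g. (\<integral>\<^sup>+p. (\<integral>\<^sup>+\<xi>. \<Phi> (g *v p) (stab_conj i (s n \<xi>) (g *v p) ** g) \<partial>tents_law) \<partial>count_space (prim_vecs i)) \<partial>\<pi>) =
      (\<integral>\<^sup>+g. (\<integral>\<^sup>+\<xi>. (\<integral>\<^sup>+p. \<Phi> (g *v p) (stab_conj i (s n \<xi>) (g *v p) ** g) \<partial>count_space (prim_vecs i)) \<partial>tents_law) \<partial>\<pi>)"
      by (intro nn_integral_cong nn_integral_count_space_nn_integral[symmetric]) auto
    also have "\<dots> = (\<integral>\<^sup>+\<xi>. (\<integral>\<^sup>+g. (\<integral>\<^sup>+p. \<Phi> (g *v p) (stab_conj i (s n \<xi>) (g *v p) ** g) \<partial>count_space (prim_vecs i)) \<partial>\<pi>) \<partial>tents_law)"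
      by (rule pt.Fubini'[symmetric]) measurable
    also have "\<dots> = (\<integral>\<^sup>+\<xi>. (\<integral>\<^sup>+g. (\<integral>\<^sup>+p. \<Phi> (g *v p) g \<partial>count_space (prim_vecs i)) \<partial>\<pi>) \<partial>(tents_law :: (real^'n) measure))"
    proof (rule nn_integral_cong)
      fix \<xi> :: "real^'n"
      show "(\<integral>\<^sup>+g. (\<integral>\<^sup>+p. \<Phi> (g *v p) (stab_conj i (s n \<xi>) (g *v p) ** g) \<partial>count_space (prim_vecs i)) \<partial>\<pi>) =
        (\<integral>\<^sup>+g. (\<integral>\<^sup>+p. \<Phi> (g *v p) g \<partial>count_space (prim_vecs i)) \<partial>\<pi>)"
        by (rule prim_stabiliser_invariance[OF \<pi> _ \<Phi>m]) (auto simp: stab_conj[OF dets fixs] inv)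
    qed
    finally show ?thesis by (simp add: t.emeasure_space_1)
  qed
  have trunc: "(\<integral>\<^sup>+g. (\<integral>\<^sup>+p. \<psi> (g *v p) * min (of_nat M) (N (g *v p) g) \<partial>count_space (prim_vecs i)) \<partial>\<pi>)
     \<le> ennreal (1 / zeta CARD('n)) * (\<integral>\<^sup>+v. \<psi> v * I v \<partial>lborel)" for M :: nat
  proof -
    have Sm' [measurable]: "(\<lambda>g. S n (g *v p) g) \<in> borel_measurable \<pi>" for n p by (rule Sm) auto
    have le: "(\<integral>\<^sup>+g. (\<integral>\<^sup>+p. \<psi> (g *v p) * min (of_nat M) (N (g *v p) g) \<partial>count_space (prim_vecs i)) \<partial>\<pi>) \<le>
      (\<integral>\<^sup>+g. (\<integral>\<^sup>+p. \<psi> (g *v p) * min (of_nat M) (S n (g *v p) g) \<partial>count_space (prim_vecs i)) \<partial>\<pi>)" for n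
    proof -
      have "(\<integral>\<^sup>+g. (\<integral>\<^sup>+p. \<psi> (g *v p) * min (of_nat M) (N (g *v p) g) \<partial>count_space (prim_vecs i)) \<partial>\<pi>) =
        (\<integral>\<^sup>+g. (\<integral>\<^sup>+p. (\<integral>\<^sup>+\<xi>. \<psi> (g *v p) * min (of_nat M) (N (g *v p) (stab_conj i (s n \<xi>) (g *v p) ** g)) \<partial>tents_law) \<partial>count_space (prim_vecs i)) \<partial>\<pi>)"
        by (rule avg[of "\<lambda>v g. \<psi> v * min (of_nat M) (N v g)"]) (auto simp: Ninv split_beta')
      also have "\<dots> \<le> (\<integral>\<^sup>+g. (\<integral>\<^sup>+p. \<psi> (g *v p) * min (of_nat M) (S n (g *v p) g) \<partial>count_space (prim_vecs i)) \<partial>\<pi>)"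
      proof (intro nn_integral_mono)
        fix g :: "real^'n^'n" and p :: "real^'n"
        have m: "(\<lambda>\<xi>. N (g *v p) (stab_conj i (s n \<xi>) (g *v p) ** g)) \<in> borel_measurable tents_law" by measurable
        then have "(\<integral>\<^sup>+\<xi>. \<psi> (g *v p) * min (of_nat M) (N (g *v p) (stab_conj i (s n \<xi>) (g *v p) ** g)) \<partial>tents_law) =
          \<psi> (g *v p) * (\<integral>\<^sup>+\<xi>. min (of_nat M) (N (g *v p) (stab_conj i (s n \<xi>) (g *v p) ** g)) \<partial>tents_law)"
          by (intro nn_integral_cmult) measurable
        also have "\<dots> \<le> \<psi> (g *v p) * min (of_nat M) (S n (g *v p) g)"
          unfolding S_def by (intro mult_left_mono nn_integral_min_const[OF prob_space_tents_law m]) simp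
        finally show "(\<integral>\<^sup>+\<xi>. \<psi> (g *v p) * min (of_nat M) (N (g *v p) (stab_conj i (s n \<xi>) (g *v p) ** g)) \<partial>tents_law)
          \<le> \<psi> (g *v p) * min (of_nat M) (S n (g *v p) g)" .
      qed
      finally show ?thesis .
    qed
    have w_int: "(\<integral>\<^sup>+g. (\<integral>\<^sup>+p. \<psi> (g *v p) * of_nat M \<partial>count_space (prim_vecs i)) \<partial>\<pi>) < \<infinity>"
    proof -
      have "(\<integral>\<^sup>+g. (\<integral>\<^sup>+p. \<psi> (g *v p) * of_nat M \<partial>count_space (prim_vecs i)) \<partial>\<pi>) = of_nat M * prim_int i \<pi> \<psi>"
        using prim_int_cmult[OF \<pi> \<psi>m, of i "of_nat M"] unfolding prim_int_def by (simp add: mult.commute)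
      also have "\<dots> < \<infinity>"
        using prim_mean_value[OF \<pi> card2 \<psi>m, of i] \<psi>fin by (simp add: ennreal_mult_less_top of_nat_less_top)
      finally show ?thesis .
    qed
    have psifin: "\<psi> (g *v p) \<noteq> \<infinity>" if "(\<integral>\<^sup>+p. \<psi> (g *v p) \<partial>count_space (prim_vecs i)) < \<infinity>" "p \<in> prim_vecs i" for g p
    proof -
      have "\<psi> (g *v p) = (\<integral>\<^sup>+q. \<psi> (g *v p) * indicator {p} q \<partial>count_space (prim_vecs i))"
        using that(2) by (simp add: nn_integral_cmult_indicator)
      also have "\<dots> \<le> (\<integral>\<^sup>+p. \<psi> (g *v p) \<partial>count_space (prim_vecs i))"
        by (intro nn_integral_mono) (auto simp: indicator_def)
      finally show ?thesis using that(1) by auto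
    qed
    \<comment> \<open>Dominated convergence is used twice, for the sum over p at almost every g and
      for the integral over g. Both times \<psi> times M dominates.\<close>
    have sum_fin: "AE g in \<pi>. (\<integral>\<^sup>+p. \<psi> (g *v p) \<partial>count_space (prim_vecs i)) \<noteq> \<infinity>"
    proof (rule nn_integral_PInf_AE)
      show "(\<lambda>g. \<integral>\<^sup>+p. \<psi> (g *v p) \<partial>count_space (prim_vecs i)) \<in> borel_measurable \<pi>" by measurable
      show "(\<integral>\<^sup>+g. (\<integral>\<^sup>+p. \<psi> (g *v p) \<partial>count_space (prim_vecs i)) \<partial>\<pi>) \<noteq> \<infinity>"
        using prim_mean_value[OF \<pi> card2 \<psi>m, of i] \<psi>fin unfolding prim_int_def by (simp add: ennreal_mult_eq_top_iff)
    qed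
    have lim: "(\<lambda>n. \<integral>\<^sup>+g. (\<integral>\<^sup>+p. \<psi> (g *v p) * min (of_nat M) (S n (g *v p) g) \<partial>count_space (prim_vecs i)) \<partial>\<pi>) \<longlonglongrightarrow>
      (\<integral>\<^sup>+g. (\<integral>\<^sup>+p. \<psi> (g *v p) * min (of_nat M) (I (g *v p)) \<partial>count_space (prim_vecs i)) \<partial>\<pi>)"
    proof (rule nn_integral_dominated_convergence[where w="\<lambda>g. \<integral>\<^sup>+p. \<psi> (g *v p) * of_nat M \<partial>count_space (prim_vecs i)"])
      show "AE g in \<pi>. (\<integral>\<^sup>+p. \<psi> (g *v p) * min (of_nat M) (S n (g *v p) g) \<partial>count_space (prim_vecs i)) \<le>
        (\<integral>\<^sup>+p. \<psi> (g *v p) * of_nat M \<partial>count_space (prim_vecs i))" for n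
        by (intro AE_I2 nn_integral_mono mult_left_mono) auto
      show "AE g in \<pi>. (\<lambda>n. \<integral>\<^sup>+p. \<psi> (g *v p) * min (of_nat M) (S n (g *v p) g) \<partial>count_space (prim_vecs i)) \<longlonglongrightarrow>
        (\<integral>\<^sup>+p. \<psi> (g *v p) * min (of_nat M) (I (g *v p)) \<partial>count_space (prim_vecs i))"
        using inv_law_D(3)[OF \<pi>] sum_fin
      proof eventually_elim
        fix g :: "real^'n^'n" assume g: "det g = 1" and fin: "(\<integral>\<^sup>+p. \<psi> (g *v p) \<partial>count_space (prim_vecs i)) \<noteq> \<infinity>"
        show "(\<lambda>n. \<integral>\<^sup>+p. \<psi> (g *v p) * min (of_nat M) (S n (g *v p) g) \<partial>count_space (prim_vecs i)) \<longlonglongrightarrow>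
          (\<integral>\<^sup>+p. \<psi> (g *v p) * min (of_nat M) (I (g *v p)) \<partial>count_space (prim_vecs i))"
        proof (rule nn_integral_dominated_convergence[where w="\<lambda>p. \<psi> (g *v p) * of_nat M"])
          show "AE p in count_space (prim_vecs i). (\<lambda>n. \<psi> (g *v p) * min (of_nat M) (S n (g *v p) g)) \<longlonglongrightarrow>
            \<psi> (g *v p) * min (of_nat M) (I (g *v p))"
          proof (rule AE_I2)
            fix p :: "real^'n" assume p: "p \<in> space (count_space (prim_vecs i))"
            show "(\<lambda>n. \<psi> (g *v p) * min (of_nat M) (S n (g *v p) g)) \<longlonglongrightarrow> \<psi> (g *v p) * min (of_nat M) (I (g *v p))"
            proof (cases "(g *v p) $ i = 0")
              case True
              then show ?thesis by (simp add: \<psi>0)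
            next
              case False
              have "\<psi> (g *v p) \<noteq> top" using psifin[of g p] fin p by (auto simp: less_top)
              then show ?thesis
                by (intro ennreal_tendsto_cmult tendsto_min tendsto_const S_lim[OF g False]) (simp add: less_top)
            qed
          qed
          show "(\<integral>\<^sup>+p. \<psi> (g *v p) * of_nat M \<partial>count_space (prim_vecs i)) < \<infinity>"
            using fin by (simp add: nn_integral_multc ennreal_mult_less_top of_nat_less_top less_top)
        qed (auto intro!: mult_left_mono)
      qed
    qed (use w_int in measurable)
    have "(\<integral>\<^sup>+g. (\<integral>\<^sup>+p. \<psi> (g *v p) * min (of_nat M) (N (g *v p) g) \<partial>count_space (prim_vecs i)) \<partial>\<pi>) \<le>
      (\<integral>\<^sup>+g. (\<integral>\<^sup>+p. \<psi> (g *v p) * min (of_nat M) (I (g *v p)) \<partial>count_space (prim_vecs i)) \<partial>\<pi>)"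
      using lim by (rule LIMSEQ_le_const) (use le in blast)
    also have "\<dots> \<le> prim_int i \<pi> (\<lambda>v. \<psi> v * I v)"
      unfolding prim_int_def by (intro nn_integral_mono mult_left_mono) auto
    also have "\<dots> = ennreal (1 / zeta CARD('n)) * (\<integral>\<^sup>+v. \<psi> v * I v \<partial>lborel)"
      by (rule prim_mean_value[OF \<pi> card2]) measurable
    finally show ?thesis .
  qed
  have inc: "incseq (\<lambda>M g. \<integral>\<^sup>+p. \<psi> (g *v p) * min (of_nat M) (N (g *v p) g) \<partial>count_space (prim_vecs i))"
    by (intro incseq_SucI le_funI nn_integral_mono mult_left_mono min.mono) auto
  have inc': "incseq (\<lambda>M p. \<psi> (g *v p) * min (of_nat M) (N (g *v p) g))" for g
    by (intro incseq_SucI le_funI mult_left_mono min.mono) auto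
  have "(\<integral>\<^sup>+g. (\<integral>\<^sup>+p. \<psi> (g *v p) * N (g *v p) g \<partial>count_space (prim_vecs i)) \<partial>\<pi>) =
    (\<integral>\<^sup>+g. (\<integral>\<^sup>+p. (SUP M. \<psi> (g *v p) * min (of_nat M) (N (g *v p) g)) \<partial>count_space (prim_vecs i)) \<partial>\<pi>)"
    by (simp add: SUP_mult_left_ennreal[symmetric] SUP_min_of_nat)
  also have "\<dots> = (\<integral>\<^sup>+g. (SUP M. \<integral>\<^sup>+p. \<psi> (g *v p) * min (of_nat M) (N (g *v p) g) \<partial>count_space (prim_vecs i)) \<partial>\<pi>)"
    by (intro nn_integral_cong nn_integral_monotone_convergence_SUP inc') auto
  also have "\<dots> = (SUP M. \<integral>\<^sup>+g. (\<integral>\<^sup>+p. \<psi> (g *v p) * min (of_nat M) (N (g *v p) g) \<partial>count_space (prim_vecs i)) \<partial>\<pi>)"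
    by (intro nn_integral_monotone_convergence_SUP inc) measurable
  also have "\<dots> \<le> ennreal (1 / zeta CARD('n)) * (\<integral>\<^sup>+v. \<psi> v * I v \<partial>lborel)"
    by (intro SUP_least trunc)
  finally show ?thesis unfolding N_def I_def .
qed

section \<open>Pairs of a primitive vector and a lattice vector\<close>

definition pair_int :: "'n::finite \<Rightarrow> (real^'n^'n) measure \<Rightarrow> (real^'n \<Rightarrow> ennreal) \<Rightarrow> (real^'n \<Rightarrow> real^'n \<Rightarrow> ennreal) \<Rightarrow> ennreal" where
  "pair_int i \<pi> \<psi> \<Phi> = (\<integral>\<^sup>+g. (\<integral>\<^sup>+p. \<psi> (g *v p) * (\<integral>\<^sup>+m. \<Phi> (g *v p) (g *v m) \<partial>count_space int_lattice)
      \<partial>count_space (prim_vecs i)) \<partial>\<pi>)"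

lemma pair_int_mono: "(\<And>v w. \<Phi> v w \<le> \<Phi>' v w) \<Longrightarrow> pair_int i \<pi> \<psi> \<Phi> \<le> pair_int i \<pi> \<psi> \<Phi>'"
  unfolding pair_int_def by (intro nn_integral_mono mult_left_mono) auto

lemma measurable_split_compose:
  assumes "case_prod \<Phi> \<in> borel_measurable (borel \<Otimes>\<^sub>M borel)" "a \<in> borel_measurable M" "b \<in> borel_measurable M"
  shows "(\<lambda>x. \<Phi> (a x) (b x)) \<in> borel_measurable M"
  using measurable_compose[OF measurable_Pair[OF assms(2,3)] assms(1)] by simp

lemma pair_int_SUP:
  fixes \<Phi> :: "nat \<Rightarrow> real^'n \<Rightarrow> real^'n \<Rightarrow> ennreal"
  assumes \<pi>: "inv_law \<pi>" and [measurable]: "\<psi> \<in> borel_measurable borel"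
    and \<Phi>: "\<And>k. case_prod (\<Phi> k) \<in> borel_measurable (borel \<Otimes>\<^sub>M borel)" and inc: "\<And>k v w. \<Phi> k v w \<le> \<Phi> (Suc k) v w"
  shows "pair_int i \<pi> \<psi> (\<lambda>v w. SUP k. \<Phi> k v w) = (SUP k. pair_int i \<pi> \<psi> (\<Phi> k))"
proof -
  note [measurable_cong] = inv_law_D(2)[OF \<pi>]
  note [measurable] = measurable_split_compose[OF \<Phi>]
  have "pair_int i \<pi> \<psi> (\<lambda>v w. SUP k. \<Phi> k v w) =
    (\<integral>\<^sup>+g. (\<integral>\<^sup>+p. (SUP k. \<psi> (g *v p) * (\<integral>\<^sup>+m. \<Phi> k (g *v p) (g *v m) \<partial>count_space int_lattice)) \<partial>count_space (prim_vecs i)) \<partial>\<pi>)"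
    unfolding pair_int_def SUP_mult_left_ennreal[symmetric]
    by (intro nn_integral_cong arg_cong2[of _ _ _ _ "(*)"] refl nn_integral_monotone_convergence_SUP incseq_SucI le_funI inc) auto
  also have "\<dots> = (\<integral>\<^sup>+g. (SUP k. \<integral>\<^sup>+p. \<psi> (g *v p) * (\<integral>\<^sup>+m. \<Phi> k (g *v p) (g *v m) \<partial>count_space int_lattice) \<partial>count_space (prim_vecs i)) \<partial>\<pi>)"
    by (intro nn_integral_cong nn_integral_monotone_convergence_SUP incseq_SucI le_funI mult_left_mono nn_integral_mono inc) auto
  also have "\<dots> = (SUP k. pair_int i \<pi> \<psi> (\<Phi> k))"
    unfolding pair_int_def
    by (intro nn_integral_monotone_convergence_SUP incseq_SucI le_funI mult_left_mono nn_integral_mono inc) auto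
  finally show ?thesis .
qed

text \<open>For v_i nonzero and j different from i this is w_j - (v_j / v_i) w_i, a 2 by 2 minor of
  (v, w) divided by v_i.\<close>

definition fibre_coord :: "'n::finite \<Rightarrow> 'n \<Rightarrow> real^'n \<Rightarrow> real^'n \<Rightarrow> real" where
  "fibre_coord i j v w = (sinv (base i v) *v w) $ j"

lemma fibre_coord_measurable [measurable (raw)]:
  assumes [measurable]: "a \<in> borel_measurable M" "b \<in> borel_measurable M"
  shows "(\<lambda>x. fibre_coord i j (a x) (b x)) \<in> borel_measurable M"
  unfolding fibre_coord_def by measurable

text \<open>Continuous and increasing in k to the indicator of t being nonzero, with each member
  vanishing near 0, so that the hypothesis on \<delta> holds for every k.\<close>

definition cutoff :: "nat \<Rightarrow> real \<Rightarrow> real" where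
  "cutoff k t = max 0 (min 1 (real k * \<bar>t\<bar> - 1))"

lemma cutoff_bounds [simp]: "0 \<le> cutoff k t" "cutoff k t \<le> 1"
  by (auto simp: cutoff_def)

lemma cutoff_mono: "cutoff k t \<le> cutoff (Suc k) t"
  unfolding cutoff_def by (intro max.mono min.mono diff_mono mult_right_mono) auto

lemma continuous_cutoff: "continuous_on A (cutoff k)"
  unfolding cutoff_def by (intro continuous_intros)

lemma borel_measurable_cutoff [measurable]: "cutoff k \<in> borel_measurable borel"
  by (rule borel_measurable_continuous_onI[OF continuous_cutoff])

lemma cutoff_nonzero:
  assumes "cutoff k t \<noteq> 0" shows "1 / (real k + 1) \<le> \<bar>t\<bar>"
proof -
  have "real k * \<bar>t\<bar> > 1" using assms by (auto simp: cutoff_def max_def min_def split: if_splits)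
  then have "1 < (real k + 1) * \<bar>t\<bar>" by (simp add: algebra_simps)
  then show ?thesis by (simp add: divide_le_eq mult.commute)
qed

lemma cutoff_eventually_1:
  assumes "t \<noteq> 0" shows "\<exists>k0. \<forall>k\<ge>k0. cutoff k t = 1"
proof -
  obtain k0 :: nat where k0: "2 < real k0 * \<bar>t\<bar>" using reals_Archimedean3[of "\<bar>t\<bar>"] assms by auto
  have "cutoff k t = 1" if "k \<ge> k0" for k
  proof -
    have "real k0 * \<bar>t\<bar> \<le> real k * \<bar>t\<bar>" using that by (intro mult_right_mono) auto
    then show ?thesis using k0 by (simp add: cutoff_def)
  qed
  then show ?thesis by blast
qed

lemma matrix_norm_le_imp_coord:
  fixes A :: "real^'n^'n"
  shows "\<exists>R\<ge>0. \<forall>u. norm (A *v u) \<le> r \<longrightarrow> det A = 1 \<longrightarrow> (\<forall>a. \<bar>u $ a\<bar> \<le> R)"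
proof -
  obtain B where B: "B > 0" "\<And>x. norm (sinv A *v x) \<le> B * norm x" using matrix_vector_bound[of "sinv A"] by blast
  have "\<bar>u $ a\<bar> \<le> B * \<bar>r\<bar>" if "norm (A *v u) \<le> r" "det A = 1" for u a
  proof -
    have "\<bar>u $ a\<bar> \<le> norm u" by (rule component_le_norm_cart)
    also have "\<dots> \<le> B * norm (A *v u)" using B(2)[of "A *v u"] that by (simp add: sinv_cancel)
    also have "\<dots> \<le> B * \<bar>r\<bar>" using that B(1) by (intro mult_left_mono) auto
    finally show ?thesis .
  qed
  then show ?thesis using B(1) by (intro exI[of _ "B * \<bar>r\<bar>"]) auto
qed

lemma continuous_matrix_vector: "continuous_on A (\<lambda>x. (M :: real^'n^'n) *v x)"
  by (rule linear_continuous_on[OF matrix_vector_mul_bounded_linear])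

text \<open>The roles of the factors: h localises the second vector, \<open>cutoff\<close> keeps it
  off a hyperplane, and q can squeeze it onto another hyperplane.\<close>

lemma pair_bound_product:
  fixes \<pi> :: "(real^'n^'n) measure" and \<psi> :: "real^'n \<Rightarrow> ennreal" and h :: "real^'n \<Rightarrow> real" and q :: "real^'n \<Rightarrow> real"
  assumes \<pi>: "inv_law \<pi>" and card: "CARD('n) \<ge> 3" and ji: "j \<noteq> i"
    and \<psi>: "\<psi> \<in> borel_measurable borel" "(\<integral>\<^sup>+v. \<psi> v \<partial>lborel) < \<infinity>" "\<And>v. v $ i = 0 \<Longrightarrow> \<psi> v = 0"
    and h: "continuous_on UNIV h" "\<And>w. 0 \<le> h w" "\<And>w. h w \<le> 1" "\<And>w. h w \<noteq> 0 \<Longrightarrow> norm w \<le> r"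
    and q: "continuous_on UNIV q" "\<And>w. 0 \<le> q w" "\<And>w. q w \<le> 1"
  shows "pair_int i \<pi> \<psi> (\<lambda>v w. ennreal (h w * cutoff k (fibre_coord i j v w) * q (sinv (base i v) *v w)))
    \<le> ennreal (1 / zeta CARD('n)) * (\<integral>\<^sup>+v. \<psi> v * (\<integral>\<^sup>+u. ennreal (h (base i v *v u) * cutoff k (u $ j) * q u) \<partial>lborel) \<partial>lborel)"
proof -
  define F where "F v u = h (base i v *v u) * cutoff k (u $ j) * q u" for v u
  have hm [measurable]: "h \<in> borel_measurable borel" "q \<in> borel_measurable borel"
    using h(1) q(1) by (auto intro: borel_measurable_continuous_onI)
  have "pair_int i \<pi> \<psi> (\<lambda>v w. ennreal (h w * cutoff k (fibre_coord i j v w) * q (sinv (base i v) *v w))) =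
    pair_int i \<pi> \<psi> (\<lambda>v w. ennreal (F v (sinv (base i v) *v w)))"
    by (simp add: F_def fibre_coord_def sinv_cancel)
  also have "\<dots> \<le> ennreal (1 / zeta CARD('n)) * (\<integral>\<^sup>+v. \<psi> v * (\<integral>\<^sup>+u. ennreal (F v u) \<partial>lborel) \<partial>lborel)"
    unfolding pair_int_def
  proof (rule pair_bound_continuous[OF \<pi> card ji \<psi>])
    show "case_prod F \<in> borel_measurable (borel \<Otimes>\<^sub>M borel)" unfolding F_def split_beta' by measurable
    show "continuous_on UNIV (F v)" for v
      unfolding F_def
      by (intro continuous_on_mult q(1) continuous_on_compose2[OF h(1) continuous_matrix_vector]
          continuous_on_compose2[OF continuous_cutoff[of UNIV]] continuous_intros) auto
    show "0 \<le> F v u" for v u by (simp add: F_def h q)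
    show "\<exists>C. \<forall>u. F v u \<le> C" for v
      by (intro exI[of _ 1] allI) (auto simp: F_def h q intro!: mult_le_one mult_nonneg_nonneg)
    show "\<exists>R\<ge>0. \<forall>u. F v u \<noteq> 0 \<longrightarrow> 1 / (real k + 1) \<le> \<bar>u $ j\<bar> \<and> (\<forall>a. \<bar>u $ a\<bar> \<le> R)" for v
    proof -
      obtain R where R: "R \<ge> 0" "\<And>u. norm (base i v *v u) \<le> r \<Longrightarrow> (\<forall>a. \<bar>u $ a\<bar> \<le> R)"
        using matrix_norm_le_imp_coord[of "base i v" r] by auto
      have "1 / (real k + 1) \<le> \<bar>u $ j\<bar> \<and> (\<forall>a. \<bar>u $ a\<bar> \<le> R)" if "F v u \<noteq> 0" for u
        using that R(2)[OF h(4)] cutoff_nonzero[of k "u $ j"] by (auto simp: F_def)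
      then show ?thesis using R(1) by blast
    qed
    show "0 < 1 / (real k + 1)" by (simp add: add_nonneg_pos)
  qed
  finally show ?thesis unfolding F_def .
qed

text \<open>Continuous functions increase to the indicator, and the determinant one matrix
  \<open>base i v\<close> leaves the volume of U unchanged.\<close>

lemma pair_bound_open:
  fixes \<pi> :: "(real^'n^'n) measure" and \<psi> :: "real^'n \<Rightarrow> ennreal"
  assumes \<pi>: "inv_law \<pi>" and card: "CARD('n) \<ge> 3" and ji: "j \<noteq> i"
    and \<psi>: "\<psi> \<in> borel_measurable borel" "(\<integral>\<^sup>+v. \<psi> v \<partial>lborel) < \<infinity>" "\<And>v. v $ i = 0 \<Longrightarrow> \<psi> v = 0"
    and U: "open U" "U \<subseteq> cball 0 r"
  shows "pair_int i \<pi> \<psi> (\<lambda>v w. indicator U w * indicator {t. t \<noteq> 0} (fibre_coord i j v w))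
    \<le> ennreal (1 / zeta CARD('n)) * ((\<integral>\<^sup>+v. \<psi> v \<partial>lborel) * emeasure lborel U)"
proof -
  note [measurable] = \<psi>(1)
  have Um [measurable]: "U \<in> sets borel" using U by simp
  define h where "h k w = min 1 (real k * infdist w (- U))" for k w
  have hc: "continuous_on UNIV (h k)" for k unfolding h_def by (intro continuous_intros)
  have [measurable]: "h k \<in> borel_measurable borel" for k by (rule borel_measurable_continuous_onI[OF hc])
  have h01: "0 \<le> h k w" "h k w \<le> 1" for k w by (auto simp: h_def infdist_nonneg)
  have hU: "w \<in> U" if "h k w \<noteq> 0" for k w
    using that infdist_zero[of w "- U"] by (cases "w \<in> U") (auto simp: h_def)
  have hr: "norm w \<le> r" if "h k w \<noteq> 0" for k w using hU[OF that] U(2) by auto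
  have hmono: "h k w \<le> h (Suc k) w" for k w
    unfolding h_def by (intro min.mono mult_right_mono) (auto simp: infdist_nonneg)
  have nU: "U \<noteq> UNIV" using U(2) bounded_subset[OF bounded_cball, of U 0 r] not_bounded_UNIV by blast
  have ev: "\<exists>k0. \<forall>k\<ge>k0. h k w = 1" if w: "w \<in> U" for w
  proof -
    have ne: "- U \<noteq> {}" "closed (- U)" using nU U(1) by auto
    have "infdist w (- U) \<noteq> 0" using in_closed_iff_infdist_zero[OF ne(2,1), of w] w by simp
    then have "infdist w (- U) > 0" using infdist_nonneg[of w "- U"] by simp
    then obtain k0 :: nat where k0: "1 < real k0 * infdist w (- U)" using reals_Archimedean3 by blast
    have "h k w = 1" if "k \<ge> k0" for k
    proof -
      have "real k0 * infdist w (- U) \<le> real k * infdist w (- U)" using that by (intro mult_right_mono) (auto simp: infdist_nonneg)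
      then show ?thesis using k0 by (simp add: h_def)
    qed
    then show ?thesis by blast
  qed
  define \<Phi> where "\<Phi> k v w = ennreal (h k w * cutoff k (fibre_coord i j v w) * 1)" for k v w
  have "indicator U w * indicator {t. t \<noteq> 0} (fibre_coord i j v w) \<le> (SUP k. \<Phi> k v w)" for v w
  proof (cases "w \<in> U \<and> fibre_coord i j v w \<noteq> 0")
    case True
    then obtain a b where "\<forall>k\<ge>a. h k w = 1" "\<forall>k\<ge>b. cutoff k (fibre_coord i j v w) = 1"
      using ev cutoff_eventually_1 by meson
    then have "\<Phi> (max a b) v w = 1" by (simp add: \<Phi>_def)
    moreover have "\<Phi> (max a b) v w \<le> (SUP k. \<Phi> k v w)" by (rule SUP_upper) simp
    ultimately show ?thesis using True by simp
  qed (auto simp: indicator_def)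
  then have "pair_int i \<pi> \<psi> (\<lambda>v w. indicator U w * indicator {t. t \<noteq> 0} (fibre_coord i j v w)) \<le> pair_int i \<pi> \<psi> (\<lambda>v w. SUP k. \<Phi> k v w)"
    by (rule pair_int_mono)
  also have "\<dots> = (SUP k. pair_int i \<pi> \<psi> (\<Phi> k))"
  proof (rule pair_int_SUP[OF \<pi> \<psi>(1)])
    show "case_prod (\<Phi> k) \<in> borel_measurable (borel \<Otimes>\<^sub>M borel)" for k unfolding \<Phi>_def split_beta' by measurable
    show "\<Phi> k v w \<le> \<Phi> (Suc k) v w" for k v w
      unfolding \<Phi>_def by (intro ennreal_leI mult_mono hmono cutoff_mono) (auto simp: h01)
  qed
  also have "\<dots> \<le> ennreal (1 / zeta CARD('n)) * ((\<integral>\<^sup>+v. \<psi> v \<partial>lborel) * emeasure lborel U)"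
  proof (rule SUP_least)
    fix k
    have "pair_int i \<pi> \<psi> (\<Phi> k) \<le> ennreal (1 / zeta CARD('n)) *
      (\<integral>\<^sup>+v. \<psi> v * (\<integral>\<^sup>+u. ennreal (h k (base i v *v u) * cutoff k (u $ j) * 1) \<partial>lborel) \<partial>lborel)"
      unfolding \<Phi>_def
      by (rule pair_bound_product[OF \<pi> card ji \<psi> hc h01 hr, where q="\<lambda>_. 1"]) auto
    also have "\<dots> \<le> ennreal (1 / zeta CARD('n)) * (\<integral>\<^sup>+v. \<psi> v * emeasure lborel U \<partial>lborel)"
    proof (intro mult_left_mono nn_integral_mono)
      fix v
      have "(\<integral>\<^sup>+u. ennreal (h k (base i v *v u) * cutoff k (u $ j) * 1) \<partial>lborel) \<le> (\<integral>\<^sup>+u. indicator U (base i v *v u) \<partial>lborel)"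
      proof (rule nn_integral_mono)
        fix u
        show "ennreal (h k (base i v *v u) * cutoff k (u $ j) * 1) \<le> indicator U (base i v *v u)"
          using hU[of k "base i v *v u"] mult_le_one[OF h01(2) cutoff_bounds(1) cutoff_bounds(2), of k "base i v *v u" k "u $ j"]
          by (cases "h k (base i v *v u) = 0") (auto simp: indicator_def ennreal_le_1)
      qed
      also have "\<dots> = (\<integral>\<^sup>+u. indicator U u \<partial>lborel)" by (rule nn_integral_matrix_vector_mult) auto
      also have "\<dots> = emeasure lborel U" by simp
      finally show "(\<integral>\<^sup>+u. ennreal (h k (base i v *v u) * cutoff k (u $ j) * 1) \<partial>lborel) \<le> emeasure lborel U" .
    qed auto
    finally show "pair_int i \<pi> \<psi> (\<Phi> k) \<le> ennreal (1 / zeta CARD('n)) * ((\<integral>\<^sup>+v. \<psi> v \<partial>lborel) * emeasure lborel U)"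
      by (simp add: nn_integral_multc)
  qed
  finally show ?thesis .
qed

text \<open>\<open>pair_bound_open\<close> misses independent pairs whose coordinate j1 vanishes.
  For these another coordinate j is nonzero, so the bound with cutoff in j applies to slabs around
  the hyperplane of j1, whose volume shrinks to 0.\<close>

lemma pair_exceptional_null:
  fixes \<pi> :: "(real^'n^'n) measure" and \<psi> :: "real^'n \<Rightarrow> ennreal"
  assumes \<pi>: "inv_law \<pi>" and card: "CARD('n) \<ge> 3" and ji: "j \<noteq> i" and r: "r \<ge> 0"
    and \<psi>: "\<psi> \<in> borel_measurable borel" "(\<integral>\<^sup>+v. \<psi> v \<partial>lborel) < \<infinity>" "\<And>v. v $ i = 0 \<Longrightarrow> \<psi> v = 0"
  shows "pair_int i \<pi> \<psi> (\<lambda>v w. indicator (cball 0 r) w * indicator {0} (fibre_coord i j1 v w) * indicator {t. t \<noteq> 0} (fibre_coord i j v w)) = 0"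
proof -
  note [measurable] = \<psi>(1)
  have cbm [measurable]: "cball (0::real^'n) r \<in> sets borel" for r by simp
  define h where "h w = max 0 (min 1 (r + 1 - norm w))" for w :: "real^'n"
  have hc: "continuous_on UNIV h" unfolding h_def by (intro continuous_intros)
  have [measurable]: "h \<in> borel_measurable borel" by (rule borel_measurable_continuous_onI[OF hc])
  have h01: "0 \<le> h w" "h w \<le> 1" for w by (auto simp: h_def)
  have hr: "norm w \<le> r + 1" if "h w \<noteq> 0" for w using that by (auto simp: h_def max_def min_def split: if_splits)
  \<comment> \<open>Equal to 1 on the hyperplane and supported in a slab of width of order 1 /
    n.\<close>
  define q where "q n u = max 0 (1 - real n * \<bar>u $ j1\<bar>)" for n and u :: "real^'n"
  have qc: "continuous_on UNIV (q n)" for n unfolding q_def by (intro continuous_intros)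
  have [measurable]: "q n \<in> borel_measurable borel" for n by (rule borel_measurable_continuous_onI[OF qc])
  have q01: "0 \<le> q n u" "q n u \<le> 1" for n u by (auto simp: q_def)
  let ?B = "cball (0::real^'n) (r + 1)"
  have vol: "(\<integral>\<^sup>+u. indicator ?B (base i v *v u) \<partial>lborel) = emeasure lborel ?B" for v :: "real^'n"
  proof -
    have "(\<integral>\<^sup>+u. indicator ?B (base i v *v u) \<partial>lborel) = (\<integral>\<^sup>+u. indicator ?B u \<partial>lborel)" by (rule nn_integral_matrix_vector_mult) auto
    then show ?thesis by simp
  qed
  have volfin: "emeasure lborel ?B < \<infinity>" by (rule emeasure_lborel_cball_finite)
  define \<Phi> where "\<Phi> k v w = indicator (cball 0 r) w * indicator {0} (fibre_coord i j1 v w) * ennreal (cutoff k (fibre_coord i j v w))" for k v w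
  have zero: "pair_int i \<pi> \<psi> (\<Phi> k) = 0" for k
  proof -
    define G where "G n v = (\<integral>\<^sup>+u. ennreal (h (base i v *v u) * cutoff k (u $ j) * q n u) \<partial>lborel)" for n v
    have Gm [measurable]: "G n \<in> borel_measurable borel" for n
    proof -
      have "(\<lambda>(v, u). ennreal (h (base i v *v u) * cutoff k (u $ j) * q n u)) \<in> borel_measurable (borel \<Otimes>\<^sub>M (lborel :: (real^'n) measure))"
        unfolding split_beta' by measurable
      then show ?thesis unfolding G_def by (rule lborel.borel_measurable_nn_integral)
    qed
    have dom: "ennreal (h (base i v *v u) * cutoff k (u $ j) * q n u) \<le> indicator ?B (base i v *v u)" for n v u
      using hr[of "base i v *v u"]
      by (cases "h (base i v *v u) = 0") (auto simp: indicator_def ennreal_le_1 intro!: mult_le_one h01 q01 mult_nonneg_nonneg)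
    have Gle: "G n v \<le> emeasure lborel ?B" for n v
      unfolding G_def vol[of v, symmetric] by (intro nn_integral_mono dom)
    have Glim: "(\<lambda>n. G n v) \<longlonglongrightarrow> 0" for v
    proof -
      have "(\<lambda>n. G n v) \<longlonglongrightarrow> (\<integral>\<^sup>+u. 0 \<partial>(lborel :: (real^'n) measure))"
        unfolding G_def
      proof (rule nn_integral_dominated_convergence[where w="\<lambda>u. indicator ?B (base i v *v u)"])
        show "(\<integral>\<^sup>+u. indicator ?B (base i v *v u) \<partial>lborel) < \<infinity>" unfolding vol by (rule volfin)
        show "AE u in lborel. (\<lambda>n. ennreal (h (base i v *v u) * cutoff k (u $ j) * q n u)) \<longlonglongrightarrow> 0"
          using AE_lborel_component_nonzero[of j1]
        proof eventually_elim
          fix u :: "real^'n" assume u: "u $ j1 \<noteq> 0"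
          obtain n0 :: nat where n0: "1 < real n0 * \<bar>u $ j1\<bar>" using reals_Archimedean3[of "\<bar>u $ j1\<bar>"] u by auto
          have "q n u = 0" if "n \<ge> n0" for n
          proof -
            have "real n0 * \<bar>u $ j1\<bar> \<le> real n * \<bar>u $ j1\<bar>" using that by (intro mult_right_mono) auto
            then show ?thesis using n0 by (simp add: q_def)
          qed
          then have "\<forall>\<^sub>F n in sequentially. ennreal (h (base i v *v u) * cutoff k (u $ j) * q n u) = 0"
            by (intro eventually_sequentiallyI[of n0]) simp
          then show "(\<lambda>n. ennreal (h (base i v *v u) * cutoff k (u $ j) * q n u)) \<longlonglongrightarrow> 0"
            by (rule tendsto_eventually)
        qed
      qed (use dom in auto)
      then show ?thesis by simp
    qed
    have "(\<lambda>n. \<integral>\<^sup>+v. \<psi> v * G n v \<partial>lborel) \<longlonglongrightarrow> (\<integral>\<^sup>+v. 0 \<partial>(lborel :: (real^'n) measure))"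
    proof (rule nn_integral_dominated_convergence[where w="\<lambda>v. \<psi> v * emeasure lborel ?B"])
      show "(\<integral>\<^sup>+v. \<psi> v * emeasure lborel ?B \<partial>lborel) < \<infinity>"
        using \<psi>(2) volfin by (simp add: nn_integral_multc ennreal_mult_less_top)
      have "AE v in lborel. \<psi> v \<noteq> \<infinity>" by (rule nn_integral_PInf_AE) (use \<psi> in auto)
      then show "AE v in lborel. (\<lambda>n. \<psi> v * G n v) \<longlonglongrightarrow> 0"
      proof eventually_elim
        fix v assume "\<psi> v \<noteq> \<infinity>"
        then have "(\<lambda>n. \<psi> v * G n v) \<longlonglongrightarrow> \<psi> v * 0" by (intro ennreal_tendsto_cmult Glim) (simp add: less_top)
        then show "(\<lambda>n. \<psi> v * G n v) \<longlonglongrightarrow> 0" by simp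
      qed
    qed (auto intro!: mult_left_mono Gle)
    then have "(\<lambda>n. ennreal (1 / zeta CARD('n)) * (\<integral>\<^sup>+v. \<psi> v * G n v \<partial>lborel)) \<longlonglongrightarrow> ennreal (1 / zeta CARD('n)) * 0"
      by (intro ennreal_tendsto_cmult) auto
    moreover have "pair_int i \<pi> \<psi> (\<Phi> k) \<le> ennreal (1 / zeta CARD('n)) * (\<integral>\<^sup>+v. \<psi> v * G n v \<partial>lborel)" for n
    proof -
      have "pair_int i \<pi> \<psi> (\<Phi> k) \<le> pair_int i \<pi> \<psi> (\<lambda>v w. ennreal (h w * cutoff k (fibre_coord i j v w) * q n (sinv (base i v) *v w)))"
      proof (rule pair_int_mono)
        fix v w :: "real^'n"
        show "\<Phi> k v w \<le> ennreal (h w * cutoff k (fibre_coord i j v w) * q n (sinv (base i v) *v w))"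
          by (auto simp: \<Phi>_def indicator_def h_def q_def fibre_coord_def)
      qed
      also have "\<dots> \<le> ennreal (1 / zeta CARD('n)) * (\<integral>\<^sup>+v. \<psi> v * G n v \<partial>lborel)"
        unfolding G_def by (rule pair_bound_product[OF \<pi> card ji \<psi> hc h01 hr qc q01])
      finally show ?thesis .
    qed
    ultimately have "pair_int i \<pi> \<psi> (\<Phi> k) \<le> ennreal (1 / zeta CARD('n)) * 0"
      by (intro LIMSEQ_le_const) auto
    then show ?thesis by simp
  qed
  have "pair_int i \<pi> \<psi> (\<lambda>v w. indicator (cball 0 r) w * indicator {0} (fibre_coord i j1 v w) * indicator {t. t \<noteq> 0} (fibre_coord i j v w)) \<le>
    pair_int i \<pi> \<psi> (\<lambda>v w. SUP k. \<Phi> k v w)"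
  proof (rule pair_int_mono)
    fix v w :: "real^'n"
    show "indicator (cball 0 r) w * indicator {0} (fibre_coord i j1 v w) * indicator {t. t \<noteq> 0} (fibre_coord i j v w) \<le> (SUP k. \<Phi> k v w)"
    proof (cases "w \<in> cball 0 r \<and> fibre_coord i j1 v w = 0 \<and> fibre_coord i j v w \<noteq> 0")
      case True
      then obtain a where "\<forall>k\<ge>a. cutoff k (fibre_coord i j v w) = 1" using cutoff_eventually_1 by meson
      then have "\<Phi> a v w = 1" using True by (simp add: \<Phi>_def)
      moreover have "\<Phi> a v w \<le> (SUP k. \<Phi> k v w)" by (rule SUP_upper) simp
      ultimately show ?thesis using True by simp
    qed (auto simp: indicator_def)
  qed
  also have "\<dots> = (SUP k. pair_int i \<pi> \<psi> (\<Phi> k))"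
  proof (rule pair_int_SUP[OF \<pi> \<psi>(1)])
    show "case_prod (\<Phi> k) \<in> borel_measurable (borel \<Otimes>\<^sub>M borel)" for k unfolding \<Phi>_def split_beta' by measurable
    show "\<Phi> k v w \<le> \<Phi> (Suc k) v w" for k v w
      unfolding \<Phi>_def by (intro mult_left_mono ennreal_leI cutoff_mono) auto
  qed
  finally show ?thesis by (simp add: zero)
qed

lemma pair_int_sum:
  fixes \<Phi> :: "'a \<Rightarrow> real^'n \<Rightarrow> real^'n \<Rightarrow> ennreal"
  assumes \<pi>: "inv_law \<pi>" and [measurable]: "\<psi> \<in> borel_measurable borel" and fin: "finite A"
    and \<Phi>: "\<And>a. case_prod (\<Phi> a) \<in> borel_measurable (borel \<Otimes>\<^sub>M borel)"
  shows "pair_int i \<pi> \<psi> (\<lambda>v w. \<Sum>a\<in>A. \<Phi> a v w) = (\<Sum>a\<in>A. pair_int i \<pi> \<psi> (\<Phi> a))"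
proof -
  note [measurable_cong] = inv_law_D(2)[OF \<pi>]
  note [measurable] = measurable_split_compose[OF \<Phi>]
  show ?thesis
    unfolding pair_int_def using fin
    by (simp add: nn_integral_sum sum_distrib_left)
qed

lemma dependent_iff_fibre_coord:
  assumes "v $ i \<noteq> 0"
  shows "(\<exists>r. w = r *\<^sub>R v) \<longleftrightarrow> (\<forall>j. j \<noteq> i \<longrightarrow> fibre_coord i j v w = 0)"
proof
  assume "\<exists>r. w = r *\<^sub>R v"
  then show "\<forall>j. j \<noteq> i \<longrightarrow> fibre_coord i j v w = 0"
    using assms by (auto simp: fibre_coord_def sinv_base_vec)
next
  assume *: "\<forall>j. j \<noteq> i \<longrightarrow> fibre_coord i j v w = 0"
  have "w = (w $ i / v $ i) *\<^sub>R v"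
    unfolding vec_eq_iff
  proof
    fix j show "w $ j = ((w $ i / v $ i) *\<^sub>R v) $ j"
      using * assms by (cases "j = i") (auto simp: fibre_coord_def sinv_base_vec field_simps)
  qed
  then show "\<exists>r. w = r *\<^sub>R v" ..
qed

text \<open>Almost every independent pair is detected by the single coordinate j1, so one
  application of the open bound suffices and no factor is lost to the number of coordinates. Outer
  regularity passes from open sets to B.\<close>

lemma pair_bound_independent:
  fixes \<pi> :: "(real^'n^'n) measure" and \<psi> :: "real^'n \<Rightarrow> ennreal"
  assumes \<pi>: "inv_law \<pi>" and card: "CARD('n) \<ge> 3"
    and \<psi>: "\<psi> \<in> borel_measurable borel" "(\<integral>\<^sup>+v. \<psi> v \<partial>lborel) < \<infinity>"
    and B: "B \<in> sets borel" "B \<subseteq> cball 0 r" "r \<ge> 0"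
  shows "pair_int i \<pi> \<psi> (\<lambda>v w. indicator B w * of_bool (\<nexists>t. w = t *\<^sub>R v))
    \<le> ennreal (1 / zeta CARD('n)) * ((\<integral>\<^sup>+v. \<psi> v \<partial>lborel) * emeasure lborel B)"
proof -
  have card2: "CARD('n) \<ge> 2" using card by simp
  note [measurable] = \<psi>(1) B(1)
  have cbm [measurable]: "cball (0::real^'n) r \<in> sets borel" for r by simp
  define \<psi>' where "\<psi>' v = \<psi> v * of_bool (v $ i \<noteq> 0)" for v
  have \<psi>'m [measurable]: "\<psi>' \<in> borel_measurable borel" unfolding \<psi>'_def by measurable
  have \<psi>'le: "(\<integral>\<^sup>+v. \<psi>' v \<partial>lborel) \<le> (\<integral>\<^sup>+v. \<psi> v \<partial>lborel)" unfolding \<psi>'_def by (intro nn_integral_mono) auto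
  then have \<psi>': "\<psi>' \<in> borel_measurable borel" "(\<integral>\<^sup>+v. \<psi>' v \<partial>lborel) < \<infinity>" "\<And>v. v $ i = 0 \<Longrightarrow> \<psi>' v = 0"
    using \<psi>(2) by (auto simp: \<psi>'_def)
  \<comment> \<open>The primitive mean value bound for the null set v_i = 0 shows that almost surely
    no primitive vector of the lattice lies on that hyperplane.\<close>
  have change: "pair_int i \<pi> \<psi> \<Phi> = pair_int i \<pi> \<psi>' \<Phi>" for \<Phi>
  proof -
    have z: "prim_int i \<pi> (\<lambda>v. of_bool (v $ i = 0)) = 0"
    proof -
      have "prim_int i \<pi> (\<lambda>v. of_bool (v $ i = 0)) \<le> (\<integral>\<^sup>+v. of_bool (v $ i = 0) \<partial>(lborel :: (real^'n) measure))"
        by (rule prim_int_le[OF \<pi> card2]) measurable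
      also have "\<dots> = (\<integral>\<^sup>+v. 0 \<partial>(lborel :: (real^'n) measure))"
        using AE_lborel_component_nonzero[of i] by (intro nn_integral_cong_AE, elim eventually_mono) simp
      finally show ?thesis by simp
    qed
    note [measurable_cong] = inv_law_D(2)[OF \<pi>]
    have "AE g in \<pi>. (\<integral>\<^sup>+p. of_bool ((g *v p) $ i = 0) \<partial>count_space (prim_vecs i)) = (0::ennreal)"
      using z unfolding prim_int_def by (subst (asm) nn_integral_0_iff_AE) auto
    then have "AE g in \<pi>. \<forall>p\<in>prim_vecs i. (g *v p) $ i \<noteq> 0"
    proof (rule eventually_mono)
      fix g :: "real^'n^'n" assume "(\<integral>\<^sup>+p. of_bool ((g *v p) $ i = 0) \<partial>count_space (prim_vecs i)) = (0::ennreal)"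
      then show "\<forall>p\<in>prim_vecs i. (g *v p) $ i \<noteq> 0"
        by (subst (asm) nn_integral_0_iff_AE) (auto simp: AE_count_space)
    qed
    then show ?thesis
      unfolding pair_int_def
      by (intro nn_integral_cong_AE, elim eventually_mono) (auto intro!: nn_integral_cong simp: \<psi>'_def)
  qed
  obtain j1 :: 'n where j1: "j1 \<noteq> i"
  proof -
    have "UNIV \<noteq> {i}"
    proof
      assume "UNIV = {i}"
      then have "CARD('n) = card {i}" by (rule arg_cong)
      then show False using card by simp
    qed
    then show thesis using that by blast
  qed
  define X0 where "X0 v w = (indicator B w * indicator {t. t \<noteq> 0} (fibre_coord i j1 v w) :: ennreal)" for v w
  define X where "X j v w = (indicator (cball 0 r) w * indicator {0} (fibre_coord i j1 v w) * indicator {t. t \<noteq> 0} (fibre_coord i j v w) :: ennreal)" for j v w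
  have X0m: "case_prod X0 \<in> borel_measurable (borel \<Otimes>\<^sub>M borel)" unfolding X0_def split_beta' by measurable
  have Xm: "case_prod (X j) \<in> borel_measurable (borel \<Otimes>\<^sub>M borel)" for j unfolding X_def split_beta' by measurable
  have main: "pair_int i \<pi> \<psi>' X0 \<le> ennreal (1 / zeta CARD('n)) * ((\<integral>\<^sup>+v. \<psi>' v \<partial>lborel) * emeasure lborel B)"
  proof -
    have fin: "(\<integral>\<^sup>+v. \<psi>' v \<partial>lborel) * ennreal e < top" for e using \<psi>'(2) by (simp add: ennreal_mult_less_top)
    let ?c = "ennreal (1 / zeta CARD('n))" and ?I = "\<integral>\<^sup>+v. \<psi>' v \<partial>lborel"
    have "pair_int i \<pi> \<psi>' X0 \<le> ?c * (?I * (emeasure lborel B + ennreal (1 / real (Suc n))))" for n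
    proof -
      obtain U where U: "open U" "B \<subseteq> U" "emeasure lborel (U - B) < ennreal (1 / real (Suc n))"
        by (rule outer_regular_lborel[OF B(1), of "1 / real (Suc n)"]) auto
      let ?U = "U \<inter> ball 0 (r + 1)"
      have Um [measurable]: "U \<in> sets borel" using U by simp
      have BU: "B \<subseteq> ?U" using U(2) B(2) by (force simp: subset_iff)
      have "pair_int i \<pi> \<psi>' X0 \<le> pair_int i \<pi> \<psi>' (\<lambda>v w. indicator ?U w * indicator {t. t \<noteq> 0} (fibre_coord i j1 v w))"
        unfolding X0_def using BU by (intro pair_int_mono mult_right_mono) (auto simp: indicator_def)
      also have "\<dots> \<le> ?c * (?I * emeasure lborel ?U)"
        by (rule pair_bound_open[OF \<pi> card j1 \<psi>', where r="r + 1"]) (use U in auto)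
      also have "emeasure lborel ?U \<le> emeasure lborel B + ennreal (1 / real (Suc n))"
      proof -
        have "emeasure lborel ?U \<le> emeasure lborel (B \<union> (U - B))" by (intro emeasure_mono) auto
        also have "\<dots> \<le> emeasure lborel B + emeasure lborel (U - B)" by (intro emeasure_subadditive) auto
        also have "\<dots> \<le> emeasure lborel B + ennreal (1 / real (Suc n))" using U(3) by (intro add_left_mono) simp
        finally show ?thesis .
      qed
      finally show ?thesis by (simp add: mult_left_mono)
    qed
    moreover have "(\<lambda>n. ?c * (?I * (emeasure lborel B + ennreal (1 / real (Suc n))))) \<longlonglongrightarrow> ?c * (?I * (emeasure lborel B + ennreal 0))"
      using \<psi>'(2) by (intro ennreal_tendsto_cmult tendsto_add tendsto_const tendsto_ennrealI LIMSEQ_inverse_real_of_nat[unfolded inverse_eq_divide]) auto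
    ultimately have "pair_int i \<pi> \<psi>' X0 \<le> ?c * (?I * (emeasure lborel B + ennreal 0))"
      by (intro LIMSEQ_le_const) auto
    then show ?thesis by simp
  qed
  have "pair_int i \<pi> \<psi>' (\<lambda>v w. indicator B w * of_bool (\<nexists>t. w = t *\<^sub>R v)) \<le>
    pair_int i \<pi> \<psi>' (\<lambda>v w. \<Sum>a\<in>UNIV. if a = i then X0 v w else X a v w)"
  proof -
    \<comment> \<open>The slot a = i of the sum holds the main term X0; the slots a different from i
      hold the exceptional terms, which catch a pair with vanishing coordinate j1 through some other
      nonzero coordinate.\<close>
    have le: "\<psi>' v * (indicator B w * of_bool (\<nexists>t. w = t *\<^sub>R v)) \<le> \<psi>' v * (\<Sum>a\<in>UNIV. if a = i then X0 v w else X a v w)" for v w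
    proof (cases "w \<in> B \<and> (\<nexists>t. w = t *\<^sub>R v) \<and> v $ i \<noteq> 0")
      case True
      then obtain j where j: "j \<noteq> i" "fibre_coord i j v w \<noteq> 0" using dependent_iff_fibre_coord[of v i w] by blast
      have "\<exists>a. 1 \<le> (if a = i then X0 v w else X a v w)"
      proof (cases "fibre_coord i j1 v w = 0")
        case True
        then show ?thesis using \<open>w \<in> B \<and> _\<close> B(2) j by (intro exI[of _ j]) (auto simp: X_def)
      next
        case False
        then show ?thesis using True by (intro exI[of _ i]) (simp add: X0_def)
      qed
      then obtain a where "1 \<le> (if a = i then X0 v w else X a v w)" ..
      also have "\<dots> \<le> (\<Sum>a\<in>UNIV. if a = i then X0 v w else X a v w)" by (rule member_le_sum) auto
      finally show ?thesis using True by (intro mult_left_mono) auto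
    qed (auto simp: \<psi>'_def)
    show ?thesis
      unfolding pair_int_def
      by (simp add: nn_integral_cmult[symmetric] del: not_ex) (intro nn_integral_mono le)
  qed
  also have "\<dots> = (\<Sum>a\<in>UNIV. pair_int i \<pi> \<psi>' (\<lambda>v w. if a = i then X0 v w else X a v w))"
  proof (rule pair_int_sum[OF \<pi> \<psi>'(1) finite_class.finite_UNIV])
    show "case_prod (\<lambda>v w. if a = i then X0 v w else X a v w) \<in> borel_measurable (borel \<Otimes>\<^sub>M borel)" for a
      using X0m Xm[of a] by (cases "a = i") simp_all
  qed
  also have "\<dots> = (\<Sum>a\<in>UNIV. if a = i then pair_int i \<pi> \<psi>' X0 else 0)"
  proof (intro sum.cong refl)
    fix a :: 'n
    show "pair_int i \<pi> \<psi>' (\<lambda>v w. if a = i then X0 v w else X a v w) = (if a = i then pair_int i \<pi> \<psi>' X0 else 0)"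
      using pair_exceptional_null[OF \<pi> card _ B(3) \<psi>', where j=a and ?j1.0=j1] by (auto simp: X_def)
  qed
  also have "\<dots> = pair_int i \<pi> \<psi>' X0" by simp
  also have "\<dots> \<le> ennreal (1 / zeta CARD('n)) * ((\<integral>\<^sup>+v. \<psi>' v \<partial>lborel) * emeasure lborel B)" by (rule main)
  also have "\<dots> \<le> ennreal (1 / zeta CARD('n)) * ((\<integral>\<^sup>+v. \<psi> v \<partial>lborel) * emeasure lborel B)"
    by (intro mult_left_mono mult_right_mono \<psi>'le) auto
  finally show ?thesis unfolding change .
qed

section \<open>Linearly dependent pairs\<close>

lemma dependent_multiples:
  fixes p m :: "real^'n"
  assumes p: "p \<in> prim_vecs i" and m: "m \<in> int_lattice" and r: "m = r *\<^sub>R p"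
  shows "\<exists>z::int. r = of_int z"
proof -
  obtain \<gamma> where \<gamma>: "\<gamma> \<in> SL_int" "p = \<gamma> *v axis i 1" using p by (auto simp: prim_vecs_def)
  have "sinv \<gamma> *v m = r *\<^sub>R axis i 1"
    using \<gamma> by (simp add: r matrix_vector_mult_scaleR sinv_cancel SL_int_det)
  moreover have "(sinv \<gamma> *v m) $ i \<in> \<int>"
    using SL_int_int_lattice[OF SL_int_sinv[OF \<gamma>(1)] m] by (simp add: int_lattice_def)
  ultimately have "r \<in> \<int>" by (simp add: axis_def)
  then show ?thesis by (auto elim: Ints_cases)
qed

text \<open>Lattice points on the line of a primitive vector are its integer multiples; the factor 2
  accounts for the sign.\<close>

lemma sum_dependent_le:
  fixes p :: "real^'n" and f :: "real^'n \<Rightarrow> ennreal"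
  assumes p: "p \<in> prim_vecs i" and even: "\<And>v. f (- v) = f v" and g: "det g = 1" and f0: "f 0 = 0"
  shows "(\<integral>\<^sup>+m. f (g *v m) * of_bool (\<exists>t. g *v m = t *\<^sub>R (g *v p)) \<partial>count_space int_lattice) \<le>
    2 * (\<Sum>n. f (real (Suc n) *\<^sub>R (g *v p)))"
proof -
  let ?q = "\<lambda>n. real (Suc n) *\<^sub>R p"
  have "(\<integral>\<^sup>+m. f (g *v m) * of_bool (\<exists>t. g *v m = t *\<^sub>R (g *v p)) \<partial>count_space int_lattice) \<le>
    (\<integral>\<^sup>+m. (\<Sum>n. f (g *v m) * indicator {?q n} m + f (g *v m) * indicator {- ?q n} m) \<partial>count_space int_lattice)"
  proof (rule nn_integral_mono)
    fix m :: "real^'n" assume "m \<in> space (count_space int_lattice)"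
    then have m: "m \<in> int_lattice" by simp
    show "f (g *v m) * of_bool (\<exists>t. g *v m = t *\<^sub>R (g *v p)) \<le> (\<Sum>n. f (g *v m) * indicator {?q n} m + f (g *v m) * indicator {- ?q n} m)"
    proof (cases "(\<exists>t. g *v m = t *\<^sub>R (g *v p)) \<and> m \<noteq> 0")
      case True
      then obtain t where t: "g *v m = t *\<^sub>R (g *v p)" by blast
      then have "sinv g *v (g *v m) = t *\<^sub>R (sinv g *v (g *v p))" by (simp add: matrix_vector_mult_scaleR)
      then have mt: "m = t *\<^sub>R p" by (simp add: sinv_cancel g)
      obtain z :: int where z: "t = of_int z" using dependent_multiples[OF p m mt] by blast
      have "z \<noteq> 0" using mt z True by auto
      define n where "n = nat (\<bar>z\<bar> - 1)"
      have "m = ?q n \<or> m = - ?q n"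
        using \<open>z \<noteq> 0\<close> by (cases "z > 0") (auto simp: mt z n_def simp flip: scaleR_minus_left)
      then have "f (g *v m) \<le> f (g *v m) * indicator {?q n} m + f (g *v m) * indicator {- ?q n} m"
        by (auto simp: indicator_def)
      also have "\<dots> \<le> (\<Sum>n. f (g *v m) * indicator {?q n} m + f (g *v m) * indicator {- ?q n} m)"
        using sum_le_suminf[of "\<lambda>n. f (g *v m) * indicator {?q n} m + f (g *v m) * indicator {- ?q n} m" "{n}"] by simp
      finally show ?thesis using True by simp
    qed (auto simp: f0)
  qed
  also have "\<dots> = (\<Sum>n. \<integral>\<^sup>+m. f (g *v m) * indicator {?q n} m + f (g *v m) * indicator {- ?q n} m \<partial>count_space int_lattice)"
    by (rule nn_integral_suminf) simp
  also have "\<dots> \<le> (\<Sum>n. 2 * f (real (Suc n) *\<^sub>R (g *v p)))"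
  proof (intro suminf_le summableI)
    fix n
    have s: "(\<integral>\<^sup>+m. f (g *v m) * indicator {x} m \<partial>count_space int_lattice) \<le> f (g *v x)" for x :: "real^'n"
    proof (cases "x \<in> int_lattice")
      case True
      have "(\<integral>\<^sup>+m. f (g *v m) * indicator {x} m \<partial>count_space int_lattice) = (\<integral>\<^sup>+m. f (g *v x) * indicator {x} m \<partial>count_space int_lattice)"
        by (intro nn_integral_cong) (auto simp: indicator_def)
      then show ?thesis using True by (simp add: nn_integral_cmult_indicator)
    next
      case False
      then have "(\<integral>\<^sup>+m. f (g *v m) * indicator {x} m \<partial>count_space int_lattice) = (\<integral>\<^sup>+m. 0 \<partial>count_space (int_lattice :: (real^'n) set))"
        by (intro nn_integral_cong) (auto simp: indicator_def)
      then show ?thesis by simp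
    qed
    have "(\<integral>\<^sup>+m. f (g *v m) * indicator {?q n} m + f (g *v m) * indicator {- ?q n} m \<partial>count_space int_lattice) =
      (\<integral>\<^sup>+m. f (g *v m) * indicator {?q n} m \<partial>count_space int_lattice) + (\<integral>\<^sup>+m. f (g *v m) * indicator {- ?q n} m \<partial>count_space int_lattice)"
      by (rule nn_integral_add) auto
    also have "\<dots> \<le> f (g *v ?q n) + f (g *v (- ?q n))" by (intro add_mono s)
    also have "\<dots> = 2 * f (real (Suc n) *\<^sub>R (g *v p))"
    proof -
      have "g *v (- ?q n) = - (g *v ?q n)" by (simp add: matrix_vector_mult_def vec_eq_iff sum_negf)
      then show ?thesis by (simp only: even matrix_vector_mult_scaleR mult_2)
    qed
    finally show "(\<integral>\<^sup>+m. f (g *v m) * indicator {?q n} m + f (g *v m) * indicator {- ?q n} m \<partial>count_space int_lattice) \<le>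
      2 * f (real (Suc n) *\<^sub>R (g *v p))" .
  qed
  also have "\<dots> = 2 * (\<Sum>n. f (real (Suc n) *\<^sub>R (g *v p)))" by simp
  finally show ?thesis .
qed

text \<open>Since all terms are at most 1, a product is at most the term with the larger index, and
  index n is the larger one for n + 1 choices of the other. The weight n + 1 is what later lowers
  zeta(d) to zeta(d - 1).\<close>

lemma suminf_product_le:
  fixes a :: "nat \<Rightarrow> ennreal"
  assumes "\<And>n. a n \<le> 1"
  shows "(\<Sum>n. a n * (\<Sum>k. a k)) \<le> 2 * (\<Sum>n. of_nat (Suc n) * a n)"
proof -
  have "(\<Sum>n. a n * (\<Sum>k. a k)) = (\<Sum>n. \<Sum>k. a n * a k)" by simp
  also have "\<dots> \<le> (\<Sum>n. \<Sum>k. a n * of_bool (k \<le> n) + a k * of_bool (n \<le> k))"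
  proof (intro suminf_le summableI)
    fix n k
    show "a n * a k \<le> a n * of_bool (k \<le> n) + a k * of_bool (n \<le> k)"
      using mult_left_mono[OF assms[of k], of "a n"] mult_right_mono[OF assms[of n], of "a k"]
      by (cases "k \<le> n") (auto simp: add_increasing2)
  qed
  also have "\<dots> = (\<Sum>n. \<Sum>k. a n * of_bool (k \<le> n)) + (\<Sum>n. \<Sum>k. a k * of_bool (n \<le> k))"
  proof -
    have *: "(\<Sum>n. x n + y n) = (\<Sum>n. x n) + (\<Sum>n. y n)" for x y :: "nat \<Rightarrow> ennreal"
      by (rule suminf_add[symmetric]) (rule summableI)+
    show ?thesis by (simp only: *)
  qed
  also have "(\<Sum>n. \<Sum>k. a k * of_bool (n \<le> k)) = (\<Sum>k. \<Sum>n. a k * of_bool (n \<le> k))"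
    unfolding nn_integral_count_space_nat[symmetric]
    by (rule nn_integral_count_space_nn_integral) auto
  finally have le: "(\<Sum>n. a n * (\<Sum>k. a k)) \<le> (\<Sum>n. \<Sum>k. a n * of_bool (k \<le> n)) + (\<Sum>k. \<Sum>n. a k * of_bool (n \<le> k))" .
  have inner: "(\<Sum>k. a n * of_bool (k \<le> n)) = of_nat (Suc n) * a n" for n
  proof -
    have "(\<Sum>k. a n * of_bool (k \<le> n)) = (\<Sum>k\<in>{..n}. a n * of_bool (k \<le> n))"
      by (rule suminf_finite) auto
    then show ?thesis by simp
  qed
  show ?thesis using le by (simp only: inner mult_2)
qed

section \<open>Second moments\<close>

lemma two_cmult_le_squares:
  fixes x y :: ennreal
  shows "2 * (x * y) \<le> x\<^sup>2 + y\<^sup>2"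
proof (cases "x = top \<or> y = top")
  case False
  then obtain a b where "x = ennreal a" "y = ennreal b" "a \<ge> 0" "b \<ge> 0"
    by (metis ennreal_cases)
  moreover have "2 * (a * b) \<le> a\<^sup>2 + b\<^sup>2"
    using sum_squares_bound[of a b] by simp
  ultimately show ?thesis
    by (simp add: ennreal_mult[symmetric] power2_eq_square ennreal_plus[symmetric] ennreal_numeral[symmetric]
        del: ennreal_plus ennreal_numeral)
qed (auto simp: power2_eq_square ennreal_mult_eq_top_iff)

text \<open>Chebyshev's inequality without subtraction in \<open>ennreal\<close>: pointwise, 2 \<mu>
  N plus \<mu>^2 on the event N = 0 is at most \<mu>^2 + N^2.\<close>

lemma (in prob_space) second_moment_bound:
  fixes N :: "'a \<Rightarrow> ennreal"
  assumes [measurable]: "N \<in> borel_measurable M"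
    and m1: "(\<integral>\<^sup>+x. N x \<partial>M) = \<mu>" and fin: "\<mu> < \<infinity>" and m2: "(\<integral>\<^sup>+x. (N x)\<^sup>2 \<partial>M) \<le> \<mu>\<^sup>2 + V"
  shows "emeasure M {x \<in> space M. N x = 0} * \<mu>\<^sup>2 \<le> V"
proof -
  have "2 * \<mu>\<^sup>2 + emeasure M {x \<in> space M. N x = 0} * \<mu>\<^sup>2 =
    (\<integral>\<^sup>+x. (2 * \<mu>) * N x + \<mu>\<^sup>2 * indicator {x \<in> space M. N x = 0} x \<partial>M)"
  proof -
    have "(\<integral>\<^sup>+x. (2 * \<mu>) * N x \<partial>M) = 2 * \<mu>\<^sup>2"
      by (subst nn_integral_cmult) (auto simp: m1 power2_eq_square mult.assoc)
    then show ?thesis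
      by (subst nn_integral_add) (auto simp: nn_integral_cmult_indicator mult.commute)
  qed
  also have "\<dots> \<le> (\<integral>\<^sup>+x. \<mu>\<^sup>2 + (N x)\<^sup>2 \<partial>M)"
    by (rule nn_integral_mono) (use two_cmult_le_squares[of \<mu>] in \<open>auto simp: indicator_def mult.assoc\<close>)
  also have "\<dots> = \<mu>\<^sup>2 + (\<integral>\<^sup>+x. (N x)\<^sup>2 \<partial>M)"
    by (subst nn_integral_add) (auto simp: emeasure_space_1)
  also have "\<dots> \<le> \<mu>\<^sup>2 + (\<mu>\<^sup>2 + V)" by (rule add_left_mono[OF m2])
  also have "\<dots> = 2 * \<mu>\<^sup>2 + V" by (simp add: mult_2 add.assoc)
  finally show ?thesis
    using fin by (subst (asm) ennreal_add_left_cancel_le) (auto simp: power2_eq_square ennreal_mult_eq_top_iff)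
qed

lemma suminf_ennreal_zeta:
  assumes "k \<ge> 2" shows "(\<Sum>n. ennreal (1 / real (Suc n) ^ k)) = ennreal (zeta k)"
  using zeta_sums[OF assms] by (intro suminf_ennreal_eq) auto

text \<open>Replaces the uncountable quantifier over t by finitely many polynomial equations, which
  makes dependence measurable. The zero vector needs its own clause.\<close>

lemma multiple_iff:
  fixes v w :: "real^'n"
  shows "(\<exists>t. w = t *\<^sub>R v) \<longleftrightarrow> w = 0 \<or> v \<noteq> 0 \<and> (\<forall>a b. v $ a * w $ b = v $ b * w $ a)"
proof
  assume "w = 0 \<or> v \<noteq> 0 \<and> (\<forall>a b. v $ a * w $ b = v $ b * w $ a)"
  then consider "w = 0" | "v \<noteq> 0" "\<And>a b. v $ a * w $ b = v $ b * w $ a" by blast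
  then show "\<exists>t. w = t *\<^sub>R v"
  proof cases
    case 1
    then have "w = 0 *\<^sub>R v" by simp
    then show ?thesis ..
  next
    case 2
    then obtain a where a: "v $ a \<noteq> 0" by (auto simp: vec_eq_iff)
    have "w = (w $ a / v $ a) *\<^sub>R v"
      using a 2(2)[of a] by (auto simp: vec_eq_iff field_simps)
    then show ?thesis ..
  qed
qed auto

lemma borel_measurable_multiple:
  "case_prod (\<lambda>v w. of_bool (\<nexists>t. w = t *\<^sub>R v)) \<in> borel_measurable (borel \<Otimes>\<^sub>M (borel :: (real^'n) measure))"
proof -
  have "Measurable.pred (borel \<Otimes>\<^sub>M (borel :: (real^'n) measure)) (\<lambda>x. \<nexists>t. snd x = t *\<^sub>R fst x)"
    unfolding multiple_iff by measurable
  then show ?thesis unfolding split_beta' by measurable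
qed

text \<open>In the squared count one factor is summed over primitive vectors, the other over all
  lattice vectors and split by dependence. Independent pairs give |B|^2, because the factor 1 /
  zeta(d) of the pair bound cancels the zeta(d) in the integral of \<psi>. Dependent pairs give 4: a
  2 for the sign and a 2 from \<open>suminf_product_le\<close>.\<close>

lemma second_moment_ge_3:
  fixes \<pi> :: "(real^'n^'n) measure" and B :: "(real^'n) set"
  assumes \<pi>: "inv_law \<pi>" and card: "CARD('n) \<ge> 3"
    and B: "B \<in> sets borel" "B \<subseteq> cball 0 r" "r \<ge> 0" "0 \<notin> B" "\<And>v. - v \<in> B \<longleftrightarrow> v \<in> B"
  shows "(\<integral>\<^sup>+g. (\<integral>\<^sup>+m. indicator B (g *v m) \<partial>count_space (int_lattice - {0}))\<^sup>2 \<partial>\<pi>) \<le>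
    (emeasure lborel B)\<^sup>2 + ennreal (4 * zeta (CARD('n) - 1) / zeta CARD('n)) * emeasure lborel B"
proof -
  let ?d = "CARD('n)"
  obtain i :: 'n where True by blast
  have card2: "?d \<ge> 2" using card by simp
  note [measurable_cong] = inv_law_D(2)[OF \<pi>]
  note [measurable] = B(1)
  have z: "zeta ?d > 0" "zeta (?d - 1) \<ge> 0"
    using zeta_bounds(1)[of ?d] zeta_bounds(1)[of "?d - 1"] card by fastforce+
  have Bfin: "emeasure lborel B < \<infinity>"
    using emeasure_bounded_finite[OF bounded_subset[OF bounded_cball B(2)]] by simp
  define f :: "real^'n \<Rightarrow> ennreal" where "f = indicator B"
  have [measurable]: "f \<in> borel_measurable borel" unfolding f_def by measurable
  have f0: "f 0 = 0" and even: "f (- v) = f v" and f1: "f v \<le> 1" for v using B(4,5) by (auto simp: f_def indicator_def)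
  have If: "(\<integral>\<^sup>+v. f v \<partial>lborel) = emeasure lborel B" by (simp add: f_def)
  \<comment> \<open>Collects all positive multiples of a primitive vector, so that its sum over
    primitive vectors is the full count.\<close>
  define \<psi> where "\<psi> v = (\<Sum>n. f (real (Suc n) *\<^sub>R v))" for v
  have [measurable]: "\<psi> \<in> borel_measurable borel" unfolding \<psi>_def by measurable
  have scaled: "(\<integral>\<^sup>+v. f (real (Suc n) *\<^sub>R v) \<partial>lborel) = ennreal (1 / real (Suc n) ^ ?d) * emeasure lborel B" for n
    by (subst nn_integral_vec_scaleR'[where h=f]) (auto simp: If)
  have I\<psi>: "(\<integral>\<^sup>+v. \<psi> v \<partial>lborel) = ennreal (zeta ?d) * emeasure lborel B"
    unfolding \<psi>_def
    by (subst nn_integral_suminf) (auto simp only: scaled ennreal_suminf_multc suminf_ennreal_zeta[OF card2], measurable)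
  define D where "D v w = f w * of_bool (\<exists>t. w = t *\<^sub>R v)" for v w
  define W where "W v w = indicator B w * (of_bool (\<nexists>t. w = t *\<^sub>R v) :: ennreal)" for v w :: "real^'n"
  have Wm: "case_prod W \<in> borel_measurable (borel \<Otimes>\<^sub>M borel)"
  proof -
    have "case_prod W = (\<lambda>x. indicator B (snd x) * case_prod (\<lambda>v w. of_bool (\<nexists>t. w = t *\<^sub>R v)) x)"
      by (auto simp: W_def)
    then show ?thesis
      by (simp only:) (intro borel_measurable_times_ennreal borel_measurable_multiple, measurable)
  qed
  note [measurable] = measurable_split_compose[OF Wm]
  have split: "f w = W v w + D v w" for v w by (auto simp: W_def D_def f_def)
  have N: "(\<integral>\<^sup>+m. f (g *v m) \<partial>count_space (int_lattice - {0})) = (\<integral>\<^sup>+p. \<psi> (g *v p) \<partial>count_space (prim_vecs i))" for g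
  proof -
    have "(\<integral>\<^sup>+m. f (g *v m) \<partial>count_space (int_lattice - {0})) =
      (\<Sum>n. \<integral>\<^sup>+p. f (real (Suc n) *\<^sub>R (g *v p)) \<partial>count_space (prim_vecs i))"
      by (subst sum_int_lattice_eq_sum_prim[OF card2]) (simp only: matrix_vector_mult_scaleR)
    then show ?thesis unfolding \<psi>_def by (simp only: nn_integral_suminf borel_measurable_count_space)
  qed
  have sq: "(\<integral>\<^sup>+m. f (g *v m) \<partial>count_space (int_lattice - {0}))\<^sup>2 \<le>
      (\<integral>\<^sup>+p. \<psi> (g *v p) * (\<integral>\<^sup>+m. W (g *v p) (g *v m) \<partial>count_space int_lattice) \<partial>count_space (prim_vecs i)) +
      (\<integral>\<^sup>+p. 4 * (\<Sum>n. of_nat (Suc n) * f (real (Suc n) *\<^sub>R (g *v p))) \<partial>count_space (prim_vecs i))"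
    if g: "det g = 1" for g
  proof -
    have N': "(\<integral>\<^sup>+m. f (g *v m) \<partial>count_space (int_lattice - {0})) = (\<integral>\<^sup>+m. f (g *v m) \<partial>count_space int_lattice)"
      by (rule nn_integral_count_space_remove_0) (simp add: f0)
    have "(\<integral>\<^sup>+m. f (g *v m) \<partial>count_space (int_lattice - {0}))\<^sup>2 =
      (\<integral>\<^sup>+p. \<psi> (g *v p) * (\<integral>\<^sup>+m. f (g *v m) \<partial>count_space int_lattice) \<partial>count_space (prim_vecs i))"
      unfolding power2_eq_square by (subst (1) N, subst N') (simp add: nn_integral_multc)
    also have "\<dots> \<le> (\<integral>\<^sup>+p. \<psi> (g *v p) * (\<integral>\<^sup>+m. W (g *v p) (g *v m) \<partial>count_space int_lattice)
        + 4 * (\<Sum>n. of_nat (Suc n) * f (real (Suc n) *\<^sub>R (g *v p))) \<partial>count_space (prim_vecs i))"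
    proof (rule nn_integral_mono)
      fix p :: "real^'n" assume "p \<in> space (count_space (prim_vecs i))"
      then have p: "p \<in> prim_vecs i" by simp
      have "(\<integral>\<^sup>+m. f (g *v m) \<partial>count_space int_lattice) =
        (\<integral>\<^sup>+m. W (g *v p) (g *v m) \<partial>count_space int_lattice) + (\<integral>\<^sup>+m. D (g *v p) (g *v m) \<partial>count_space int_lattice)"
        unfolding split[of _ "g *v p"] by (rule nn_integral_add) auto
      also have "(\<integral>\<^sup>+m. D (g *v p) (g *v m) \<partial>count_space int_lattice) \<le> 2 * \<psi> (g *v p)"
        unfolding D_def \<psi>_def by (rule sum_dependent_le[OF p even g f0])
      finally have "\<psi> (g *v p) * (\<integral>\<^sup>+m. f (g *v m) \<partial>count_space int_lattice) \<le>
        \<psi> (g *v p) * ((\<integral>\<^sup>+m. W (g *v p) (g *v m) \<partial>count_space int_lattice) + 2 * \<psi> (g *v p))"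
        by (simp add: mult_left_mono add_left_mono)
      also have "\<dots> = \<psi> (g *v p) * (\<integral>\<^sup>+m. W (g *v p) (g *v m) \<partial>count_space int_lattice) + 2 * (\<psi> (g *v p) * \<psi> (g *v p))"
        by (simp add: distrib_left mult_ac)
      also have "\<psi> (g *v p) * \<psi> (g *v p) \<le> 2 * (\<Sum>n. of_nat (Suc n) * f (real (Suc n) *\<^sub>R (g *v p)))"
        unfolding \<psi>_def using suminf_product_le[of "\<lambda>n. f (real (Suc n) *\<^sub>R (g *v p))"] f1
        by (simp add: ennreal_suminf_multc)
      finally show "\<psi> (g *v p) * (\<integral>\<^sup>+m. f (g *v m) \<partial>count_space int_lattice) \<le>
        \<psi> (g *v p) * (\<integral>\<^sup>+m. W (g *v p) (g *v m) \<partial>count_space int_lattice)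
        + 4 * (\<Sum>n. of_nat (Suc n) * f (real (Suc n) *\<^sub>R (g *v p)))"
        by (simp add: mult_left_mono add_left_mono mult.assoc[symmetric])
    qed
    also have "\<dots> = (\<integral>\<^sup>+p. \<psi> (g *v p) * (\<integral>\<^sup>+m. W (g *v p) (g *v m) \<partial>count_space int_lattice) \<partial>count_space (prim_vecs i)) +
      (\<integral>\<^sup>+p. 4 * (\<Sum>n. of_nat (Suc n) * f (real (Suc n) *\<^sub>R (g *v p))) \<partial>count_space (prim_vecs i))"
      by (rule nn_integral_add) auto
    finally show ?thesis .
  qed
  define h where "h v = 4 * (\<Sum>n. of_nat (Suc n) * f (real (Suc n) *\<^sub>R v))" for v
  have [measurable]: "h \<in> borel_measurable borel" unfolding h_def by measurable
  have "(\<integral>\<^sup>+g. (\<integral>\<^sup>+m. f (g *v m) \<partial>count_space (int_lattice - {0}))\<^sup>2 \<partial>\<pi>) \<le>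
    (\<integral>\<^sup>+g. (\<integral>\<^sup>+p. \<psi> (g *v p) * (\<integral>\<^sup>+m. W (g *v p) (g *v m) \<partial>count_space int_lattice) \<partial>count_space (prim_vecs i)) +
      (\<integral>\<^sup>+p. h (g *v p) \<partial>count_space (prim_vecs i)) \<partial>\<pi>)"
    using inv_law_D(3)[OF \<pi>] unfolding h_def by (intro nn_integral_mono_AE, elim eventually_mono) (rule sq)
  also have "\<dots> \<le> pair_int i \<pi> \<psi> W + prim_int i \<pi> h"
    unfolding pair_int_def prim_int_def
    by (subst nn_integral_add) simp_all
  also have "prim_int i \<pi> h = ennreal (4 * zeta (?d - 1) / zeta ?d) * emeasure lborel B"
  proof -
    have "(\<integral>\<^sup>+v. h v \<partial>lborel) = 4 * (\<Sum>n. ennreal (real (Suc n)) * (ennreal (1 / real (Suc n) ^ ?d) * emeasure lborel B))"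
    proof -
      have "(\<integral>\<^sup>+v. h v \<partial>lborel) = 4 * (\<integral>\<^sup>+v. (\<Sum>n. of_nat (Suc n) * f (real (Suc n) *\<^sub>R v)) \<partial>lborel)"
        unfolding h_def by (rule nn_integral_cmult) measurable
      also have "(\<integral>\<^sup>+v. (\<Sum>n. of_nat (Suc n) * f (real (Suc n) *\<^sub>R v)) \<partial>lborel) =
        (\<Sum>n. \<integral>\<^sup>+v. of_nat (Suc n) * f (real (Suc n) *\<^sub>R v) \<partial>lborel)"
        by (rule nn_integral_suminf) measurable
      also have "(\<lambda>n. \<integral>\<^sup>+v. of_nat (Suc n) * f (real (Suc n) *\<^sub>R v) \<partial>lborel) =
        (\<lambda>n. of_nat (Suc n) * (ennreal (1 / real (Suc n) ^ ?d) * emeasure lborel B))"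
        unfolding scaled[symmetric] by (intro ext nn_integral_cmult) measurable
      finally show ?thesis by (simp only: ennreal_of_nat_eq_real_of_nat)
    qed
    also have "(\<lambda>n. ennreal (real (Suc n)) * (ennreal (1 / real (Suc n) ^ ?d) * emeasure lborel B)) =
      (\<lambda>n. ennreal (1 / real (Suc n) ^ (?d - 1)) * emeasure lborel B)"
    proof
      fix n
      have "real (Suc n) * (1 / real (Suc n) ^ ?d) = 1 / real (Suc n) ^ (?d - 1)"
        using card by (subst power_eq_if) auto
      then show "ennreal (real (Suc n)) * (ennreal (1 / real (Suc n) ^ ?d) * emeasure lborel B) = ennreal (1 / real (Suc n) ^ (?d - 1)) * emeasure lborel B"
        by (simp only: mult.assoc[symmetric] ennreal_mult[symmetric] of_nat_0_le_iff zero_le_divide_1_iff zero_le_power)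
    qed
    also have "(\<Sum>n. ennreal (1 / real (Suc n) ^ (?d - 1)) * emeasure lborel B) = ennreal (zeta (?d - 1)) * emeasure lborel B"
      using card by (subst ennreal_suminf_multc) (subst suminf_ennreal_zeta, auto)
    finally have "prim_int i \<pi> h = ennreal (1 / zeta ?d) * (ennreal 4 * (ennreal (zeta (?d - 1)) * emeasure lborel B))"
      by (subst prim_mean_value[OF \<pi> card2]) simp_all
    then show ?thesis
      using z by (simp add: mult.assoc[symmetric] ennreal_mult[symmetric] del: ennreal_numeral)
  qed
  also have "pair_int i \<pi> \<psi> W \<le> (emeasure lborel B)\<^sup>2"
  proof -
    have "pair_int i \<pi> \<psi> W \<le> ennreal (1 / zeta ?d) * ((\<integral>\<^sup>+v. \<psi> v \<partial>lborel) * emeasure lborel B)"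
      unfolding W_def
      by (rule pair_bound_independent[OF \<pi> card _ _ B(1-3)]) (use Bfin in \<open>auto simp: I\<psi> ennreal_mult_less_top\<close>)
    also have "\<dots> = (emeasure lborel B)\<^sup>2"
      using z by (simp add: I\<psi> mult.assoc[symmetric] ennreal_mult[symmetric] power2_eq_square)
    finally show ?thesis .
  qed
  finally show ?thesis by (simp add: f_def)
qed

section \<open>Primitive vectors of planar lattices\<close>

lemma card_2_UNIV:
  assumes "CARD('n::finite) = 2"
  obtains j where "(UNIV :: 'n set) = {i, j}" "i \<noteq> j"
proof -
  obtain a b :: 'n where ab: "UNIV = {a, b}" "a \<noteq> b" using assms unfolding card_2_iff by blast
  have "i \<in> {a, b}" using ab(1) by blast
  then consider "i = a" | "i = b" by blast
  then show thesis
  proof cases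
    case 1 then show ?thesis using that[of b] ab by simp
  next
    case 2 then show ?thesis using that[of a] ab by (simp add: insert_commute)
  qed
qed

lemma det_doubleton:
  fixes M :: "'a::comm_ring_1^'n^'n"
  assumes "(UNIV :: 'n::finite set) = {i, j}" "i \<noteq> j"
  shows "det M = M $ i $ i * M $ j $ j - M $ i $ j * M $ j $ i"
proof -
  have f: "finite {j}" "i \<notin> {j}" using assms by auto
  show ?thesis
    unfolding det_def assms(1)
    unfolding sum_over_permutations_insert[OF f] permutes_sing
    using assms(2) by (simp add: sign_swap_id sign_id swap_id_eq)
qed

definition det2 :: "'n \<Rightarrow> 'n \<Rightarrow> real^'n \<Rightarrow> real^'n \<Rightarrow> real" where
  "det2 i j v w = v $ i * w $ j - v $ j * w $ i"

lemma det2_matrix_vector_mult: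
  fixes g :: "real^'n^'n"
  assumes ij: "(UNIV :: 'n::finite set) = {i, j}" "i \<noteq> j"
  shows "det2 i j (g *v v) (g *v w) = det g * det2 i j v w"
proof -
  define M where "M v w = (\<chi> a b. if b = i then v $ a else w $ a)" for v w :: "real^'n"
  have M: "det (M v w) = det2 i j v w" for v w
    using ij(2) by (simp add: det_doubleton[OF ij] M_def det2_def mult.commute)
  have "g ** M v w = M (g *v v) (g *v w)"
    by (auto simp: M_def vec_eq_iff matrix_matrix_mult_def matrix_vector_mult_def)
  then show ?thesis by (metis M det_mul)
qed

lemma det2_diff_right: "det2 i j v (x - y) = det2 i j v x - det2 i j v y"
  by (simp add: det2_def algebra_simps)

lemma det2_eq_0_iff:
  fixes v w :: "real^'n"
  assumes ij: "(UNIV :: 'n::finite set) = {i, j}" and v: "v \<noteq> 0"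
  shows "det2 i j v w = 0 \<longleftrightarrow> (\<exists>t. w = t *\<^sub>R v)"
proof -
  have all: "(\<forall>a::'n. P a) \<longleftrightarrow> P i \<and> P j" for P
    using ij by (metis UNIV_I insertE singletonD)
  show ?thesis unfolding multiple_iff all det2_def using v by auto
qed

lemma det2_int_lattice: "p \<in> int_lattice \<Longrightarrow> m \<in> int_lattice \<Longrightarrow> det2 i j p m \<in> \<int>"
  by (auto simp: det2_def int_lattice_def)

section \<open>Rectangles attached to a primitive vector\<close>

lemma inner_doubleton:
  fixes v w :: "real^'n"
  assumes ij: "(UNIV :: 'n::finite set) = {i, j}" "i \<noteq> j"
  shows "v \<bullet> w = v $ i * w $ i + v $ j * w $ j"
  using ij(2) by (simp add: inner_vec_def ij(1))

lemma lagrange_identity: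
  fixes v w :: "real^'n"
  assumes ij: "(UNIV :: 'n::finite set) = {i, j}" "i \<noteq> j"
  shows "(norm v * norm w)\<^sup>2 = (v \<bullet> w)\<^sup>2 + (det2 i j v w)\<^sup>2"
  unfolding power_mult_distrib power2_norm_eq_inner inner_doubleton[OF ij] det2_def
  by (simp add: algebra_simps power2_eq_square)

text \<open>Coordinates with respect to v and the quarter turn of v divided by its squared norm.
  This basis has determinant one, and its unit cell is a rectangle with sides \<open>norm v\<close>
  and \<open>1 / norm v\<close>.\<close>

definition frame :: "'n \<Rightarrow> 'n \<Rightarrow> real^'n \<Rightarrow> real^'n^'n" where
  "frame i j v = (\<chi> a b. if a = i then v $ b / (norm v)\<^sup>2 else if b = i then - v $ j else v $ i)"

lemma frame_vec:
  fixes v x :: "real^'n"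
  assumes ij: "(UNIV :: 'n::finite set) = {i, j}" "i \<noteq> j"
  shows "(frame i j v *v x) $ i = (v \<bullet> x) / (norm v)\<^sup>2" "(frame i j v *v x) $ j = det2 i j v x"
proof -
  have s: "(\<Sum>b\<in>UNIV. h b) = h i + h j" for h :: "'n \<Rightarrow> real" using ij(2) by (simp add: ij(1))
  show "(frame i j v *v x) $ i = (v \<bullet> x) / (norm v)\<^sup>2" "(frame i j v *v x) $ j = det2 i j v x"
    using ij(2) by (simp_all add: frame_def matrix_vector_mult_def s inner_doubleton[OF ij] det2_def add_divide_distrib)
qed

lemma det_frame:
  assumes ij: "(UNIV :: 'n::finite set) = {i, j}" "i \<noteq> j" and v: "v \<noteq> (0::real^'n)"
  shows "det (frame i j v) = 1"
proof -
  have "(norm v)\<^sup>2 = v $ i * v $ i + v $ j * v $ j"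
    by (simp add: power2_norm_eq_inner inner_doubleton[OF ij])
  moreover have "(norm v)\<^sup>2 \<noteq> 0" using v by simp
  ultimately show ?thesis using ij(2) by (simp add: det_doubleton[OF ij] frame_def add_divide_distrib[symmetric])
qed

lemma floor_vec_eq_0_iff: "floor_vec z = 0 \<longleftrightarrow> (\<forall>a. 0 \<le> z $ a \<and> z $ a < 1)"
  by (simp add: floor_vec_def vec_eq_iff floor_eq_iff)

lemma nn_integral_unit_cell: "(\<integral>\<^sup>+z. of_bool (floor_vec z = 0) \<partial>(lborel :: (real^'n) measure)) = 1"
proof -
  have "(\<integral>\<^sup>+z. of_bool (floor_vec z = 0) \<partial>(lborel :: (real^'n) measure)) = (\<integral>\<^sup>+m. of_bool (m = 0) \<partial>count_space (int_lattice :: (real^'n) set))"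
    by (rule nn_integral_floor_vec)
  also have "\<dots> = (\<integral>\<^sup>+m. indicator {0} m \<partial>count_space (int_lattice :: (real^'n) set))"
    by (intro nn_integral_cong) (auto simp: indicator_def)
  also have "\<dots> = 1" by (subst nn_integral_indicator) (auto simp: int_lattice_def)
  finally show ?thesis .
qed

text \<open>The diameter of the rectangle is at most the sum of its sides; the Lagrange identity
  splits a vector into its parts along and across v.\<close>

lemma frame_cell_bound:
  fixes v x :: "real^'n"
  assumes ij: "(UNIV :: 'n::finite set) = {i, j}" "i \<noteq> j" and v: "v \<noteq> 0" and x: "floor_vec (frame i j v *v x) = 0"
  shows "norm x \<le> norm v + 1 / norm v"
proof -
  have nv: "norm v > 0" using v by simp
  have 1: "0 \<le> (v \<bullet> x) / (norm v)\<^sup>2" "(v \<bullet> x) / (norm v)\<^sup>2 < 1" "0 \<le> det2 i j v x" "det2 i j v x < 1"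
    using x unfolding floor_vec_eq_0_iff frame_vec[OF ij, symmetric] by blast+
  have "\<bar>v \<bullet> x\<bar> \<le> (norm v)\<^sup>2" using 1(1,2) nv by (simp add: field_simps)
  then have "(v \<bullet> x)\<^sup>2 \<le> ((norm v)\<^sup>2)\<^sup>2" by (metis abs_le_square_iff abs_of_nonneg zero_le_power2)
  moreover have "(det2 i j v x)\<^sup>2 \<le> 1" using 1(3,4) by (simp add: power_le_one_iff abs_square_le_1)
  ultimately have "(norm v * norm x)\<^sup>2 \<le> ((norm v)\<^sup>2)\<^sup>2 + 1" unfolding lagrange_identity[OF ij] by simp
  also have "\<dots> \<le> ((norm v)\<^sup>2 + 1)\<^sup>2" by (simp add: power2_sum)
  finally have "norm v * norm x \<le> (norm v)\<^sup>2 + 1" by (rule power2_le_imp_le) simp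
  then show ?thesis using nv by (simp add: field_simps power2_eq_square)
qed

text \<open>The translates of the rectangle spanned by \<open>v\<close> and its normal of length \<open>1 / norm v\<close> by the
  lattice points form a brick wall, so they are disjoint.\<close>

lemma frame_cell_disjoint:
  fixes g :: "real^'n^'n"
  assumes ij: "(UNIV :: 'n::finite set) = {i, j}" "i \<noteq> j" and g: "det g = 1" and p: "p \<in> prim_vecs i"
    and m: "m \<in> int_lattice" "m' \<in> int_lattice"
    and y: "floor_vec (frame i j (g *v p) *v (y - g *v m)) = 0" "floor_vec (frame i j (g *v p) *v (y - g *v m')) = 0"
  shows "m = m'"
proof -
  let ?v = "g *v p" let ?u = "m' - m" let ?x = "y - g *v m" let ?x' = "y - g *v m'"
  have p0: "p \<noteq> 0" using p prim_vecs_nonzero by blast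
  have v0: "?v \<noteq> 0"
  proof
    assume "?v = 0"
    then have "sinv g *v (g *v p) = 0" by simp
    then show False using p0 by (simp add: sinv_cancel g)
  qed
  have nv: "(norm ?v)\<^sup>2 > 0" using v0 by simp
  have gu: "?x - ?x' = g *v ?u" by (simp add: matrix_vector_mult_diff_distrib)
  have 1: "0 \<le> (?v \<bullet> ?x) / (norm ?v)\<^sup>2" "(?v \<bullet> ?x) / (norm ?v)\<^sup>2 < 1" "0 \<le> det2 i j ?v ?x" "det2 i j ?v ?x < 1"
    and 2: "0 \<le> (?v \<bullet> ?x') / (norm ?v)\<^sup>2" "(?v \<bullet> ?x') / (norm ?v)\<^sup>2 < 1" "0 \<le> det2 i j ?v ?x'" "det2 i j ?v ?x' < 1"
    using y unfolding floor_vec_eq_0_iff frame_vec[OF ij, symmetric] by blast+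
  have "p \<in> int_lattice" using p prim_vecs_int_lattice by blast
  moreover have u: "?u \<in> int_lattice" using m by (auto simp: int_lattice_def)
  \<comment> \<open>The difference of the two lattice points has integer determinant with p. Overlap
    in the direction across v makes it smaller than 1, so both points lie on one line parallel to
    v.\<close>
  ultimately have "det2 i j p ?u \<in> \<int>" by (rule det2_int_lattice)
  moreover have "det2 i j ?v (g *v ?u) = det2 i j p ?u" by (simp add: det2_matrix_vector_mult[OF ij] g)
  moreover have "\<bar>det2 i j ?v (g *v ?u)\<bar> < 1"
    unfolding gu[symmetric] det2_diff_right[of _ _ _ ?x ?x'] using 1(3,4) 2(3,4) by linarith
  ultimately have "det2 i j p ?u = 0" by (auto elim!: Ints_cases)
  then obtain t where t: "?u = t *\<^sub>R p" using det2_eq_0_iff[OF ij(1) p0] by blast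
  obtain z :: int where z: "t = of_int z" using dependent_multiples[OF p u t] by blast
  \<comment> \<open>On that line the points differ by an integer multiple t of v, and overlap along
    v makes t smaller than 1.\<close>
  have "t = (?v \<bullet> (g *v ?u)) / (norm ?v)\<^sup>2"
    using nv by (simp add: t matrix_vector_mult_scaleR power2_norm_eq_inner)
  also have "\<dots> = (?v \<bullet> ?x) / (norm ?v)\<^sup>2 - (?v \<bullet> ?x') / (norm ?v)\<^sup>2"
    unfolding gu[symmetric] by (simp only: inner_diff_right diff_divide_distrib)
  finally have "\<bar>t\<bar> < 1" using 1(1,2) 2(1,2) by simp
  then have "t = 0" by (simp add: z)
  then show ?thesis using t by simp
qed

lemma nn_integral_count_space_le_1:
  assumes "\<And>x y. x \<in> A \<Longrightarrow> y \<in> A \<Longrightarrow> P x \<Longrightarrow> P y \<Longrightarrow> x = y"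
  shows "(\<integral>\<^sup>+x. of_bool (P x) \<partial>count_space A) \<le> (1 :: ennreal)"
proof (cases "\<exists>x\<in>A. P x")
  case True
  then obtain a where a: "a \<in> A" "P a" by blast
  have "(\<integral>\<^sup>+x. of_bool (P x) \<partial>count_space A) = (\<integral>\<^sup>+x. indicator {a} x \<partial>count_space A)"
    using assms a by (intro nn_integral_cong) (auto simp: indicator_def)
  then show ?thesis using a by simp
next
  case False
  then have "(\<integral>\<^sup>+x. of_bool (P x) \<partial>count_space A) = (\<integral>\<^sup>+x. 0 \<partial>count_space A)"
    by (intro nn_integral_cong) auto
  then show ?thesis by simp
qed

text \<open>Each lattice point is spread uniformly over its own rectangle of area 1. Disjointness
  bounds the total by an integral, and F dominates f over the diameter of a rectangle. The leading
  constant 1 is essential for the planar argument.\<close>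

lemma packing_bound:
  fixes g :: "real^'n^'n" and f F :: "real^'n \<Rightarrow> ennreal"
  assumes ij: "(UNIV :: 'n::finite set) = {i, j}" "i \<noteq> j" and g: "det g = 1" and p: "p \<in> prim_vecs i"
    and Fm [measurable]: "F \<in> borel_measurable borel"
    and F: "\<And>x y. norm (y - x) \<le> norm (g *v p) + 1 / norm (g *v p) \<Longrightarrow> f x \<le> F y"
  shows "(\<integral>\<^sup>+m. f (g *v m) \<partial>count_space int_lattice) \<le> (\<integral>\<^sup>+y. F y \<partial>lborel)"
proof -
  let ?A = "frame i j (g *v p)"
  have v0: "g *v p \<noteq> 0"
  proof
    assume "g *v p = 0"
    then have "sinv g *v (g *v p) = 0" by simp
    then show False using p prim_vecs_nonzero by (auto simp: sinv_cancel g)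
  qed
  define D :: "real^'n \<Rightarrow> ennreal" where "D x = of_bool (floor_vec (?A *v x) = 0)" for x
  have [measurable]: "D \<in> borel_measurable borel" unfolding D_def by measurable
  have D1: "(\<integral>\<^sup>+y. D (y - c) \<partial>lborel) = 1" for c
  proof -
    have "(\<integral>\<^sup>+y. D (y - c) \<partial>lborel) = (\<integral>\<^sup>+y. D (y - c) \<partial>distr lborel borel ((+) c))" by (simp add: lborel_distr_plus)
    also have "\<dots> = (\<integral>\<^sup>+y. D y \<partial>lborel)" by (subst nn_integral_distr) simp_all
    also have "\<dots> = (\<integral>\<^sup>+y. of_bool (floor_vec y = (0::real^'n)) \<partial>lborel)"
      unfolding D_def by (rule nn_integral_matrix_vector_mult) (auto simp: det_frame[OF ij v0])
    finally show ?thesis by (simp add: nn_integral_unit_cell)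
  qed
  have "(\<integral>\<^sup>+m. f (g *v m) \<partial>count_space int_lattice) = (\<integral>\<^sup>+m. (\<integral>\<^sup>+y. f (g *v m) * D (y - g *v m) \<partial>lborel) \<partial>count_space int_lattice)"
    by (simp add: nn_integral_cmult D1)
  also have "\<dots> \<le> (\<integral>\<^sup>+m. (\<integral>\<^sup>+y. F y * D (y - g *v m) \<partial>lborel) \<partial>count_space int_lattice)"
  proof (intro nn_integral_mono)
    fix m y
    show "f (g *v m) * D (y - g *v m) \<le> F y * D (y - g *v m)"
    proof (cases "floor_vec (?A *v (y - g *v m)) = 0")
      case True
      then show ?thesis by (intro mult_right_mono F frame_cell_bound[OF ij v0]) auto
    qed (simp add: D_def)
  qed
  also have "\<dots> = (\<integral>\<^sup>+y. (\<integral>\<^sup>+m. F y * D (y - g *v m) \<partial>count_space int_lattice) \<partial>lborel)"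
    by (rule nn_integral_count_space_nn_integral[symmetric]) auto
  also have "\<dots> \<le> (\<integral>\<^sup>+y. F y * 1 \<partial>lborel)"
  proof (rule nn_integral_mono)
    fix y :: "real^'n"
    have "(\<integral>\<^sup>+m. D (y - g *v m) \<partial>count_space int_lattice) \<le> 1"
      unfolding D_def by (rule nn_integral_count_space_le_1) (rule frame_cell_disjoint[OF ij g p])
    then show "(\<integral>\<^sup>+m. F y * D (y - g *v m) \<partial>count_space int_lattice) \<le> F y * 1"
      using mult_left_mono[of _ 1 "F y"] by (subst nn_integral_cmult) auto
  qed
  finally show ?thesis by simp
qed

text \<open>Representatives of the primitive vectors off the \<open>i\<close>-axis modulo the stabiliser of \<open>axis i 1\<close> in \<open>SL_int\<close>.\<close>

definition reduced_vecs :: "'n \<Rightarrow> 'n \<Rightarrow> (real^'n) set" where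
  "reduced_vecs i j = {m \<in> prim_vecs i. 0 \<le> m $ i \<and> m $ i < \<bar>m $ j\<bar>}"

lemma countable_reduced_vecs [simp]: "countable (reduced_vecs i j)"
  by (rule countable_subset[OF _ countable_prim_vecs[of i]]) (auto simp: reduced_vecs_def)

text \<open>An integer matrix of determinant one fixing \<open>axis i 1\<close> adds a multiple of
  m_j to m_i and keeps m_j. The condition 0 <= m_i < |m_j| therefore leaves only the
  identity.\<close>

lemma reduced_pair_inj:
  fixes \<gamma> \<delta> :: "real^'n^'n"
  assumes ij: "(UNIV :: 'n::finite set) = {i, j}" "i \<noteq> j"
    and \<gamma>: "\<gamma> \<in> SL_int" "\<gamma>' \<in> SL_int" and m: "m \<in> reduced_vecs i j" "m' \<in> reduced_vecs i j"
    and eq: "\<gamma> *v axis i 1 = \<gamma>' *v axis i 1" "\<gamma> *v m = \<gamma>' *v m'"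
  shows "\<gamma> = \<gamma>'" "m = m'"
proof -
  define \<delta> where "\<delta> = sinv \<gamma> ** \<gamma>'"
  have \<delta>: "\<delta> \<in> SL_int" unfolding \<delta>_def by (intro SL_int_mult SL_int_sinv \<gamma>)
  note d = SL_int_det[OF \<gamma>(1)] SL_int_det[OF \<gamma>(2)] SL_int_det[OF \<delta>]
  have e: "\<delta> *v axis i 1 = axis i 1"
    unfolding \<delta>_def matrix_vector_mul_assoc[symmetric] eq(1)[symmetric] by (rule sinv_cancel[OF d(1)])
  have mm: "m = \<delta> *v m'"
    unfolding \<delta>_def matrix_vector_mul_assoc[symmetric] eq(2)[symmetric] by (simp add: sinv_cancel[OF d(1)])
  have s: "(\<Sum>b\<in>UNIV. h b) = h i + h j" for h :: "'n \<Rightarrow> real" using ij(2) by (simp add: ij(1))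
  have col: "\<delta> $ i $ i = 1" "\<delta> $ j $ i = 0"
  proof -
    have "column i \<delta> = axis i 1" using e by (simp add: matrix_vector_mult_basis)
    then show "\<delta> $ i $ i = 1" "\<delta> $ j $ i = 0" using ij(2) by (auto simp: vec_eq_iff column_def axis_def)
  qed
  have jj: "\<delta> $ j $ j = 1" using d(3) col by (simp add: det_doubleton[OF ij])
  have mj: "m $ j = m' $ j" by (simp add: mm matrix_vector_mult_def s col jj)
  have mi: "m $ i = m' $ i + \<delta> $ i $ j * m' $ j" by (simp add: mm matrix_vector_mult_def s col)
  have "\<delta> $ i $ j \<in> \<int>" using \<delta> by (simp add: SL_int_iff)
  then obtain z :: int where z: "\<delta> $ i $ j = of_int z" by (auto elim: Ints_cases)
  have "\<bar>m $ i - m' $ i\<bar> < \<bar>m' $ j\<bar>" using m mj by (auto simp: reduced_vecs_def)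
  then have "\<bar>of_int z * m' $ j\<bar> < 1 * \<bar>m' $ j\<bar>" using mi z by simp
  then have "\<bar>real_of_int z\<bar> < 1" unfolding abs_mult by (rule mult_right_less_imp_less) simp
  then have "z = 0" by simp
  then show "m = m'" using mi mj z ij(1) by (auto simp: vec_eq_iff)
  have "\<delta> $ a $ b = (mat 1 :: real^'n^'n) $ a $ b" for a b
  proof -
    have "a \<in> {i, j}" "b \<in> {i, j}" using ij(1) by blast+
    then show ?thesis using col jj z \<open>z = 0\<close> ij(2) by (auto simp: mat_def)
  qed
  then have "\<delta> = mat 1" by (simp add: vec_eq_iff)
  then have "\<gamma> ** \<delta> = \<gamma>" by simp
  then show "\<gamma> = \<gamma>'" unfolding \<delta>_def by (simp add: sinv_cancel[OF d(1)])
qed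

lemma reduced_pair_surj:
  fixes p q :: "real^'n"
  assumes ij: "(UNIV :: 'n::finite set) = {i, j}" "i \<noteq> j"
    and p: "p \<in> prim_vecs i" and q: "q \<in> prim_vecs i" and indep: "\<nexists>t. q = t *\<^sub>R p"
  shows "\<exists>\<gamma>\<in>SL_int. \<exists>m\<in>reduced_vecs i j. \<gamma> *v axis i 1 = p \<and> \<gamma> *v m = q"
proof -
  obtain \<gamma>0 where \<gamma>0: "\<gamma>0 \<in> SL_int" "p = \<gamma>0 *v axis i 1" using p by (auto simp: prim_vecs_def)
  define m0 where "m0 = sinv \<gamma>0 *v q"
  have m0p: "m0 \<in> prim_vecs i" unfolding m0_def by (intro SL_int_prim_vecs SL_int_sinv \<gamma>0 q)
  then have m0I: "m0 \<in> int_lattice" using prim_vecs_int_lattice by blast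
  have q0: "\<gamma>0 *v m0 = q" by (simp add: m0_def sinv_cancel SL_int_det[OF \<gamma>0(1)])
  have "m0 $ j \<noteq> 0"
  proof
    assume 0: "m0 $ j = 0"
    have "m0 $ a = (m0 $ i *\<^sub>R axis i 1) $ a" for a
    proof -
      have "a \<in> {i, j}" using ij(1) by blast
      then show ?thesis using 0 ij(2) by (auto simp: axis_def)
    qed
    then have "m0 = m0 $ i *\<^sub>R axis i 1" by (rule vec_eq_iff[THEN iffD2, OF allI])
    then have "\<gamma>0 *v m0 = m0 $ i *\<^sub>R p" using \<gamma>0(2) by (metis matrix_vector_mult_scaleR)
    then show False using q0 indep by auto
  qed
  have "m0 $ i \<in> \<int>" "m0 $ j \<in> \<int>" using m0I by (simp_all add: int_lattice_def)
  then obtain a b :: int where ab: "m0 $ i = of_int a" "m0 $ j = of_int b" by (elim Ints_cases)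
  have b: "b \<noteq> 0" using ab \<open>m0 $ j \<noteq> 0\<close> by auto
  \<comment> \<open>The quotient of division by |b|, with the sign that makes c b equal to the
    multiple of |b| to be subtracted; what remains is the remainder a mod |b|.\<close>
  define c where "c = real_of_int ((a div \<bar>b\<bar>) * sgn b)"
  have cI: "c \<in> \<int>" "- c \<in> \<int>" by (simp_all add: c_def)
  let ?T = "transvection i j c" and ?T' = "transvection i j (- c)"
  have TT: "?T *v (?T' *v x) = x" for x
    using ij(2) by (auto simp: transvection_vec vec_eq_iff)
  have "c * real_of_int b = real_of_int ((a div \<bar>b\<bar>) * \<bar>b\<bar>)"
    unfolding c_def of_int_mult[symmetric] mult.assoc sgn_mult_self_eq by (simp add: abs_sgn mult.commute)
  then have "(?T' *v m0) $ i = real_of_int (a mod \<bar>b\<bar>)"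
    by (simp add: transvection_vec ab minus_div_mult_eq_mod[symmetric])
  moreover have "(?T' *v m0) $ j = b" using ij(2) by (simp add: transvection_vec ab)
  moreover have "real_of_int (a mod \<bar>b\<bar>) < \<bar>real_of_int b\<bar>"
    using b by (metis of_int_abs of_int_less_iff pos_mod_bound zero_less_abs_iff)
  ultimately have "?T' *v m0 \<in> reduced_vecs i j"
    using b m0p ij(2) by (auto simp: reduced_vecs_def intro!: SL_int_prim_vecs transvection_SL_int cI)
  moreover have "\<gamma>0 ** ?T \<in> SL_int" by (intro SL_int_mult \<gamma>0 transvection_SL_int ij cI)
  moreover have "\<gamma>0 ** ?T *v axis i 1 = p"
  proof -
    have "?T *v axis i 1 = axis i 1" using ij(2) by (auto simp: transvection_vec vec_eq_iff axis_def)
    then show ?thesis by (simp add: matrix_vector_mul_assoc[symmetric] \<gamma>0(2))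
  qed
  moreover have "\<gamma>0 ** ?T *v (?T' *v m0) = q"
    by (simp add: matrix_vector_mul_assoc[symmetric] TT q0)
  ultimately show ?thesis by blast
qed

lemma nn_integral_count_space_Times:
  "(\<integral>\<^sup>+x. f x \<partial>count_space (A \<times> B)) = (\<integral>\<^sup>+a. (\<integral>\<^sup>+b. f (a, b) \<partial>count_space B) \<partial>count_space A)"
proof -
  have inner: "(\<integral>\<^sup>+b. f (a, b) * indicator (A \<times> B) (a, b) \<partial>count_space UNIV) = (\<integral>\<^sup>+b. f (a, b) \<partial>count_space B) * indicator A a" for a
  proof (cases "a \<in> A")
    case True
    have "(\<integral>\<^sup>+b. f (a, b) \<partial>count_space B) = (\<integral>\<^sup>+b. f (a, b) * indicator B b \<partial>count_space UNIV)"
      by (rule nn_integral_count_space_indicator) simp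
    also have "\<dots> = (\<integral>\<^sup>+b. f (a, b) * indicator (A \<times> B) (a, b) \<partial>count_space UNIV)"
      using True by (intro nn_integral_cong) (simp add: indicator_def)
    finally show ?thesis using True by simp
  qed simp
  have "(\<integral>\<^sup>+x. f x \<partial>count_space (A \<times> B)) = (\<integral>\<^sup>+x. f x * indicator (A \<times> B) x \<partial>count_space UNIV)"
    by (rule nn_integral_count_space_indicator) simp
  also have "\<dots> = (\<integral>\<^sup>+a. (\<integral>\<^sup>+b. f (a, b) * indicator (A \<times> B) (a, b) \<partial>count_space UNIV) \<partial>count_space UNIV)"
    by (rule nn_integral_fst_count_space[symmetric])
  also have "\<dots> = (\<integral>\<^sup>+a. (\<integral>\<^sup>+b. f (a, b) \<partial>count_space B) * indicator A a \<partial>count_space UNIV)"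
    by (simp only: inner)
  also have "\<dots> = (\<integral>\<^sup>+a. (\<integral>\<^sup>+b. f (a, b) \<partial>count_space B) \<partial>count_space A)"
    by (rule nn_integral_count_space_indicator[symmetric]) simp
  finally show ?thesis .
qed

text \<open>Orbit decomposition of independent primitive pairs. For fixed m the pair is a function
  of the basis g \<gamma>, so its expected sum is a \<open>basis_int\<close> and enjoys the
  symmetries of Haar measure.\<close>

lemma sum_prim_pairs:
  fixes \<Phi> :: "real^'n \<Rightarrow> real^'n \<Rightarrow> ennreal"
  assumes ij: "(UNIV :: 'n::finite set) = {i, j}" "i \<noteq> j" and dep: "\<And>p t. \<Phi> p (t *\<^sub>R p) = 0"
  shows "(\<integral>\<^sup>+p. (\<integral>\<^sup>+q. \<Phi> p q \<partial>count_space (prim_vecs i)) \<partial>count_space (prim_vecs i)) =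
    (\<integral>\<^sup>+m. (\<integral>\<^sup>+\<gamma>. \<Phi> (\<gamma> *v axis i 1) (\<gamma> *v m) \<partial>count_space SL_int) \<partial>count_space (reduced_vecs i j))"
proof -
  define S where "S = {(p, q). p \<in> prim_vecs i \<and> q \<in> prim_vecs i \<and> (\<nexists>t. q = t *\<^sub>R p)}"
  let ?F = "\<lambda>(m, \<gamma>). (\<gamma> *v axis i 1, \<gamma> *v m)"
  have bij: "bij_betw ?F (reduced_vecs i j \<times> SL_int) S"
    unfolding bij_betw_def
  proof
    show "inj_on ?F (reduced_vecs i j \<times> SL_int)"
      by (rule inj_onI) (auto dest: reduced_pair_inj[OF ij])
    show "?F ` (reduced_vecs i j \<times> SL_int) = S"
    proof (intro equalityI subsetI)
      fix x assume "x \<in> ?F ` (reduced_vecs i j \<times> SL_int)"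
      then obtain m \<gamma> where *: "m \<in> reduced_vecs i j" "\<gamma> \<in> SL_int" "x = (\<gamma> *v axis i 1, \<gamma> *v m)" by auto
      have "\<gamma> *v m \<noteq> t *\<^sub>R (\<gamma> *v axis i 1)" for t
      proof
        assume "\<gamma> *v m = t *\<^sub>R (\<gamma> *v axis i 1)"
        then have "sinv \<gamma> *v (\<gamma> *v m) = t *\<^sub>R (sinv \<gamma> *v (\<gamma> *v axis i 1))" by (simp add: matrix_vector_mult_scaleR)
        then have "m = t *\<^sub>R axis i 1" by (simp add: sinv_cancel SL_int_det[OF *(2)])
        then show False using *(1) ij(2) by (auto simp: reduced_vecs_def axis_def)
      qed
      then show "x \<in> S"
        using * by (auto simp: S_def reduced_vecs_def SL_int_prim_vecs) (auto simp: prim_vecs_def)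
    next
      fix x assume "x \<in> S"
      then show "x \<in> ?F ` (reduced_vecs i j \<times> SL_int)"
      proof (cases x)
        case (Pair p q)
        then have "p \<in> prim_vecs i" "q \<in> prim_vecs i" "\<nexists>t. q = t *\<^sub>R p" using \<open>x \<in> S\<close> by (simp_all add: S_def)
        then obtain \<gamma> m where "\<gamma> \<in> SL_int" "m \<in> reduced_vecs i j" "\<gamma> *v axis i 1 = p" "\<gamma> *v m = q"
          using reduced_pair_surj[OF ij] by metis
        then have "x = ?F (m, \<gamma>)" "(m, \<gamma>) \<in> reduced_vecs i j \<times> SL_int" by (simp_all add: Pair)
        then show ?thesis by (rule image_eqI)
      qed
    qed
  qed
  have "(\<integral>\<^sup>+p. (\<integral>\<^sup>+q. \<Phi> p q \<partial>count_space (prim_vecs i)) \<partial>count_space (prim_vecs i)) =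
    (\<integral>\<^sup>+x. case_prod \<Phi> x \<partial>count_space (prim_vecs i \<times> prim_vecs i))"
    using nn_integral_count_space_Times[of "prim_vecs i" "prim_vecs i" "case_prod \<Phi>"] by simp
  also have "\<dots> = (\<integral>\<^sup>+x. case_prod \<Phi> x * indicator (prim_vecs i \<times> prim_vecs i) x \<partial>count_space UNIV)"
    by (rule nn_integral_count_space_indicator) simp
  also have "\<dots> = (\<integral>\<^sup>+x. case_prod \<Phi> x * indicator S x \<partial>count_space UNIV)"
    by (rule nn_integral_cong) (auto simp: S_def indicator_def dep)
  also have "\<dots> = (\<integral>\<^sup>+x. case_prod \<Phi> x \<partial>count_space S)"
    by (rule nn_integral_count_space_indicator[symmetric]) simp
  also have "\<dots> = (\<integral>\<^sup>+x. case_prod \<Phi> (?F x) \<partial>count_space (reduced_vecs i j \<times> SL_int))"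
    by (rule nn_integral_bij_count_space[OF bij, symmetric])
  finally show ?thesis
    using nn_integral_count_space_Times[of "reduced_vecs i j" SL_int "\<lambda>x. case_prod \<Phi> (?F x)"] by simp
qed

section \<open>Scaling symmetry of planar pairs\<close>

definition prim_pair :: "'n::finite \<Rightarrow> (real^'n^'n) measure \<Rightarrow> (real^'n \<Rightarrow> real^'n \<Rightarrow> ennreal) \<Rightarrow> ennreal" where
  "prim_pair i \<pi> \<Psi> = (\<integral>\<^sup>+g. (\<integral>\<^sup>+p. (\<integral>\<^sup>+q. \<Psi> (g *v p) (g *v q) \<partial>count_space (prim_vecs i)) \<partial>count_space (prim_vecs i)) \<partial>\<pi>)"

text \<open>The law gives left invariance only. Invariance under right multiplication by real
  matrices is inherited from Haar measure, which is unimodular.\<close>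

lemma basis_int_right:
  fixes \<pi> :: "(real^'n^'n) measure"
  assumes \<pi>: "inv_law \<pi>" and [measurable]: "F \<in> borel_measurable borel" and s: "det s = 1"
  shows "basis_int \<pi> (\<lambda>X. F (X ** s)) = basis_int \<pi> F"
  by (rule basis_int_cong_haar[OF \<pi>]) (simp_all add: haar_int_right s)

lemma prim_pair_basis_int:
  fixes \<pi> :: "(real^'n^'n) measure"
  assumes \<pi>: "inv_law \<pi>" and ij: "(UNIV :: 'n::finite set) = {i, j}" "i \<noteq> j"
    and m: "case_prod \<Psi> \<in> borel_measurable (borel \<Otimes>\<^sub>M borel)" and dep: "\<And>v t. \<Psi> v (t *\<^sub>R v) = 0"
  shows "prim_pair i \<pi> \<Psi> = (\<integral>\<^sup>+m. basis_int \<pi> (\<lambda>X. \<Psi> (X *v axis i 1) (X *v m)) \<partial>count_space (reduced_vecs i j))"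
proof -
  note [measurable] = measurable_split_compose[OF m]
  note [measurable_cong] = inv_law_D(2)[OF \<pi>]
  have "prim_pair i \<pi> \<Psi> = (\<integral>\<^sup>+g. (\<integral>\<^sup>+m. (\<integral>\<^sup>+\<gamma>. \<Psi> (g *v (\<gamma> *v axis i 1)) (g *v (\<gamma> *v m)) \<partial>count_space SL_int) \<partial>count_space (reduced_vecs i j)) \<partial>\<pi>)"
    unfolding prim_pair_def
    by (subst sum_prim_pairs[OF ij]) (simp_all add: matrix_vector_mult_scaleR dep)
  also have "\<dots> = (\<integral>\<^sup>+m. (\<integral>\<^sup>+g. (\<integral>\<^sup>+\<gamma>. \<Psi> (g *v (\<gamma> *v axis i 1)) (g *v (\<gamma> *v m)) \<partial>count_space SL_int) \<partial>\<pi>) \<partial>count_space (reduced_vecs i j))"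
    by (rule nn_integral_count_space_nn_integral) (simp, measurable)
  finally show ?thesis by (simp add: basis_int_def matrix_vector_mul_assoc)
qed

text \<open>For each reduced m the vectors \<open>axis i 1\<close> and m are independent, so a
  determinant one matrix scales the first by l and the second by 1 / l. Multiplying all bases by it
  on the right is harmless.\<close>

theorem prim_pair_scaling:
  fixes \<pi> :: "(real^'n^'n) measure"
  assumes \<pi>: "inv_law \<pi>" and ij: "(UNIV :: 'n::finite set) = {i, j}" "i \<noteq> j"
    and m: "case_prod \<Psi> \<in> borel_measurable (borel \<Otimes>\<^sub>M borel)" and dep: "\<And>v t. \<Psi> v (t *\<^sub>R v) = 0" and l: "l > 0"
  shows "prim_pair i \<pi> (\<lambda>v w. \<Psi> (l *\<^sub>R v) ((1 / l) *\<^sub>R w)) = prim_pair i \<pi> \<Psi>"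
proof -
  note [measurable] = measurable_split_compose[OF m]
  have dep': "\<Psi> (l *\<^sub>R v) ((1 / l) *\<^sub>R (t *\<^sub>R v)) = 0" for v t
    using dep[of "l *\<^sub>R v" "t / l\<^sup>2"] l by (simp add: power2_eq_square)
  have m': "case_prod (\<lambda>v w. \<Psi> (l *\<^sub>R v) ((1 / l) *\<^sub>R w)) \<in> borel_measurable (borel \<Otimes>\<^sub>M borel)"
    unfolding split_beta' by measurable
  have "basis_int \<pi> (\<lambda>X. \<Psi> (l *\<^sub>R (X *v axis i 1)) ((1 / l) *\<^sub>R (X *v m))) = basis_int \<pi> (\<lambda>X. \<Psi> (X *v axis i 1) (X *v m))"
    if mr: "m \<in> reduced_vecs i j" for m
  proof -
    have mj: "m $ j \<noteq> 0" using mr by (auto simp: reduced_vecs_def)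
    \<comment> \<open>The entry above the diagonal is the only one for which m is an eigenvector
      with eigenvalue 1 / l; dividing by m_j is possible since m is reduced.\<close>
    define s :: "real^'n^'n" where "s = (\<chi> a b. if b = i then (if a = i then l else 0)
      else if a = i then (m $ i / l - l * m $ i) / m $ j else 1 / l)"
    have sum2: "(\<Sum>b\<in>UNIV. h b) = h i + h j" for h :: "'n \<Rightarrow> real" using ij(2) by (simp add: ij(1))
    have all2: "(\<forall>a::'n. P a) \<longleftrightarrow> P i \<and> P j" for P using ij(1) by (metis UNIV_I insertE singletonD)
    have "det s = 1" using ij(2) l by (simp add: det_doubleton[OF ij] s_def)
    moreover have "s *v axis i 1 = l *\<^sub>R axis i 1" "s *v m = (1 / l) *\<^sub>R m"
      using ij(2) l mj by (auto simp: vec_eq_iff all2 matrix_vector_mult_def sum2 s_def axis_def field_simps)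
    ultimately show ?thesis
      using basis_int_right[OF \<pi>, of "\<lambda>X. \<Psi> (X *v axis i 1) (X *v m)" s]
      by (simp add: matrix_vector_mul_assoc[symmetric] matrix_vector_mult_scaleR)
  qed
  then show ?thesis
    unfolding prim_pair_basis_int[OF \<pi> ij m dep] prim_pair_basis_int[OF \<pi> ij m' dep']
    by (intro nn_integral_cong) simp
qed

text \<open>The Lipschitz constant controls the error of the packing estimate. The inner radius a
  bounds the rectangle side \<open>1 / norm v\<close>, and the outer radius b excludes independent
  pairs at large scales.\<close>

locale planar_test =
  fixes \<pi> :: "(real^'n^'n) measure" and i j :: "'n::finite" and f :: "real^'n \<Rightarrow> real" and L a b :: real
  assumes inv: "inv_law \<pi>" and ij: "(UNIV :: 'n set) = {i, j}" "i \<noteq> j"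
    and nonneg: "0 \<le> f v" and le_1: "f v \<le> 1"
    and lipschitz: "\<bar>f x - f y\<bar> \<le> L * norm (x - y)" and L: "L \<ge> 0"
    and supp: "f v \<noteq> 0 \<Longrightarrow> a \<le> norm v \<and> norm v \<le> b" and ab: "0 < a" "a \<le> b"
begin

lemma card: "CARD('n) = 2"
  by (subst ij(1)) (simp add: ij(2))

definition \<phi> :: "real^'n \<Rightarrow> ennreal" where "\<phi> v = ennreal (f v)"
definition c :: real where "c = 1 / zeta 2"
definition mass :: real where "mass = enn2real (\<integral>\<^sup>+v. \<phi> v \<partial>lborel)"
definition count :: "real \<Rightarrow> real^'n^'n \<Rightarrow> ennreal" where
  "count s g = (\<integral>\<^sup>+p. \<phi> (s *\<^sub>R (g *v p)) \<partial>count_space (prim_vecs i))"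
definition indep :: "real^'n \<Rightarrow> real^'n \<Rightarrow> ennreal" where "indep v w = of_bool (\<nexists>t. w = t *\<^sub>R v)"
definition corr :: "real \<Rightarrow> ennreal" where
  "corr s = prim_pair i \<pi> (\<lambda>v w. \<phi> v * \<phi> (s *\<^sub>R w) * indep v w)"

lemma measurable_f [measurable]: "f \<in> borel_measurable borel"
proof -
  have "L-lipschitz_on UNIV f"
    using lipschitz L by (intro lipschitz_onI) (auto simp: dist_norm)
  then show ?thesis by (intro borel_measurable_continuous_onI lipschitz_on_continuous_on)
qed

lemma measurable_\<phi> [measurable]: "\<phi> \<in> borel_measurable borel"
  unfolding \<phi>_def by measurable

lemma measurable_indep: "case_prod indep \<in> borel_measurable (borel \<Otimes>\<^sub>M borel)"
  unfolding indep_def by (rule borel_measurable_multiple)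

lemmas [measurable (raw)] = measurable_split_compose[OF measurable_indep]

lemma measurable_count [measurable]: "count s \<in> borel_measurable borel"
  unfolding count_def by measurable

lemma \<phi>_le_1: "\<phi> v \<le> 1"
  using le_1 by (simp add: \<phi>_def)

lemma \<phi>_supp: "\<phi> v \<noteq> 0 \<Longrightarrow> a \<le> norm v \<and> norm v \<le> b"
  using supp[of v] by (cases "f v = 0") (simp_all add: \<phi>_def)

lemma c_bounds: "0 < c" "c \<le> 1"
  using zeta_bounds(1)[of 2] by (simp_all add: c_def)

lemma nn_integral_\<phi>: "(\<integral>\<^sup>+v. \<phi> v \<partial>lborel) = ennreal mass" and mass_nonneg: "mass \<ge> 0"
proof -
  have "\<phi> v \<le> indicator (cball 0 b) v" for v
    using \<phi>_le_1[of v] \<phi>_supp[of v] by (cases "\<phi> v = 0") (auto simp: indicator_def)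
  then have "(\<integral>\<^sup>+v. \<phi> v \<partial>lborel) \<le> (\<integral>\<^sup>+v. indicator (cball 0 b) v \<partial>(lborel :: (real^'n) measure))"
    by (rule nn_integral_mono)
  also have "\<dots> < \<infinity>" using emeasure_lborel_cball_finite[of "0::real^'n" b] by simp
  finally show "(\<integral>\<^sup>+v. \<phi> v \<partial>lborel) = ennreal mass" by (simp add: mass_def)
  show "mass \<ge> 0" by (simp add: mass_def)
qed

lemma nn_integral_count:
  assumes "s > 0" shows "(\<integral>\<^sup>+g. count s g \<partial>\<pi>) = ennreal (c * mass / s\<^sup>2)"
proof -
  have "(\<integral>\<^sup>+g. count s g \<partial>\<pi>) = prim_int i \<pi> (\<lambda>v. \<phi> (s *\<^sub>R v))"
    by (simp add: count_def prim_int_def)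
  also have "\<dots> = ennreal (1 / zeta 2) * (ennreal (1 / s\<^sup>2) * ennreal mass)"
    using prim_mean_value[OF inv, of "\<lambda>v. \<phi> (s *\<^sub>R v)" i] nn_integral_vec_scaleR'[OF measurable_\<phi> assms]
    by (simp add: card nn_integral_\<phi>)
  also have "\<dots> = ennreal (c * mass / s\<^sup>2)"
    using mass_nonneg c_bounds by (simp add: ennreal_mult[symmetric] c_def)
  finally show ?thesis .
qed

lemma indep_scaleR: "s \<noteq> 0 \<Longrightarrow> t \<noteq> 0 \<Longrightarrow> indep (s *\<^sub>R v) (t *\<^sub>R w) = indep v w"
proof -
  assume st: "s \<noteq> 0" "t \<noteq> 0"
  have "(\<exists>r. t *\<^sub>R w = r *\<^sub>R (s *\<^sub>R v)) \<longleftrightarrow> (\<exists>r. w = r *\<^sub>R v)"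
  proof
    assume "\<exists>r. t *\<^sub>R w = r *\<^sub>R (s *\<^sub>R v)"
    then obtain r where "t *\<^sub>R w = r *\<^sub>R (s *\<^sub>R v)" ..
    then have "(1 / t) *\<^sub>R (t *\<^sub>R w) = (1 / t) *\<^sub>R (r *\<^sub>R (s *\<^sub>R v))" by simp
    then have "w = (r * s / t) *\<^sub>R v" using st by simp
    then show "\<exists>r. w = r *\<^sub>R v" ..
  next
    assume "\<exists>r. w = r *\<^sub>R v"
    then obtain r where "w = r *\<^sub>R v" ..
    then have "t *\<^sub>R w = (t * r / s) *\<^sub>R (s *\<^sub>R v)" using st by simp
    then show "\<exists>r. t *\<^sub>R w = r *\<^sub>R (s *\<^sub>R v)" ..
  qed
  then show ?thesis by (simp add: indep_def)
qed

text \<open>By the scaling symmetry only the product of the two scales matters; in particular scales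
  s and 1 / s give the correlation at scale 1.\<close>

lemma corr_scaling:
  assumes "s > 0" "t > 0"
  shows "prim_pair i \<pi> (\<lambda>v w. \<phi> (s *\<^sub>R v) * \<phi> (t *\<^sub>R w) * indep v w) = corr (s * t)"
proof -
  have "case_prod (\<lambda>v w. \<phi> v * \<phi> ((s * t) *\<^sub>R w) * indep v w) \<in> borel_measurable (borel \<Otimes>\<^sub>M borel)"
    unfolding split_beta' by measurable
  from prim_pair_scaling[OF inv ij this _ assms(1)] show ?thesis
    using assms by (simp add: corr_def indep_scaleR) (simp add: indep_def)
qed

lemma corr_le_count:
  assumes "s > 0" "t > 0"
  shows "corr (s * t) \<le> (\<integral>\<^sup>+g. count s g * count t g \<partial>\<pi>)"
proof -
  have "corr (s * t) \<le> prim_pair i \<pi> (\<lambda>v w. \<phi> (s *\<^sub>R v) * \<phi> (t *\<^sub>R w))"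
    unfolding corr_scaling[OF assms, symmetric] prim_pair_def
    by (intro nn_integral_mono) (auto simp: indep_def)
  also have "\<dots> = (\<integral>\<^sup>+g. count s g * count t g \<partial>\<pi>)"
    by (simp add: prim_pair_def count_def nn_integral_cmult nn_integral_multc)
  finally show ?thesis .
qed

lemma prim_vecs_uminus: "p \<in> prim_vecs i \<Longrightarrow> q \<in> prim_vecs i \<Longrightarrow> q = t *\<^sub>R p \<Longrightarrow> q = p \<or> q = - p"
proof -
  assume p: "p \<in> prim_vecs i" and q: "q \<in> prim_vecs i" and t: "q = t *\<^sub>R p"
  have pI: "p \<in> int_lattice" and qI: "q \<in> int_lattice" using p q prim_vecs_int_lattice by blast+
  obtain z :: int where z: "t = of_int z" using dependent_multiples[OF p qI t] by blast
  have "q \<noteq> 0" using q prim_vecs_nonzero by blast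
  then have t0: "t \<noteq> 0" using t by auto
  have "p = (1 / t) *\<^sub>R q" using t t0 by simp
  then obtain z' :: int where z': "1 / t = of_int z'" using dependent_multiples[OF q pI] by blast
  have "of_int (z * z') = (1 :: real)" using t0 by (simp add: z[symmetric] z'[symmetric])
  then have "z * z' = 1" by (simp only: of_int_eq_1_iff)
  then have "z = 1 \<or> z = -1" using zmult_eq_1_iff by auto
  then show "q = p \<or> q = - p" using t z by auto
qed

text \<open>A primitive vector has at most two dependent primitive partners, itself and its
  negative, and each contributes at most one further count.\<close>

lemma count_square_le:
  assumes s: "s > 0"
  shows "(\<integral>\<^sup>+g. (count s g)\<^sup>2 \<partial>\<pi>) \<le> corr (s\<^sup>2) + ennreal (2 * c * mass / s\<^sup>2)"
proof -
  note [measurable_cong] = inv_law_D(2)[OF inv]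
  have pw: "(count s g)\<^sup>2 \<le> (\<integral>\<^sup>+p. (\<integral>\<^sup>+q. \<phi> (s *\<^sub>R (g *v p)) * \<phi> (s *\<^sub>R (g *v q)) * indep (g *v p) (g *v q) \<partial>count_space (prim_vecs i)) \<partial>count_space (prim_vecs i))
      + 2 * count s g" if g: "det g = 1" for g
  proof -
    have "(count s g)\<^sup>2 = (\<integral>\<^sup>+p. \<phi> (s *\<^sub>R (g *v p)) * (\<integral>\<^sup>+q. \<phi> (s *\<^sub>R (g *v q)) \<partial>count_space (prim_vecs i)) \<partial>count_space (prim_vecs i))"
      by (simp add: power2_eq_square count_def nn_integral_multc)
    also have "\<dots> \<le> (\<integral>\<^sup>+p. (\<integral>\<^sup>+q. \<phi> (s *\<^sub>R (g *v p)) * \<phi> (s *\<^sub>R (g *v q)) * indep (g *v p) (g *v q) \<partial>count_space (prim_vecs i))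
      + 2 * \<phi> (s *\<^sub>R (g *v p)) \<partial>count_space (prim_vecs i))"
    proof (rule nn_integral_mono)
      fix p :: "real^'n" assume "p \<in> space (count_space (prim_vecs i))"
      then have p: "p \<in> prim_vecs i" by simp
      let ?P = "prim_vecs i"
      have "(\<integral>\<^sup>+q. \<phi> (s *\<^sub>R (g *v q)) \<partial>count_space ?P) \<le>
        (\<integral>\<^sup>+q. \<phi> (s *\<^sub>R (g *v q)) * indep (g *v p) (g *v q) + (indicator {p} q + indicator {- p} q) \<partial>count_space ?P)"
      proof (rule nn_integral_mono)
        fix q :: "real^'n" assume "q \<in> space (count_space ?P)"
        then have q: "q \<in> ?P" by simp
        show "\<phi> (s *\<^sub>R (g *v q)) \<le> \<phi> (s *\<^sub>R (g *v q)) * indep (g *v p) (g *v q) + (indicator {p} q + indicator {- p} q)"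
        proof (cases "\<exists>t. g *v q = t *\<^sub>R (g *v p)")
          case True
          then obtain t where "g *v q = t *\<^sub>R (g *v p)" ..
          then have "sinv g *v (g *v q) = t *\<^sub>R (sinv g *v (g *v p))" by (simp add: matrix_vector_mult_scaleR)
          then have "q = t *\<^sub>R p" by (simp add: sinv_cancel g)
          then have "q = p \<or> q = - p" by (rule prim_vecs_uminus[OF p q])
          then have "(1::ennreal) \<le> indicator {p} q + indicator {- p} q" by (auto simp: indicator_def)
          then show ?thesis using \<phi>_le_1 by (meson add_increasing order_trans zero_le)
        qed (simp add: indep_def)
      qed
      also have "\<dots> = (\<integral>\<^sup>+q. \<phi> (s *\<^sub>R (g *v q)) * indep (g *v p) (g *v q) \<partial>count_space ?P) +
          ((\<integral>\<^sup>+q. indicator {p} q \<partial>count_space ?P) + (\<integral>\<^sup>+q. indicator {- p} q \<partial>count_space ?P))"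
        by (simp add: nn_integral_add)
      also have "\<dots> \<le> (\<integral>\<^sup>+q. \<phi> (s *\<^sub>R (g *v q)) * indep (g *v p) (g *v q) \<partial>count_space ?P) + 2"
      proof -
        have "(\<integral>\<^sup>+q. indicator {x} q \<partial>count_space ?P) \<le> (1::ennreal)" for x
          using nn_integral_count_space_le_1[of ?P "\<lambda>q. q = x"] by (simp add: indicator_def of_bool_def)
        from add_mono[OF this[of p] this[of "- p"]] show ?thesis by (intro add_left_mono) simp
      qed
      finally show "\<phi> (s *\<^sub>R (g *v p)) * (\<integral>\<^sup>+q. \<phi> (s *\<^sub>R (g *v q)) \<partial>count_space ?P) \<le>
        (\<integral>\<^sup>+q. \<phi> (s *\<^sub>R (g *v p)) * \<phi> (s *\<^sub>R (g *v q)) * indep (g *v p) (g *v q) \<partial>count_space ?P) + 2 * \<phi> (s *\<^sub>R (g *v p))"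
        by (subst mult.assoc, subst nn_integral_cmult)
           (auto simp: distrib_left[symmetric] mult.commute[of 2] intro!: mult_left_mono)
    qed
    also have "\<dots> = (\<integral>\<^sup>+p. (\<integral>\<^sup>+q. \<phi> (s *\<^sub>R (g *v p)) * \<phi> (s *\<^sub>R (g *v q)) * indep (g *v p) (g *v q) \<partial>count_space (prim_vecs i)) \<partial>count_space (prim_vecs i)) + 2 * count s g"
      by (simp add: nn_integral_add nn_integral_cmult count_def)
    finally show ?thesis .
  qed
  have "(\<integral>\<^sup>+g. (count s g)\<^sup>2 \<partial>\<pi>) \<le> (\<integral>\<^sup>+g. (\<integral>\<^sup>+p. (\<integral>\<^sup>+q. \<phi> (s *\<^sub>R (g *v p)) * \<phi> (s *\<^sub>R (g *v q)) * indep (g *v p) (g *v q) \<partial>count_space (prim_vecs i)) \<partial>count_space (prim_vecs i))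
      + 2 * count s g \<partial>\<pi>)"
    using inv_law_D(3)[OF inv] by (intro nn_integral_mono_AE, elim eventually_mono) (rule pw)
  also have "\<dots> = corr (s * s) + 2 * (\<integral>\<^sup>+g. count s g \<partial>\<pi>)"
    unfolding corr_scaling[OF s s, symmetric] prim_pair_def
    by (subst nn_integral_add) (simp_all add: nn_integral_cmult)
  also have "2 * (\<integral>\<^sup>+g. count s g \<partial>\<pi>) = ennreal (2 * c * mass / s\<^sup>2)"
    unfolding nn_integral_count[OF s] using c_bounds mass_nonneg
    by (simp add: ennreal_mult[symmetric] ennreal_numeral[symmetric] del: ennreal_numeral)
  finally show ?thesis by (simp add: power2_eq_square)
qed

text \<open>Lipschitz constant, times the displacement bound b + 1 / a inside a rectangle, times the
  area of a disc containing every displaced support point.\<close>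

definition err :: real where
  "err = L * (b + 1 / a) * measure lborel (cball (0::real^'n) (b + (b + 1 / a)))"

lemma err_nonneg: "err \<ge> 0"
  using L ab by (simp add: err_def)

text \<open>Positive multiples of primitive vectors exhaust the nonzero lattice points. Summing the
  scales e / R therefore counts all lattice points in a region of size R, and packing bounds that
  count by its area up to a boundary term linear in R.\<close>

lemma suminf_corr_le:
  assumes R: "R \<ge> 1"
  shows "(\<Sum>e. corr (real (Suc e) / R)) \<le> ennreal (c * mass * (mass * R\<^sup>2 + err * R))"
proof -
  note [measurable_cong] = inv_law_D(2)[OF inv]
  let ?P = "prim_vecs i" and ?\<delta> = "b + 1 / a"
  have cb [measurable]: "cball (0::real^'n) r \<in> sets borel" for r by simp
  have \<delta>: "?\<delta> \<ge> 0" using ab by simp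
  \<comment> \<open>An upper envelope of \<phi>: after division by R, points of one rectangle differ
    by at most ?\<delta> / R, and R >= 1 keeps them inside the enlarged disc.\<close>
  define G where "G z = \<phi> z + ennreal (L * ?\<delta> / R) * indicator (cball 0 (b + ?\<delta>)) z" for z
  have [measurable]: "G \<in> borel_measurable borel" unfolding G_def by measurable
  have G: "\<phi> ((1 / R) *\<^sub>R x) \<le> G ((1 / R) *\<^sub>R y)" if xy: "norm (y - x) \<le> ?\<delta>" for x y
  proof (cases "f ((1 / R) *\<^sub>R x) = 0")
    case False
    have "norm ((1 / R) *\<^sub>R y) \<le> norm ((1 / R) *\<^sub>R x) + norm ((1 / R) *\<^sub>R (y - x))"
      by (metis add.commute diff_add_cancel norm_triangle_ineq scaleR_add_right)
    also have "norm ((1 / R) *\<^sub>R x) \<le> b" using supp[OF False] by simp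
    also have d: "norm ((1 / R) *\<^sub>R (y - x)) \<le> ?\<delta> / R" using xy R by (simp add: divide_right_mono)
    also have "?\<delta> / R \<le> ?\<delta> / 1" by (rule divide_left_mono) (use \<delta> R in auto)
    finally have y: "(1 / R) *\<^sub>R y \<in> cball 0 (b + ?\<delta>)" by simp
    have "f ((1 / R) *\<^sub>R x) \<le> f ((1 / R) *\<^sub>R y) + L * norm ((1 / R) *\<^sub>R (y - x))"
      using lipschitz[of "(1 / R) *\<^sub>R y" "(1 / R) *\<^sub>R x"] by (simp add: scaleR_diff_right[symmetric] del: norm_scaleR)
    also have "L * norm ((1 / R) *\<^sub>R (y - x)) \<le> L * (?\<delta> / R)" by (rule mult_left_mono[OF d L])
    finally have "\<phi> ((1 / R) *\<^sub>R x) \<le> ennreal (f ((1 / R) *\<^sub>R y) + L * (?\<delta> / R))"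
      unfolding \<phi>_def by (intro ennreal_leI) simp
    then show ?thesis using y nonneg L \<delta> R by (simp add: G_def \<phi>_def ennreal_plus[symmetric] del: ennreal_plus)
  qed (simp add: \<phi>_def)
  have IG: "(\<integral>\<^sup>+y. G ((1 / R) *\<^sub>R y) \<partial>lborel) = ennreal (mass * R\<^sup>2 + err * R)"
  proof -
    have "(\<integral>\<^sup>+y. G ((1 / R) *\<^sub>R y) \<partial>lborel) = ennreal (R\<^sup>2) * (\<integral>\<^sup>+y. G y \<partial>lborel)"
      using R by (subst nn_integral_vec_scaleR'[where h=G]) (simp_all add: card power_one_over)
    also have "(\<integral>\<^sup>+y. G y \<partial>lborel) = ennreal mass + ennreal (L * ?\<delta> / R) * emeasure lborel (cball (0::real^'n) (b + ?\<delta>))"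
      unfolding G_def by (subst nn_integral_add) (simp_all add: nn_integral_\<phi> nn_integral_cmult_indicator)
    also have "emeasure lborel (cball (0::real^'n) (b + ?\<delta>)) = ennreal (measure lborel (cball (0::real^'n) (b + ?\<delta>)))"
      by (rule emeasure_eq_ennreal_measure) (use emeasure_lborel_cball_finite[of "0::real^'n" "b + ?\<delta>"] in auto)
    also have "ennreal (R\<^sup>2) * (ennreal mass + ennreal (L * ?\<delta> / R) * ennreal (measure lborel (cball (0::real^'n) (b + ?\<delta>)))) =
      ennreal (R\<^sup>2 * (mass + L * ?\<delta> / R * measure lborel (cball (0::real^'n) (b + ?\<delta>))))"
    proof -
      have "ennreal (R\<^sup>2) * (ennreal mass + ennreal x * ennreal \<kappa>) = ennreal (R\<^sup>2 * (mass + x * \<kappa>))"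
        if "x \<ge> 0" "\<kappa> \<ge> 0" for x \<kappa>
        using that mass_nonneg by (simp add: ennreal_mult ennreal_plus)
      then show ?thesis using R L \<delta> by simp
    qed
    also have "R\<^sup>2 * (mass + L * ?\<delta> / R * measure lborel (cball (0::real^'n) (b + ?\<delta>))) = mass * R\<^sup>2 + err * R"
      using R by (simp add: err_def field_simps power2_eq_square)
    finally show ?thesis .
  qed
  have pw: "(\<Sum>e. \<integral>\<^sup>+p. (\<integral>\<^sup>+q. \<phi> (g *v p) * \<phi> ((real (Suc e) / R) *\<^sub>R (g *v q)) * indep (g *v p) (g *v q) \<partial>count_space ?P) \<partial>count_space ?P)
    \<le> count 1 g * ennreal (mass * R\<^sup>2 + err * R)" if g: "det g = 1" for g
  proof -
    let ?h = "\<lambda>m. \<phi> ((1 / R) *\<^sub>R (g *v m))"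
    have "(\<Sum>e. \<integral>\<^sup>+p. (\<integral>\<^sup>+q. \<phi> (g *v p) * \<phi> ((real (Suc e) / R) *\<^sub>R (g *v q)) * indep (g *v p) (g *v q) \<partial>count_space ?P) \<partial>count_space ?P)
      \<le> (\<Sum>e. \<integral>\<^sup>+p. (\<integral>\<^sup>+q. \<phi> (g *v p) * ?h (real (Suc e) *\<^sub>R q) \<partial>count_space ?P) \<partial>count_space ?P)"
      by (intro suminf_le summableI nn_integral_mono) (auto simp: indep_def matrix_vector_mult_scaleR)
    also have "\<dots> = (\<integral>\<^sup>+p. \<phi> (g *v p) * (\<Sum>e. \<integral>\<^sup>+q. ?h (real (Suc e) *\<^sub>R q) \<partial>count_space ?P) \<partial>count_space ?P)"
      by (subst nn_integral_suminf[symmetric]) (simp_all add: nn_integral_cmult)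
    also have "(\<Sum>e. \<integral>\<^sup>+q. ?h (real (Suc e) *\<^sub>R q) \<partial>count_space ?P) = (\<integral>\<^sup>+m. ?h m \<partial>count_space (int_lattice - {0}))"
      by (rule sum_int_lattice_eq_sum_prim[symmetric]) (simp add: card)
    also have "\<dots> = (\<integral>\<^sup>+m. ?h m \<partial>count_space int_lattice)"
      by (rule nn_integral_count_space_remove_0) (use \<phi>_supp[of 0] ab in auto)
    also have "(\<integral>\<^sup>+p. \<phi> (g *v p) * (\<integral>\<^sup>+m. ?h m \<partial>count_space int_lattice) \<partial>count_space ?P) \<le>
      (\<integral>\<^sup>+p. \<phi> (g *v p) * ennreal (mass * R\<^sup>2 + err * R) \<partial>count_space ?P)"
    proof (rule nn_integral_mono)
      fix p :: "real^'n" assume "p \<in> space (count_space ?P)"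
      then have p: "p \<in> ?P" by simp
      show "\<phi> (g *v p) * (\<integral>\<^sup>+m. ?h m \<partial>count_space int_lattice) \<le> \<phi> (g *v p) * ennreal (mass * R\<^sup>2 + err * R)"
      proof (cases "\<phi> (g *v p) = 0")
        case False
        then have v: "a \<le> norm (g *v p)" "norm (g *v p) \<le> b" using \<phi>_supp by auto
        then have "norm (g *v p) + 1 / norm (g *v p) \<le> ?\<delta>"
          using ab by (intro add_mono frac_le) auto
        then have "(\<integral>\<^sup>+m. ?h m \<partial>count_space int_lattice) \<le> (\<integral>\<^sup>+y. G ((1 / R) *\<^sub>R y) \<partial>lborel)"
          by (intro packing_bound[OF ij g p, where f="\<lambda>x. \<phi> ((1 / R) *\<^sub>R x)"] G) auto
        then show ?thesis unfolding IG by (rule mult_left_mono) simp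
      qed simp
    qed
    also have "\<dots> = count 1 g * ennreal (mass * R\<^sup>2 + err * R)"
      by (simp add: count_def nn_integral_multc)
    finally show ?thesis .
  qed
  have "(\<Sum>e. corr (real (Suc e) / R)) = (\<integral>\<^sup>+g. (\<Sum>e. \<integral>\<^sup>+p. (\<integral>\<^sup>+q. \<phi> (g *v p) * \<phi> ((real (Suc e) / R) *\<^sub>R (g *v q)) * indep (g *v p) (g *v q) \<partial>count_space ?P) \<partial>count_space ?P) \<partial>\<pi>)"
    unfolding corr_def prim_pair_def by (rule nn_integral_suminf[symmetric]) measurable
  also have "\<dots> \<le> (\<integral>\<^sup>+g. count 1 g * ennreal (mass * R\<^sup>2 + err * R) \<partial>\<pi>)"
    using inv_law_D(3)[OF inv] by (intro nn_integral_mono_AE, elim eventually_mono) (rule pw)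
  also have "\<dots> = ennreal (c * mass) * ennreal (mass * R\<^sup>2 + err * R)"
    using nn_integral_count[of 1] by (simp add: nn_integral_multc)
  also have "\<dots> = ennreal (c * mass * (mass * R\<^sup>2 + err * R))"
    using c_bounds mass_nonneg err_nonneg R by (intro ennreal_mult[symmetric]) auto
  finally show ?thesis .
qed

end

lemma zeta_2_partial:
  assumes "N \<ge> 1"
  shows "zeta 2 - 1 / real N \<le> (\<Sum>n<N. 1 / real (Suc n) ^ 2)"
proof -
  have *: "(\<Sum>n<N + k. 1 / real (Suc n) ^ 2) \<le> (\<Sum>n<N. 1 / real (Suc n) ^ 2) + 1 / real N - 1 / real (N + k)" for k
  proof (induction k)
    case (Suc k)
    have "1 / real (Suc (N + k)) ^ 2 \<le> 1 / (real (N + k) * real (Suc (N + k)))"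
      using assms by (intro divide_left_mono) (auto simp: power2_eq_square intro!: mult_mono mult_pos_pos)
    also have "\<dots> = 1 / real (N + k) - 1 / real (Suc (N + k))"
      using assms by (simp add: field_simps)
    finally show ?case using Suc by simp
  qed simp
  have "(\<lambda>k. \<Sum>n<N + k. 1 / real (Suc n) ^ 2) \<longlonglongrightarrow> zeta 2"
    using zeta_sums[of 2] LIMSEQ_ignore_initial_segment[of "\<lambda>k. \<Sum>n<k. 1 / real (Suc n) ^ 2" "zeta 2" N]
    by (simp add: sums_def add.commute)
  moreover have "(\<Sum>n<N + k. 1 / real (Suc n) ^ 2) \<le> (\<Sum>n<N. 1 / real (Suc n) ^ 2) + 1 / real N" for k
  proof -
    have "1 / real (N + k) \<ge> 0" by simp
    then show ?thesis using *[of k] by linarith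
  qed
  ultimately have "zeta 2 \<le> (\<Sum>n<N. 1 / real (Suc n) ^ 2) + 1 / real N"
    by (intro LIMSEQ_le_const2) auto
  then show ?thesis by simp
qed

text \<open>The inequality (s x - t z - y)^2 >= 0 with negative terms moved across, so that it makes
  sense in \<open>ennreal\<close>.\<close>

lemma square_of_difference_le:
  fixes x z :: ennreal and s t y :: real
  assumes "s \<ge> 0" "t \<ge> 0" "y \<ge> 0" "s * t = 1"
  shows "2 * (x * z) + ennreal (2 * y * s) * x \<le>
    ennreal (s\<^sup>2) * x\<^sup>2 + ennreal (t\<^sup>2) * z\<^sup>2 + ennreal (y\<^sup>2) + ennreal (2 * y * t) * z"
proof (cases "x = top \<or> z = top")
  case True
  moreover have "ennreal (s\<^sup>2) \<noteq> 0" "ennreal (t\<^sup>2) \<noteq> 0" using assms by (auto simp: ennreal_eq_0_iff)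
  ultimately show ?thesis by (auto simp: power2_eq_square ennreal_mult_top ennreal_top_mult)
next
  case False
  then obtain u v where uv: "x = ennreal u" "z = ennreal v" "u \<ge> 0" "v \<ge> 0"
    by (metis ennreal_cases)
  have "0 \<le> (s * u - t * v - y)\<^sup>2" by simp
  also have "\<dots> = s\<^sup>2 * u\<^sup>2 + t\<^sup>2 * v\<^sup>2 + y\<^sup>2 + 2 * y * t * v - 2 * (s * t) * (u * v) - 2 * y * s * u"
    by (simp add: power2_eq_square algebra_simps)
  finally have "2 * (u * v) + 2 * y * s * u \<le> s\<^sup>2 * u\<^sup>2 + t\<^sup>2 * v\<^sup>2 + y\<^sup>2 + 2 * y * t * v"
    using assms(4) by simp
  then show ?thesis
    using assms uv by (simp add: ennreal_mult[symmetric] ennreal_plus[symmetric] power2_eq_square ennreal_numeral[symmetric] mult.assoc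
        del: ennreal_plus ennreal_numeral)
qed

lemma variance_arith:
  fixes r e u h k w x y z q :: real
  assumes "2 * ennreal r + ennreal u * ennreal e \<le>
    ennreal x * (ennreal q + ennreal h) + ennreal y * (0 + ennreal k) + ennreal z + ennreal w * ennreal v"
    and "r \<ge> 0" "e \<ge> 0" "u \<ge> 0" "h \<ge> 0" "k \<ge> 0" "w \<ge> 0" "x \<ge> 0" "y \<ge> 0" "z \<ge> 0" "q \<ge> 0" "v \<ge> 0"
  shows "2 * r + u * e \<le> x * (q + h) + y * k + z + w * v"
proof -
  have "ennreal (2 * r + u * e) \<le> ennreal (x * (q + h) + y * k + z + w * v)"
    using assms by (simp add: ennreal_mult ennreal_plus)
  then show ?thesis using assms by (subst (asm) ennreal_le_iff) auto
qed

context planar_test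
begin

text \<open>At such scales |det(v, w)| <= |v| |w| <= b^2 / l < 1 for contributing pairs, while the
  determinant of two lattice vectors is an integer; hence it is 0 and the vectors are
  dependent.\<close>

lemma corr_eq_0:
  assumes "l > b\<^sup>2"
  shows "corr l = 0"
proof -
  have l: "l > 0" using assms zero_le_power2[of b] by linarith
  have pw: "\<phi> (g *v p) * \<phi> (l *\<^sub>R (g *v q)) * indep (g *v p) (g *v q) = 0"
    if g: "det g = 1" and p: "p \<in> prim_vecs i" and q: "q \<in> prim_vecs i" for g :: "real^'n^'n" and p q
  proof (rule ccontr)
    assume *: "\<not> ?thesis"
    have v: "norm (g *v p) \<le> b" "g *v p \<noteq> 0" using \<phi>_supp[of "g *v p"] * ab by auto
    have "norm (l *\<^sub>R (g *v q)) \<le> b" using \<phi>_supp[of "l *\<^sub>R (g *v q)"] * by auto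
    then have w: "norm (g *v q) \<le> b / l" using l by (simp add: field_simps)
    have "(det2 i j (g *v p) (g *v q))\<^sup>2 \<le> (norm (g *v p) * norm (g *v q))\<^sup>2"
      unfolding lagrange_identity[OF ij] by simp
    then have "\<bar>det2 i j (g *v p) (g *v q)\<bar> \<le> norm (g *v p) * norm (g *v q)"
      by (metis abs_le_square_iff abs_mult abs_norm_cancel)
    also have "\<dots> \<le> b * (b / l)" using v w ab by (intro mult_mono) auto
    also have "\<dots> < 1" using assms l by (simp add: power2_eq_square field_simps)
    finally have "\<bar>det2 i j p q\<bar> < 1" by (simp add: det2_matrix_vector_mult[OF ij] g)
    moreover have "det2 i j p q \<in> \<int>"
      using p q prim_vecs_int_lattice by (intro det2_int_lattice) blast+
    ultimately have "det2 i j (g *v p) (g *v q) = 0"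
      by (auto simp: det2_matrix_vector_mult[OF ij] g elim!: Ints_cases)
    then show False using * det2_eq_0_iff[OF ij(1) v(2)] by (simp add: indep_def)
  qed
  have "corr l = (\<integral>\<^sup>+g. (\<integral>\<^sup>+p. (\<integral>\<^sup>+q. 0 \<partial>count_space (prim_vecs i)) \<partial>count_space (prim_vecs i)) \<partial>\<pi>)"
    unfolding corr_def prim_pair_def
    using inv_law_D(3)[OF inv] by (intro nn_integral_cong_AE, elim eventually_mono, intro nn_integral_cong) (simp add: pw)
  then show ?thesis by simp
qed

text \<open>The value expected of uncorrelated vectors would be
  \<open>c\<^sup>2 * mass\<^sup>2 / l\<^sup>2\<close>, the product of the mean counts at scales 1
  and l. The excess in the following lemmas is l times the difference between \<open>rho l\<close>
  and this value.\<close>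

definition rho :: "real \<Rightarrow> real" where "rho l = enn2real (corr l)"

text \<open>Finiteness comes from \<open>suminf_corr_le\<close> with R = 1 / l, where corr l is the
  first term.\<close>

lemma corr_rho:
  assumes "0 < l" "l \<le> 1" shows "corr l = ennreal (rho l)"
proof -
  have "corr l = (\<Sum>e\<in>{0}. corr (real (Suc e) / (1 / l)))" by simp
  also have "\<dots> \<le> (\<Sum>e. corr (real (Suc e) / (1 / l)))" by (rule sum_le_suminf) auto
  also have "\<dots> < \<infinity>" using suminf_corr_le[of "1 / l"] assms by (auto intro: le_less_trans)
  finally show ?thesis by (simp add: rho_def)
qed

text \<open>This is the nonnegativity of the variance of \<open>s * count s - t * count t\<close> for \<open>s = sqrt l\<close>, \<open>s * t = 1\<close>: the cross
  term is \<open>corr 1\<close> by scaling, and \<open>corr (1 / l)\<close> vanishes.\<close>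

lemma variance_inequality:
  assumes l: "0 < l" "l < 1" "1 / l > b\<^sup>2"
  shows "rho 1 \<le> c\<^sup>2 * mass\<^sup>2 + 2 * c * mass + (l * rho l - c\<^sup>2 * mass\<^sup>2 / l) / 2"
proof -
  note [measurable_cong] = inv_law_D(2)[OF inv]
  define s where "s = sqrt l"
  define t where "t = 1 / s"
  \<comment> \<open>The mean of s * count s - t * count t: the two means are c * mass * t and c *
    mass * s.\<close>
  define y where "y = c * mass * (t - s)"
  have s: "0 < s" "s < 1" "s\<^sup>2 = l" using l by (simp_all add: s_def real_sqrt_lt_1_iff)
  have t: "0 < t" "1 \<le> t" "s * t = 1" "t\<^sup>2 = 1 / l" using s by (simp_all add: t_def power_one_over)
  have y: "y \<ge> 0" using s t mass_nonneg c_bounds by (simp add: y_def)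
  have rho0: "rho x \<ge> 0" for x by (simp add: rho_def)
  let ?S = "\<integral>\<^sup>+g. (count s g)\<^sup>2 \<partial>\<pi>" and ?T = "\<integral>\<^sup>+g. (count t g)\<^sup>2 \<partial>\<pi>"
  have "2 * corr 1 + ennreal (2 * y * s) * (\<integral>\<^sup>+g. count s g \<partial>\<pi>) \<le>
    2 * (\<integral>\<^sup>+g. count s g * count t g \<partial>\<pi>) + ennreal (2 * y * s) * (\<integral>\<^sup>+g. count s g \<partial>\<pi>)"
    using corr_le_count[OF s(1) t(1)] by (intro add_right_mono mult_left_mono) (simp_all add: t(3))
  also have "\<dots> = (\<integral>\<^sup>+g. 2 * (count s g * count t g) + ennreal (2 * y * s) * count s g \<partial>\<pi>)"
    by (simp add: nn_integral_add nn_integral_cmult)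
  also have "\<dots> \<le> (\<integral>\<^sup>+g. ennreal (s\<^sup>2) * (count s g)\<^sup>2 + ennreal (t\<^sup>2) * (count t g)\<^sup>2 + ennreal (y\<^sup>2) + ennreal (2 * y * t) * count t g \<partial>\<pi>)"
    using s t y by (intro nn_integral_mono square_of_difference_le) auto
  also have "\<dots> = ennreal (s\<^sup>2) * ?S + ennreal (t\<^sup>2) * ?T + ennreal (y\<^sup>2) + ennreal (2 * y * t) * (\<integral>\<^sup>+g. count t g \<partial>\<pi>)"
    using prob_space.emeasure_space_1[OF inv_law_D(1)[OF inv]] by (simp add: nn_integral_add nn_integral_cmult)
  \<comment> \<open>The square of count t has no contribution from independent pairs, as its scale
    t^2 = 1 / l exceeds b^2; only the diagonal term survives.\<close>
  also have "\<dots> \<le> ennreal (s\<^sup>2) * (ennreal (rho l) + ennreal (2 * c * mass / s\<^sup>2)) + ennreal (t\<^sup>2) * (0 + ennreal (2 * c * mass / t\<^sup>2))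
      + ennreal (y\<^sup>2) + ennreal (2 * y * t) * (\<integral>\<^sup>+g. count t g \<partial>\<pi>)"
    using count_square_le[OF s(1)] count_square_le[OF t(1)] corr_rho[of l] corr_eq_0[of "t\<^sup>2"] l
    by (intro add_mono mult_left_mono) (simp_all add: s(3) t(4))
  finally have "2 * ennreal (rho 1) + ennreal (2 * y * s) * ennreal (c * mass / s\<^sup>2) \<le>
    ennreal (s\<^sup>2) * (ennreal (rho l) + ennreal (2 * c * mass / s\<^sup>2)) + ennreal (t\<^sup>2) * (0 + ennreal (2 * c * mass / t\<^sup>2))
      + ennreal (y\<^sup>2) + ennreal (2 * y * t) * ennreal (c * mass / t\<^sup>2)"
    using corr_rho[of 1] nn_integral_count[OF s(1)] nn_integral_count[OF t(1)] by simp
  then have "2 * rho 1 + 2 * y * s * (c * mass / s\<^sup>2) \<le>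
    s\<^sup>2 * (rho l + 2 * c * mass / s\<^sup>2) + t\<^sup>2 * (2 * c * mass / t\<^sup>2) + y\<^sup>2 + 2 * y * t * (c * mass / t\<^sup>2)"
    by (rule variance_arith) (use s t y l mass_nonneg c_bounds rho0 in simp_all)
  also have "2 * y * s * (c * mass / s\<^sup>2) = 2 * y * (c * mass * t)" using s(1) by (simp add: t_def power2_eq_square)
  also have "2 * y * t * (c * mass / t\<^sup>2) = 2 * y * (c * mass * s)" using s(1) by (simp add: t_def power2_eq_square)
  also have "s\<^sup>2 * (rho l + 2 * c * mass / s\<^sup>2) = l * rho l + 2 * c * mass" using s l by (simp add: distrib_left)
  also have "t\<^sup>2 * (2 * c * mass / t\<^sup>2) = 2 * c * mass" using t l by simp
  finally have "2 * rho 1 \<le> l * rho l + 4 * c * mass + y\<^sup>2 - 2 * y * (c * mass * (t - s))"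
    by (simp add: algebra_simps)
  also have "\<dots> = l * rho l + 4 * c * mass - y\<^sup>2" by (simp add: y_def power2_eq_square)
  also have "y\<^sup>2 = c\<^sup>2 * mass\<^sup>2 * (t\<^sup>2 - 2 * (s * t) + s\<^sup>2)"
    by (simp add: y_def power2_eq_square algebra_simps)
  also have "\<dots> = c\<^sup>2 * mass\<^sup>2 / l - 2 * (c\<^sup>2 * mass\<^sup>2) + c\<^sup>2 * mass\<^sup>2 * l"
    by (simp add: t s algebra_simps)
  finally have "2 * rho 1 \<le> l * rho l + 4 * c * mass - c\<^sup>2 * mass\<^sup>2 / l + 2 * (c\<^sup>2 * mass\<^sup>2) - c\<^sup>2 * mass\<^sup>2 * l" by simp
  moreover have "c\<^sup>2 * mass\<^sup>2 * l \<ge> 0" using l by simp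
  ultimately have "2 * rho 1 \<le> l * rho l + 4 * c * mass - c\<^sup>2 * mass\<^sup>2 / l + 2 * (c\<^sup>2 * mass\<^sup>2)" by linarith
  then show ?thesis by (simp add: field_simps)
qed

text \<open>Averaging \<open>l * rho l\<close> over the multiples of a small \<open>l\<close> with logarithmic weights \<open>1 / e\<close> counts all lattice
  points instead of the primitive ones; a uniformly positive excess would contradict \<open>suminf_corr_le\<close>.\<close>

lemma small_excess:
  assumes e: "\<epsilon> > 0" and d: "0 < \<delta>" "\<delta> \<le> 1"
  shows "\<exists>l. 0 < l \<and> l < \<delta> \<and> l * rho l - c\<^sup>2 * mass\<^sup>2 / l \<le> \<epsilon>"
proof (rule ccontr)
  assume "\<not> ?thesis"
  then have big: "\<epsilon> + c\<^sup>2 * mass\<^sup>2 / l \<le> l * rho l" if "0 < l" "l < \<delta>" for l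
    using that by (metis diff_gt_0_iff_gt less_eq_real_def not_less add.commute diff_add_cancel le_diff_eq)
  have bound: "\<epsilon> * (\<Sum>n<E. 1 / real (Suc n)) \<le> 2 * (c\<^sup>2 * mass\<^sup>2) / \<delta> + c * mass * err" if E: "E \<ge> 1" for E
  proof -
    \<comment> \<open>Chosen so that all scales 1 / R, ..., E / R lie strictly below
      \<delta>.\<close>
    define R where "R = real (Suc E) / \<delta>"
    have R: "R \<ge> 1" "R > 0" using E d by (auto simp: R_def field_simps)
    have lam: "0 < real (Suc n) / R" "real (Suc n) / R < \<delta>" if "n < E" for n
    proof -
      show "0 < real (Suc n) / R" using R by simp
      have "real (Suc n) * \<delta> < real (Suc E) * \<delta>" using that d by simp
      then show "real (Suc n) / R < \<delta>" using d by (simp add: R_def pos_divide_less_eq mult.commute)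
    qed
    have "ennreal (\<Sum>n<E. rho (real (Suc n) / R)) = (\<Sum>n<E. corr (real (Suc n) / R))"
    proof -
      have "corr (real (Suc n) / R) = ennreal (rho (real (Suc n) / R))" if "n < E" for n
        using lam[OF that] d by (intro corr_rho) auto
      then show ?thesis by (subst sum_ennreal[symmetric]) (auto simp: rho_def)
    qed
    also have "\<dots> \<le> (\<Sum>n. corr (real (Suc n) / R))" by (rule sum_le_suminf) auto
    also have "\<dots> \<le> ennreal (c * mass * (mass * R\<^sup>2 + err * R))" by (rule suminf_corr_le[OF R(1)])
    finally have 1: "(\<Sum>n<E. rho (real (Suc n) / R)) \<le> c * mass * (mass * R\<^sup>2 + err * R)"
      using c_bounds mass_nonneg err_nonneg R by (subst (asm) ennreal_le_iff) auto
    have "\<epsilon> * R * (1 / real (Suc n)) + c\<^sup>2 * mass\<^sup>2 * R\<^sup>2 * (1 / real (Suc n) ^ 2) \<le> rho (real (Suc n) / R)" if nE: "n < E" for n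
    proof -
      define x where "x = real (Suc n)"
      have x: "x > 0" by (simp add: x_def)
      have "\<epsilon> + c\<^sup>2 * mass\<^sup>2 / (x / R) \<le> x / R * rho (x / R)" unfolding x_def by (intro big lam nE)
      from this have "(R / x) * (\<epsilon> + c\<^sup>2 * mass\<^sup>2 / (x / R)) \<le> (R / x) * (x / R * rho (x / R))" using R x by (intro mult_left_mono) auto
      then show ?thesis unfolding x_def[symmetric] using R x by (simp add: field_simps power2_eq_square)
    qed
    then have "(\<Sum>n<E. \<epsilon> * R * (1 / real (Suc n)) + c\<^sup>2 * mass\<^sup>2 * R\<^sup>2 * (1 / real (Suc n) ^ 2)) \<le> (\<Sum>n<E. rho (real (Suc n) / R))"
      by (intro sum_mono) simp
    then have "\<epsilon> * R * (\<Sum>n<E. 1 / real (Suc n)) + c\<^sup>2 * mass\<^sup>2 * R\<^sup>2 * (\<Sum>n<E. 1 / real (Suc n) ^ 2) \<le> c * mass * (mass * R\<^sup>2 + err * R)"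
      using 1 unfolding sum.distrib sum_distrib_left[symmetric] by linarith
    moreover have "c\<^sup>2 * mass\<^sup>2 * R\<^sup>2 * (zeta 2 - 1 / real E) \<le> c\<^sup>2 * mass\<^sup>2 * R\<^sup>2 * (\<Sum>n<E. 1 / real (Suc n) ^ 2)"
      by (rule mult_left_mono[OF zeta_2_partial[OF E]]) simp
    \<comment> \<open>Since c = 1 / zeta(2), the terms of order R^2 on both sides cancel up to the
      tail of the zeta series. What remains is linear in R, so \<epsilon> times a harmonic sum stays
      bounded, which is impossible.\<close>
    moreover have "c\<^sup>2 * zeta 2 = c" using c_bounds by (simp add: c_def power2_eq_square)
    then have "c\<^sup>2 * mass\<^sup>2 * R\<^sup>2 * (zeta 2 - 1 / real E) = c * mass\<^sup>2 * R\<^sup>2 - c\<^sup>2 * mass\<^sup>2 * R\<^sup>2 / real E"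
      by (simp add: right_diff_distrib)
    moreover have "c\<^sup>2 * mass\<^sup>2 * R\<^sup>2 / real E \<le> R * (2 * (c\<^sup>2 * mass\<^sup>2) / \<delta>)"
    proof -
      have "R / real E \<le> 2 / \<delta>" using E d by (simp add: R_def field_simps)
      then have "(c\<^sup>2 * mass\<^sup>2 * R) * (R / real E) \<le> (c\<^sup>2 * mass\<^sup>2 * R) * (2 / \<delta>)" using R by (intro mult_left_mono) auto
      then show ?thesis by (simp add: power2_eq_square mult_ac)
    qed
    ultimately have "\<epsilon> * R * (\<Sum>n<E. 1 / real (Suc n)) \<le> R * (2 * (c\<^sup>2 * mass\<^sup>2) / \<delta>) + c * mass * (err * R)"
      by (simp add: distrib_left power2_eq_square mult_ac)
    then have "R * (\<epsilon> * (\<Sum>n<E. 1 / real (Suc n))) \<le> R * (2 * (c\<^sup>2 * mass\<^sup>2) / \<delta> + c * mass * err)"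
      by (simp add: distrib_left mult_ac)
    then show ?thesis using R by simp
  qed
  let ?K = "(2 * (c\<^sup>2 * mass\<^sup>2) / \<delta> + c * mass * err) / \<epsilon>"
  have "(\<Sum>n<E. 1 / real (Suc n)) \<le> ?K" if "E \<ge> 1" for E
    using bound[OF that] e by (simp add: field_simps)
  then have H: "harm E \<le> ?K" if "E \<ge> 1" for E
    using that by (simp add: harm_altdef inverse_eq_divide)
  have "\<forall>\<^sub>F E in sequentially. ?K + 1 \<le> harm E"
    using harm_at_top by (auto simp: filterlim_at_top)
  then have "\<forall>\<^sub>F E in sequentially. E \<ge> 1 \<and> ?K + 1 \<le> harm E"
    using eventually_ge_at_top[of 1] by eventually_elim simp
  then obtain E where E: "E \<ge> 1" "?K + 1 \<le> harm E"
    using eventually_happens trivial_limit_sequentially by blast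
  show False using H[OF E(1)] E(2) by linarith
qed

text \<open>The 4 is made of 2 from the diagonal pairs plus and minus p at scale 1, and 2 from the
  diagonal terms of the two counts in \<open>variance_inequality\<close>.\<close>

theorem count_second_moment: "(\<integral>\<^sup>+g. (count 1 g)\<^sup>2 \<partial>\<pi>) \<le> ennreal (c\<^sup>2 * mass\<^sup>2 + 4 * c * mass)"
proof -
  have "rho 1 \<le> c\<^sup>2 * mass\<^sup>2 + 2 * c * mass + \<epsilon>" if \<epsilon>: "\<epsilon> > 0" for \<epsilon>
  proof -
    define \<delta> where "\<delta> = min 1 (1 / (b\<^sup>2 + 1))"
    have b: "b\<^sup>2 + 1 > 0" by (simp add: add_nonneg_pos)
    have "0 < \<delta>" "\<delta> \<le> 1" using b by (auto simp: \<delta>_def)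
    then obtain l where l: "0 < l" "l < \<delta>" "l * rho l - c\<^sup>2 * mass\<^sup>2 / l \<le> \<epsilon>" using small_excess[OF \<epsilon>] by blast
    have "l < 1 / (b\<^sup>2 + 1)" using l by (simp add: \<delta>_def)
    then have "b\<^sup>2 + 1 < 1 / l" using l b by (simp add: field_simps)
    then have "1 / l > b\<^sup>2" by simp
    moreover have "l < 1" using l by (simp add: \<delta>_def)
    moreover define A where "A = l * rho l - c\<^sup>2 * mass\<^sup>2 / l"
    ultimately have "rho 1 \<le> c\<^sup>2 * mass\<^sup>2 + 2 * c * mass + A / 2"
      using l by (simp only: A_def) (intro variance_inequality)
    moreover have "A / 2 \<le> \<epsilon>" using l(3) \<epsilon> by (simp add: A_def[symmetric])
    ultimately show ?thesis by linarith
  qed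
  then have "rho 1 \<le> c\<^sup>2 * mass\<^sup>2 + 2 * c * mass" by (rule field_le_epsilon)
  then have "corr (1\<^sup>2) + ennreal (2 * c * mass / 1\<^sup>2) \<le> ennreal (c\<^sup>2 * mass\<^sup>2 + 2 * c * mass) + ennreal (2 * c * mass)"
    using corr_rho[of 1] by (simp add: ennreal_leI add_right_mono)
  also have "\<dots> = ennreal (c\<^sup>2 * mass\<^sup>2 + 4 * c * mass)"
    using c_bounds mass_nonneg by (simp add: ennreal_plus[symmetric] del: ennreal_plus)
  finally show ?thesis using count_square_le[of 1] by simp
qed

end

text \<open>Lipschitz functions above the indicator of B converge to it because B is closed, and
  their masses converge by dominated convergence.\<close>

lemma second_moment_planar:
  fixes \<pi> :: "(real^'n^'n) measure" and B :: "(real^'n) set"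
  assumes \<pi>: "inv_law \<pi>" and card: "CARD('n) = 2"
    and B: "compact B" "0 \<notin> B"
  defines "\<beta> \<equiv> measure lborel B / zeta 2"
  shows "(\<integral>\<^sup>+g. (\<integral>\<^sup>+p. indicator B (g *v p) \<partial>count_space (prim_vecs i))\<^sup>2 \<partial>\<pi>) \<le> ennreal (\<beta>\<^sup>2 + 4 * \<beta>)"
proof (cases "B = {}")
  case False
  obtain j where ij: "(UNIV :: 'n set) = {i, j}" "i \<noteq> j" using card_2_UNIV[OF card] by metis
  have cl: "closed B" using B(1) by (rule compact_imp_closed)
  define a where "a = infdist 0 B"
  have a: "a > 0" unfolding a_def by (rule infdist_pos_not_in_closed[OF cl False B(2)])
  obtain b0 where b0: "\<And>v. v \<in> B \<Longrightarrow> norm v \<le> b0" using compact_imp_bounded[OF B(1)] by (auto simp: bounded_iff)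
  define b where "b = b0 + a"
  \<comment> \<open>The summand 2 / a keeps the support within distance a / 2 of B, hence outside
    the disc of radius a / 2 around the origin; the summand k sharpens the approximation.\<close>
  define L where "L k = real k + 2 / a" for k
  define f where "f k v = max 0 (1 - L k * infdist v B)" for k v
  have L: "L k > 0" for k using a by (auto simp: L_def intro: add_nonneg_pos)
  have supp: "a / 2 \<le> norm v \<and> norm v \<le> b" if nz: "f k v \<noteq> 0" for k v
  proof -
    obtain w where w: "w \<in> B" "infdist v B = dist v w" using infdist_attains_inf[OF cl False] by blast
    have "L k * infdist v B < 1" using nz by (auto simp: f_def split: if_splits)
    moreover have "2 / a * infdist v B \<le> L k * infdist v B" by (intro mult_right_mono) (auto simp: L_def infdist_nonneg)
    ultimately have "2 / a * infdist v B < 1" by linarith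
    then have d: "dist v w < a / 2" using a w by (simp add: field_simps)
    have "a \<le> norm w" using infdist_le[OF w(1), of 0] by (simp add: a_def)
    moreover have "\<bar>norm v - norm w\<bar> \<le> dist v w" by (metis dist_norm norm_triangle_ineq3)
    ultimately show ?thesis using d b0[OF w(1)] a by (auto simp: b_def)
  qed
  have "a \<le> b"
  proof -
    obtain w where "w \<in> B" using False by blast
    then have "0 \<le> b0" using b0 norm_ge_zero order_trans by blast
    then show ?thesis by (simp add: b_def)
  qed
  have T: "planar_test \<pi> i j (f k) (L k) (a / 2) b" for k
  proof
    show "inv_law \<pi>" by (rule \<pi>)
    show "UNIV = {i, j}" "i \<noteq> j" by (rule ij)+
    show "0 \<le> f k v" "f k v \<le> 1" for v using L[of k] infdist_nonneg[of v B] by (auto simp: f_def)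
    show "\<bar>f k x - f k y\<bar> \<le> L k * norm (x - y)" for x y
    proof -
      have "\<bar>f k x - f k y\<bar> \<le> \<bar>L k * infdist x B - L k * infdist y B\<bar>" by (auto simp: f_def)
      also have "\<dots> = L k * \<bar>infdist x B - infdist y B\<bar>" using L[of k] by (simp add: abs_mult flip: right_diff_distrib)
      also have "\<dots> \<le> L k * norm (x - y)"
        using infdist_triangle_abs[of x B y] L[of k] by (intro mult_left_mono) (auto simp: dist_norm)
      finally show ?thesis .
    qed
    show "f k v \<noteq> 0 \<Longrightarrow> a / 2 \<le> norm v \<and> norm v \<le> b" for v by (rule supp)
    show "0 \<le> L k" "0 < a / 2" "a / 2 \<le> b" using L[of k] a \<open>a \<le> b\<close> by auto
  qed
  have [measurable]: "f k \<in> borel_measurable borel" for k by (rule planar_test.measurable_f[OF T])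
  have ind: "indicator B v \<le> ennreal (f k v)" for k v
    using in_closed_iff_infdist_zero[OF cl False, of v] by (auto simp: f_def indicator_def)
  have ptw: "(\<lambda>k. ennreal (f k v)) \<longlonglongrightarrow> indicator B v" for v
  proof (cases "v \<in> B")
    case True
    then have "ennreal (f k v) = 1" for k using in_closed_iff_infdist_zero[OF cl False, of v] by (simp add: f_def)
    then show ?thesis using True by simp
  next
    case v: False
    then have d: "infdist v B > 0" by (rule infdist_pos_not_in_closed[OF cl False])
    obtain k0 :: nat where k0: "1 / infdist v B \<le> real k0" using real_arch_simple by blast
    have "ennreal (f k v) = 0" if "k \<ge> k0" for k
    proof -
      have "1 / infdist v B \<le> L k" using k0 that a by (simp add: L_def add_increasing2)
      then have "1 \<le> L k * infdist v B" using d by (simp add: field_simps)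
      then show ?thesis by (simp add: f_def)
    qed
    then have "\<forall>\<^sub>F k in sequentially. ennreal (f k v) = 0" unfolding eventually_sequentially by blast
    then show ?thesis using v by (simp add: tendsto_eventually)
  qed
  have Bm [measurable]: "B \<in> sets borel" using cl by simp
  have Bfin: "emeasure lborel B < \<infinity>" using emeasure_bounded_finite[OF compact_imp_bounded[OF B(1)]] by simp
  define M where "M k = enn2real (\<integral>\<^sup>+v. ennreal (f k v) \<partial>lborel)" for k
  have cb [measurable]: "cball (0::real^'n) b \<in> sets borel" by simp
  have "(\<lambda>k. \<integral>\<^sup>+v. ennreal (f k v) \<partial>lborel) \<longlonglongrightarrow> (\<integral>\<^sup>+v. indicator B v \<partial>lborel)"
  proof (rule nn_integral_dominated_convergence[where w="indicator (cball 0 b)"])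
    show "AE v in lborel. ennreal (f k v) \<le> indicator (cball 0 b) v" for k
    proof (intro AE_I2)
      fix v show "ennreal (f k v) \<le> indicator (cball 0 b) v"
        using supp[of k v] planar_test.le_1[OF T, of k v] by (cases "f k v = 0") (auto simp: indicator_def)
    qed
    show "(\<integral>\<^sup>+v. indicator (cball (0::real^'n) b) v \<partial>lborel) < \<infinity>"
      using emeasure_lborel_cball_finite[of "0::real^'n" b] by simp
    show "AE v in lborel. (\<lambda>k. ennreal (f k v)) \<longlonglongrightarrow> indicator B v" by (intro AE_I2 ptw)
  qed measurable
  then have "(\<lambda>k. \<integral>\<^sup>+v. ennreal (f k v) \<partial>lborel) \<longlonglongrightarrow> ennreal (measure lborel B)"
    using Bfin by (simp add: emeasure_eq_ennreal_measure)
  then have M: "M \<longlonglongrightarrow> measure lborel B" unfolding M_def by (rule tendsto_enn2real) simp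
  have "(\<integral>\<^sup>+g. (\<integral>\<^sup>+p. indicator B (g *v p) \<partial>count_space (prim_vecs i))\<^sup>2 \<partial>\<pi>) \<le> ennreal ((M k / zeta 2)\<^sup>2 + 4 * (M k / zeta 2))" for k
  proof -
    interpret planar_test \<pi> i j "f k" "L k" "a / 2" b by (rule T)
    have "(\<integral>\<^sup>+g. (\<integral>\<^sup>+p. indicator B (g *v p) \<partial>count_space (prim_vecs i))\<^sup>2 \<partial>\<pi>) \<le> (\<integral>\<^sup>+g. (count 1 g)\<^sup>2 \<partial>\<pi>)"
      unfolding count_def \<phi>_def by (intro nn_integral_mono power_mono) (auto simp: ind)
    also have "\<dots> \<le> ennreal (c\<^sup>2 * mass\<^sup>2 + 4 * c * mass)" by (rule count_second_moment)
    also have "mass = M k" by (simp add: mass_def M_def \<phi>_def)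
    finally show ?thesis by (simp add: c_def power_divide)
  qed
  moreover have "(\<lambda>k. ennreal ((M k / zeta 2)\<^sup>2 + 4 * (M k / zeta 2))) \<longlonglongrightarrow> ennreal (\<beta>\<^sup>2 + 4 * \<beta>)"
    unfolding \<beta>_def using zeta_bounds(1)[of 2] by (intro tendsto_ennrealI tendsto_intros M) auto
  ultimately show ?thesis by (intro LIMSEQ_le_const) auto
qed simp

lemma nn_integral_count_space_indicator_eq_0_iff:
  "(\<integral>\<^sup>+m. indicator B (F m) \<partial>count_space A) = (0::ennreal) \<longleftrightarrow> (\<forall>m\<in>A. F m \<notin> B)"
  by (subst nn_integral_0_iff_AE) (auto simp: AE_count_space indicator_def)

text \<open>If no nonzero lattice vector lies in B then no primitive one does, so either count may
  be fed into the second moment bound. Symmetry of B enters where vectors are paired with their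
  negatives.\<close>

theorem gap_bound:
  fixes \<pi> :: "(real^'n^'n) measure" and B :: "(real^'n) set"
  assumes \<pi>: "inv_law \<pi>" and card: "CARD('n) \<ge> 2"
    and B: "compact B" "0 \<notin> B" "\<And>v. - v \<in> B \<longleftrightarrow> v \<in> B"
  shows "emeasure \<pi> {g \<in> space \<pi>. \<forall>m\<in>int_lattice - {0}. g *v m \<notin> B} * emeasure lborel B \<le> ennreal (gap_const CARD('n))"
proof (cases "measure lborel B = 0")
  case True
  then have "emeasure lborel B = 0"
    using emeasure_bounded_finite[OF compact_imp_bounded[OF B(1)]] by (simp add: measure_eq_0_null_sets emeasure_eq_ennreal_measure)
  then show ?thesis by simp
next
  case False
  note [measurable_cong] = inv_law_D(2)[OF \<pi>]
  interpret prob_space \<pi> by (rule inv_law_D[OF \<pi>])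
  have Bm [measurable]: "B \<in> sets borel" using B(1) by (simp add: compact_imp_closed)
  define \<beta> where "\<beta> = measure lborel B"
  have \<beta>: "\<beta> > 0" "emeasure lborel B = ennreal \<beta>"
    using False emeasure_bounded_finite[OF compact_imp_bounded[OF B(1)]]
    by (auto simp: \<beta>_def emeasure_eq_ennreal_measure zero_less_measure_iff)
  let ?E = "{g \<in> space \<pi>. \<forall>m\<in>int_lattice - {0}. g *v m \<notin> B}"
  \<comment> \<open>Here x is the mean count and y x the variance bound. Dividing by x gives P x <=
    y; multiplying by \<beta> and comparing with K x removes the factor between mean and
    volume.\<close>
  have cancel: "emeasure \<pi> ?E * ennreal \<beta> \<le> ennreal K"
    if "emeasure \<pi> ?E * (ennreal x)\<^sup>2 \<le> ennreal (y * x)" "x > 0" "y \<ge> 0" "y * \<beta> = K * x" for x y K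
  proof -
    define P where "P = measure \<pi> ?E"
    have P: "emeasure \<pi> ?E = ennreal P" by (simp add: P_def emeasure_eq_measure)
    have "P * x\<^sup>2 \<le> y * x"
      using that P_def by (simp add: P ennreal_mult[symmetric] ennreal_power)
    then have "P * x \<le> y" using that(2) by (simp add: power2_eq_square)
    then have "P * x * \<beta> \<le> y * \<beta>" using \<beta> by simp
    then have "(P * \<beta>) * x \<le> K * x" unfolding that(4) by (simp add: mult_ac)
    then have "P * \<beta> \<le> K" using that(2) by simp
    then show ?thesis using \<beta> by (simp add: P P_def ennreal_mult[symmetric] ennreal_leI)
  qed
  show ?thesis
  proof (cases "CARD('n) = 2")
    case True
    obtain i :: 'n where "True" by blast
    define N where "N g = (\<integral>\<^sup>+p. indicator B (g *v p) \<partial>count_space (prim_vecs i))" for g :: "real^'n^'n"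
    have [measurable]: "N \<in> borel_measurable \<pi>" unfolding N_def by measurable
    have z: "zeta 2 > 0" using zeta_bounds(1)[of 2] by simp
    have "(\<integral>\<^sup>+g. N g \<partial>\<pi>) = ennreal (\<beta> / zeta 2)"
      using prim_mean_value[OF \<pi> card, of "indicator B" i] z \<beta>
      by (simp add: prim_int_def N_def True ennreal_mult[symmetric])
    moreover have "(\<integral>\<^sup>+g. (N g)\<^sup>2 \<partial>\<pi>) \<le> (ennreal (\<beta> / zeta 2))\<^sup>2 + ennreal (4 * (\<beta> / zeta 2))"
      using second_moment_planar[OF \<pi> True B(1,2), of i] z \<beta>
      by (simp add: N_def \<beta>_def ennreal_power ennreal_plus[symmetric] del: ennreal_plus)
    ultimately have "emeasure \<pi> {g \<in> space \<pi>. N g = 0} * (ennreal (\<beta> / zeta 2))\<^sup>2 \<le> ennreal (4 * (\<beta> / zeta 2))"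
      by (intro second_moment_bound) auto
    moreover have "emeasure \<pi> ?E \<le> emeasure \<pi> {g \<in> space \<pi>. N g = 0}"
    proof (rule emeasure_mono)
      have "prim_vecs i \<subseteq> int_lattice - {0}" using prim_vecs_int_lattice prim_vecs_nonzero by blast
      then show "?E \<subseteq> {g \<in> space \<pi>. N g = 0}"
        unfolding N_def nn_integral_count_space_indicator_eq_0_iff by blast
    qed measurable
    ultimately have "emeasure \<pi> ?E * (ennreal (\<beta> / zeta 2))\<^sup>2 \<le> ennreal (4 * (\<beta> / zeta 2))"
      by (meson mult_right_mono order_trans zero_le)
    then have "emeasure \<pi> ?E * ennreal \<beta> \<le> ennreal (4 * zeta 2)"
      by (rule cancel) (use z \<beta> in auto)
    also have "\<dots> \<le> ennreal (gap_const CARD('n))" using z by (intro ennreal_leI) (simp add: gap_const_def True)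
    finally show ?thesis using \<beta> by simp
  next
    case False
    then have card3: "CARD('n) \<ge> 3" using card by simp
    obtain r where r: "B \<subseteq> cball 0 r" "r \<ge> 0"
    proof -
      obtain x where "x > 0" "\<forall>v\<in>B. norm v \<le> x" using compact_imp_bounded[OF B(1)] bounded_pos by blast
      then show thesis by (intro that[of x]) auto
    qed
    define N where "N g = (\<integral>\<^sup>+m. indicator B (g *v m) \<partial>count_space (int_lattice - {0}))" for g :: "real^'n^'n"
    have [measurable]: "N \<in> borel_measurable \<pi>"
      unfolding N_def by (intro borel_measurable_nn_integral_count_space) (auto intro: countable_Diff)
    define K where "K = 4 * zeta (CARD('n) - 1) / zeta CARD('n)"
    have "2 \<le> CARD('n) - 1" using card3 by simp
    then have K: "K \<ge> 0" using zeta_bounds(1)[of "CARD('n) - 1"] zeta_bounds(1)[OF card] by (simp add: K_def)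
    have "(\<integral>\<^sup>+g. N g \<partial>\<pi>) = ennreal \<beta>"
      using nn_integral_mean_value[OF \<pi> card, of "indicator B"] \<beta> by (simp add: N_def)
    moreover have "(\<integral>\<^sup>+g. (N g)\<^sup>2 \<partial>\<pi>) \<le> (ennreal \<beta>)\<^sup>2 + ennreal (K * \<beta>)"
      using second_moment_ge_3[OF \<pi> card3 Bm r B(2,3), folded K_def] \<beta> K by (simp add: N_def ennreal_mult)
    ultimately have "emeasure \<pi> {g \<in> space \<pi>. N g = 0} * (ennreal \<beta>)\<^sup>2 \<le> ennreal (K * \<beta>)"
      by (intro second_moment_bound) auto
    then have "emeasure \<pi> ?E * (ennreal \<beta>)\<^sup>2 \<le> ennreal (K * \<beta>)"
      by (simp add: N_def nn_integral_count_space_indicator_eq_0_iff)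
    then have "emeasure \<pi> ?E * ennreal \<beta> \<le> ennreal K"
      by (rule cancel) (use K \<beta> in auto)
    also have "\<dots> \<le> ennreal (gap_const CARD('n))" using K False by (intro ennreal_leI) (simp add: gap_const_def K_def)
    finally show ?thesis using \<beta> by simp
  qed
qed

section \<open>The probability of a gap\<close>

definition radial_density :: "'n::finite itself \<Rightarrow> real \<Rightarrow> ennreal" where
  "radial_density _ r = ennreal (real CARD('n) * measure lborel (ball (0::real^'n) 1) * r ^ (CARD('n) - 1))"

lemma borel_norm_vimage [measurable]: "X \<in> sets borel \<Longrightarrow> {v::real^'n. norm v \<in> X} \<in> sets borel"
  using measurable_sets[of "norm :: real^'n \<Rightarrow> real" borel borel X] by (simp add: vimage_def)

text \<open>Restriction to a ball makes the measure finite, so that compact inner approximation is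
  available.\<close>

definition norm_law :: "'n::finite itself \<Rightarrow> nat \<Rightarrow> real measure" where
  "norm_law _ n = distr (density lborel (indicator (cball (0::real^'n) (real n)))) borel norm"

lemma sets_norm_law [simp]: "sets (norm_law T n) = sets borel"
  by (simp add: norm_law_def)

lemma emeasure_norm_law:
  assumes X: "X \<in> sets borel"
  shows "emeasure (norm_law TYPE('n::finite) n) X = emeasure lborel ({v::real^'n. norm v \<in> X} \<inter> cball 0 (real n))"
proof -
  have cb [measurable]: "cball (0::real^'n) (real n) \<in> sets borel" by simp
  have "norm -` X = {v::real^'n. norm v \<in> X}" by auto
  then have "emeasure (norm_law TYPE('n) n) X = (\<integral>\<^sup>+v. indicator (cball (0::real^'n) (real n)) v * indicator {v. norm v \<in> X} v \<partial>lborel)"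
    unfolding norm_law_def using X borel_norm_vimage[OF X, where 'n='n]
    by (simp add: emeasure_distr emeasure_density)
  also have "\<dots> = (\<integral>\<^sup>+v. indicator ({v::real^'n. norm v \<in> X} \<inter> cball 0 (real n)) v \<partial>lborel)"
    by (intro nn_integral_cong) (auto simp: indicator_def)
  finally show ?thesis using borel_norm_vimage[OF X, where 'n='n] by simp
qed

text \<open>Polar integration reduced to one variable: both sides are finite measures in A, and on
  half lines they agree because the volume of a ball is the integral of its surface density.\<close>

lemma radial_shell:
  assumes A: "A \<in> sets borel" "A \<subseteq> {0<..}"
  shows "emeasure lborel ({v::real^'n. norm v \<in> A} \<inter> cball 0 (real n)) =
    (\<integral>\<^sup>+r. radial_density TYPE('n) r * indicator {0..real n} r * indicator A r \<partial>lborel)"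
proof -
  define d where "d = CARD('n)"
  define \<kappa> where "\<kappa> = unit_ball_vol (real d)"
  have d: "d > 0" by (simp add: d_def)
  have \<kappa>: "\<kappa> \<ge> 0" "measure lborel (ball (0::real^'n) 1) = \<kappa>" by (simp_all add: \<kappa>_def d_def content_ball)
  have ball: "emeasure lborel (cball (0::real^'n) r) = ennreal (\<kappa> * r ^ d)" if "r \<ge> 0" for r
    using emeasure_cball[OF that, of "0::real^'n"] by (simp add: \<kappa>_def d_def)
  have cb [measurable]: "cball (0::real^'n) r \<in> sets borel" for r by simp
  define M where "M = norm_law TYPE('n) n"
  define D where "D = density lborel (\<lambda>r. radial_density TYPE('n) r * indicator {0..real n} r)"
  have [measurable]: "radial_density TYPE('n) \<in> borel_measurable borel" unfolding radial_density_def by measurable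
  have eM: "emeasure M X = emeasure lborel ({v::real^'n. norm v \<in> X} \<inter> cball 0 (real n))" if "X \<in> sets borel" for X
    unfolding M_def by (rule emeasure_norm_law[OF that])
  have eD: "emeasure D X = (\<integral>\<^sup>+r. radial_density TYPE('n) r * indicator {0..real n} r * indicator X r \<partial>lborel)" if "X \<in> sets borel" for X
    unfolding D_def using that by (subst emeasure_density) auto
  have Ix: "{x<..} \<in> sets borel" for x :: real by simp
  have "M = D"
  proof (rule measure_eqI_lessThan)
    show "sets M = sets borel" "sets D = sets borel" by (simp_all add: M_def D_def)
    fix x :: real
    have "emeasure M {x<..} \<le> emeasure lborel (cball (0::real^'n) (real n))" unfolding eM[OF Ix] by (rule emeasure_mono) auto
    then show "emeasure M {x<..} < \<infinity>" using emeasure_lborel_cball_finite[of "0::real^'n" "real n"] by (auto intro: le_less_trans)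
    show "emeasure M {x<..} = emeasure D {x<..}"
    proof (cases "x < real n")
      case True
      \<comment> \<open>For negative x the half line contains all norms, and the density lives on
        nonnegative radii only.\<close>
      define y where "y = max 0 x"
      have y: "0 \<le> y" "y \<le> real n" using True by (auto simp: y_def)
      have "emeasure D {x<..} = (\<integral>\<^sup>+r. ennreal (real d * \<kappa> * r ^ (d - 1)) * indicator {y..real n} r \<partial>lborel)"
        unfolding eD[OF Ix]
        using AE_lborel_singleton[of x] AE_lborel_singleton[of "0::real"]
        by (intro nn_integral_cong_AE, elim AE_mp, intro AE_I2 impI)
           (auto simp: indicator_def radial_density_def d_def \<kappa> y_def)
      also have "\<dots> = ennreal (\<kappa> * real n ^ d - \<kappa> * y ^ d)"
        using y \<kappa> by (intro nn_integral_FTC_Icc) (auto intro!: derivative_eq_intros)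
      also have "\<dots> = emeasure M {x<..}"
      proof (cases "x \<ge> 0")
        case True
        have "emeasure M {x<..} = emeasure lborel (cball (0::real^'n) (real n) - cball 0 x)"
          unfolding eM[OF Ix] by (rule arg_cong[where f="emeasure lborel"]) auto
        also have "\<dots> = emeasure lborel (cball (0::real^'n) (real n)) - emeasure lborel (cball (0::real^'n) x)"
          using \<open>x < real n\<close> True ball[of x] by (intro emeasure_Diff) auto
        also have "\<dots> = ennreal (\<kappa> * real n ^ d - \<kappa> * y ^ d)"
          using True \<kappa> by (simp add: ball y_def ennreal_minus)
        finally show ?thesis by simp
      next
        case False
        have "norm v > x" for v :: "real^'n" using False norm_ge_zero[of v] by linarith
        then have "emeasure M {x<..} = emeasure lborel (cball (0::real^'n) (real n))"
          unfolding eM[OF Ix] by (intro arg_cong[where f="emeasure lborel"]) auto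
        then show ?thesis using False d by (simp add: ball y_def power_0_left)
      qed
      finally show ?thesis by simp
    next
      case False
      have "{v::real^'n. norm v \<in> {x<..}} \<inter> cball 0 (real n) = {}" using False by auto
      moreover have "(\<lambda>r. radial_density TYPE('n) r * indicator {0..real n} r * indicator {x<..} r) = (\<lambda>r. 0)"
        using False by (auto simp: indicator_def fun_eq_iff)
      ultimately show ?thesis by (simp only: eM[OF Ix] eD[OF Ix]) simp
    qed
  qed
  then show ?thesis using eM[OF A(1)] eD[OF A(1)] by simp
qed

lemma radial_volume_borel:
  assumes [measurable]: "A \<in> sets borel" and that: "A \<subseteq> {0<..}"
  shows "radial_volume TYPE('n::finite) A = (SUP n. \<integral>\<^sup>+r. radial_density TYPE('n) r * indicator {0..real n} r * indicator A r \<partial>lborel)"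
proof -
  let ?c = "real CARD('n) * measure lborel (ball (0::real^'n) 1)"
  have [measurable]: "radial_density TYPE('n) \<in> borel_measurable borel" unfolding radial_density_def by measurable
  have "radial_volume TYPE('n) A = (\<integral>\<^sup>+r. ennreal ?c * (ennreal (r ^ (CARD('n) - 1)) * indicator A r) \<partial>lborel)"
    unfolding radial_volume_def nn_integral_completion by (rule nn_integral_cmult[symmetric]) measurable
  also have "\<dots> = (\<integral>\<^sup>+r. (SUP n. radial_density TYPE('n) r * indicator {0..real n} r * indicator A r) \<partial>lborel)"
  proof (rule nn_integral_cong)
    fix r :: real
    show "ennreal ?c * (ennreal (r ^ (CARD('n) - 1)) * indicator A r) = (SUP n. radial_density TYPE('n) r * indicator {0..real n} r * indicator A r)"
    proof (cases "r \<in> A")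
      case True
      then have r: "r > 0" using that by auto
      have eq: "ennreal ?c * ennreal (r ^ (CARD('n) - 1)) = radial_density TYPE('n) r"
        using r by (simp add: radial_density_def ennreal_mult)
      obtain n0 :: nat where "r \<le> real n0" using real_arch_simple by blast
      then have "radial_density TYPE('n) r = radial_density TYPE('n) r * indicator {0..real n0} r * indicator A r"
        using r True by simp
      then have "radial_density TYPE('n) r \<le> (SUP n. radial_density TYPE('n) r * indicator {0..real n} r * indicator A r)"
        by (metis (lifting) SUP_upper UNIV_I)
      moreover have "(SUP n. radial_density TYPE('n) r * indicator {0..real n} r * indicator A r) \<le> radial_density TYPE('n) r"
        by (intro SUP_least) (auto simp: indicator_def)
      ultimately show ?thesis using True eq by simp
    qed simp
  qed
  also have "\<dots> = (SUP n. \<integral>\<^sup>+r. radial_density TYPE('n) r * indicator {0..real n} r * indicator A r \<partial>lborel)"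
    by (rule nn_integral_monotone_convergence_SUP)
       (auto simp: incseq_def le_fun_def indicator_def intro: order_trans)
  finally show ?thesis .
qed

lemma radial_null:
  assumes "X \<in> null_sets lborel" "X \<subseteq> {0<..}"
  shows "emeasure lborel {v::real^'n. norm v \<in> X} = 0"
proof -
  have Xm [measurable]: "X \<in> sets borel" using assms by auto
  have "emeasure lborel ({v::real^'n. norm v \<in> X} \<inter> cball 0 (real n)) = 0" for n
  proof -
    have "AE r in lborel. r \<notin> X" using assms(1) by (rule AE_not_in)
    then have "(\<integral>\<^sup>+r. radial_density TYPE('n) r * indicator {0..real n} r * indicator X r \<partial>lborel) = (\<integral>\<^sup>+r. 0 \<partial>(lborel :: real measure))"
      by (intro nn_integral_cong_AE, elim eventually_mono) simp
    then show ?thesis unfolding radial_shell[OF Xm assms(2)] by simp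
  qed
  then have "{v::real^'n. norm v \<in> X} \<inter> cball 0 (real n) \<in> null_sets lborel" for n
    by (intro null_setsI) auto
  then have "(\<Union>n. {v::real^'n. norm v \<in> X} \<inter> cball 0 (real n)) \<in> null_sets lborel" by (rule null_sets_UN)
  moreover have "(\<Union>n. {v::real^'n. norm v \<in> X} \<inter> cball 0 (real n)) = {v. norm v \<in> X}"
    using real_arch_simple by auto
  ultimately show ?thesis by (simp add: null_setsD1)
qed

definition avoiding :: "(real^'n^'n) measure \<Rightarrow> real set \<Rightarrow> (real^'n^'n) set" where
  "avoiding \<pi> X = {g \<in> space \<pi>. \<forall>m\<in>int_lattice - {0}. norm (g *v m) \<notin> X}"

text \<open>By the mean value theorem the expected number of lattice vectors with norm in a null set
  is zero. This makes passing from Lebesgue to Borel sets of radii harmless.\<close>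

lemma avoiding_null:
  fixes \<pi> :: "(real^'n^'n) measure"
  assumes \<pi>: "inv_law \<pi>" and card: "CARD('n) \<ge> 2" and X: "X \<in> sets borel"
  shows avoiding_sets: "avoiding \<pi> X \<in> sets \<pi>"
    and "X \<in> null_sets lborel \<Longrightarrow> X \<subseteq> {0<..} \<Longrightarrow> space \<pi> - avoiding \<pi> X \<in> null_sets \<pi>"
proof -
  note [measurable_cong] = inv_law_D(2)[OF \<pi>]
  let ?B = "{v::real^'n. norm v \<in> X}"
  have Bm [measurable]: "?B \<in> sets borel" by (rule borel_norm_vimage[OF X])
  define N where "N g = (\<integral>\<^sup>+m. indicator ?B (g *v m) \<partial>count_space (int_lattice - {0}))" for g :: "real^'n^'n"
  have Nm [measurable]: "N \<in> borel_measurable \<pi>"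
    unfolding N_def by (intro borel_measurable_nn_integral_count_space) (auto intro: countable_Diff)
  have eq: "avoiding \<pi> X = {g \<in> space \<pi>. N g = 0}"
    unfolding avoiding_def N_def nn_integral_count_space_indicator_eq_0_iff by simp
  show s: "avoiding \<pi> X \<in> sets \<pi>" unfolding eq by measurable
  assume null: "X \<in> null_sets lborel" "X \<subseteq> {0<..}"
  have "(\<integral>\<^sup>+g. N g \<partial>\<pi>) = 0"
    using nn_integral_mean_value[OF \<pi> card, of "indicator ?B"] radial_null[OF null, where 'n='n] by (simp add: N_def)
  then have "AE g in \<pi>. N g = 0" by (subst (asm) nn_integral_0_iff_AE) auto
  then have "AE g in \<pi>. g \<notin> space \<pi> - avoiding \<pi> X" unfolding eq by (rule eventually_mono) simp
  then show "space \<pi> - avoiding \<pi> X \<in> null_sets \<pi>"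
    using s by (subst (asm) AE_iff_null_sets[symmetric]) auto
qed

text \<open>Avoiding A implies avoiding every compact K inside A, for which the gap bound holds.
  Inner regularity lets K fill A within a ball, and the balls then exhaust space.\<close>

lemma avoiding_bound:
  fixes \<pi> :: "(real^'n^'n) measure"
  assumes \<pi>: "inv_law \<pi>" and card: "CARD('n) \<ge> 2" and A: "A \<in> sets borel" "A \<subseteq> {0<..}"
  shows "emeasure \<pi> (avoiding \<pi> A) * radial_volume TYPE('n) A \<le> ennreal (gap_const CARD('n))"
proof -
  let ?P = "emeasure \<pi> (avoiding \<pi> A)"
  have cb [measurable]: "cball (0::real^'n) r \<in> sets borel" for r by simp
  let ?M = "norm_law TYPE('n)"
  have K: "?P * emeasure (?M n) K \<le> ennreal (gap_const CARD('n))" if K: "K \<subseteq> A" "compact K" for K n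
  proof -
    let ?B = "{v::real^'n. norm v \<in> K}"
    have Kb: "K \<in> sets borel" using K by (simp add: compact_imp_closed)
    have "closed ?B"
      using continuous_closed_vimage[OF compact_imp_closed[OF K(2)], of "norm :: real^'n \<Rightarrow> real"] by (simp add: vimage_def continuous_norm)
    moreover have "bounded ?B"
    proof -
      obtain b where "\<forall>x\<in>K. norm x \<le> b" using compact_imp_bounded[OF K(2)] by (auto simp: bounded_iff)
      then show ?thesis unfolding bounded_iff by (intro exI[of _ b]) auto
    qed
    ultimately have "compact ?B" by (simp add: compact_eq_bounded_closed)
    moreover have "0 \<notin> ?B" using K A by auto
    ultimately have gb: "emeasure \<pi> {g \<in> space \<pi>. \<forall>m\<in>int_lattice - {0}. g *v m \<notin> ?B} * emeasure lborel ?B \<le> ennreal (gap_const CARD('n))"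
      by (intro gap_bound[OF \<pi> card]) auto
    have Bm: "?B \<in> sets borel" by (rule borel_norm_vimage[OF Kb])
    have "?P \<le> emeasure \<pi> {g \<in> space \<pi>. \<forall>m\<in>int_lattice - {0}. g *v m \<notin> ?B}"
      using avoiding_sets[OF \<pi> card Kb] K(1) by (intro emeasure_mono) (auto simp: avoiding_def)
    moreover have "emeasure (?M n) K \<le> emeasure lborel ?B"
      unfolding emeasure_norm_law[OF Kb] using Bm by (intro emeasure_mono) auto
    ultimately show ?thesis using gb by (meson mult_mono order_trans zero_le)
  qed
  have "?P * emeasure (?M n) A \<le> ennreal (gap_const CARD('n))" for n
  proof -
    have "emeasure (?M n) (space (?M n)) = emeasure (?M n) UNIV" by (simp add: norm_law_def)
    also have "\<dots> \<noteq> \<infinity>" using emeasure_lborel_cball_finite[of "0::real^'n" "real n"] by (subst emeasure_norm_law) auto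
    finally have "emeasure (?M n) A = (SUP K \<in> {K. K \<subseteq> A \<and> compact K}. emeasure (?M n) K)"
      using A(1) by (intro inner_regular) auto
    then have "?P * emeasure (?M n) A = (SUP K \<in> {K. K \<subseteq> A \<and> compact K}. ?P * emeasure (?M n) K)"
      by (simp add: SUP_mult_left_ennreal)
    also have "\<dots> \<le> ennreal (gap_const CARD('n))" using K by (intro SUP_least) auto
    finally show ?thesis .
  qed
  then show ?thesis
    unfolding radial_volume_borel[OF A] radial_shell[OF A, symmetric] emeasure_norm_law[OF A(1), symmetric] SUP_mult_left_ennreal
    by (intro SUP_least) auto
qed

section \<open>Dual lattices and the completed measure\<close>

lemma dual_lattice_lattice_of:
  fixes g :: "real^'n^'n"
  assumes g: "det g = 1"
  shows "dual_lattice (lattice_of g) = lattice_of (transpose (sinv g))"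
proof -
  have T: "transpose (sinv g) *v (transpose g *v w) = w" "transpose g *v (transpose (sinv g) *v w) = w" for w
    by (simp_all only: matrix_vector_mul_assoc matrix_transpose_mul[symmetric] sinv_right[OF g] sinv_left[OF g]
        transpose_mat matrix_vector_mul_lid)
  have dual: "w \<in> dual_lattice (lattice_of g) \<longleftrightarrow> transpose g *v w \<in> int_lattice" for w
  proof -
    have adj: "w \<bullet> (g *v m) = (transpose g *v w) \<bullet> m" for m
      by (simp add: dot_lmul_matrix[symmetric] transpose_matrix_vector)
    show ?thesis
    proof
      assume w: "w \<in> dual_lattice (lattice_of g)"
      have "(transpose g *v w) $ a \<in> \<int>" for a
      proof -
        have "w \<bullet> (g *v axis a 1) \<in> \<int>"
          using w axis_int_lattice[of a] by (auto simp: dual_lattice_def lattice_of_def)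
        then show ?thesis unfolding adj by (simp add: inner_axis)
      qed
      then show "transpose g *v w \<in> int_lattice" by (simp add: int_lattice_def)
    next
      assume u: "transpose g *v w \<in> int_lattice"
      have "(transpose g *v w) \<bullet> m \<in> \<int>" if "m \<in> int_lattice" for m
        using u that unfolding int_lattice_def inner_vec_def mem_Collect_eq by (intro Ints_sum) (simp only: inner_real_def Ints_mult)
      then show "w \<in> dual_lattice (lattice_of g)"
        unfolding dual_lattice_def lattice_of_def using adj by auto
    qed
  qed
  show ?thesis
  proof (intro equalityI subsetI)
    fix w assume "w \<in> dual_lattice (lattice_of g)"
    then have "transpose g *v w \<in> int_lattice" by (simp only: dual)
    then show "w \<in> lattice_of (transpose (sinv g))"
      unfolding lattice_of_def by (rule image_eqI[where x="transpose g *v w", rotated]) (simp only: T)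
  next
    fix w assume "w \<in> lattice_of (transpose (sinv g))"
    then obtain m where "m \<in> int_lattice" "w = transpose (sinv g) *v m" by (auto simp only: lattice_of_def)
    then show "w \<in> dual_lattice (lattice_of g)" by (simp only: dual T)
  qed
qed

lemma length_spectrum_disjoint_iff:
  fixes g :: "real^'n^'n"
  assumes g: "det g = 1"
  shows "length_spectrum (lattice_of g) \<inter> A = {} \<longleftrightarrow>
    (\<forall>m\<in>int_lattice - {0}. norm (transpose (sinv g) *v m) \<notin> A)"
proof -
  have "det (transpose (sinv g)) = 1" by (simp add: det_transpose det_sinv g)
  then have "transpose (sinv g) *v m = 0 \<longleftrightarrow> m = 0" for m by (rule SL_int_vec_eq_0_iff)
  then show ?thesis
    unfolding length_spectrum_def dual_lattice_lattice_of[OF g] by (auto simp: lattice_of_def)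
qed

text \<open>The degenerate cases follow the conventions of the claim: a positive numerator over 0 is
  infinite, and a finite numerator over infinity is 0, which the product bound enforces for
  P.\<close>

lemma le_divide_ennreal:
  fixes P V K :: ennreal
  assumes "P * V \<le> K" "K > 0" "K < \<infinity>"
  shows "P \<le> K / V"
proof -
  consider "V = 0" | "V = top" | "V \<noteq> 0" "V \<noteq> top" by blast
  then show ?thesis
  proof cases
    case 1 then show ?thesis using assms(2) by (simp add: ennreal_divide_zero)
  next
    case 2
    then have "P = 0" using assms(1,3) by (cases "P = 0") (auto simp: ennreal_mult_top)
    then show ?thesis by simp
  next
    case 3
    have "P = P * V / V" using 3 by (simp add: mult_divide_eq_ennreal)
    also have "\<dots> \<le> K / V" by (rule divide_right_mono_ennreal[OF assms(1)])
    finally show ?thesis .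
  qed
qed

theorem theorem2:
  fixes \<nu> :: "(real^'n) set measure" and A :: "real set"
  assumes "CARD('n) \<ge> 2"
    and "haar_probability \<nu>"
    and "A \<subseteq> {0<..}" and "A \<in> sets lebesgue"
  shows "{L \<in> unimodular_lattices. length_spectrum L \<inter> A = {}} \<in> sets (completion \<nu>) \<and>
    emeasure (completion \<nu>) {L \<in> unimodular_lattices. length_spectrum L \<inter> A = {}}
      \<le> ennreal (gap_const CARD('n)) / radial_volume TYPE('n) A"
proof -
  note card = assms(1)
  obtain s :: "(real^'n) set \<Rightarrow> real^'n^'n" where s: "s \<in> lattice_borel \<rightarrow>\<^sub>M borel"
    "\<And>L. L \<in> unimodular_lattices \<Longrightarrow> det (s L) = 1" "\<And>L. L \<in> unimodular_lattices \<Longrightarrow> lattice_of (s L) = L"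
    by (rule borel_section, rule that, assumption, simp_all)
  have sets_\<nu>: "sets \<nu> = sets lattice_borel" using assms(2) by (simp add: haar_probability_def)
  have space_\<nu>: "space \<nu> = unimodular_lattices" using sets_eq_imp_space_eq[OF sets_\<nu>] by (simp add: space_lattice_borel)
  have sm [measurable]: "s \<in> \<nu> \<rightarrow>\<^sub>M borel" using s(1) by (simp add: measurable_cong_sets[OF sets_\<nu> refl])
  \<comment> \<open>A measurable choice of basis for the dual of L; its law is the one to which the
    gap bound is applied.\<close>
  define h where "h L = transpose (sinv (s L))" for L
  have hm [measurable]: "h \<in> \<nu> \<rightarrow>\<^sub>M borel" unfolding h_def by measurable
  define \<pi> where "\<pi> = distr \<nu> borel h"
  have \<pi>: "inv_law \<pi>"
  proof -
    have "distr (distr \<nu> borel s) borel (\<lambda>g. transpose (sinv g)) = \<pi>"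
      unfolding \<pi>_def h_def by (subst distr_distr) (auto simp: comp_def)
    then show ?thesis using inv_law_dual[OF inv_law_section[OF assms(2) s]] by simp
  qed
  define E where "E X = {L \<in> (unimodular_lattices :: (real^'n) set set). length_spectrum L \<inter> X = {}}" for X
  have E: "E X = h -` avoiding \<pi> X \<inter> space \<nu>" for X
  proof -
    have "length_spectrum L \<inter> X = {} \<longleftrightarrow> (\<forall>m\<in>int_lattice - {0}. norm (h L *v m) \<notin> X)" if "L \<in> unimodular_lattices" for L
      using length_spectrum_disjoint_iff[OF s(2)[OF that], of X] by (simp add: s(3)[OF that] h_def)
    then show ?thesis by (auto simp: E_def space_\<nu> avoiding_def \<pi>_def)
  qed
  have Em: "E X \<in> sets \<nu>" if "X \<in> sets borel" for X
    unfolding E using avoiding_sets[OF \<pi> card that] by (intro measurable_sets[OF hm]) (simp add: \<pi>_def)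
  have Ee: "emeasure \<nu> (E X) = emeasure \<pi> (avoiding \<pi> X)" if "X \<in> sets borel" for X
    unfolding E using avoiding_sets[OF \<pi> card that] unfolding \<pi>_def by (intro emeasure_distr[symmetric] hm) simp
  \<comment> \<open>A Lebesgue set is a Borel set A' together with a part of a Borel null
    set.\<close>
  obtain N0 where N0: "N0 \<in> null_sets lborel" "null_part lborel A \<subseteq> N0" using null_part[OF assms(4)] by blast
  define A' where "A' = main_part lborel A"
  define N where "N = N0 \<inter> {0<..}"
  have A_eq: "A = A' \<union> null_part lborel A" using main_part_null_part_Un[OF assms(4)] by (simp add: A'_def)
  have A': "A' \<in> sets borel" "A' \<subseteq> {0<..}" "A' \<subseteq> A" "A \<subseteq> A' \<union> N"
  proof -
    show "A' \<in> sets borel" using main_part_sets[OF assms(4)] by (simp add: A'_def)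
    show "A' \<subseteq> A" using A_eq by blast
    then show "A' \<subseteq> {0<..}" using assms(3) by blast
    show "A \<subseteq> A' \<union> N" using A_eq N0(2) assms(3) unfolding N_def by blast
  qed
  have N: "N \<in> null_sets lborel" "N \<subseteq> {0<..}" "N \<in> sets borel"
    using N0(1) unfolding N_def by (auto intro: null_set_Int2)
  have null: "space \<nu> - E N \<in> null_sets \<nu>"
  proof -
    have "emeasure \<nu> (space \<nu> - E N) = emeasure \<pi> (space \<pi> - avoiding \<pi> N)"
    proof -
      have "space \<nu> - E N = h -` (space \<pi> - avoiding \<pi> N) \<inter> space \<nu>" unfolding E by (auto simp: \<pi>_def)
      moreover have "space \<pi> - avoiding \<pi> N \<in> sets borel"
        using sets.compl_sets[OF avoiding_sets[OF \<pi> card N(3)]] by (simp add: \<pi>_def)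
      ultimately show ?thesis using emeasure_distr[OF hm] by (simp add: \<pi>_def)
    qed
    also have "\<dots> = 0" using avoiding_null(2)[OF \<pi> card N(3) N(1,2)] by (rule null_setsD1)
    finally show ?thesis using Em[OF N(3)] by (intro null_setsI) auto
  qed
  \<comment> \<open>A lattice avoiding A' but meeting A has a dual length in N. Such lattices lie in
    a \<nu>-null set, so the event differs from a measurable one only inside a null set.\<close>
  have diff: "E A' - E A \<in> null_sets (completion \<nu>)"
  proof (rule null_sets_completion_subset[OF _ null_sets_completionI[OF null]])
    show "E A' - E A \<subseteq> space \<nu> - E N" using A'(4) unfolding E_def space_\<nu> by blast
  qed
  have E_A: "E A = E A' - (E A' - E A)" using A'(3) unfolding E_def by blast
  have EA: "E A \<in> sets (completion \<nu>)"
    by (subst E_A, rule sets.Diff) (use Em[OF A'(1)] diff in auto)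
  have V: "radial_volume TYPE('n) A' = radial_volume TYPE('n) A"
    unfolding radial_volume_def nn_integral_completion using AE_in_main_part[OF assms(4)]
    by (intro arg_cong2[where f="(*)"] refl nn_integral_cong_AE) (elim eventually_mono, simp add: A'_def indicator_def)
  have "emeasure (completion \<nu>) (E A) \<le> emeasure (completion \<nu>) (E A')"
    using A'(3) Em[OF A'(1)] by (intro emeasure_mono) (auto simp: E_def)
  also have "\<dots> = emeasure \<pi> (avoiding \<pi> A')" using Em[OF A'(1)] by (simp add: Ee[OF A'(1)])
  also have "\<dots> \<le> ennreal (gap_const CARD('n)) / radial_volume TYPE('n) A'"
  proof (rule le_divide_ennreal[OF avoiding_bound[OF \<pi> card A'(1,2)]])
    have "gap_const CARD('n) > 0"
    proof (cases "CARD('n) = 2")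
      case False
      then have "2 \<le> CARD('n) - 1" using card by simp
      then show ?thesis
        using False zeta_bounds(1)[of "CARD('n) - 1"] zeta_bounds(1)[OF card] by (simp add: gap_const_def)
    qed (use zeta_bounds(1)[of 2] in \<open>simp add: gap_const_def\<close>)
    then show "0 < ennreal (gap_const CARD('n))" by simp
  qed simp
  finally show ?thesis using EA unfolding V E_def by simp
qed

end
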